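(* Let $\mathfrak g$ and $\mathfrak h$ be two complete dglas. Then there is a quasi-isomorphism $$\mathcal C_+(\mathfrak g*\mathfrak h)\ \simeq\ \mathcal C_+(\mathfrak g)\times\mathcal C_+(\mathfrak h).$$
   Context: $\Bbbk$ is a field of characteristic zero. A dgla is a homologically $\mathbb Z$-graded differential graded Lie algebra over $\Bbbk$. A complete dgla is an inverse limit of finite-dimensional nilpotent dglas; $\hat{\mathscr L}$ is the category of complete dglas and continuous dgla maps. $\mathfrak g*\mathfrak h$ is the completed free product, i.e. the coproduct of $\mathfrak g$ and $\mathfrak h$ in $\hat{\mathscr L}$. For a complete dgla $\mathfrak g$, $\mathfrak g^*$ is the continuous (discrete) dual, with $(\mathfrak g^* )^i=(\mathfrak g_i)^*$ and $(\Sigma\mathfrak g^* )^i=(\mathfrak g^* )^{i-1}$. $\mathcal C(\mathfrak g)$ is the augmented commutative dg algebra with underlying graded algebra the symmetric algebra $S\Sigma\mathfrak g^*$ and differential $d_I+d_{II}$, where $d_I$ is induced by the differential of $\mathfrak g$ and $d_{II}$ is the derivation determined on $\Sigma\mathfrak g^*$ by the dual of the bracket. $\mathcal C_+(\mathfrak g)$ is the augmentation ideal of $\mathcal C(\mathfrak g)$, a non-unital commutative dg algebra. *)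

theory Defs
  imports
    "HOL-Analysis.Function_Topology"
    "HOL-Library.Function_Algebras"
    "HOL-Library.Poly_Mapping"
begin

text \<open>
  A graded vector space is a family, indexed by \<open>int\<close>, of subspaces of one ambient vector space;
  distinct members meet only in \<open>0\<close>, so that a nonzero homogeneous element has a degree.
  The ambient type is a mere container: nothing is assumed about nonhomogeneous elements,
  and the operations below matter on homogeneous elements only.
\<close>

section \<open>Differential graded Lie algebras\<close>

record ('a, 'k) dgla_struct =
  scl :: "'k \<Rightarrow> 'a \<Rightarrow> 'a"
  grd :: "int \<Rightarrow> 'a set"
  dif :: "'a \<Rightarrow> 'a"
  brk :: "'a \<Rightarrow> 'a \<Rightarrow> 'a"

text \<open>
  In characteristic zero the graded Jacobi identity and antisymmetry imply \<open>[x,[x,x]] = 0\<close>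
  for odd \<open>x\<close> and \<open>[x,x] = 0\<close> for even \<open>x\<close>.
\<close>

locale dgla =
  fixes L :: "('a::ab_group_add, 'k::field_char_0, 'z) dgla_struct_scheme"
  assumes vector_space: "vector_space (scl L)"
    and subspace: "module.subspace (scl L) (grd L n)"
    and disjoint: "m \<noteq> n \<Longrightarrow> grd L m \<inter> grd L n = {0}"
    and dif_grd: "x \<in> grd L n \<Longrightarrow> dif L x \<in> grd L (n - 1)"
    and dif_add: "\<lbrakk>x \<in> grd L n; y \<in> grd L n\<rbrakk> \<Longrightarrow> dif L (x + y) = dif L x + dif L y"
    and dif_scl: "x \<in> grd L n \<Longrightarrow> dif L (scl L c x) = scl L c (dif L x)"
    and dif_dif: "x \<in> grd L n \<Longrightarrow> dif L (dif L x) = 0"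
    and brk_grd: "\<lbrakk>x \<in> grd L m; y \<in> grd L n\<rbrakk> \<Longrightarrow> brk L x y \<in> grd L (m + n)"
    and brk_add_left:
      "\<lbrakk>x \<in> grd L m; x' \<in> grd L m; y \<in> grd L n\<rbrakk> \<Longrightarrow> brk L (x + x') y = brk L x y + brk L x' y"
    and brk_scl_left:
      "\<lbrakk>x \<in> grd L m; y \<in> grd L n\<rbrakk> \<Longrightarrow> brk L (scl L c x) y = scl L c (brk L x y)"
    and brk_antisym:
      "\<lbrakk>x \<in> grd L m; y \<in> grd L n\<rbrakk> \<Longrightarrow> brk L x y = scl L (- ((-1) powi (m * n))) (brk L y x)"
    and jacobi:
      "\<lbrakk>x \<in> grd L m; y \<in> grd L n; z \<in> grd L l\<rbrakk> \<Longrightarrow>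
        brk L x (brk L y z) = brk L (brk L x y) z + scl L ((-1) powi (m * n)) (brk L y (brk L x z))"
    and dif_brk:
      "\<lbrakk>x \<in> grd L m; y \<in> grd L n\<rbrakk> \<Longrightarrow>
        dif L (brk L x y) = brk L (dif L x) y + scl L ((-1) powi m) (brk L x (dif L y))"

definition dgla_hom ::
  "('a::ab_group_add, 'k, 'y) dgla_struct_scheme \<Rightarrow> ('b::ab_group_add, 'k, 'z) dgla_struct_scheme
    \<Rightarrow> ('a \<Rightarrow> 'b) \<Rightarrow> bool" where
  "dgla_hom L M f \<longleftrightarrow>
    (\<forall>n. \<forall>x\<in>grd L n. f x \<in> grd M n) \<and>
    (\<forall>n. \<forall>x\<in>grd L n. \<forall>y\<in>grd L n. f (x + y) = f x + f y) \<and>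
    (\<forall>n c. \<forall>x\<in>grd L n. f (scl L c x) = scl M c (f x)) \<and>
    (\<forall>n. \<forall>x\<in>grd L n. f (dif L x) = dif M (f x)) \<and>
    (\<forall>m n. \<forall>x\<in>grd L m. \<forall>y\<in>grd L n. f (brk L x y) = brk M (f x) (f y))"

definition fin_dim :: "('a::ab_group_add, 'k::field, 'z) dgla_struct_scheme \<Rightarrow> bool" where
  "fin_dim L \<longleftrightarrow>
    finite {n. grd L n \<noteq> {0}} \<and>
    (\<forall>n. \<exists>B. finite B \<and> grd L n \<subseteq> module.span (scl L) B)"

primrec lower_central ::
  "('a::ab_group_add, 'k::field, 'z) dgla_struct_scheme \<Rightarrow> nat \<Rightarrow> int \<Rightarrow> 'a set" where
  "lower_central L 0 n = grd L n"
| "lower_central L (Suc k) n =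
    module.span (scl L) {brk L x y | x y i j. x \<in> grd L i \<and> y \<in> lower_central L k j \<and> i + j = n}"

definition nilpotent :: "('a::ab_group_add, 'k::field, 'z) dgla_struct_scheme \<Rightarrow> bool" where
  "nilpotent L \<longleftrightarrow> (\<exists>k. \<forall>n. lower_central L k n = {0})"

section \<open>Complete dglas\<close>

record ('i, 'a, 'k) inv_sys =
  le :: "'i \<Rightarrow> 'i \<Rightarrow> bool"
  obj :: "'i \<Rightarrow> ('a, 'k) dgla_struct"
  trans_map :: "'i \<Rightarrow> 'i \<Rightarrow> 'a \<Rightarrow> 'a"

locale inverse_system =
  fixes S :: "('i, 'a::ab_group_add, 'k::field_char_0) inv_sys"
  assumes le_refl: "le S \<alpha> \<alpha>"
    and le_trans: "\<lbrakk>le S \<alpha> \<beta>; le S \<beta> \<gamma>\<rbrakk> \<Longrightarrow> le S \<alpha> \<gamma>"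
    and directed: "\<exists>\<gamma>. le S \<alpha> \<gamma> \<and> le S \<beta> \<gamma>"
    and dgla_obj: "dgla (obj S \<alpha>)"
    and fin_dim_obj: "fin_dim (obj S \<alpha>)"
    and nilpotent_obj: "nilpotent (obj S \<alpha>)"
    and trans_hom: "le S \<alpha> \<beta> \<Longrightarrow> dgla_hom (obj S \<beta>) (obj S \<alpha>) (trans_map S \<alpha> \<beta>)"
    and trans_id: "x \<in> grd (obj S \<alpha>) n \<Longrightarrow> trans_map S \<alpha> \<alpha> x = x"
    and trans_comp:
      "\<lbrakk>le S \<alpha> \<beta>; le S \<beta> \<gamma>; x \<in> grd (obj S \<gamma>) n\<rbrakk> \<Longrightarrow>
        trans_map S \<alpha> \<beta> (trans_map S \<beta> \<gamma> x) = trans_map S \<alpha> \<gamma> x"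

record ('a, 'k) top_dgla = "('a, 'k) dgla_struct" +
  topo :: "int \<Rightarrow> 'a topology"

definition lim_grd :: "('i, 'a, 'k) inv_sys \<Rightarrow> int \<Rightarrow> ('i \<Rightarrow> 'a) set" where
  "lim_grd S n = {x. (\<forall>\<alpha>. x \<alpha> \<in> grd (obj S \<alpha>) n) \<and>
                     (\<forall>\<alpha> \<beta>. le S \<alpha> \<beta> \<longrightarrow> trans_map S \<alpha> \<beta> (x \<beta>) = x \<alpha>)}"

text \<open>Each degree carries the inverse limit topology of the discrete finite-dimensional pieces.\<close>

definition inv_lim :: "('i, 'a, 'k) inv_sys \<Rightarrow> ('i \<Rightarrow> 'a, 'k) top_dgla" where
  "inv_lim S =
    \<lparr> scl = (\<lambda>c x \<alpha>. scl (obj S \<alpha>) c (x \<alpha>)),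
      grd = lim_grd S,
      dif = (\<lambda>x \<alpha>. dif (obj S \<alpha>) (x \<alpha>)),
      brk = (\<lambda>x y \<alpha>. brk (obj S \<alpha>) (x \<alpha>) (y \<alpha>)),
      topo = (\<lambda>n. subtopology
                (product_topology (\<lambda>\<alpha>. discrete_topology (grd (obj S \<alpha>) n)) UNIV) (lim_grd S n)) \<rparr>"

definition complete_dgla ::
  "('i \<Rightarrow> 'a::ab_group_add, 'k::field_char_0) top_dgla \<Rightarrow> bool" where
  "complete_dgla g \<longleftrightarrow> (\<exists>S. inverse_system S \<and> g = inv_lim S)"

definition cont_hom ::
  "('a::ab_group_add, 'k) top_dgla \<Rightarrow> ('b::ab_group_add, 'k) top_dgla \<Rightarrow> ('a \<Rightarrow> 'b) \<Rightarrow> bool" where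
  "cont_hom g h f \<longleftrightarrow> dgla_hom g h f \<and> (\<forall>n. continuous_map (topo g n) (topo h n) f)"

text \<open>
  HOL cannot quantify over complete dglas on all types at once, so the test objects \<open>t\<close> live on
  one fixed type. It contains, up to isomorphism, every finite-dimensional nilpotent dgla (as a
  constant system). These detect all complete dglas, since maps into an inverse limit are
  compatible families of maps into its terms: \<open>coproduct_universal\<close> below derives the universal
  property with respect to complete dglas on arbitrary types.
\<close>

definition mediates ::
  "('a::ab_group_add, 'k) top_dgla \<Rightarrow> ('b::ab_group_add, 'k) top_dgla \<Rightarrow>
   ('c::ab_group_add, 'k) top_dgla \<Rightarrow> ('a \<Rightarrow> 'c) \<Rightarrow> ('b \<Rightarrow> 'c) \<Rightarrow>
   ('t::ab_group_add, 'k) top_dgla \<Rightarrow> ('a \<Rightarrow> 't) \<Rightarrow> ('b \<Rightarrow> 't) \<Rightarrow> ('c \<Rightarrow> 't) \<Rightarrow> bool" where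
  "mediates g h p i j t f f' u \<longleftrightarrow>
    cont_hom p t u \<and>
    (\<forall>n. \<forall>x\<in>grd g n. u (i x) = f x) \<and>
    (\<forall>n. \<forall>y\<in>grd h n. u (j y) = f' y)"

definition is_coproduct ::
  "('i1 \<Rightarrow> 'a::ab_group_add, 'k::field_char_0) top_dgla \<Rightarrow> ('i2 \<Rightarrow> 'b::ab_group_add, 'k) top_dgla \<Rightarrow>
   ('i3 \<Rightarrow> 'c::ab_group_add, 'k) top_dgla \<Rightarrow>
   (('i1 \<Rightarrow> 'a) \<Rightarrow> ('i3 \<Rightarrow> 'c)) \<Rightarrow> (('i2 \<Rightarrow> 'b) \<Rightarrow> ('i3 \<Rightarrow> 'c)) \<Rightarrow> bool" where
  "is_coproduct g h p i j \<longleftrightarrow>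
    complete_dgla p \<and> cont_hom g p i \<and> cont_hom h p j \<and>
    (\<forall>(t :: (nat \<Rightarrow> nat \<Rightarrow> 'k, 'k) top_dgla) f f'.
      complete_dgla t \<and> cont_hom g t f \<and> cont_hom h t f' \<longrightarrow>
      (\<exists>u. mediates g h p i j t f f' u \<and>
        (\<forall>u'. mediates g h p i j t f f' u' \<longrightarrow> (\<forall>n. \<forall>z\<in>grd p n. u' z = u z))))"

section \<open>Graded algebras and quasi-isomorphisms\<close>

text \<open>Cohomologically graded, not necessarily unital; only homogeneous elements are recorded.\<close>

record ('m, 'k) gr_alg =
  part :: "int \<Rightarrow> 'm set"
  azero :: 'm
  aadd :: "'m \<Rightarrow> 'm \<Rightarrow> 'm"
  asmul :: "'k \<Rightarrow> 'm \<Rightarrow> 'm"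
  amul :: "'m \<Rightarrow> 'm \<Rightarrow> 'm"

record ('m, 'k) dg_alg = "('m, 'k) gr_alg" +
  adiff :: "'m \<Rightarrow> 'm"

record ('m, 'k) aug_dg_alg = "('m, 'k) dg_alg" +
  aunit :: 'm
  aug :: "'m \<Rightarrow> 'k"

definition augmentation_ideal :: "('m, 'k::zero) aug_dg_alg \<Rightarrow> ('m, 'k) dg_alg" where
  "augmentation_ideal A =
    \<lparr> part = (\<lambda>n. {x \<in> part A n. aug A x = 0}), azero = azero A, aadd = aadd A,
      asmul = asmul A, amul = amul A, adiff = adiff A \<rparr>"

definition dg_prod :: "('m, 'k) dg_alg \<Rightarrow> ('n, 'k) dg_alg \<Rightarrow> ('m \<times> 'n, 'k) dg_alg" where
  "dg_prod A B =
    \<lparr> part = (\<lambda>n. part A n \<times> part B n),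
      azero = (azero A, azero B),
      aadd = (\<lambda>(x, y) (x', y'). (aadd A x x', aadd B y y')),
      asmul = (\<lambda>c (x, y). (asmul A c x, asmul B c y)),
      amul = (\<lambda>(x, y) (x', y'). (amul A x x', amul B y y')),
      adiff = (\<lambda>(x, y). (adiff A x, adiff B y)) \<rparr>"

definition dg_alg_hom :: "('m, 'k) dg_alg \<Rightarrow> ('n, 'k) dg_alg \<Rightarrow> ('m \<Rightarrow> 'n) \<Rightarrow> bool" where
  "dg_alg_hom A B f \<longleftrightarrow>
    (\<forall>n. \<forall>x\<in>part A n. f x \<in> part B n) \<and>
    (\<forall>n. \<forall>x\<in>part A n. \<forall>y\<in>part A n. f (aadd A x y) = aadd B (f x) (f y)) \<and>
    (\<forall>n c. \<forall>x\<in>part A n. f (asmul A c x) = asmul B c (f x)) \<and>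
    (\<forall>m n. \<forall>x\<in>part A m. \<forall>y\<in>part A n. f (amul A x y) = amul B (f x) (f y)) \<and>
    (\<forall>n. \<forall>x\<in>part A n. f (adiff A x) = adiff B (f x))"

definition cocycles :: "('m, 'k) dg_alg \<Rightarrow> int \<Rightarrow> 'm set" where
  "cocycles A n = {z \<in> part A n. adiff A z = azero A}"

definition coh_class :: "('m, 'k) dg_alg \<Rightarrow> int \<Rightarrow> 'm \<Rightarrow> 'm set" where
  "coh_class A n z = {aadd A z (adiff A y) | y. y \<in> part A (n - 1)}"

definition cohomology :: "('m, 'k) dg_alg \<Rightarrow> int \<Rightarrow> 'm set set" where
  "cohomology A n = coh_class A n ` cocycles A n"

definition coh_map :: "('n, 'k) dg_alg \<Rightarrow> int \<Rightarrow> ('m \<Rightarrow> 'n) \<Rightarrow> 'm set \<Rightarrow> 'n set" where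
  "coh_map B n f X = (\<Union>z\<in>X. coh_class B n (f z))"

definition quasi_isomorphism :: "('m, 'k) dg_alg \<Rightarrow> ('n, 'k) dg_alg \<Rightarrow> ('m \<Rightarrow> 'n) \<Rightarrow> bool" where
  "quasi_isomorphism A B f \<longleftrightarrow>
    dg_alg_hom A B f \<and> (\<forall>n. bij_betw (coh_map B n f) (cohomology A n) (cohomology B n))"

section \<open>The symmetric algebra of a graded vector space\<close>

text \<open>
  The letter \<open>(n, x)\<close> stands for \<open>x\<close> in degree \<open>n\<close> of the graded vector space \<open>W\<close>, whose scalar
  multiplication is \<open>sc\<close>. The symmetric algebra is the free algebra on the letters modulo linearity
  of \<open>x \<mapsto> (n, x)\<close> (which gives the tensor algebra) and graded commutativity; its elements are
  cosets. In characteristic zero graded commutativity forces odd elements to have square zero.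
\<close>

type_synonym ('w, 'k) free_alg = "(int \<times> 'w) list \<Rightarrow>\<^sub>0 'k"

definition fsmul :: "'k \<Rightarrow> ('w, 'k::field) free_alg \<Rightarrow> ('w, 'k) free_alg" where
  "fsmul c a = Poly_Mapping.map ((*) c) a"

definition fmul :: "('w, 'k::field) free_alg \<Rightarrow> ('w, 'k) free_alg \<Rightarrow> ('w, 'k) free_alg" where
  "fmul a b = (\<Sum>u\<in>Poly_Mapping.keys a. \<Sum>v\<in>Poly_Mapping.keys b. Poly_Mapping.single (u @ v) (Poly_Mapping.lookup a u * Poly_Mapping.lookup b v))"

abbreviation word :: "(int \<times> 'w) list \<Rightarrow> ('w, 'k::field) free_alg" where
  "word u \<equiv> Poly_Mapping.single u 1"

definition words :: "(int \<Rightarrow> 'w set) \<Rightarrow> (int \<times> 'w) list set" where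
  "words W = {u. \<forall>(n, x)\<in>set u. x \<in> W n}"

definition word_degree :: "(int \<times> 'w) list \<Rightarrow> int" where
  "word_degree u = sum_list (map fst u)"

definition sym_relators ::
  "('k::field \<Rightarrow> 'w::ab_group_add \<Rightarrow> 'w) \<Rightarrow> (int \<Rightarrow> 'w set) \<Rightarrow> ('w, 'k) free_alg set" where
  "sym_relators sc W =
    {word (u @ [(n, x + y)] @ v) - word (u @ [(n, x)] @ v) - word (u @ [(n, y)] @ v) | u v n x y.
      u \<in> words W \<and> v \<in> words W \<and> x \<in> W n \<and> y \<in> W n} \<union>
    {word (u @ [(n, sc c x)] @ v) - fsmul c (word (u @ [(n, x)] @ v)) | u v n c x.
      u \<in> words W \<and> v \<in> words W \<and> x \<in> W n} \<union>
    {word (u @ [(m, x), (n, y)] @ v) - fsmul ((-1) powi (m * n)) (word (u @ [(n, y), (m, x)] @ v)) |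
      u v m n x y. u \<in> words W \<and> v \<in> words W \<and> x \<in> W m \<and> y \<in> W n}"

definition sym_class ::
  "('k::field \<Rightarrow> 'w::ab_group_add \<Rightarrow> 'w) \<Rightarrow> (int \<Rightarrow> 'w set) \<Rightarrow> ('w, 'k) free_alg \<Rightarrow>
    ('w, 'k) free_alg set" where
  "sym_class sc W a = {a + r | r. r \<in> module.span fsmul (sym_relators sc W)}"

definition sym_alg ::
  "('k::field \<Rightarrow> 'w::ab_group_add \<Rightarrow> 'w) \<Rightarrow> (int \<Rightarrow> 'w set) \<Rightarrow> (('w, 'k) free_alg set, 'k) gr_alg" where
  "sym_alg sc W =
    \<lparr> part = (\<lambda>n. sym_class sc W ` module.span fsmul {word u | u. u \<in> words W \<and> word_degree u = n}),
      azero = sym_class sc W 0,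
      aadd = (\<lambda>X Y. {a + b | a b. a \<in> X \<and> b \<in> Y}),
      asmul = (\<lambda>c X. \<Union>a\<in>X. sym_class sc W (fsmul c a)),
      amul = (\<lambda>X Y. \<Union>a\<in>X. \<Union>b\<in>Y. sym_class sc W (fmul a b)) \<rparr>"

definition is_derivation :: "('m, 'k::field, 'z) gr_alg_scheme \<Rightarrow> ('m \<Rightarrow> 'm) \<Rightarrow> bool" where
  "is_derivation A d \<longleftrightarrow>
    (\<forall>n. \<forall>x\<in>part A n. d x \<in> part A (n + 1)) \<and>
    (\<forall>n. \<forall>x\<in>part A n. \<forall>y\<in>part A n. d (aadd A x y) = aadd A (d x) (d y)) \<and>
    (\<forall>n c. \<forall>x\<in>part A n. d (asmul A c x) = asmul A c (d x)) \<and>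
    (\<forall>m n. \<forall>x\<in>part A m. \<forall>y\<in>part A n.
      d (amul A x y) = aadd A (amul A (d x) y) (asmul A ((-1) powi m) (amul A x (d y))))"

text \<open>
  The degree \<open>+1\<close> derivation of the symmetric algebra with prescribed values \<open>\<delta> n x\<close> on \<open>x \<in> W n\<close>,
  given by representatives in the free algebra.
\<close>

definition sym_derivation ::
  "('k::field \<Rightarrow> 'w::ab_group_add \<Rightarrow> 'w) \<Rightarrow> (int \<Rightarrow> 'w set) \<Rightarrow> (int \<Rightarrow> 'w \<Rightarrow> ('w, 'k) free_alg) \<Rightarrow>
    ('w, 'k) free_alg set \<Rightarrow> ('w, 'k) free_alg set" where
  "sym_derivation sc W \<delta> = (THE d.
    is_derivation (sym_alg sc W) d \<and>
    (\<forall>n. \<forall>x\<in>W n. d (sym_class sc W (word [(n, x)])) = sym_class sc W (\<delta> n x)) \<and>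
    (\<forall>X. X \<notin> (\<Union>n. part (sym_alg sc W) n) \<longrightarrow> d X = azero (sym_alg sc W)))"

section \<open>The Chevalley--Eilenberg algebra\<close>

text \<open>A functional on one degree is extended by \<open>0\<close> to the ambient type.\<close>

definition dual :: "('a::ab_group_add, 'k::field) top_dgla \<Rightarrow> int \<Rightarrow> ('a \<Rightarrow> 'k) set" where
  "dual g i = {\<phi>.
    (\<forall>x\<in>grd g i. \<forall>y\<in>grd g i. \<phi> (x + y) = \<phi> x + \<phi> y) \<and>
    (\<forall>c. \<forall>x\<in>grd g i. \<phi> (scl g c x) = c * \<phi> x) \<and>
    (\<forall>x. x \<notin> grd g i \<longrightarrow> \<phi> x = 0) \<and>
    continuous_map (topo g i) (discrete_topology UNIV) \<phi>}"

definition susp_dual :: "('a::ab_group_add, 'k::field) top_dgla \<Rightarrow> int \<Rightarrow> ('a \<Rightarrow> 'k) set" where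
  "susp_dual g n = dual g (n - 1)"

definition fun_scale :: "'k::field \<Rightarrow> ('a \<Rightarrow> 'k) \<Rightarrow> ('a \<Rightarrow> 'k)" where
  "fun_scale c \<phi> = (\<lambda>x. c * \<phi> x)"

definition dual_dif :: "('a, 'k::field) top_dgla \<Rightarrow> int \<Rightarrow> ('a \<Rightarrow> 'k) \<Rightarrow> ('a \<Rightarrow> 'k)" where
  "dual_dif g i \<phi> = (\<lambda>x. if x \<in> grd g (i + 1) then \<phi> (dif g x) else 0)"

text \<open>
  The list \<open>ps\<close> of triples \<open>(i, a, b)\<close>, with \<open>a\<close> and \<open>b\<close> functionals in degrees \<open>i\<close> and \<open>n - i\<close>,
  denotes the tensor \<open>\<Sum> a \<otimes> b\<close>; it represents \<open>\<phi> \<circ> [\<cdot>,\<cdot>]\<close>, the image of \<open>\<phi> \<in> (g_n)\<^sup>*\<close> under the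
  dual of the bracket. The tensor is determined by \<open>\<phi>\<close>, the list is not.
\<close>

definition represents_dual_brk ::
  "('a::ab_group_add, 'k::field) top_dgla \<Rightarrow> int \<Rightarrow> ('a \<Rightarrow> 'k) \<Rightarrow>
    (int \<times> ('a \<Rightarrow> 'k) \<times> ('a \<Rightarrow> 'k)) list \<Rightarrow> bool" where
  "represents_dual_brk g n \<phi> ps \<longleftrightarrow>
    (\<forall>(i, a, b)\<in>set ps. a \<in> dual g i \<and> b \<in> dual g (n - i)) \<and>
    (\<forall>i. \<forall>x\<in>grd g i. \<forall>y\<in>grd g (n - i).
      \<phi> (brk g x y) = (\<Sum>(i', a, b)\<leftarrow>ps. if i' = i then a x * b y else 0))"

definition dual_brk ::
  "('a::ab_group_add, 'k::field) top_dgla \<Rightarrow> int \<Rightarrow> ('a \<Rightarrow> 'k) \<Rightarrow>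
    (int \<times> ('a \<Rightarrow> 'k) \<times> ('a \<Rightarrow> 'k)) list" where
  "dual_brk g n \<phi> = (SOME ps. represents_dual_brk g n \<phi> ps)"

text \<open>
  Signs. Let \<open>e\<^sub>a\<close> be a homogeneous basis and \<open>t\<^sup>a\<close> the dual generators, of degree \<open>|e\<^sub>a| + 1\<close>.
  The differential is the one for which \<open>\<xi> = \<Sum> t\<^sup>a e\<^sub>a\<close> satisfies the Maurer--Cartan equation
  \<open>D \<xi> + \<onehalf>[\<xi>, \<xi>] = 0\<close>; with the Koszul rule this says
  \<open>d t\<^sup>c = (-1)\<^bsup>|t\<^sup>c|\<^esup> \<Sum> t\<^sup>a (d e\<^sub>a)\<^sup>c - \<onehalf> \<Sum> (-1)\<^bsup>|e\<^sub>a| |t\<^sup>b|\<^esup> t\<^sup>a t\<^sup>b [e\<^sub>a, e\<^sub>b]\<^sup>c\<close>.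
  Below \<open>n\<close> is the degree in \<open>susp_dual g\<close>, so \<open>\<phi> \<in> (g_(n-1))\<^sup>*\<close>.
\<close>

definition CE_I :: "('a::ab_group_add, 'k::field) top_dgla \<Rightarrow> int \<Rightarrow> ('a \<Rightarrow> 'k) \<Rightarrow> ('a \<Rightarrow> 'k, 'k) free_alg" where
  "CE_I g n \<phi> = fsmul ((-1) powi n) (word [(n + 1, dual_dif g (n - 1) \<phi>)])"

definition CE_II :: "('a::ab_group_add, 'k::field) top_dgla \<Rightarrow> int \<Rightarrow> ('a \<Rightarrow> 'k) \<Rightarrow> ('a \<Rightarrow> 'k, 'k) free_alg" where
  "CE_II g n \<phi> = (\<Sum>(i, a, b)\<leftarrow>dual_brk g (n - 1) \<phi>.
    fsmul (- (1/2) * (-1) powi (i * (n - i))) (word [(i + 1, a), (n - i, b)]))"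

definition CE :: "('a::ab_group_add, 'k::field) top_dgla \<Rightarrow> (('a \<Rightarrow> 'k, 'k) free_alg set, 'k) aug_dg_alg" where
  "CE g = (let W = susp_dual g; A = sym_alg fun_scale W in
    \<lparr> part = part A, azero = azero A, aadd = aadd A, asmul = asmul A, amul = amul A,
      adiff = (\<lambda>X. aadd A (sym_derivation fun_scale W (CE_I g) X)
                          (sym_derivation fun_scale W (CE_II g) X)),
      aunit = sym_class fun_scale W (word []),
      aug = (\<lambda>X. THE c. \<forall>a\<in>X. Poly_Mapping.lookup a [] = c) \<rparr>)"

definition CE_plus :: "('a::ab_group_add, 'k::field) top_dgla \<Rightarrow> (('a \<Rightarrow> 'k, 'k) free_alg set, 'k) dg_alg" where
  "CE_plus g = augmentation_ideal (CE g)"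

section \<open>The limit is a dgla\<close>

lemma (in inverse_system) dgla_inv_lim: "dgla (inv_lim S)"
proof -
  have O: "dgla (obj S \<alpha>)" for \<alpha> by (rule dgla_obj)
  have vs: "vector_space (scl (obj S \<alpha>))" for \<alpha> using O by (rule dgla.vector_space)
  note ax = vs[unfolded vector_space_def]
  have V: "vector_space (\<lambda>c x \<alpha>. scl (obj S \<alpha>) c (x \<alpha>))"
    unfolding vector_space_def using ax by (auto simp: fun_eq_iff)
  have sb: "0 \<in> grd (obj S \<alpha>) n" "x \<in> grd (obj S \<alpha>) n \<Longrightarrow> y \<in> grd (obj S \<alpha>) n \<Longrightarrow> x + y \<in> grd (obj S \<alpha>) n"
    "x \<in> grd (obj S \<alpha>) n \<Longrightarrow> scl (obj S \<alpha>) c x \<in> grd (obj S \<alpha>) n" for \<alpha> n x y c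
    using dgla.subspace[OF O[of \<alpha>], of n] vs[of \<alpha>]
    by (auto simp: module.subspace_def module_iff_vector_space)
  have m: "x \<alpha> \<in> grd (obj S \<alpha>) n" "le S \<alpha> \<beta> \<Longrightarrow> trans_map S \<alpha> \<beta> (x \<beta>) = x \<alpha>"
    if "x \<in> lim_grd S n" for x n \<alpha> \<beta> using that by (auto simp: lim_grd_def)
  have t: "trans_map S \<alpha> \<beta> x \<in> grd (obj S \<alpha>) n"
    "y \<in> grd (obj S \<beta>) n \<Longrightarrow> trans_map S \<alpha> \<beta> (x + y) = trans_map S \<alpha> \<beta> x + trans_map S \<alpha> \<beta> y"
    "trans_map S \<alpha> \<beta> (scl (obj S \<beta>) c x) = scl (obj S \<alpha>) c (trans_map S \<alpha> \<beta> x)"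
    "trans_map S \<alpha> \<beta> (dif (obj S \<beta>) x) = dif (obj S \<alpha>) (trans_map S \<alpha> \<beta> x)"
    "z \<in> grd (obj S \<beta>) l \<Longrightarrow> trans_map S \<alpha> \<beta> (brk (obj S \<beta>) x z) =
      brk (obj S \<alpha>) (trans_map S \<alpha> \<beta> x) (trans_map S \<alpha> \<beta> z)"
    if "le S \<alpha> \<beta>" "x \<in> grd (obj S \<beta>) n" for \<alpha> \<beta> x y c z n l
    using trans_hom[OF that(1)] that(2) unfolding dgla_hom_def by blast+
  have z: "0 \<in> lim_grd S n" for n
  proof -
    have "trans_map S \<alpha> \<beta> 0 = 0" if "le S \<alpha> \<beta>" for \<alpha> \<beta>
      using t(2)[OF that sb(1) sb(1)] by simp
    then show ?thesis by (auto simp: lim_grd_def sb)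
  qed
  show ?thesis
  proof (rule dgla.intro)
    show "vector_space (scl (inv_lim S))" using V by (simp add: inv_lim_def)
    show "module.subspace (scl (inv_lim S)) (grd (inv_lim S) n)" for n
    proof -
      have "module (\<lambda>c x \<alpha>. scl (obj S \<alpha>) c (x \<alpha>))" using V by (simp add: module_iff_vector_space)
      moreover have "x + y \<in> lim_grd S n" if "x \<in> lim_grd S n" "y \<in> lim_grd S n" for x y
        using m(2)[OF that(1)] m(2)[OF that(2)] t(2)[OF _ m(1)[OF that(1)] m(1)[OF that(2)]]
          sb(2)[OF m(1)[OF that(1)] m(1)[OF that(2)]] by (auto simp: lim_grd_def)
      moreover have "(\<lambda>\<alpha>. scl (obj S \<alpha>) c (x \<alpha>)) \<in> lim_grd S n" if "x \<in> lim_grd S n" for x c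
        using m(2)[OF that] t(3)[OF _ m(1)[OF that]] sb(3)[OF m(1)[OF that]] by (auto simp: lim_grd_def)
      ultimately show ?thesis using z by (simp add: inv_lim_def module.subspace_def)
    qed
    show "grd (inv_lim S) m \<inter> grd (inv_lim S) n = {0}" if "m \<noteq> n" for m n
    proof -
      have "x = 0" if "x \<in> lim_grd S m" "x \<in> lim_grd S n" for x
        using m(1)[OF that(1)] m(1)[OF that(2)] dgla.disjoint[OF O \<open>m \<noteq> n\<close>] by (auto simp: fun_eq_iff)
      then show ?thesis using z by (auto simp: inv_lim_def)
    qed
    fix x and n :: int assume "x \<in> grd (inv_lim S) n"
    then have x: "x \<in> lim_grd S n" by (simp add: inv_lim_def)
    note mx = m[OF x]
    show "dif (inv_lim S) x \<in> grd (inv_lim S) (n - 1)"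
      using dgla.dif_grd[OF O mx(1)] mx(2) t(4)[OF _ mx(1)] by (auto simp: inv_lim_def lim_grd_def)
    show "dif (inv_lim S) (x + y) = dif (inv_lim S) x + dif (inv_lim S) y" if "y \<in> grd (inv_lim S) n" for y
      using dgla.dif_add[OF O mx(1) m(1)[of y n]] that by (auto simp: inv_lim_def fun_eq_iff)
    show "dif (inv_lim S) (scl (inv_lim S) c x) = scl (inv_lim S) c (dif (inv_lim S) x)" for c
      using dgla.dif_scl[OF O mx(1)] by (auto simp: inv_lim_def fun_eq_iff)
    show "dif (inv_lim S) (dif (inv_lim S) x) = 0"
      using dgla.dif_dif[OF O mx(1)] by (auto simp: inv_lim_def fun_eq_iff)
  next
    fix x y and m' n :: int assume "x \<in> grd (inv_lim S) m'" "y \<in> grd (inv_lim S) n"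
    then have "x \<in> lim_grd S m'" "y \<in> lim_grd S n" by (simp_all add: inv_lim_def)
    note mx = m[OF this(1)] and my = m[OF this(2)]
    show "brk (inv_lim S) x y \<in> grd (inv_lim S) (m' + n)"
      using dgla.brk_grd[OF O mx(1) my(1)] mx(2) my(2) t(5)[OF _ mx(1) my(1)] by (auto simp: inv_lim_def lim_grd_def)
    show "brk (inv_lim S) (x + w) y = brk (inv_lim S) x y + brk (inv_lim S) w y" if "w \<in> grd (inv_lim S) m'" for w
      using dgla.brk_add_left[OF O mx(1) m(1)[of w m'] my(1)] that by (auto simp: inv_lim_def fun_eq_iff)
    show "brk (inv_lim S) (scl (inv_lim S) c x) y = scl (inv_lim S) c (brk (inv_lim S) x y)" for c
      using dgla.brk_scl_left[OF O mx(1) my(1)] by (auto simp: inv_lim_def fun_eq_iff)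
    show "brk (inv_lim S) x y = scl (inv_lim S) (- ((-1) powi (m' * n))) (brk (inv_lim S) y x)"
      using dgla.brk_antisym[OF O mx(1) my(1)] by (simp add: inv_lim_def fun_eq_iff)
    show "brk (inv_lim S) x (brk (inv_lim S) y w) =
        brk (inv_lim S) (brk (inv_lim S) x y) w + scl (inv_lim S) ((-1) powi (m' * n)) (brk (inv_lim S) y (brk (inv_lim S) x w))"
      if "w \<in> grd (inv_lim S) l" for w l
      using dgla.jacobi[OF O mx(1) my(1) m(1)[of w l]] that by (auto simp: inv_lim_def fun_eq_iff)
    show "dif (inv_lim S) (brk (inv_lim S) x y) =
        brk (inv_lim S) (dif (inv_lim S) x) y + scl (inv_lim S) ((-1) powi m') (brk (inv_lim S) x (dif (inv_lim S) y))"
      using dgla.dif_brk[OF O mx(1) my(1)] by (auto simp: inv_lim_def fun_eq_iff)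
  qed
qed

section \<open>The coproduct does not depend on the type of test objects\<close>

definition const_sys :: "('a, 'k) dgla_struct \<Rightarrow> (nat, 'a, 'k) inv_sys" where
  "const_sys M = \<lparr> le = (\<lambda>_ _. True), obj = (\<lambda>_. M), trans_map = (\<lambda>_ _ x. x) \<rparr>"

lemma dgla_hom_comp:
  assumes "dgla_hom L M f" "dgla_hom M N f'"
  shows "dgla_hom L N (\<lambda>x. f' (f x))"
proof -
  have "f x \<in> grd M n" if "x \<in> grd L n" for x n using assms(1) that by (auto simp: dgla_hom_def)
  then show ?thesis using assms unfolding dgla_hom_def by (intro conjI allI ballI) (metis)+
qed

lemma inverse_system_const_sys:
  assumes "dgla M" "fin_dim M" "nilpotent M"
  shows "inverse_system (const_sys M)"
  using assms by (auto simp: inverse_system_def const_sys_def dgla_hom_def)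

lemma grd_const: "x \<in> grd (inv_lim (const_sys M)) n \<longleftrightarrow> x 0 \<in> grd M n \<and> (\<forall>k. x k = x 0)"
  unfolding inv_lim_def lim_grd_def const_sys_def by (simp, metis)

lemma cont_hom_to_const:
  assumes u: "cont_hom p (inv_lim T) u" and F: "dgla_hom (obj T \<alpha>) M F"
    and top: "\<And>n. topspace (topo p n) = grd p n"
  shows "cont_hom p (inv_lim (const_sys M)) (\<lambda>z m. F (u z \<alpha>))"
proof -
  have mem: "u z \<alpha> \<in> grd (obj T \<alpha>) n" if "z \<in> grd p n" for z n
    using u that unfolding cont_hom_def dgla_hom_def inv_lim_def lim_grd_def by auto
  have "dgla_hom p (inv_lim (const_sys M)) (\<lambda>z m. F (u z \<alpha>))"
    unfolding dgla_hom_def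
  proof (intro conjI allI ballI)
    fix m n c x y assume x: "x \<in> grd p n"
    note hF = F[unfolded dgla_hom_def]
    have hu: "u (x + y) = u x + u y" if "y \<in> grd p n" for y
      using u x that by (auto simp: cont_hom_def dgla_hom_def)
    have hs: "u (scl p c x) \<alpha> = scl (obj T \<alpha>) c (u x \<alpha>)" "u (dif p x) \<alpha> = dif (obj T \<alpha>) (u x \<alpha>)"
      using u x by (auto simp: cont_hom_def dgla_hom_def inv_lim_def)
    have hb: "u (brk p x y) \<alpha> = brk (obj T \<alpha>) (u x \<alpha>) (u y \<alpha>)" if "y \<in> grd p m" for y
      using u x that by (auto simp: cont_hom_def dgla_hom_def inv_lim_def)
    show "(\<lambda>m. F (u x \<alpha>)) \<in> grd (inv_lim (const_sys M)) n"
      using mem[OF x] hF by (auto simp: inv_lim_def lim_grd_def const_sys_def)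
    show "(\<lambda>m. F (u (scl p c x) \<alpha>)) = scl (inv_lim (const_sys M)) c (\<lambda>m. F (u x \<alpha>))"
      using mem[OF x] hF by (auto simp: inv_lim_def const_sys_def hs)
    show "(\<lambda>m. F (u (dif p x) \<alpha>)) = dif (inv_lim (const_sys M)) (\<lambda>m. F (u x \<alpha>))"
      using mem[OF x] hF by (auto simp: inv_lim_def const_sys_def hs)
    show "(\<lambda>m. F (u (x + y) \<alpha>)) = (\<lambda>m. F (u x \<alpha>)) + (\<lambda>m. F (u y \<alpha>))" if "y \<in> grd p n"
      using mem[OF x] mem[OF that] hF hu[OF that] by (auto simp: fun_eq_iff)
    show "(\<lambda>k. F (u (brk p x y) \<alpha>)) = brk (inv_lim (const_sys M)) (\<lambda>k. F (u x \<alpha>)) (\<lambda>k. F (u y \<alpha>))"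
      if "y \<in> grd p m"
      using hb[OF that] hF mem[OF x] mem[OF that] by (simp add: inv_lim_def const_sys_def)
  qed
  moreover have "continuous_map (topo p n) (topo (inv_lim (const_sys M)) n) (\<lambda>z m. F (u z \<alpha>))" for n
  proof -
    have "continuous_map (topo p n)
        (product_topology (\<lambda>\<alpha>. discrete_topology (grd (obj T \<alpha>) n)) UNIV) u"
      using u unfolding cont_hom_def inv_lim_def by (auto simp: continuous_map_in_subtopology)
    then have "continuous_map (topo p n) (discrete_topology (grd (obj T \<alpha>) n)) (\<lambda>z. u z \<alpha>)"
      by (simp add: continuous_map_componentwise_UNIV)
    moreover have "continuous_map (discrete_topology (grd (obj T \<alpha>) n)) (discrete_topology (grd M n)) F"
      using F by (auto simp: dgla_hom_def)
    ultimately have "continuous_map (topo p n) (discrete_topology (grd M n)) (\<lambda>z. F (u z \<alpha>))"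
      using continuous_map_compose[unfolded comp_def] by blast
    moreover have "F (u z \<alpha>) \<in> grd M n" if "z \<in> grd p n" for z
      using mem[OF that] F by (auto simp: dgla_hom_def)
    ultimately show ?thesis
      by (auto simp: inv_lim_def const_sys_def continuous_map_in_subtopology
          continuous_map_componentwise_UNIV lim_grd_def top)
  qed
  ultimately show ?thesis by (simp add: cont_hom_def)
qed

lemma topspace_inv_lim: "topspace (topo (inv_lim S) n) = grd (inv_lim S) n"
  by (auto simp: inv_lim_def lim_grd_def)

lemma topspace_complete: "complete_dgla g \<Longrightarrow> topspace (topo g n) = grd g n"
  unfolding complete_dgla_def using topspace_inv_lim by metis

lemma dgla_copy:
  fixes L :: "('a::ab_group_add, 'k::field_char_0) dgla_struct" and F :: "'a \<Rightarrow> 'b::ab_group_add"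
  assumes L: "dgla L" and sc: "vector_space sc"
    and add: "\<And>n x y. x \<in> grd L n \<Longrightarrow> y \<in> grd L n \<Longrightarrow> F (x + y) = F x + F y"
    and scl: "\<And>n c x. x \<in> grd L n \<Longrightarrow> F (scl L c x) = sc c (F x)"
    and inj: "inj_on F (\<Union>n. grd L n)"
    and fin: "fin_dim L" and nil: "nilpotent L"
  obtains M :: "('b, 'k) dgla_struct" and G where "dgla M" "fin_dim M" "nilpotent M"
    "dgla_hom L M F" "dgla_hom M L G" "\<And>n x. x \<in> grd L n \<Longrightarrow> G (F x) = x"
    "\<And>n y. y \<in> grd M n \<Longrightarrow> F (G y) = y"
proof -
  interpret L: dgla L by fact
  interpret VL: vector_space "scl L" by (rule L.vector_space)
  interpret VM: vector_space sc by fact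
  define G where "G = inv_into (\<Union>n. grd L n) F"
  define M where "M = \<lparr> scl = sc, grd = (\<lambda>n. F ` grd L n), dif = (\<lambda>y. F (dif L (G y))),
    brk = (\<lambda>x y. F (brk L (G x) (G y))) \<rparr>"
  have GF: "G (F x) = x" if "x \<in> grd L n" for x n
    unfolding G_def using that by (intro inv_into_f_f[OF inj]) auto
  have sub: "x + y \<in> grd L n" "scl L c x \<in> grd L n" "0 \<in> grd L n" if "x \<in> grd L n" "y \<in> grd L n" for x y n c
    using that L.subspace[of n] by (auto simp: VL.subspace_def)
  have ssub: "scl L c x \<in> grd L n" if "x \<in> grd L n" for x n c using sub that by blast
  have Gs: "G (F (scl L c x)) = scl L c x" if "x \<in> grd L n" for x n c using GF[OF ssub[OF that]] .
  have Ga: "G (F (x + y)) = x + y" if "x \<in> grd L n" "y \<in> grd L n" for x y n using GF[OF sub(1)[OF that]] .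
  have zero[simp]: "0 \<in> grd L n" for n using L.subspace[of n] by (auto simp: VL.subspace_def)
  have F0: "F 0 = 0" using add[of 0 0 0] by simp
  have [simp]: "F x = 0 \<longleftrightarrow> x = 0" if "x \<in> grd L n" for x n
    using GF[OF that] GF[of 0 n] F0 by auto
  have Fscl: "sc c (F x) = F (scl L c x)" and Fadd: "y \<in> grd L n \<Longrightarrow> F x + F y = F (x + y)"
    if "x \<in> grd L n" for x y c n using add scl that by metis+
  have GFs: "\<And>x n. x \<in> grd L n \<Longrightarrow> G (F x) = x" using GF by blast
  have D: "dgla M"
  proof (rule dgla.intro)
    show "vector_space (dgla_struct.scl M)" using sc by (simp add: M_def)
    show "module.subspace (dgla_struct.scl M) (grd M n)" for n
      unfolding M_def using sub Fscl Fadd F0 by (auto simp: VM.subspace_def image_iff)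
    show "grd M m \<inter> grd M n = {0}" if "m \<noteq> n" for m n
    proof -
      have "x = 0" if x: "x \<in> F ` grd L m" "x \<in> F ` grd L n" for x
      proof -
        from x obtain y z where yz: "y \<in> grd L m" "z \<in> grd L n" "x = F y" "x = F z" by auto
        have "y = z" using GF[OF yz(1)] GF[OF yz(2)] yz by simp
        then have "y = 0" using L.disjoint[OF \<open>m \<noteq> n\<close>] yz by auto
        then show ?thesis using yz F0 by simp
      qed
      moreover have "0 \<in> F ` grd L m" "0 \<in> F ` grd L n" using F0 zero by (metis imageI)+
      ultimately show ?thesis by (auto simp: M_def)
    qed
    fix x and n :: int assume x: "x \<in> grd M n"
    from x obtain x' where x': "x' \<in> grd L n" "x = F x'" by (auto simp: M_def)
    show "dif M x \<in> grd M (n - 1)" using x' L.dif_grd by (auto simp: M_def GFs)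
    show "dif M (dgla_struct.scl M c x) = dgla_struct.scl M c (dif M x)" for c
      using x' Fscl L.dif_scl L.dif_grd[OF x'(1)] Gs[OF x'(1)] by (simp add: M_def GFs)
    show "dif M (dif M x) = 0"
      using x' L.dif_dif F0 L.dif_grd[OF x'(1)] by (simp add: M_def GFs)
    show "dif M (x + y) = dif M x + dif M y" if "y \<in> grd M n" for y
    proof -
      from that obtain y' where y': "y' \<in> grd L n" "y = F y'" by (auto simp: M_def)
      show ?thesis
        using x' y' Fadd[OF x'(1) y'(1)] L.dif_add[OF x'(1) y'(1)] Ga[OF x'(1) y'(1)]
          Fadd[OF L.dif_grd[OF x'(1)] L.dif_grd[OF y'(1)]] by (simp add: M_def GFs)
    qed
  next
    fix x y z and m n l :: int and c :: 'k
    assume x: "x \<in> grd M m" and y: "y \<in> grd M n"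
    from x obtain x' where x': "x' \<in> grd L m" "x = F x'" by (auto simp: M_def)
    from y obtain y' where y': "y' \<in> grd L n" "y = F y'" by (auto simp: M_def)
    note b = L.brk_grd[OF x'(1) y'(1)] L.brk_grd[OF y'(1) x'(1)]
    note b2 = b(2)[folded add.commute[of m n]]
    show "brk M x y \<in> grd M (m + n)" using x' y' b by (auto simp: M_def GFs)
    show "brk M (dgla_struct.scl M c x) y = dgla_struct.scl M c (brk M x y)"
      using x' y' Fscl[OF x'(1)] Fscl[OF b(1)] Gs[OF x'(1)] b L.brk_scl_left by (simp add: M_def GFs)
    show "brk M x y = dgla_struct.scl M (- ((-1) powi (m * n))) (brk M y x)"
      using x' y' Fscl[OF b(2)] L.brk_antisym[OF x'(1) y'(1)]
      by (simp add: M_def GFs del: VL.scale_minus_left VM.scale_minus_left)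
    show "dif M (brk M x y) = brk M (dif M x) y + dgla_struct.scl M ((-1) powi m) (brk M x (dif M y))"
    proof -
      have 1: "brk L (dif L x') y' \<in> grd L (m + n - 1)" "brk L x' (dif L y') \<in> grd L (m + n - 1)"
        using L.brk_grd[OF L.dif_grd[OF x'(1)] y'(1)] L.brk_grd[OF x'(1) L.dif_grd[OF y'(1)]]
        by (simp_all add: algebra_simps)
      then show ?thesis
        using x' y' b L.dif_brk[OF x'(1) y'(1)] L.dif_grd[OF x'(1)] L.dif_grd[OF y'(1)] 1
          Fscl[OF 1(2)] add[OF 1(1) sub(2)[OF 1(2) 1(2)]] by (simp add: M_def GFs)
    qed
    show "brk M (x + w) y = brk M x y + brk M w y" if "w \<in> grd M m" for w
    proof -
      from that obtain w' where w': "w' \<in> grd L m" "w = F w'" by (auto simp: M_def)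
      show ?thesis using x' y' w' Ga[OF x'(1) w'(1)] Fadd[OF x'(1) w'(1)] b(1) L.brk_grd[OF w'(1) y'(1)]
          L.brk_add_left[OF x'(1) w'(1) y'(1)] add[OF b(1) L.brk_grd[OF w'(1) y'(1)]]
        by (simp add: M_def GFs)
    qed
    show "brk M x (brk M y z) = brk M (brk M x y) z + dgla_struct.scl M ((-1) powi (m * n)) (brk M y (brk M x z))"
      if "z \<in> grd M l"
    proof -
      from that obtain z' where z': "z' \<in> grd L l" "z = F z'" by (auto simp: M_def)
      have 1: "brk L (brk L x' y') z' \<in> grd L (m + n + l)" "brk L y' (brk L x' z') \<in> grd L (m + n + l)"
        using L.brk_grd[OF b(1) z'(1)] L.brk_grd[OF y'(1) L.brk_grd[OF x'(1) z'(1)]]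
        by (simp_all add: algebra_simps)
      show ?thesis
        using x' y' z' b L.brk_grd[OF y'(1) z'(1)] L.brk_grd[OF x'(1) z'(1)]
          L.jacobi[OF x'(1) y'(1) z'(1)] Fscl[OF 1(2)] add[OF 1(1) sub(2)[OF 1(2) 1(2)]]
        by (simp add: M_def GFs)
    qed
  qed
  have hF: "dgla_hom L M F"
    unfolding dgla_hom_def using add scl by (auto simp: M_def GFs)
  have hG: "dgla_hom M L G"
    unfolding dgla_hom_def using sub Fscl Fadd L.dif_grd L.brk_grd
    by (auto simp: M_def GFs) (metis GFs sub)+
  have lcs_sub: "lower_central L k n \<subseteq> grd L n" for k n
  proof (induction k arbitrary: n)
    case (Suc k)
    have "{brk L x y |x y i j. x \<in> grd L i \<and> y \<in> lower_central L k j \<and> i + j = n} \<subseteq> grd L n"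
      using Suc L.brk_grd by blast
    then show ?case using VL.span_minimal[OF _ L.subspace] by simp
  qed auto
  have img_sub: "VM.subspace (F ` S)" if S: "VL.subspace S" "S \<subseteq> grd L n" for S n
  proof -
    have "sc c (F x) \<in> F ` S" if "x \<in> S" for c x
      using Fscl[of x n c] that S by (auto simp: VL.subspace_def)
    moreover have "F x + F y \<in> F ` S" if "x \<in> S" "y \<in> S" for x y
      using Fadd[of x n y] that S by (auto simp: VL.subspace_def)
    moreover have "0 \<in> F ` S" using F0 S by (force simp: VL.subspace_def)
    ultimately show ?thesis by (auto simp: VM.subspace_def)
  qed
  have lcs: "lower_central M k n \<subseteq> F ` lower_central L k n" for k n
  proof (induction k arbitrary: n)
    case (Suc k)
    let ?B = "{brk L x y |x y i j. x \<in> grd L i \<and> y \<in> lower_central L k j \<and> i + j = n}"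
    have B: "?B \<subseteq> grd L n" using lcs_sub L.brk_grd by blast
    have "{brk M x y |x y i j. x \<in> grd M i \<and> y \<in> lower_central M k j \<and> i + j = n} \<subseteq> F ` ?B"
    proof clarify
      fix x y i j assume "x \<in> grd M i" "y \<in> lower_central M k j"
      then obtain x' y' where "x' \<in> grd L i" "x = F x'" "y' \<in> lower_central L k j" "y = F y'"
        using Suc[of j] by (auto simp: M_def)
      moreover from this have "brk M x y = F (brk L x' y')" using lcs_sub[of k j] by (auto simp: M_def GFs)
      ultimately show "brk M x y \<in> F ` {brk L x y |x y i' j'. x \<in> grd L i' \<and> y \<in> lower_central L k j' \<and> i' + j' = i + j}"
        by blast
    qed
    also have "\<dots> \<subseteq> F ` VL.span ?B" by (intro image_mono VL.span_superset)
    finally have "VM.span {brk M x y |x y i j. x \<in> grd M i \<and> y \<in> lower_central M k j \<and> i + j = n} \<subseteq> F ` VL.span ?B"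
      by (rule VM.span_minimal[OF _ img_sub[OF VL.subspace_span VL.span_minimal[OF B L.subspace]]])
    then show ?case by (simp add: M_def)
  qed (simp add: M_def)
  have lcs0: "0 \<in> lower_central M k n" for k n
    using F0 by (cases k) (auto simp: M_def VM.span_zero image_iff intro: bexI[of _ 0])
  have N: "nilpotent M"
  proof -
    obtain k where "\<And>n. lower_central L k n = {0}" using nil unfolding nilpotent_def by auto
    then have "lower_central M k n = {0}" for n
      using lcs[of k n] lcs0[of k n] F0 by auto
    then show ?thesis unfolding nilpotent_def by blast
  qed
  have FD: "fin_dim M"
  proof -
    have "{n. grd M n \<noteq> {0}} \<subseteq> {n. grd L n \<noteq> {0}}" using F0 by (auto simp: M_def)
    then have "finite {n. grd M n \<noteq> {0}}" using fin finite_subset unfolding fin_dim_def by blast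
    moreover have "\<exists>B. finite B \<and> grd M n \<subseteq> VM.span B" for n
    proof -
      obtain C where C: "finite C" "grd L n \<subseteq> VL.span C" using fin unfolding fin_dim_def by blast
      obtain B where B: "B \<subseteq> grd L n" "VL.independent B" "grd L n \<subseteq> VL.span B"
        using VL.maximal_independent_subset by blast
      have fB: "finite B" using VL.independent_span_bound[OF C(1) B(2)] B C by blast
      let ?S = "{x \<in> grd L n. F x \<in> VM.span (F ` B)}"
      have "VL.subspace ?S"
        by (auto simp: VL.subspace_def add scl F0 VM.span_zero sub(1) ssub
            intro: VM.span_add VM.span_scale)
      moreover have "B \<subseteq> ?S" using B by (auto intro: VM.span_base)
      ultimately have "grd L n \<subseteq> ?S" using VL.span_minimal B(3) by blast
      then show ?thesis using fB by (intro exI[of _ "F ` B"]) (auto simp: M_def)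
    qed
    ultimately show ?thesis unfolding fin_dim_def by (simp add: M_def)
  qed
  show thesis
    by (rule that[OF D FD N hF hG]) (auto simp: GFs M_def)
qed

lemma fin_dim_copy:
  fixes L :: "('a::ab_group_add, 'k::field_char_0) dgla_struct"
  assumes L: "dgla L" and fin: "fin_dim L"
  obtains F :: "'a \<Rightarrow> nat \<Rightarrow> 'k" where
    "\<And>n x y. x \<in> grd L n \<Longrightarrow> y \<in> grd L n \<Longrightarrow> F (x + y) = F x + F y"
    "\<And>n c x. x \<in> grd L n \<Longrightarrow> F (scl L c x) = (\<lambda>m. c * F x m)"
    "inj_on F (\<Union>n. grd L n)"
proof -
  interpret L: dgla L by fact
  interpret VL: vector_space "scl L" by (rule L.vector_space)
  have "\<exists>B. finite B \<and> VL.independent B \<and> B \<subseteq> grd L n \<and> grd L n \<subseteq> VL.span B" for n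
  proof -
    obtain C where C: "finite C" "grd L n \<subseteq> VL.span C" using fin unfolding fin_dim_def by blast
    obtain B where B: "B \<subseteq> grd L n" "VL.independent B" "grd L n \<subseteq> VL.span B"
      using VL.maximal_independent_subset by blast
    then show ?thesis using VL.independent_span_bound[OF C(1) B(2)] C by blast
  qed
  then obtain B where B: "\<And>n. finite (B n)" "\<And>n. VL.independent (B n)"
    "\<And>n. B n \<subseteq> grd L n" "\<And>n. grd L n \<subseteq> VL.span (B n)" by metis
  obtain b where b: "\<And>n. b n ` {..<card (B n)} = B n"
    using ex_bij_betw_nat_finite[OF B(1)] unfolding bij_betw_def atLeast0LessThan by metis
  define co where "co n l x = (if x \<in> grd L n \<and> l < card (B n)
    then VL.representation (B n) x (b n l) else 0)" for n :: int and l :: nat and x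
  define F where "F x = (\<lambda>m. co (fst (from_nat m :: int \<times> nat)) (snd (from_nat m :: int \<times> nat)) x)" for x
  have sub: "x + y \<in> grd L n" "scl L c x \<in> grd L n" "0 \<in> grd L n" if "x \<in> grd L n" "y \<in> grd L n" for x y n c
    using that L.subspace[of n] by (auto simp: VL.subspace_def)
  have zero: "0 \<in> grd L n" for n using L.subspace[of n] by (auto simp: VL.subspace_def)
  have co0: "co n l 0 = 0" for n l by (simp add: co_def VL.representation_zero)
  have off: "co n' l x = 0" if "x \<in> grd L n" "n' \<noteq> n" for n' n l x
  proof (cases "x \<in> grd L n'")
    case True then have "x = 0" using L.disjoint[OF that(2)] that by blast
    then show ?thesis by (simp add: co0)
  qed (simp add: co_def)
  have coadd: "co n' l (x + y) = co n' l x + co n' l y" if "x \<in> grd L n" "y \<in> grd L n" for n n' l x y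
  proof (cases "n' = n")
    case True
    moreover have "x \<in> VL.span (B n)" "y \<in> VL.span (B n)" using that B(4) by auto
    ultimately show ?thesis using that sub(1)[OF that] by (simp add: co_def VL.representation_add[OF B(2)])
  qed (simp add: off[OF that(1)] off[OF that(2)] off[OF sub(1)[OF that]])
  have coscl: "co n' l (scl L c x) = c * co n' l x" if "x \<in> grd L n" for n n' l x c
  proof (cases "n' = n")
    case True
    moreover have "x \<in> VL.span (B n)" using that B(4) by auto
    ultimately show ?thesis using that sub(2)[OF that that] by (simp add: co_def VL.representation_scale[OF B(2)])
  qed (simp add: off[OF that] off[OF sub(2)[OF that that]])
  have Fco: "co n l x = co n l y" if "F x = F y" for n l x y
    using fun_cong[OF that, of "to_nat (n, l)"] by (simp add: F_def)
  have eq0: "x = 0" if "x \<in> grd L n" "\<And>l. co n l x = 0" for x n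
  proof -
    have "VL.representation (B n) x v = 0" if "v \<in> B n" for v
    proof -
      from that obtain l where "l < card (B n)" "v = b n l" using b[of n] by blast
      then show ?thesis using \<open>\<And>l. co n l x = 0\<close>[of l] \<open>x \<in> grd L n\<close> by (simp add: co_def)
    qed
    moreover have "(\<Sum>v\<in>B n. scl L (VL.representation (B n) x v) v) = x"
      by (rule VL.sum_representation_eq[OF B(2) _ B(1)]) (use that(1) B(4) in auto)
    ultimately show ?thesis by (simp cong: sum.cong)
  qed
  have "x = y" if x: "x \<in> grd L m" and y: "y \<in> grd L n" and e: "F x = F y" for x y m n
  proof (cases "m = n")
    case True
    have my: "scl L (-1) y \<in> grd L n" by (rule sub(2)[OF y y])
    have xn: "x \<in> grd L n" using x True by simp
    have "co n l (x + scl L (-1) y) = 0" for l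
      unfolding coadd[OF xn my] coscl[OF y] Fco[OF e] by simp
    then have "x + scl L (-1) y = 0" by (rule eq0[OF sub(1)[OF xn my]])
    then show ?thesis by simp
  next
    case False
    have "co m l x = 0" for l using Fco[OF e, of m l] off[OF y False] by simp
    moreover have "co n l y = 0" for l using Fco[OF e, of n l] off[OF x False[symmetric]] by simp
    ultimately show ?thesis using eq0[OF x] eq0[OF y] by simp
  qed
  then have "inj_on F (\<Union>n. grd L n)" unfolding inj_on_def by blast
  then show thesis
    by (intro that[of F]) (simp_all add: F_def fun_eq_iff coadd coscl)
qed

lemma coproduct_universal:
  fixes g :: "('i1 \<Rightarrow> 'a::ab_group_add, 'k::field_char_0) top_dgla"
    and t :: "('s \<Rightarrow> 'd::ab_group_add, 'k) top_dgla"
  assumes cop: "is_coproduct g h p i j"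
    and g: "complete_dgla g" and h: "complete_dgla h" and t: "complete_dgla t"
    and f: "cont_hom g t f" and f': "cont_hom h t f'"
  shows "\<exists>u. mediates g h p i j t f f' u \<and>
    (\<forall>u'. mediates g h p i j t f f' u' \<longrightarrow> (\<forall>n. \<forall>z\<in>grd p n. u' z = u z))"
proof -
  obtain T where T: "inverse_system T" and tT: "t = inv_lim T" using t unfolding complete_dgla_def by blast
  interpret T: inverse_system T by fact
  have p: "complete_dgla p" and hi: "cont_hom g p i" and hj: "cont_hom h p j"
    using cop unfolding is_coproduct_def by auto
  note tp = topspace_complete[OF p] and tg = topspace_complete[OF g] and th = topspace_complete[OF h]
  have ig: "i x \<in> grd p n" if "x \<in> grd g n" for x n using hi that by (auto simp: cont_hom_def dgla_hom_def)
  have jh: "j x \<in> grd p n" if "x \<in> grd h n" for x n using hj that by (auto simp: cont_hom_def dgla_hom_def)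
  have vs: "vector_space (\<lambda>c (x :: nat \<Rightarrow> 'k) m. c * x m)"
    by unfold_locales (auto simp: fun_eq_iff algebra_simps)
  have "\<exists>(M :: (nat \<Rightarrow> 'k, 'k) dgla_struct) F G. dgla M \<and> fin_dim M \<and> nilpotent M \<and> dgla_hom (obj T \<alpha>) M F \<and> dgla_hom M (obj T \<alpha>) G \<and>
      (\<forall>n. \<forall>x\<in>grd (obj T \<alpha>) n. G (F x) = x) \<and> (\<forall>n. \<forall>y\<in>grd M n. F (G y) = y)"
    for \<alpha>
  proof -
    obtain F :: "'d \<Rightarrow> nat \<Rightarrow> 'k" where F:
      "\<And>n x y. x \<in> grd (obj T \<alpha>) n \<Longrightarrow> y \<in> grd (obj T \<alpha>) n \<Longrightarrow> F (x + y) = F x + F y"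
      "\<And>n c x. x \<in> grd (obj T \<alpha>) n \<Longrightarrow> F (scl (obj T \<alpha>) c x) = (\<lambda>m. c * F x m)"
      "inj_on F (\<Union>n. grd (obj T \<alpha>) n)"
      by (rule fin_dim_copy[OF T.dgla_obj T.fin_dim_obj]) (rule that)
    show ?thesis
    proof (rule dgla_copy[OF T.dgla_obj vs _ _ F(3) T.fin_dim_obj T.nilpotent_obj])
      fix M :: "(nat \<Rightarrow> 'k, 'k) dgla_struct" and G
      assume "dgla M" "fin_dim M" "nilpotent M" "dgla_hom (obj T \<alpha>) M F" "dgla_hom M (obj T \<alpha>) G"
        "\<And>n x. x \<in> grd (obj T \<alpha>) n \<Longrightarrow> G (F x) = x" "\<And>n y. y \<in> grd M n \<Longrightarrow> F (G y) = y"
      then show ?thesis by - (rule exI[of _ M], rule exI[of _ F], rule exI[of _ G], simp)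
    qed (fact F(1), fact F(2))
  qed
  then obtain M :: "'s \<Rightarrow> (nat \<Rightarrow> 'k, 'k) dgla_struct" and F G where
    M: "\<And>\<alpha>. dgla (M \<alpha>)" "\<And>\<alpha>. fin_dim (M \<alpha>)" "\<And>\<alpha>. nilpotent (M \<alpha>)" and
    hF: "\<And>\<alpha>. dgla_hom (obj T \<alpha>) (M \<alpha>) (F \<alpha>)" and hG: "\<And>\<alpha>. dgla_hom (M \<alpha>) (obj T \<alpha>) (G \<alpha>)" and
    GF: "\<And>\<alpha> n x. x \<in> grd (obj T \<alpha>) n \<Longrightarrow> G \<alpha> (F \<alpha> x) = x" and
    FG: "\<And>\<alpha> n y. y \<in> grd (M \<alpha>) n \<Longrightarrow> F \<alpha> (G \<alpha> y) = y"
    by metis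
  define t' where "t' \<alpha> = inv_lim (const_sys (M \<alpha>))" for \<alpha>
  define e where "e \<alpha> w = (\<lambda>m::nat. F \<alpha> (w \<alpha>))" for \<alpha> and w :: "'s \<Rightarrow> 'd"
  have ct: "complete_dgla (t' \<alpha>)" for \<alpha>
    unfolding complete_dgla_def t'_def using inverse_system_const_sys[OF M] by blast
  have c1: "cont_hom g (t' \<alpha>) (\<lambda>x. e \<alpha> (f x))" for \<alpha>
    unfolding t'_def e_def by (rule cont_hom_to_const[OF f[unfolded tT] hF tg])
  have c2: "cont_hom h (t' \<alpha>) (\<lambda>x. e \<alpha> (f' x))" for \<alpha>
    unfolding t'_def e_def by (rule cont_hom_to_const[OF f'[unfolded tT] hF th])
  have "\<exists>u. mediates g h p i j (t' \<alpha>) (\<lambda>x. e \<alpha> (f x)) (\<lambda>x. e \<alpha> (f' x)) u \<and>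
    (\<forall>u'. mediates g h p i j (t' \<alpha>) (\<lambda>x. e \<alpha> (f x)) (\<lambda>x. e \<alpha> (f' x)) u' \<longrightarrow> (\<forall>n. \<forall>z\<in>grd p n. u' z = u z))"
    for \<alpha> using cop ct c1 c2 unfolding is_coproduct_def by blast
  then obtain u where u: "\<And>\<alpha>. mediates g h p i j (t' \<alpha>) (\<lambda>x. e \<alpha> (f x)) (\<lambda>x. e \<alpha> (f' x)) (u \<alpha>)"
    and uniq: "\<And>\<alpha> u' n z. mediates g h p i j (t' \<alpha>) (\<lambda>x. e \<alpha> (f x)) (\<lambda>x. e \<alpha> (f' x)) u' \<Longrightarrow>
      z \<in> grd p n \<Longrightarrow> u' z = u \<alpha> z" by metis
  have uc: "cont_hom p (inv_lim (const_sys (M \<alpha>))) (u \<alpha>)" for \<alpha>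
    using u unfolding mediates_def t'_def by blast
  have ug: "u \<alpha> z 0 \<in> grd (M \<alpha>) n" "u \<alpha> z k = u \<alpha> z 0" if "z \<in> grd p n" for \<alpha> z n k
    using uc[of \<alpha>] that grd_const[of "u \<alpha> z" "M \<alpha>" n] unfolding cont_hom_def dgla_hom_def by blast+
  define v where "v z = (\<lambda>\<alpha>. G \<alpha> (u \<alpha> z 0))" for z
  have vg: "v z \<alpha> \<in> grd (obj T \<alpha>) n" if "z \<in> grd p n" for z \<alpha> n
    using hG[of \<alpha>] ug[OF that] unfolding v_def dgla_hom_def by blast
  have fg: "f x \<in> lim_grd T n" if "x \<in> grd g n" for x n
    using f that unfolding tT cont_hom_def dgla_hom_def inv_lim_def by auto
  have fh: "f' x \<in> lim_grd T n" if "x \<in> grd h n" for x n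
    using f' that unfolding tT cont_hom_def dgla_hom_def inv_lim_def by auto
  have GFl: "G \<alpha> (F \<alpha> (w \<alpha>)) = w \<alpha>" if "w \<in> lim_grd T n" for w \<alpha> n
    by (rule GF[of _ _ n]) (use that in \<open>auto simp: lim_grd_def\<close>)
  have tml: "trans_map T \<alpha> \<beta> (w \<beta>) = w \<alpha>" if "w \<in> lim_grd T n" "le T \<alpha> \<beta>" for w \<alpha> \<beta> n
    using that by (auto simp: lim_grd_def)
  have compat: "trans_map T \<alpha> \<beta> (v z \<beta>) = v z \<alpha>" if le: "le T \<alpha> \<beta>" and z: "z \<in> grd p n" for \<alpha> \<beta> z n
  proof -
    have tr: "trans_map T \<alpha> \<beta> x \<in> grd (obj T \<alpha>) n" if "x \<in> grd (obj T \<beta>) n" for x n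
      using T.trans_hom[OF le] that by (auto simp: dgla_hom_def)
    have H: "dgla_hom (obj (const_sys (M \<beta>)) 0) (M \<alpha>) (\<lambda>y. F \<alpha> (trans_map T \<alpha> \<beta> (G \<beta> y)))"
      using dgla_hom_comp[OF dgla_hom_comp[OF hG T.trans_hom[OF le]] hF] by (simp add: const_sys_def)
    have "mediates g h p i j (t' \<alpha>) (\<lambda>x. e \<alpha> (f x)) (\<lambda>x. e \<alpha> (f' x))
        (\<lambda>z m. F \<alpha> (trans_map T \<alpha> \<beta> (G \<beta> (u \<beta> z 0))))"
      unfolding mediates_def
    proof (intro conjI allI ballI)
      show "cont_hom p (t' \<alpha>) (\<lambda>z m. F \<alpha> (trans_map T \<alpha> \<beta> (G \<beta> (u \<beta> z 0))))"
        unfolding t'_def by (rule cont_hom_to_const[OF uc H tp])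
      show "(\<lambda>m. F \<alpha> (trans_map T \<alpha> \<beta> (G \<beta> (u \<beta> (i x) 0)))) = e \<alpha> (f x)" if "x \<in> grd g n" for x n
      proof -
        have "u \<beta> (i x) 0 = F \<beta> (f x \<beta>)" using u[of \<beta>] that unfolding mediates_def e_def by metis
        then show ?thesis by (simp add: e_def GFl[OF fg[OF that]] tml[OF fg[OF that] le])
      qed
      show "(\<lambda>m. F \<alpha> (trans_map T \<alpha> \<beta> (G \<beta> (u \<beta> (j x) 0)))) = e \<alpha> (f' x)" if "x \<in> grd h n" for x n
      proof -
        have "u \<beta> (j x) 0 = F \<beta> (f' x \<beta>)" using u[of \<beta>] that unfolding mediates_def e_def by metis
        then show ?thesis by (simp add: e_def GFl[OF fh[OF that]] tml[OF fh[OF that] le])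
      qed
    qed
    from uniq[OF this z] have "F \<alpha> (trans_map T \<alpha> \<beta> (v z \<beta>)) = u \<alpha> z 0"
      unfolding v_def by metis
    then have "G \<alpha> (F \<alpha> (trans_map T \<alpha> \<beta> (v z \<beta>))) = v z \<alpha>" by (simp add: v_def)
    then show ?thesis using GF[OF tr[OF vg[OF z]]] by simp
  qed
  have vl: "v z \<in> lim_grd T n" if "z \<in> grd p n" for z n
    using vg[OF that] compat[OF _ that] by (auto simp: lim_grd_def)
  have hv: "dgla_hom p t v"
  proof -
    have "dgla_hom p (inv_lim (const_sys (obj T \<alpha>))) (\<lambda>z m. G \<alpha> (u \<alpha> z 0))" for \<alpha>
    proof -
      have "dgla_hom (obj (const_sys (M \<alpha>)) 0) (obj T \<alpha>) (G \<alpha>)" using hG by (simp add: const_sys_def)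
      from cont_hom_to_const[OF uc this tp] show ?thesis unfolding cont_hom_def by blast
    qed
    then show ?thesis using vl unfolding dgla_hom_def tT
      by (auto simp: inv_lim_def const_sys_def v_def fun_eq_iff)
  qed
  have cv: "continuous_map (topo p n) (topo t n) v" for n
  proof -
    have "continuous_map (topo p n) (discrete_topology (grd (obj T \<alpha>) n)) (\<lambda>z. v z \<alpha>)" for \<alpha>
    proof -
      have "continuous_map (topo p n)
          (product_topology (\<lambda>_::nat. discrete_topology (grd (M \<alpha>) n)) UNIV) (u \<alpha>)"
        using uc[of \<alpha>] unfolding cont_hom_def inv_lim_def const_sys_def
        by (auto simp: continuous_map_in_subtopology)
      then have 1: "continuous_map (topo p n) (discrete_topology (grd (M \<alpha>) n)) (\<lambda>z. u \<alpha> z 0)"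
        by (simp add: continuous_map_componentwise_UNIV)
      have 2: "continuous_map (discrete_topology (grd (M \<alpha>) n)) (discrete_topology (grd (obj T \<alpha>) n)) (G \<alpha>)"
        using hG[of \<alpha>] by (auto simp: dgla_hom_def)
      show ?thesis unfolding v_def using continuous_map_compose[OF 1 2] by (simp add: comp_def)
    qed
    then show ?thesis using vl
      by (auto simp: tT inv_lim_def continuous_map_in_subtopology continuous_map_componentwise_UNIV tp)
  qed
  have med: "mediates g h p i j t f f' v"
    unfolding mediates_def
  proof (intro conjI allI ballI)
    show "cont_hom p t v" using hv cv by (simp add: cont_hom_def)
    show "v (i x) = f x" if "x \<in> grd g n" for x n
    proof
      fix \<alpha>
      have "u \<alpha> (i x) 0 = F \<alpha> (f x \<alpha>)" using u[of \<alpha>] that unfolding mediates_def e_def by metis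
      then show "v (i x) \<alpha> = f x \<alpha>" by (simp add: v_def GFl[OF fg[OF that]])
    qed
    show "v (j x) = f' x" if "x \<in> grd h n" for x n
    proof
      fix \<alpha>
      have "u \<alpha> (j x) 0 = F \<alpha> (f' x \<alpha>)" using u[of \<alpha>] that unfolding mediates_def e_def by metis
      then show "v (j x) \<alpha> = f' x \<alpha>" by (simp add: v_def GFl[OF fh[OF that]])
    qed
  qed
  moreover have "v' z = v z" if v': "mediates g h p i j t f f' v'" and z: "z \<in> grd p n" for v' z n
  proof
    fix \<alpha>
    have cv': "cont_hom p (inv_lim T) v'" using v' unfolding mediates_def tT by blast
    have "mediates g h p i j (t' \<alpha>) (\<lambda>x. e \<alpha> (f x)) (\<lambda>x. e \<alpha> (f' x)) (\<lambda>z. e \<alpha> (v' z))"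
      using v' cont_hom_to_const[OF cv' hF tp] unfolding mediates_def t'_def e_def by simp
    from uniq[OF this z] have "u \<alpha> z 0 = F \<alpha> (v' z \<alpha>)" unfolding e_def by metis
    moreover have "v' z \<in> lim_grd T n" using cv' z unfolding cont_hom_def dgla_hom_def inv_lim_def by auto
    ultimately show "v' z \<alpha> = v z \<alpha>" by (simp add: v_def GFl)
  qed
  ultimately show ?thesis by blast
qed

end

theory Submission
  imports Defs "HOL-Library.Multiset"
begin

text \<open>
  By the universal property the coproduct \<open>p\<close> of \<open>g\<close> and \<open>h\<close> has projections \<open>\<pi>1\<close>, \<open>\<pi>2\<close> that split the
  inclusions and vanish on the other factor, so \<open>C(\<pi>1) + C(\<pi>2)\<close> is a section of \<open>(C(\<iota>\<^sub>1), C(\<iota>\<^sub>2))\<close> on augmentation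
  ideals, and it remains to show that the kernel of \<open>(C(\<iota>\<^sub>1), C(\<iota>\<^sub>2))\<close> is acyclic. Filtered by word length, this
  reduces to the exactness of the quadratic differential on the cochains that vanish on \<open>g\<close> and on \<open>h\<close>.
  In word lengths one and two it follows from the universal property, tested on central extensions of
  finite-dimensional nilpotent quotients of \<open>p\<close> by an acyclic two-dimensional complex. Exactness in higher
  word lengths is deduced from length two: adjoining a variable \<open>up v\<close> with \<open>d (up v) = v + \<dots>\<close> for every basis
  vector \<open>v\<close> makes the algebras of \<open>p\<close>, \<open>g\<close> and \<open>h\<close> acyclic, and shifts the word length down by one.

  Symmetric algebras are modelled by finitely supported supersymmetric functions on words, which turns
  statements modulo the symmetry relations into equations between functions.
\<close>

text \<open>Central extensions control only word lengths one and two; beyond that the argument is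
  dimension shifting. With the variables \<open>up v\<close> as coefficients, which behave like
  coordinate functions on the group of the Lie algebra, the quadratic complex becomes acyclic. Over
  the two factors these coefficients are the same, and a cochain over one factor vanishes on the
  other as soon as all its words contain an old letter. The primitives used to pass from word length
  \<open>i\<close> to \<open>i + 1\<close> have \<open>i - 1\<close> old letters, so
  \<open>i\<close> must be at least 2: this is why length two needs its own proof. Nilpotence enters
  through ranks given by the lower central filtration of the dual; weights built from them make the
  dots in \<open>d (up v) = v + \<dots>\<close> small. Two evaluations of symmetric words are played
  against each other: coordinates in a basis of the dual, where derivations and the restriction to a
  factor are easy, and values at elements of the dgla, where the Jacobi identity, the Leibniz rule
  and functoriality can be read off, independently of the chosen representatives of the dual
  bracket.\<close>

abbreviation "keys \<equiv> Poly_Mapping.keys"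
abbreviation "lookup \<equiv> Poly_Mapping.lookup"

abbreviation over :: "'a set \<Rightarrow> 'a list \<Rightarrow> bool"
  where "over A \<equiv> \<lambda>w. set w \<subseteq> A"

abbreviation len :: "nat \<Rightarrow> 'a list \<Rightarrow> bool" where "len n \<equiv> \<lambda>w. length w = n"

abbreviation wds :: "'a set \<Rightarrow> nat \<Rightarrow> 'a list \<Rightarrow> bool"
  where "wds A n \<equiv> \<lambda>w. set w \<subseteq> A \<and> length w = n"

section \<open>The signed shuffle algebra\<close>

text \<open>Signs depend on parity alone, so identities between Koszul signs reduce to case
  distinctions once \<open>eps\<close> is unfolded; \<open>powi_eps\<close> connects it with the
  powers of -1 in the definitions.\<close>

definition eps :: "int \<Rightarrow> 'k::comm_ring_1" where
  "eps n = (if even n then 1 else -1)"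

lemma eps_add: "eps (m + n) = eps m * eps n" and eps_diff: "eps (m - n) = eps m * eps n"
  and eps_0: "eps 0 = 1"
  and eps_sq: "eps n * eps n = 1" by (auto simp: eps_def)

lemma eps_sq_left: "eps n * (eps n * x) = x" by (simp add: mult.assoc[symmetric] eps_sq)

lemma eps_cong: "even (m + n) \<Longrightarrow> eps m = eps n" by (auto simp: eps_def)

lemma powi_eps: "(-1) powi n = (eps n :: 'k::field)"
  by (auto simp: eps_def power_int_def minus_one_power_iff even_nat_iff)

abbreviation sc :: "'k::field \<Rightarrow> ('x \<Rightarrow> 'k) \<Rightarrow> 'x \<Rightarrow> 'k" where
  "sc \<equiv> fun_scale"

lemma sc_simps [simp]: "sc c f x = c * f x" "sc c (sc d f) = sc (c * d) f" "sc 1 f = f" "sc 0 f = 0"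
  "sc c (f + g) = sc c f + sc c g" "sc c (f - g) = sc c f - sc c g" "sc c 0 = 0" "sc c (- f) = - sc c f"
  by (auto simp: fun_scale_def fun_eq_iff algebra_simps)

lemma sum_fun_apply: "(\<Sum>i\<in>I. f i) x = (\<Sum>i\<in>I. f i x)"
  by (induction I rule: infinite_finite_induct) auto

lemma additive_sum: assumes "F 0 = 0" "\<And>x y. F (x + y) = F x + F y"
  shows "F (\<Sum>i\<in>I. f i) = (\<Sum>i\<in>I. F (f i))"
  using sum_comp_morphism[OF assms, of f I] by (simp add: comp_def)

lemma sc_sum: "sc c (\<Sum>i\<in>I. f i) = (\<Sum>i\<in>I. sc c (f i))" by (rule additive_sum[of "sc c"]) simp_all

lemma vector_space_sc: "vector_space (sc :: 'k::field \<Rightarrow> _)"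
  by unfold_locales (auto simp: fun_scale_def fun_eq_iff algebra_simps)

text \<open>In the encoding of polynomials by iterated derivatives explained below, this is the
  partial derivative along \<open>b\<close>.\<close>

definition ldel :: "'b \<Rightarrow> ('b list \<Rightarrow> 'k) \<Rightarrow> 'b list \<Rightarrow> 'k" where
  "ldel b f = (\<lambda>w. f (b # w))"

lemma ldel_simps [simp]: "ldel b (f + g) = ldel b f + ldel b g" "ldel b (f - g) = ldel b f - ldel b g"
  "ldel b 0 = 0" "ldel b (sc c f) = sc c (ldel b f)" "ldel b (- f) = - ldel b f"
  for f g :: "'b list \<Rightarrow> 'k::field" by (auto simp: ldel_def fun_eq_iff)

lemma ldel_sum: "ldel b (\<Sum>i\<in>I. f i) = (\<Sum>i\<in>I. ldel b (f i :: _ \<Rightarrow> 'k::field))"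
  by (rule additive_sum[of "ldel b"]) simp_all

lemma ldel_apply: "ldel b f w = f (b # w)" by (simp add: ldel_def)

text \<open>One additive function on words serves for degrees, weights and the number of letters of
  a given kind.\<close>

definition wsum :: "('b \<Rightarrow> 'm::comm_monoid_add) \<Rightarrow> 'b list \<Rightarrow> 'm" where
  "wsum q w = sum_list (map q w)"

lemma wsum_simps [simp]: "wsum q [] = 0" "wsum q (b # w) = q b + wsum q w" "wsum q (u @ v) = wsum q u + wsum q v"
  by (auto simp: wsum_def)

lemma wsum_shuffles: "w \<in> shuffles u v \<Longrightarrow> wsum q w = wsum q u + wsum q v"
proof (induction u v arbitrary: w rule: shuffles.induct)
  case (3 x xs y ys)
  thus ?case by (auto simp: algebra_simps)
qed auto

definition lett :: "'b \<Rightarrow> 'b list \<Rightarrow> 'k::comm_ring_1" where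
  "lett b = (\<lambda>w. if w = [b] then 1 else 0)"

definition onef :: "'b list \<Rightarrow> 'k::comm_ring_1" where
  "onef = (\<lambda>w. if w = [] then 1 else 0)"

lemma ldel_lett: "ldel c (lett b) = (if c = b then onef else 0)"
  by (auto simp: ldel_def lett_def onef_def fun_eq_iff)

lemma onef_nil [simp]: "onef [] = 1" by (simp add: onef_def)

lemma ldel_onef [simp]: "ldel c onef = 0" by (auto simp: ldel_def onef_def fun_eq_iff)

text \<open>For words over a set of letters, restriction is the substitution of 0 for all other
  variables; for words of a given length it is the projection to a homogeneous component.\<close>

definition rst :: "('b list \<Rightarrow> bool) \<Rightarrow> ('b list \<Rightarrow> 'k::zero) \<Rightarrow> 'b list \<Rightarrow> 'k" where
  "rst P f = (\<lambda>w. if P w then f w else 0)"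

abbreviation "rs A \<equiv> rst (over A)"

lemma rst_add: "rst P (f + g) = rst P f + rst P (g :: 'b list \<Rightarrow> 'k::ab_group_add)"
  and rst_diff: "rst P (f - g) = rst P f - rst P (g :: 'b list \<Rightarrow> 'k::ab_group_add)"
  and rst_0 [simp]: "rst P 0 = (0 :: 'b list \<Rightarrow> 'k::ab_group_add)"
  and rst_sc: "rst P (sc c h) = sc c (rst P (h :: 'b list \<Rightarrow> 'f::field))"
  by (auto simp: rst_def fun_eq_iff)

lemma rst_sum: "rst P (\<Sum>i\<in>I. f i) = (\<Sum>i\<in>I. rst P (f i :: 'b list \<Rightarrow> 'k::ab_group_add))"
  by (rule additive_sum[of "rst P"]) (simp_all add: rst_add)

text \<open>
  A polynomial in graded commuting variables is encoded by its iterated partial derivatives at 0: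
  the value at a word \<open>b\<^sub>1 \<dots> b\<^sub>n\<close> is \<open>\<partial>\<^sub>b\<^sub>n \<dots> \<partial>\<^sub>b\<^sub>1 f (0)\<close>. The product of polynomials is then
  the signed shuffle product.
\<close>

locale shuffle_algebra =
  fixes deg :: "'b \<Rightarrow> int" and fld :: "'k::field_char_0 itself"
begin

abbreviation wdeg :: "'b list \<Rightarrow> int" where
  "wdeg \<equiv> wsum deg"

text \<open>The sign picked up by \<open>f\<close> when an element of degree \<open>n\<close> moves
  past it, written as an operator so that inhomogeneous \<open>f\<close> are allowed.\<close>

definition twist :: "int \<Rightarrow> ('b list \<Rightarrow> 'k) \<Rightarrow> 'b list \<Rightarrow> 'k" where
  "twist n f = (\<lambda>w. eps (n * wdeg w) * f w)"

lemma twist_simps [simp]: "twist n (f + g) = twist n f + twist n g" "twist n 0 = 0"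
  "twist n (sc c f) = sc c (twist n f)" "twist n (- f) = - twist n f" "twist n (f - g) = twist n f - twist n g"
  "twist n (twist m f) = twist (n + m) f" "twist 0 f = f" "twist n onef = onef"
  by (auto simp: twist_def fun_eq_iff algebra_simps eps_add eps_0 onef_def)

lemma twist_nil [simp]: "twist n f [] = f []" by (simp add: twist_def eps_0)

lemma twist_lett: "twist n (lett b) = sc (eps (n * deg b)) (lett b)"
  by (auto simp: twist_def lett_def fun_eq_iff)

lemma ldel_twist: "ldel b (twist n f) = sc (eps (n * deg b)) (twist n (ldel b f))"
  by (auto simp: twist_def ldel_def fun_eq_iff algebra_simps eps_add)

lemma twist_cong: "even (m + n) \<Longrightarrow> twist m f = twist n f"
  unfolding twist_def by (rule ext) (metis eps_cong distrib_right even_mult_iff)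

text \<open>The recursion is the graded Leibniz rule for the derivative along the first letter, with
  evaluation at 0 on the empty word.\<close>

primrec shf :: "'b list \<Rightarrow> ('b list \<Rightarrow> 'k) \<Rightarrow> ('b list \<Rightarrow> 'k) \<Rightarrow> 'k" where
  "shf [] f g = f [] * g []"
| "shf (b # w) f g = shf w (ldel b f) g + shf w (twist (deg b) f) (ldel b g)"

definition sp :: "('b list \<Rightarrow> 'k) \<Rightarrow> ('b list \<Rightarrow> 'k) \<Rightarrow> 'b list \<Rightarrow> 'k" (infixl "\<star>" 70) where
  "f \<star> g = (\<lambda>w. shf w f g)"

lemma sp_nil [simp]: "(f \<star> g) [] = f [] * g []" by (simp add: sp_def)

lemma ldel_sp: "ldel b (f \<star> g) = ldel b f \<star> g + twist (deg b) f \<star> ldel b g"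
  by (auto simp: sp_def ldel_def fun_eq_iff)

lemma sp_cons: "(f \<star> g) (b # w) = (ldel b f \<star> g) w + (twist (deg b) f \<star> ldel b g) w"
  by (simp add: sp_def)

lemma sp_add_left: "(f + g) \<star> h = f \<star> h + g \<star> h"
proof
  fix w show "((f + g) \<star> h) w = (f \<star> h + g \<star> h) w"
    by (induction w arbitrary: f g h) (auto simp: sp_cons algebra_simps)
qed

lemma sp_add_right: "h \<star> (f + g) = h \<star> f + h \<star> g"
proof
  fix w show "(h \<star> (f + g)) w = (h \<star> f + h \<star> g) w"
    by (induction w arbitrary: f g h) (auto simp: sp_cons algebra_simps)
qed

lemma sp_sc_left: "sc c f \<star> g = sc c (f \<star> g)"
proof
  fix w show "(sc c f \<star> g) w = sc c (f \<star> g) w"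
    by (induction w arbitrary: f g) (auto simp: sp_cons algebra_simps)
qed

lemma sp_sc_right: "f \<star> sc c g = sc c (f \<star> g)"
proof
  fix w show "(f \<star> sc c g) w = sc c (f \<star> g) w"
    by (induction w arbitrary: f g) (auto simp: sp_cons algebra_simps)
qed

lemma sp_0_left [simp]: "0 \<star> g = 0" using sp_sc_left[of 0 0 g] by simp

lemma sp_0_right [simp]: "g \<star> 0 = 0" using sp_sc_right[of g 0 0] by simp

lemma sp_sum_left: "(\<Sum>i\<in>I. f i) \<star> g = (\<Sum>i\<in>I. f i \<star> g)"
  by (rule additive_sum[of "\<lambda>h. h \<star> g"]) (simp_all add: sp_add_left)

lemma sp_sum_right: "g \<star> (\<Sum>i\<in>I. f i) = (\<Sum>i\<in>I. g \<star> f i)"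
  by (rule additive_sum[of "(\<star>) g"]) (simp_all add: sp_add_right)

lemma twist_sp: "twist n (f \<star> g) = twist n f \<star> twist n g"
proof
  fix w show "twist n (f \<star> g) w = (twist n f \<star> twist n g) w"
  proof (induction w arbitrary: f g)
    case (Cons b w)
    have "twist n (f \<star> g) (b # w) = eps (n * deg b) * twist n (ldel b (f \<star> g)) w"
      using fun_cong[OF ldel_twist[of b n "f \<star> g"], of w] by (simp add: ldel_apply)
    also have "\<dots> = eps (n * deg b) * (twist n (ldel b f \<star> g) w + twist n (twist (deg b) f \<star> ldel b g) w)"
      by (simp add: ldel_sp)
    also have "\<dots> = (twist n f \<star> twist n g) (b # w)"
      by (simp add: Cons sp_cons ldel_twist sp_sc_left sp_sc_right algebra_simps)
    finally show ?case .
  qed simp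
qed

lemma sp_assoc: "(f \<star> g) \<star> h = f \<star> (g \<star> h)"
proof
  fix w show "((f \<star> g) \<star> h) w = (f \<star> (g \<star> h)) w"
    by (induction w arbitrary: f g h) (auto simp: sp_cons ldel_sp twist_sp sp_add_left sp_add_right)
qed

lemma onef_sp [simp]: "onef \<star> f = f"
proof
  fix w show "(onef \<star> f) w = f w"
    by (induction w arbitrary: f) (auto simp: sp_cons ldel_apply)
qed

lemma sp_onef [simp]: "f \<star> onef = f"
proof
  fix w show "(f \<star> onef) w = f w"
    by (induction w arbitrary: f) (auto simp: sp_cons ldel_apply)
qed

definition hom :: "int \<Rightarrow> ('b list \<Rightarrow> 'k) \<Rightarrow> bool" where
  "hom n f \<longleftrightarrow> (\<forall>w. f w \<noteq> 0 \<longrightarrow> wdeg w = n)"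

lemma hom_ldel: "hom n f \<Longrightarrow> hom (n - deg b) (ldel b f)" by (auto simp: hom_def ldel_def)

lemma hom_twist: "hom n f \<Longrightarrow> twist m f = sc (eps (m * n)) f"
  by (auto simp: hom_def twist_def fun_eq_iff)

lemma hom_closed: "hom n 0" "hom n f \<Longrightarrow> hom n g \<Longrightarrow> hom n (f + g)" "hom n f \<Longrightarrow> hom n (sc c f)"
  "hom n f \<Longrightarrow> hom n g \<Longrightarrow> hom n (f - g)" "hom n f \<Longrightarrow> hom n (rst P f)" "hom (deg b) (lett b)"
  unfolding hom_def by (auto simp: rst_def lett_def) (metis add_0 diff_self right_minus_eq)+

text \<open>Since \<open>twist\<close> carries the sign for every component of \<open>g\<close>,
  homogeneity is asked of \<open>f\<close> alone. Differentiating both sides along the first letter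
  \<open>b\<close> exchanges the two terms of the Leibniz rule; \<open>n - deg b\<close> and
  \<open>deg b + n\<close> have the same parity.\<close>

lemma sp_commute: "hom n f \<Longrightarrow> f \<star> g = twist n g \<star> f"
proof
  fix w assume "hom n f" thus "(f \<star> g) w = (twist n g \<star> f) w"
  proof (induction w arbitrary: n f g)
    case (Cons b w)
    have 1: "(ldel b f \<star> g) w = (twist (n - deg b) g \<star> ldel b f) w"
      by (rule Cons.IH[OF hom_ldel[OF Cons.prems]])
    have 2: "(f \<star> ldel b g) w = (twist n (ldel b g) \<star> f) w" by (rule Cons.IH[OF Cons.prems])
    have 3: "twist (n - deg b) g = twist (deg b + n) g" by (rule twist_cong) simp
    show ?case
      using 1 2 by (simp add: sp_cons ldel_twist sp_sc_left hom_twist[OF Cons.prems] 3 algebra_simps)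
  qed (simp add: algebra_simps)
qed

lemma sp_support: assumes "(f \<star> g) w \<noteq> 0"
  obtains u v where "f u \<noteq> 0" "g v \<noteq> 0" "w \<in> shuffles u v"
proof -
  have "\<exists>u v. f u \<noteq> 0 \<and> g v \<noteq> 0 \<and> w \<in> shuffles u v" using assms
  proof (induction w arbitrary: f g)
    case (Cons b w)
    consider "(ldel b f \<star> g) w \<noteq> 0" | "(twist (deg b) f \<star> ldel b g) w \<noteq> 0"
      using Cons.prems unfolding sp_cons by fastforce
    thus ?case
    proof cases
      case 1
      then obtain u v where "f (b # u) \<noteq> 0" "g v \<noteq> 0" "w \<in> shuffles u v"
        using Cons.IH by (force simp: ldel_def)
      thus ?thesis by (intro exI[of _ "b # u"] exI[of _ v]) (auto simp: Cons_in_shuffles_leftI)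
    next
      case 2
      then obtain u v where "f u \<noteq> 0" "g (b # v) \<noteq> 0" "w \<in> shuffles u v"
        using Cons.IH by (force simp: ldel_def twist_def)
      thus ?thesis by (intro exI[of _ u] exI[of _ "b # v"]) (auto simp: Cons_in_shuffles_rightI)
    qed
  qed auto
  thus thesis using that by blast
qed

lemma hom_sp: "hom m f \<Longrightarrow> hom n g \<Longrightarrow> hom (m + n) (f \<star> g)"
  unfolding hom_def by (metis sp_support wsum_shuffles)

lemma hom_sum: "(\<And>i. i \<in> I \<Longrightarrow> hom n (f i)) \<Longrightarrow> hom n (\<Sum>i\<in>I. f i)"
  by (induction I rule: infinite_finite_induct) (auto simp: hom_closed)

text \<open>A shuffle of two words is over \<open>A\<close> exactly when both of them are; in terms
  of polynomials, substituting 0 for variables is multiplicative.\<close>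

lemma rst_letters_sp: "rs A (f \<star> g) = rs A f \<star> rs A g"
proof
  fix w show "rs A (f \<star> g) w = (rs A f \<star> rs A g) w"
  proof (induction w arbitrary: f g)
    case (Cons b w)
    have ld: "ldel b (rs A f) = (if b \<in> A then rs A (ldel b f) else 0)" for f
      by (auto simp: ldel_def rst_def fun_eq_iff)
    have tw: "twist n (rs A f) = rs A (twist n f)" for f n
      by (auto simp: twist_def rst_def fun_eq_iff)
    have 1: "rs A (f \<star> g) (b # w) = (if b \<in> A then rs A (ldel b (f \<star> g)) w else 0)"
      by (auto simp: ldel_def rst_def)
    show ?case
    proof (cases "b \<in> A")
      case True
      thus ?thesis unfolding 1 ldel_sp rst_add plus_fun_apply Cons.IH sp_cons ld tw by simp
    next
      case False
      thus ?thesis unfolding 1 sp_cons ld tw by simp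
    qed
  qed (auto simp: rst_def)
qed

subsection \<open>Supersymmetric functions of finite support\<close>

text \<open>Partial derivatives commute up to the Koszul sign. For an odd letter
  \<open>a = b\<close> the condition equates a value with its negative, so in characteristic zero
  words with two adjacent equal odd letters have value 0.\<close>

definition supersym :: "('b list \<Rightarrow> 'k) \<Rightarrow> bool" where
  "supersym f \<longleftrightarrow> (\<forall>u a b v. f (u @ a # b # v) = eps (deg a * deg b) * f (u @ b # a # v))"

lemma supersymI: "(\<And>u a b v. f (u @ a # b # v) = eps (deg a * deg b) * f (u @ b # a # v)) \<Longrightarrow> supersym f"
  unfolding supersym_def by blast

lemma supersymD: "supersym f \<Longrightarrow> f (u @ a # b # v) = eps (deg a * deg b) * f (u @ b # a # v)"
  unfolding supersym_def by blast

lemma supersym_ldel: "supersym f \<Longrightarrow> supersym (ldel b f)"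
  unfolding supersym_def ldel_def by (metis append_Cons)

lemma supersym_ldel2: "supersym f \<Longrightarrow> ldel a (ldel b f) = sc (eps (deg a * deg b)) (ldel b (ldel a f))"
proof
  fix w assume "supersym f"
  hence "f ([] @ b # a # w) = eps (deg b * deg a) * f ([] @ a # b # w)"
    unfolding supersym_def by blast
  thus "ldel a (ldel b f) w = sc (eps (deg a * deg b)) (ldel b (ldel a f)) w"
    by (simp only: ldel_def sc_simps append_Nil mult.commute[of "deg b"])
qed

lemma supersym_twist: "supersym f \<Longrightarrow> supersym (twist n f)"
  by (rule supersymI, drule_tac u = u and a = a and b = b and v = v in supersymD) (simp add: twist_def algebra_simps)

lemma supersym_closed: "supersym 0" "supersym onef" "supersym (lett b)"
  "supersym f \<Longrightarrow> supersym g \<Longrightarrow> supersym (f + g)" "supersym f \<Longrightarrow> supersym g \<Longrightarrow> supersym (f - g)"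
  "supersym f \<Longrightarrow> supersym (sc c f)"
proof -
  show "supersym 0" "supersym onef" "supersym (lett b)"
    by (auto intro!: supersymI simp: onef_def lett_def append_eq_Cons_conv)
  show "supersym (sc c f)" if "supersym f"
    by (rule supersymI) (use that in \<open>drule_tac u = u and a = a and b = b and v = v in supersymD, simp\<close>)
  show "supersym (f + g)" "supersym (f - g)" if "supersym f" "supersym g"
    by (rule supersymI, use that in \<open>drule_tac u = u and a = a and b = b and v = v in supersymD,
          drule_tac u = u and a = a and b = b and v = v in supersymD, simp add: algebra_simps\<close>)+
qed

lemma supersym_rst: assumes "supersym f" "\<And>u a b v. P (u @ a # b # v) \<longleftrightarrow> P (u @ b # a # v)"
  shows "supersym (rst P f)"
proof (rule supersymI)
  fix u a b v
  show "rst P f (u @ a # b # v) = eps (deg a * deg b) * rst P f (u @ b # a # v)"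
    using assms(2)[of u a b v] supersymD[OF assms(1), of u a b v] by (simp add: rst_def)
qed

lemma supersym_sp: assumes "supersym f" "supersym g" shows "supersym (f \<star> g)"
proof -
  have "(f \<star> g) (u @ a # b # v) = eps (deg a * deg b) * (f \<star> g) (u @ b # a # v)" for u a b v
    using assms
  proof (induction u arbitrary: f g)
    case Nil
    have 1: "ldel b (ldel a f) = sc (eps (deg a * deg b)) (ldel a (ldel b f))"
      "ldel b (ldel a g) = sc (eps (deg a * deg b)) (ldel a (ldel b g))"
      using supersym_ldel2 Nil by (metis mult.commute)+
    show ?case
      by (simp add: sp_cons ldel_twist sp_sc_left sp_sc_right 1 algebra_simps eps_sq_left eps_sq)
  next
    case (Cons c u)
    thus ?case by (simp add: sp_cons supersym_ldel supersym_twist algebra_simps)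
  qed
  thus ?thesis unfolding supersym_def by blast
qed

text \<open>Finitely many letters and bounded length amount to finite support, in a form that passes
  directly to products and derivatives.\<close>

definition finsupp :: "('b list \<Rightarrow> 'k) \<Rightarrow> bool" where
  "finsupp f \<longleftrightarrow> (\<exists>A N. finite A \<and> (\<forall>w. f w \<noteq> 0 \<longrightarrow> set w \<subseteq> A \<and> length w \<le> N))"

lemma finsuppI: "finite A \<Longrightarrow> (\<And>w. f w \<noteq> 0 \<Longrightarrow> set w \<subseteq> A \<and> length w \<le> N) \<Longrightarrow> finsupp f"
  unfolding finsupp_def by blast

lemma finsupp_add: "finsupp f \<Longrightarrow> finsupp g \<Longrightarrow> finsupp (f + g)"
proof -
  assume "finsupp f" "finsupp g"
  then obtain A N B M where "finite A" "finite B" and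
    *: "\<And>w. f w \<noteq> 0 \<Longrightarrow> set w \<subseteq> A \<and> length w \<le> N" "\<And>w. g w \<noteq> 0 \<Longrightarrow> set w \<subseteq> B \<and> length w \<le> M"
    unfolding finsupp_def by metis
  moreover have "set w \<subseteq> A \<union> B \<and> length w \<le> max N M" if "(f + g) w \<noteq> 0" for w
  proof -
    have "f w \<noteq> 0 \<or> g w \<noteq> 0" using that by auto
    thus ?thesis using * by fastforce
  qed
  ultimately show ?thesis by (intro finsuppI[of "A \<union> B" _ "max N M"]) auto
qed

lemma finsupp_closed: "finsupp 0" "finsupp onef" "finsupp (lett b)"
  "finsupp f \<Longrightarrow> finsupp (sc c f)" "finsupp f \<Longrightarrow> finsupp (rst P f)" "finsupp f \<Longrightarrow> finsupp (twist n f)"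
  unfolding finsupp_def onef_def lett_def rst_def twist_def
  by (auto intro: exI[of _ "{b}"] exI[of _ "{}"] exI[of _ 1] exI[of _ 0])

lemma finsupp_ldel: "finsupp f \<Longrightarrow> finsupp (ldel b f)"
  unfolding finsupp_def ldel_def by (metis insert_subset list.simps(15) Suc_leD length_Cons)

lemma finsupp_sp: "finsupp f \<Longrightarrow> finsupp g \<Longrightarrow> finsupp (f \<star> g)"
proof -
  assume "finsupp f" "finsupp g"
  then obtain A N B M where *: "finite A" "finite B"
    "\<And>w. f w \<noteq> 0 \<Longrightarrow> set w \<subseteq> A \<and> length w \<le> N" "\<And>w. g w \<noteq> 0 \<Longrightarrow> set w \<subseteq> B \<and> length w \<le> M"
    unfolding finsupp_def by metis
  have "set w \<subseteq> A \<union> B \<and> length w \<le> N + M" if "(f \<star> g) w \<noteq> 0" for w using that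
  proof (rule sp_support)
    fix u v assume "f u \<noteq> 0" "g v \<noteq> 0" "w \<in> shuffles u v"
    thus ?thesis using *(3)[of u] *(4)[of v] by (auto simp: set_shuffles length_shuffles)
  qed
  with *(1,2) show ?thesis by (intro finsuppI[of "A \<union> B" _ "N + M"]) auto
qed

lemma finite_ldel: "finsupp f \<Longrightarrow> finite {b. ldel b f \<noteq> 0}"
proof -
  assume "finsupp f"
  then obtain A where "finite A" "\<And>w. f w \<noteq> 0 \<Longrightarrow> set w \<subseteq> A" unfolding finsupp_def by metis
  hence "{b. ldel b f \<noteq> 0} \<subseteq> A" by (force simp: ldel_def fun_eq_iff)
  thus ?thesis using \<open>finite A\<close> finite_subset by blast
qed

text \<open>Supported on basis letters, these functions form the symmetric algebra; see
  \<open>Phi_kernel\<close> and \<open>Phi_psi\<close>.\<close>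

definition Lam :: "('b list \<Rightarrow> 'k) set" where
  "Lam = {f. supersym f \<and> finsupp f}"

lemma Lam_closed: "0 \<in> Lam" "onef \<in> Lam" "lett b \<in> Lam" "f \<in> Lam \<Longrightarrow> sc c f \<in> Lam"
  "f \<in> Lam \<Longrightarrow> g \<in> Lam \<Longrightarrow> f + g \<in> Lam" "f \<in> Lam \<Longrightarrow> g \<in> Lam \<Longrightarrow> f \<star> g \<in> Lam"
  "f \<in> Lam \<Longrightarrow> ldel b f \<in> Lam" "f \<in> Lam \<Longrightarrow> twist n f \<in> Lam"
  by (auto simp: Lam_def supersym_closed finsupp_closed finsupp_add supersym_sp finsupp_sp
      supersym_ldel finsupp_ldel supersym_twist)

lemma Lam_diff: "f \<in> Lam \<Longrightarrow> g \<in> Lam \<Longrightarrow> f - g \<in> Lam"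
  using Lam_closed(5)[of f "sc (-1) g"] Lam_closed(4)[of g "-1"]
  by (simp add: fun_scale_def) (metis (no_types, lifting) diff_minus_eq_add ext minus_apply plus_fun_apply uminus_add_conv_diff add.commute)

lemma Lam_sum: "(\<And>i. i \<in> I \<Longrightarrow> f i \<in> Lam) \<Longrightarrow> (\<Sum>i\<in>I. f i) \<in> Lam"
  by (induction I rule: infinite_finite_induct) (auto simp: Lam_closed)

lemma Lam_rst: "f \<in> Lam \<Longrightarrow> (\<And>u a b v. P (u @ a # b # v) \<longleftrightarrow> P (u @ b # a # v)) \<Longrightarrow> rst P f \<in> Lam"
  by (auto simp: Lam_def supersym_rst finsupp_closed)

text \<open>Euler's identity, with \<open>q b\<close> as the weight of the variable
  \<open>b\<close>. The derivative of the left side along a letter \<open>c\<close> is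
  \<open>q c\<close> times that of \<open>f\<close>, plus the same expression for
  \<open>ldel c f\<close>; the sign from passing the letter \<open>b\<close> is cancelled by the one
  from exchanging the two derivatives.\<close>

lemma euler: assumes f: "f \<in> Lam" and A: "finite A" "{b. ldel b f \<noteq> 0} \<subseteq> A"
  shows "(\<Sum>b\<in>A. sc (of_nat (q b)) (lett b \<star> ldel b f)) = (\<lambda>w. of_nat (wsum q w) * f w)"
proof
  fix w show "(\<Sum>b\<in>A. sc (of_nat (q b)) (lett b \<star> ldel b f)) w = of_nat (wsum q w) * f w"
    using f A(2)
  proof (induction w arbitrary: f)
    case Nil
    show ?case by (simp add: sum_fun_apply lett_def)
  next
    case (Cons c w)
    have sub: "{b. ldel b (ldel c f) \<noteq> 0} \<subseteq> A"
    proof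
      fix b assume b: "b \<in> {b. ldel b (ldel c f) \<noteq> 0}"
      have "supersym f" using Cons.prems by (simp add: Lam_def)
      from supersym_ldel2[OF this, of b c] b have "ldel b f \<noteq> 0" by auto
      thus "b \<in> A" using Cons.prems by blast
    qed
    have ss: "sc (eps (deg c * deg b)) (lett b \<star> ldel c (ldel b f)) = lett b \<star> ldel b (ldel c f)" for b
    proof -
      have "ldel c (ldel b f) = sc (eps (deg c * deg b)) (ldel b (ldel c f))"
        using supersym_ldel2[of f c b] Cons.prems by (simp add: Lam_def)
      thus ?thesis by (simp add: sp_sc_right eps_sq)
    qed
    have "(\<Sum>b\<in>A. sc (of_nat (q b)) (lett b \<star> ldel b f)) (c # w) =
        ldel c (\<Sum>b\<in>A. sc (of_nat (q b)) (lett b \<star> ldel b f)) w" by (simp add: ldel_def)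
    also have "\<dots> = (\<Sum>b\<in>A. sc (of_nat (q b)) ((if c = b then ldel b f else 0) + lett b \<star> ldel b (ldel c f))) w"
      by (simp add: ldel_sum ldel_sp ldel_lett twist_lett sp_sc_left ss if_distrib[of "\<lambda>x. x \<star> _"] cong: if_cong)
    also have "\<dots> = ((\<Sum>b\<in>A. sc (of_nat (q b)) (if c = b then ldel b f else 0)) + (\<Sum>b\<in>A. sc (of_nat (q b)) (lett b \<star> ldel b (ldel c f)))) w"
      by (simp add: sum.distrib)
    also have "(\<Sum>b\<in>A. sc (of_nat (q b)) (if c = b then ldel b f else 0)) = sc (of_nat (q c)) (ldel c f)"
    proof (cases "c \<in> A")
      case True
      hence "(\<Sum>b\<in>A. sc (of_nat (q b)) (if c = b then ldel b f else 0)) = (\<Sum>b\<in>A. if c = b then sc (of_nat (q b)) (ldel b f) else 0)"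
        by (intro sum.cong) auto
      thus ?thesis using True A(1) by simp
    next
      case False
      hence "(\<Sum>b\<in>A. sc (of_nat (q b)) (if c = b then ldel b f else 0)) = 0"
        by (intro sum.neutral) auto
      moreover have "ldel c f = 0" using False Cons.prems by blast
      ultimately show ?thesis by simp
    qed
    finally show ?case
      using Cons.IH[OF Lam_closed(7)[OF Cons.prems(1)] sub] by (simp add: ldel_apply algebra_simps)
  qed
qed

text \<open>Euler's identity with all weights 1 writes a function without constant term as a sum of
  products of letters with shorter functions. Dividing by the word length uses characteristic
  zero.\<close>

lemma Lam_induct [consumes 1, case_names one add scale lett]:
  assumes f: "f \<in> Lam" and one: "P onef" and add: "\<And>f g. f \<in> Lam \<Longrightarrow> g \<in> Lam \<Longrightarrow> P f \<Longrightarrow> P g \<Longrightarrow> P (f + g)"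
    and scale: "\<And>c f. f \<in> Lam \<Longrightarrow> P f \<Longrightarrow> P (sc c f)" and lett: "\<And>b f. f \<in> Lam \<Longrightarrow> P f \<Longrightarrow> P (lett b \<star> f)"
  shows "P f"
proof -
  have P0: "P 0" using scale[OF Lam_closed(2) one, of 0] by simp
  have step: "P f" if "f \<in> Lam" "\<And>w. f w \<noteq> 0 \<Longrightarrow> length w \<le> N" for N f using that
  proof (induction N arbitrary: f)
    case 0
    have "f = sc (f []) onef" using 0(2) by (auto simp: fun_eq_iff onef_def)
    thus ?case using scale[OF Lam_closed(2) one] by metis
  next
    case (Suc N)
    \<comment> \<open>Since \<open>inverse 0 = 0\<close>, \<open>g\<close> vanishes at the empty
      word; the constant term of \<open>f\<close> is added back as a multiple of
      \<open>onef\<close>.\<close>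
    define g where "g = (\<lambda>w. inverse (of_nat (length w)) * f w)"
    have g: "g \<in> Lam"
    proof -
      have "supersym f" "finsupp f" using Suc.prems(1) by (auto simp: Lam_def)
      hence "supersym g" "finsupp g"
        unfolding g_def finsupp_def by (intro supersymI, drule_tac u = u and a = a and b = b and v = v in supersymD, simp, auto)
      thus ?thesis by (simp add: Lam_def)
    qed
    have lg: "length w \<le> Suc N" if "g w \<noteq> 0" for w using Suc.prems(2)[of w] that by (auto simp: g_def)
    define A where "A = {b. ldel b g \<noteq> 0}"
    have A: "finite A" unfolding A_def using g finite_ldel by (auto simp: Lam_def)
    have ln: "wsum (\<lambda>_. 1::nat) w = length w" for w :: "'b list" by (induction w) auto
    have "(\<lambda>w. of_nat (length w) * g w) = (\<Sum>b\<in>A. lett b \<star> ldel b g)"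
      using euler[OF g A, of "\<lambda>_. 1"] unfolding A_def ln by simp
    moreover have "f = sc (f []) onef + (\<lambda>w. of_nat (length w) * g w)"
      by (auto simp: g_def onef_def fun_eq_iff)
    moreover have "P (\<Sum>b\<in>B. lett b \<star> ldel b g) \<and> (\<Sum>b\<in>B. lett b \<star> ldel b g) \<in> Lam" if "finite B" for B
      using that
    proof (induction B)
      case empty
      show ?case unfolding sum.empty using P0 Lam_closed(1) by blast
    next
      case (insert b B)
      have "P (ldel b g)"
      proof (rule Suc.IH[OF Lam_closed(7)[OF g]])
        fix w assume "ldel b g w \<noteq> 0" thus "length w \<le> N" using lg[of "b # w"] by (simp add: ldel_def)
      qed
      hence 1: "P (lett b \<star> ldel b g)" "lett b \<star> ldel b g \<in> Lam"
        using lett g by (simp_all add: Lam_closed)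
      hence "P (lett b \<star> ldel b g + (\<Sum>b\<in>B. lett b \<star> ldel b g))" using insert.IH add by blast
      moreover have "lett b \<star> ldel b g + (\<Sum>b\<in>B. lett b \<star> ldel b g) \<in> Lam"
        using 1 insert.IH Lam_closed(5) by blast
      ultimately show ?case using insert.hyps by (simp del: plus_fun_apply)
    qed
    ultimately show ?case using add[OF Lam_closed(4)[OF Lam_closed(2)] _ scale[OF Lam_closed(2) one]] A by metis
  qed
  obtain N where "\<And>w. f w \<noteq> 0 \<Longrightarrow> length w \<le> N" using f unfolding Lam_def finsupp_def by blast
  thus ?thesis using step f by blast
qed

subsection \<open>Derivations\<close>

text \<open>A derivation expressed by partial derivatives, with value \<open>\<delta> b\<close> on
  the letter \<open>b\<close>; for finitely supported \<open>f\<close> the sum is finite.\<close>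

definition der :: "('b \<Rightarrow> 'b list \<Rightarrow> 'k) \<Rightarrow> ('b list \<Rightarrow> 'k) \<Rightarrow> 'b list \<Rightarrow> 'k" where
  "der \<delta> f = (\<Sum>b\<in>{b. ldel b f \<noteq> 0}. \<delta> b \<star> ldel b f)"

lemma der_eq: "finite A \<Longrightarrow> {b. ldel b f \<noteq> 0} \<subseteq> A \<Longrightarrow> der \<delta> f = (\<Sum>b\<in>A. \<delta> b \<star> ldel b f)"
  unfolding der_def by (rule sum.mono_neutral_left) auto

lemma der_add: "finsupp f \<Longrightarrow> finsupp g \<Longrightarrow> der \<delta> (f + g) = der \<delta> f + der \<delta> g"
proof -
  assume f: "finsupp f" "finsupp g"
  let ?A = "{b. ldel b f \<noteq> 0} \<union> {b. ldel b g \<noteq> 0}"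
  have "finite ?A" using f finite_ldel by auto
  thus ?thesis using der_eq[of ?A "f + g" \<delta>] der_eq[of ?A f \<delta>] der_eq[of ?A g \<delta>]
    by (force simp: sp_add_right sum.distrib)
qed

lemma der_sc: "der \<delta> (sc c f) = sc c (der \<delta> f)"
proof (cases "c = 0")
  case True thus ?thesis by (simp add: der_def)
next
  case False
  hence "ldel b (sc c f) = 0 \<longleftrightarrow> ldel b f = 0" for b by (auto simp: fun_eq_iff)
  thus ?thesis unfolding der_def by (simp add: sp_sc_right sc_sum)
qed

lemma der_0 [simp]: "der \<delta> 0 = 0" by (simp add: der_def)

lemma der_diff: "finsupp f \<Longrightarrow> finsupp g \<Longrightarrow> der \<delta> (f - g) = der \<delta> f - der \<delta> g"
proof -
  assume f: "finsupp f" "finsupp g"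
  have *: "- g = sc (-1) g" for g :: "'b list \<Rightarrow> 'k" by (auto simp: fun_eq_iff)
  have "der \<delta> (f + - g) = der \<delta> f + - der \<delta> g"
    unfolding * using f by (simp add: der_add finsupp_closed der_sc)
  thus ?thesis by simp
qed

lemma der_sum: "(\<And>i. i \<in> I \<Longrightarrow> f i \<in> Lam) \<Longrightarrow> der \<delta> (\<Sum>i\<in>I. f i) = (\<Sum>i\<in>I. der \<delta> (f i))"
proof (induction I rule: infinite_finite_induct)
  case (insert x F)
  have "finsupp (f x)" "finsupp (\<Sum>i\<in>F. f i)"
    using insert.prems Lam_sum[of F f] by (auto simp: Lam_def)
  hence "der \<delta> (f x + (\<Sum>i\<in>F. f i)) = der \<delta> (f x) + (\<Sum>i\<in>F. der \<delta> (f i))"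
    using insert.IH insert.prems by (simp add: der_add del: plus_fun_apply)
  thus ?case using insert.hyps by (simp del: plus_fun_apply)
qed (simp_all del: zero_fun_apply)

lemma der_lett [simp]: "der \<delta> (lett b) = \<delta> b"
proof -
  have "{c. ldel c (lett b :: 'b list \<Rightarrow> 'k) \<noteq> 0} = {b}"
    by (auto simp: ldel_lett) (metis onef_def one_neq_zero zero_fun_apply)
  thus ?thesis by (simp add: der_def ldel_lett)
qed

lemma der_onef [simp]: "der \<delta> onef = 0" by (simp add: der_def)

text \<open>Moving \<open>\<delta> b\<close>, of degree \<open>deg b + e\<close>, past
  \<open>f\<close> already twisted by \<open>deg b\<close> leaves a twist by \<open>e\<close>, as
  only parities matter.\<close>

lemma der_sp: assumes \<delta>: "\<And>b. hom (deg b + e) (\<delta> b)" and f: "f \<in> Lam" and g: "g \<in> Lam"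
  shows "der \<delta> (f \<star> g) = der \<delta> f \<star> g + twist e f \<star> der \<delta> g"
proof -
  let ?A = "{b. ldel b f \<noteq> 0} \<union> {b. ldel b g \<noteq> 0}"
  have fin: "finite ?A" using f g finite_ldel by (auto simp: Lam_def)
  have tw: "\<delta> b \<star> (twist (deg b) f \<star> h) = twist e f \<star> (\<delta> b \<star> h)" for b h
  proof -
    have "\<delta> b \<star> twist (deg b) f = twist e f \<star> \<delta> b"
      using sp_commute[OF \<delta>, of b "twist (deg b) f"] twist_cong[of "deg b + e + deg b" e f] by simp
    thus ?thesis by (simp add: sp_assoc[symmetric])
  qed
  have "der \<delta> (f \<star> g) = (\<Sum>b\<in>?A. \<delta> b \<star> ldel b (f \<star> g))" by (rule der_eq[OF fin]) (auto simp: ldel_sp)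
  also have "\<dots> = (\<Sum>b\<in>?A. \<delta> b \<star> ldel b f) \<star> g + twist e f \<star> (\<Sum>b\<in>?A. \<delta> b \<star> ldel b g)"
    by (simp add: ldel_sp sp_add_right sum.distrib sp_sum_left sp_sum_right sp_assoc tw)
  finally show ?thesis using der_eq[OF fin, of f \<delta>] der_eq[OF fin, of g \<delta>] by simp
qed

lemma der_support: assumes "der \<delta> f w \<noteq> 0"
  obtains b u v where "\<delta> b u \<noteq> 0" "f (b # v) \<noteq> 0" "w \<in> shuffles u v"
proof -
  from assms obtain b where "(\<delta> b \<star> ldel b f) w \<noteq> 0"
    unfolding der_def sum_fun_apply by (metis (lifting) sum.neutral)
  thus thesis by (rule sp_support) (use that in \<open>auto simp: ldel_def\<close>)
qed

lemma hom_der: "(\<And>b. hom (deg b + e) (\<delta> b)) \<Longrightarrow> hom n f \<Longrightarrow> hom (n + e) (der \<delta> f)"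
proof -
  assume d: "\<And>b. hom (deg b + e) (\<delta> b)" and f: "hom n f"
  show ?thesis unfolding hom_def
  proof (intro allI impI)
    fix w assume "der \<delta> f w \<noteq> 0"
    then obtain b u v where *: "\<delta> b u \<noteq> 0" "f (b # v) \<noteq> 0" "w \<in> shuffles u v" by (rule der_support)
    hence "wdeg u = deg b + e" "wdeg (b # v) = n" using d f unfolding hom_def by blast+
    thus "wdeg w = n + e" using wsum_shuffles[OF *(3), of deg] by simp
  qed
qed

lemma der_Lam: assumes "\<And>b. \<delta> b \<in> Lam" "f \<in> Lam" shows "der \<delta> f \<in> Lam"
  unfolding der_def by (intro Lam_sum Lam_closed assms)

lemma der_delta_add: "der (\<lambda>b. \<delta> b + \<delta>' b) f = der \<delta> f + der \<delta>' f"
  by (simp add: der_def sp_add_left sum.distrib)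

lemma der_cong: "(\<And>b v. f (b # v) \<noteq> 0 \<Longrightarrow> \<delta> b = \<delta>' b) \<Longrightarrow> der \<delta> f = der \<delta>' f"
proof -
  assume *: "\<And>b v. f (b # v) \<noteq> 0 \<Longrightarrow> \<delta> b = \<delta>' b"
  have "\<delta> b \<star> ldel b f = \<delta>' b \<star> ldel b f" if "ldel b f \<noteq> 0" for b
  proof -
    from that obtain v where "f (b # v) \<noteq> 0" by (auto simp: ldel_def fun_eq_iff)
    thus ?thesis using * by simp
  qed
  thus ?thesis unfolding der_def by (intro sum.cong) auto
qed

text \<open>The hypothesis makes the ideal generated by the variables outside \<open>A\<close>
  stable under the derivation, which therefore descends to the quotient by that ideal.\<close>

lemma rst_der: assumes f: "f \<in> Lam" and \<delta>: "\<And>b. b \<notin> A \<Longrightarrow> rs A (\<delta> b) = 0" shows "rs A (der \<delta> f) =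
    der (\<lambda>b. rs A (\<delta> b)) (rs A f)"
proof -
  let ?R = "rs A" and ?B = "{b. ldel b f \<noteq> 0}"
  have fin: "finite ?B" using f finite_ldel by (auto simp: Lam_def)
  have ld: "ldel b (?R f) = (if b \<in> A then ?R (ldel b f) else 0)" for b
    by (auto simp: ldel_def rst_def fun_eq_iff)
  have "?R (der \<delta> f) = (\<Sum>b\<in>?B. ?R (\<delta> b) \<star> ?R (ldel b f))"
    by (simp add: der_def rst_sum rst_letters_sp)
  also have "\<dots> = (\<Sum>b\<in>?B. ?R (\<delta> b) \<star> ldel b (?R f))" by (intro sum.cong) (auto simp: ld \<delta>)
  also have "\<dots> = der (\<lambda>b. ?R (\<delta> b)) (?R f)"
    by (rule der_eq[symmetric, OF fin]) (auto simp: ld split: if_splits)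
  finally show ?thesis .
qed

end

lemmas fun_ap = plus_fun_apply zero_fun_apply minus_apply uminus_apply sc_simps(1)

text \<open>Unification leaves eta-long terms behind, on which these rules would fire.\<close>

declare fun_ap [simp del]

section \<open>Supports, number operators and commutators of derivations\<close>

definition supp :: "('x \<Rightarrow> 'k::zero) \<Rightarrow> ('x \<Rightarrow> bool) \<Rightarrow> bool" where
  "supp f Q \<longleftrightarrow> (\<forall>w. f w \<noteq> 0 \<longrightarrow> Q w)"

lemma suppD: "supp f Q \<Longrightarrow> f w \<noteq> 0 \<Longrightarrow> Q w" and supp_mono: "supp f Q \<Longrightarrow> (\<And>w. Q w \<Longrightarrow> R w) \<Longrightarrow> supp f R"
  by (auto simp: supp_def)

lemma supp_closed:
  fixes f g :: "'x \<Rightarrow> 'k::field"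
  shows "supp (0 :: 'x \<Rightarrow> 'k) Q" "supp f Q \<Longrightarrow> supp g Q \<Longrightarrow> supp (f + g) Q"
    "supp f Q \<Longrightarrow> supp g Q \<Longrightarrow> supp (f - g) Q" "supp f Q \<Longrightarrow> supp (sc c f) Q" "supp f Q \<Longrightarrow> supp (- f) Q"
proof -
  show "supp (0 :: 'x \<Rightarrow> 'k) Q" "supp f Q \<Longrightarrow> supp (sc c f) Q" "supp f Q \<Longrightarrow> supp (- f) Q" by (auto simp: supp_def fun_ap)
  assume "supp f Q" "supp g Q"
  thus "supp (f + g) Q" "supp (f - g) Q" unfolding supp_def by (metis add_0 plus_fun_apply, metis diff_zero minus_apply diff_self)
qed

lemma supp_sum: "(\<And>i. i \<in> I \<Longrightarrow> supp (f i) Q) \<Longrightarrow> supp (\<Sum>i\<in>I. f i :: 'x \<Rightarrow> 'k::field) Q"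
  unfolding supp_def sum_fun_apply by (metis (lifting) sum.neutral)

lemma supp_rst: "supp f Q \<Longrightarrow> supp (rst P f) (\<lambda>w. P w \<and> Q w)" by (auto simp: supp_def rst_def)

lemma supp_False: "supp f (\<lambda>_. False) \<Longrightarrow> f = 0" by (auto simp: supp_def fun_eq_iff fun_ap)

lemma rst_id: "supp f P \<Longrightarrow> rst P f = f" by (auto simp: supp_def rst_def fun_eq_iff fun_ap)

context shuffle_algebra
begin

lemma supp_sp: "supp f Q \<Longrightarrow> supp g R \<Longrightarrow>
    (\<And>u v w. Q u \<Longrightarrow> R v \<Longrightarrow> w \<in> shuffles u v \<Longrightarrow> T w) \<Longrightarrow> supp (f \<star> g) T"
  unfolding supp_def by (metis sp_support)

lemma supp_der: assumes "supp f Q" "\<And>b u v w. \<delta> b u \<noteq> 0 \<Longrightarrow> Q (b # v) \<Longrightarrow> w \<in> shuffles u v \<Longrightarrow> T w"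
  shows "supp (der \<delta> f) T" using assms unfolding supp_def by (metis der_support)

lemma Lam_weight: assumes "f \<in> Lam" "\<And>u a b v. c (u @ a # b # v) = c (u @ b # a # v)"
  shows "(\<lambda>w. c w * f w) \<in> Lam"
proof -
  have f: "supersym f" "finsupp f" using assms by (auto simp: Lam_def)
  have "supersym (\<lambda>w. c w * f w)"
  proof (rule supersymI)
    fix u a b v
    show "c (u @ a # b # v) * f (u @ a # b # v) = eps (deg a * deg b) * (c (u @ b # a # v) * f (u @ b # a # v))"
      using assms(2)[of u a b v] supersymD[OF f(1), of u a b v] by simp
  qed
  moreover have "finsupp (\<lambda>w. c w * f w)" using f(2) unfolding finsupp_def by auto
  ultimately show ?thesis by (simp add: Lam_def)
qed

text \<open>The degree-zero derivation with eigenvalue \<open>q b\<close> on the letter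
  \<open>b\<close>; in this model it is diagonal on words.\<close>

definition numop :: "('b \<Rightarrow> nat) \<Rightarrow> ('b list \<Rightarrow> 'k) \<Rightarrow> 'b list \<Rightarrow> 'k" where
  "numop q f = (\<lambda>w. of_nat (wsum q w) * f w)"

lemma ldel_numop: "ldel b (numop q f) = sc (of_nat (q b)) (ldel b f) + numop q (ldel b f)"
  by (auto simp: numop_def ldel_def fun_eq_iff fun_ap algebra_simps)

lemma numop_twist: "numop q (twist n f) = twist n (numop q f)"
  by (auto simp: numop_def twist_def fun_eq_iff fun_ap algebra_simps)

lemma numop_simps: "numop q (f + g) = numop q f + numop q g" "numop q (sc c f) = sc c (numop q f)"
  "numop q onef = 0" "numop q (lett b) = sc (of_nat (q b)) (lett b)" "numop q 0 = 0"
  by (auto simp: numop_def fun_eq_iff fun_ap algebra_simps onef_def lett_def)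

lemma numop_sum: "numop q (\<Sum>i\<in>I. f i) = (\<Sum>i\<in>I. numop q (f i))"
  by (rule additive_sum[of "numop q"]) (simp_all add: numop_simps)

lemma numop_sp: "numop q (f \<star> g) = numop q f \<star> g + f \<star> numop q g"
proof
  fix w show "numop q (f \<star> g) w = (numop q f \<star> g + f \<star> numop q g) w"
  proof (induction w arbitrary: f g)
    case (Cons b w)
    have "numop q (f \<star> g) (b # w) = (sc (of_nat (q b)) (ldel b (f \<star> g)) + numop q (ldel b (f \<star> g))) w"
      using fun_cong[OF ldel_numop[of b q "f \<star> g"], of w] by (simp add: ldel_apply)
    thus ?case
      by (simp add: ldel_sp numop_simps Cons.IH sp_cons ldel_numop sp_add_left sp_add_right sp_sc_left sp_sc_right
          numop_twist algebra_simps fun_ap)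
  qed (simp add: numop_def fun_ap)
qed

text \<open>The anticommutator of two odd derivations is again a derivation, of even degree, and
  hence determined by its values on letters. The mixed terms of the Leibniz rule cancel because both
  derivations are odd.\<close>

lemma der_der_anticomm: assumes \<delta>: "\<And>b. hom (deg b + e) (\<delta> b)" "\<And>b. \<delta> b \<in> Lam"
    and \<delta>': "\<And>b. hom (deg b + e') (\<delta>' b)" "\<And>b. \<delta>' b \<in> Lam"
    and odd: "odd e" "odd e'"
    and q: "\<And>b. der \<delta> (\<delta>' b) + der \<delta>' (\<delta> b) = sc (of_nat (q b)) (lett b)"
    and f: "f \<in> Lam"
  shows "der \<delta> (der \<delta>' f) + der \<delta>' (der \<delta> f) = numop q f" using f
proof (induction f rule: Lam_induct)
  case (add f g)
  hence "f \<in> Lam" "g \<in> Lam" "der \<delta> f \<in> Lam" "der \<delta> g \<in> Lam" "der \<delta>' f \<in> Lam" "der \<delta>' g \<in> Lam"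
    by (simp_all add: der_Lam \<delta> \<delta>')
  hence "finsupp f" "finsupp g" "finsupp (der \<delta> f)" "finsupp (der \<delta> g)" "finsupp (der \<delta>' f)" "finsupp (der \<delta>' g)"
    by (simp_all add: Lam_def)
  hence "der \<delta> (der \<delta>' (f + g)) + der \<delta>' (der \<delta> (f + g)) =
      (der \<delta> (der \<delta>' f) + der \<delta>' (der \<delta> f)) + (der \<delta> (der \<delta>' g) + der \<delta>' (der \<delta> g))"
    by (simp add: der_add algebra_simps)
  thus ?case using add by (simp add: numop_simps)
next
  case (lett b f)
  note D = der_sp[OF \<delta>(1)] and D' = der_sp[OF \<delta>'(1)]
  have L: "der \<delta> f \<in> Lam" "der \<delta>' f \<in> Lam" using lett \<delta> \<delta>' by (simp_all add: der_Lam)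
  have fs: "finsupp (\<delta> b \<star> f)" "finsupp (\<delta>' b \<star> f)" "finsupp (lett b \<star> der \<delta> f)" "finsupp (lett b \<star> der \<delta>' f)"
    using Lam_closed(6)[OF \<delta>(2) lett(1)] Lam_closed(6)[OF \<delta>'(2) lett(1)]
      Lam_closed(6)[OF Lam_closed(3) L(1)] Lam_closed(6)[OF Lam_closed(3) L(2)] by (simp_all add: Lam_def)
  let ?s = "eps (deg b) :: 'k"
  have sg: "eps (e * deg b) = ?s" "eps (e' * deg b) = ?s" "eps (e * (deg b + e')) = - ?s" "eps (e' * (deg b + e)) = - ?s"
    using odd by (auto simp: eps_def)
  have 1: "der \<delta> (lett b \<star> f) = \<delta> b \<star> f + sc ?s (lett b \<star> der \<delta> f)"
    using D[OF Lam_closed(3) lett(1)] by (simp add: twist_lett sg sp_sc_left)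
  have 2: "der \<delta>' (lett b \<star> f) = \<delta>' b \<star> f + sc ?s (lett b \<star> der \<delta>' f)"
    using D'[OF Lam_closed(3) lett(1)] by (simp add: twist_lett sg sp_sc_left)
  have 3: "der \<delta>' (\<delta> b \<star> f) = der \<delta>' (\<delta> b) \<star> f - sc ?s (\<delta> b \<star> der \<delta>' f)"
    using D'[OF \<delta>(2) lett(1)] by (simp add: hom_twist[OF \<delta>(1)] sg sp_sc_left fun_eq_iff fun_ap)
  have 4: "der \<delta> (\<delta>' b \<star> f) = der \<delta> (\<delta>' b) \<star> f - sc ?s (\<delta>' b \<star> der \<delta> f)"
    using D[OF \<delta>'(2) lett(1)] by (simp add: hom_twist[OF \<delta>'(1)] sg sp_sc_left fun_eq_iff fun_ap)
  have 5: "der \<delta>' (lett b \<star> der \<delta> f) = \<delta>' b \<star> der \<delta> f + sc ?s (lett b \<star> der \<delta>' (der \<delta> f))"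
    using D'[OF Lam_closed(3) L(1)] by (simp add: twist_lett sg sp_sc_left)
  have 6: "der \<delta> (lett b \<star> der \<delta>' f) = \<delta> b \<star> der \<delta>' f + sc ?s (lett b \<star> der \<delta> (der \<delta>' f))"
    using D[OF Lam_closed(3) L(2)] by (simp add: twist_lett sg sp_sc_left)
  have "der \<delta> (der \<delta>' (lett b \<star> f)) + der \<delta>' (der \<delta> (lett b \<star> f)) =
      (der \<delta> (\<delta>' b) + der \<delta>' (\<delta> b)) \<star> f + lett b \<star> (der \<delta> (der \<delta>' f) + der \<delta>' (der \<delta> f))"
    unfolding 1 2 using fs
    by (simp add: der_add der_sc finsupp_closed 3 4 5 6 eps_sq sp_add_left sp_add_right algebra_simps)
  also have "\<dots> = numop q (lett b \<star> f)" using lett by (simp add: q numop_sp numop_simps sp_sc_left)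
  finally show ?case .
qed (simp_all add: der_sc numop_simps flip: sc_simps(5) del: sc_simps(5))

text \<open>The anticommutator of an odd derivation with itself is twice its square, and it is a
  derivation vanishing on letters.\<close>

lemma der_square_zero:
  assumes \<delta>: "\<And>b. hom (deg b + 1) (\<delta> b)" "\<And>b. \<delta> b \<in> Lam" and sq: "\<And>b. der \<delta> (\<delta> b) = 0" and f: "f \<in> Lam"
  shows "der \<delta> (der \<delta> f) = 0"
proof -
  have "der \<delta> (der \<delta> f) + der \<delta> (der \<delta> f) = numop (\<lambda>_. 0) f"
    by (rule der_der_anticomm[OF \<delta> \<delta> _ _ _ f]) (simp_all add: sq)
  moreover have "wsum (\<lambda>_. 0::nat) w = 0" for w :: "'b list" by (induction w) auto
  ultimately show ?thesis by (simp add: numop_def fun_eq_iff fun_ap)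
qed

end

section \<open>The perturbed Koszul complex\<close>

abbreviation cnt :: "'b set \<Rightarrow> 'b list \<Rightarrow> nat" where "cnt A \<equiv> wsum (\<lambda>b. of_bool (b \<in> A))"

abbreviation kwds :: "('b \<Rightarrow> nat) \<Rightarrow> 'b set \<Rightarrow> 'b set \<Rightarrow> nat \<Rightarrow> nat \<Rightarrow> 'b list \<Rightarrow> bool" where
  "kwds wt E U i N \<equiv> \<lambda>w. set w \<subseteq> E \<union> U \<and> cnt E w = i \<and> wsum wt w < N"

lemma cnt_shuffles: "w \<in> shuffles u v \<Longrightarrow> cnt A w = cnt A u + cnt A v" by (rule wsum_shuffles)

text \<open>
  The Koszul complex: \<open>up v\<close> is a variable with \<open>d (up v) = v + \<dots>\<close>, where the dots have lower
  weight. The contraction \<open>v \<mapsto> up v\<close> is a homotopy between the number operator and a weight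
  decreasing operator.
\<close>

locale koszul = shuffle_algebra deg fld for deg :: "'b \<Rightarrow> int" and fld :: "'k::field_char_0 itself" +
  fixes E UU :: "'b set" and up :: "'b \<Rightarrow> 'b" and wt :: "'b \<Rightarrow> nat" and \<delta> :: "'b \<Rightarrow> 'b list \<Rightarrow> 'k"
  assumes disj: "E \<inter> UU = {}" and inj: "inj_on up E" and up: "v \<in> E \<Longrightarrow> up v \<in> UU"
    and deg_up: "v \<in> E \<Longrightarrow> deg (up v) = deg v - 1" and wt_up: "v \<in> E \<Longrightarrow> wt (up v) = wt v"
    and \<delta>_hom: "hom (deg b + 1) (\<delta> b)" and \<delta>_Lam: "\<delta> b \<in> Lam"
    and \<delta>_E: "v \<in> E \<Longrightarrow> supp (\<delta> v) (kwds wt E UU 2 (wt v))"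
    and \<delta>_up: "v \<in> E \<Longrightarrow> supp (\<delta> (up v) - lett v)
      (kwds wt E UU 1 (wt v))"
    and \<delta>_U: "u \<in> UU - up ` E \<Longrightarrow> supp (\<delta> u)
      (kwds wt E UU 1 (wt u))"
    and \<delta>_out: "b \<notin> E \<union> UU \<Longrightarrow> \<delta> b = 0" and sq: "der \<delta> (\<delta> b) = 0"
begin

abbreviation "vl \<equiv> cnt E"
abbreviation "wl \<equiv> kwds wt E UU"

text \<open>\<open>\<kappa>\<close> is the leading part \<open>up v \<mapsto> v\<close> of
  \<open>\<delta>\<close>, and \<open>\<eta>\<close> is its contraction.\<close>

definition "\<kappa> u = (if u \<in> up ` E then lett (inv_into E up u) else 0 :: 'b list \<Rightarrow> 'k)"
definition "\<eta> v = (if v \<in> E then lett (up v) else 0 :: 'b list \<Rightarrow> 'k)"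

abbreviation "nE b \<equiv> of_bool (b \<in> E \<union> up ` E) :: nat"

lemma \<kappa>_up: "v \<in> E \<Longrightarrow> \<kappa> (up v) = lett v" using inj by (simp add: \<kappa>_def)

lemma \<kappa>_E: "v \<in> E \<Longrightarrow> \<kappa> v = 0" using disj up by (auto simp: \<kappa>_def)

lemma \<kappa>_hom: "hom (deg b + 1) (\<kappa> b)"
proof (cases "b \<in> up ` E")
  case True
  then obtain v where "v \<in> E" "b = up v" by blast
  thus ?thesis using hom_closed(6)[of v] by (simp add: \<kappa>_up deg_up)
qed (simp add: \<kappa>_def hom_closed)

lemma \<eta>_hom: "hom (deg b + -1) (\<eta> b)"
proof (cases "b \<in> E")
  case True
  thus ?thesis using hom_closed(6)[of "up b"] by (simp add: \<eta>_def deg_up)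
qed (simp add: \<eta>_def hom_closed)

lemma \<kappa>\<eta>_Lam: "\<kappa> b \<in> Lam" "\<eta> b \<in> Lam" by (auto simp: \<kappa>_def \<eta>_def Lam_closed)

lemma homotopy: "f \<in> Lam \<Longrightarrow> der \<kappa> (der \<eta> f) + der \<eta> (der \<kappa> f) = numop nE f"
proof (rule der_der_anticomm[OF \<kappa>_hom \<kappa>\<eta>_Lam(1) \<eta>_hom \<kappa>\<eta>_Lam(2)])
  fix b
  consider "b \<in> E" | v where "v \<in> E" "b = up v" | "b \<notin> E \<union> up ` E" by blast
  thus "der \<kappa> (\<eta> b) + der \<eta> (\<kappa> b) = sc (of_nat (nE b)) (lett b)"
  proof cases
    case 1
    thus ?thesis by (simp add: \<kappa>_E \<kappa>_up \<eta>_def)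
  next
    case 2
    hence "b \<notin> E" using disj up by blast
    thus ?thesis using 2 by (simp add: \<kappa>_up \<eta>_def)
  next
    case 3
    thus ?thesis by (simp add: \<kappa>_def \<eta>_def)
  qed
qed auto

text \<open>\<open>\<kappa>\<close> replaces \<open>up v\<close> by \<open>v\<close>, and
  \<open>nE\<close> counts both.\<close>

lemma numop_\<kappa>:  assumes f: "f \<in> Lam" shows "numop nE (der \<kappa> f) = der \<kappa> (numop nE f)"
proof -
  let ?A = "{b. ldel b f \<noteq> 0}"
  have fin: "finite ?A" using f finite_ldel by (auto simp: Lam_def)
  have "numop nE (\<kappa> b) = sc (of_nat (nE b)) (\<kappa> b)" for b
  proof (cases "b \<in> up ` E")
    case True
    then obtain v where "v \<in> E" "b = up v" by blast
    thus ?thesis by (simp add: \<kappa>_up numop_simps)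
  qed (simp add: \<kappa>_def numop_simps)
  hence "numop nE (\<kappa> b \<star> ldel b f) = \<kappa> b \<star> ldel b (numop nE f)" for b
    by (simp add: numop_sp ldel_numop sp_add_right sp_sc_left sp_sc_right)
  hence "numop nE (der \<kappa> f) = (\<Sum>b\<in>?A. \<kappa> b \<star> ldel b (numop nE f))" by (simp add: der_def numop_sum)
  also have "\<dots> = der \<kappa> (numop nE f)"
  proof (rule der_eq[symmetric, OF fin], safe)
    fix b assume *: "ldel b (numop nE f) \<noteq> 0" "ldel b f = 0"
    thus False by (simp add: ldel_numop numop_simps)
  qed
  finally show ?thesis .
qed

text \<open>The part of \<open>\<delta>\<close> beyond its leading part; it lowers the weight
  strictly, see \<open>supp_\<mu>\<close>.\<close>

definition "\<mu> b = \<delta> b - \<kappa> b"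

lemma \<mu>_supp: assumes "b \<in> E \<union> UU" shows "supp (\<mu> b) (wl (of_bool (b \<in> E) + 1) (wt b))"
proof -
  consider "b \<in> E" | v where "v \<in> E" "b = up v" | "b \<in> UU - up ` E" using assms by blast
  thus ?thesis
  proof cases
    case 1 thus ?thesis using \<delta>_E by (simp add: \<mu>_def \<kappa>_E numeral_2_eq_2)
  next
    case 2
    hence "b \<notin> E" using disj up by blast
    thus ?thesis using 2 \<delta>_up by (simp add: \<mu>_def \<kappa>_up wt_up)
  next
    case 3
    hence "b \<notin> E" using disj up by blast
    thus ?thesis using 3 \<delta>_U by (simp add: \<mu>_def \<kappa>_def)
  qed
qed

lemma supp_\<mu>: assumes "supp f (wl i (Suc N))" shows "supp (der \<mu> f) (wl (Suc i) N)"
proof (rule supp_der[OF assms])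
  fix b u v w assume *: "\<mu> b u \<noteq> 0" "set (b # v) \<subseteq> E \<union> UU \<and> vl (b # v) = i \<and> wsum wt (b # v) < Suc N"
    "w \<in> shuffles u v"
  have "set u \<subseteq> E \<union> UU \<and> vl u = of_bool (b \<in> E) + 1 \<and> wsum wt u < wt b"
    using suppD[OF \<mu>_supp *(1)] *(2) by auto
  thus "set w \<subseteq> E \<union> UU \<and> vl w = Suc i \<and> wsum wt w < N"
    using *(2) wsum_shuffles[OF *(3), of wt] cnt_shuffles[OF *(3), of E] set_shuffles[OF *(3)] by auto
qed

lemma supp_\<kappa>: assumes "supp f (wl i N)" shows "supp (der \<kappa> f) (wl (Suc i) N)"
proof (rule supp_der[OF assms])
  fix b u v w assume *: "\<kappa> b u \<noteq> 0" "set (b # v) \<subseteq> E \<union> UU \<and> vl (b # v) = i \<and> wsum wt (b # v) < N"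
    "w \<in> shuffles u v"
  obtain x where x: "x \<in> E" "b = up x" using *(1) by (auto simp: \<kappa>_def fun_ap split: if_splits)
  hence "u = [x]" "b \<notin> E" using *(1) disj up[of x] by (auto simp: \<kappa>_up lett_def split: if_splits)
  thus "set w \<subseteq> E \<union> UU \<and> vl w = Suc i \<and> wsum wt w < N"
    using x *(2) wsum_shuffles[OF *(3), of wt] cnt_shuffles[OF *(3), of E] set_shuffles[OF *(3)]
    by (auto simp: wt_up)
qed

lemma supp_\<eta>: assumes "supp f (wl (Suc i) N)" shows "supp (der \<eta> f) (wl i N)"
proof (rule supp_der[OF assms])
  fix b u v w assume *: "\<eta> b u \<noteq> 0" "set (b # v) \<subseteq> E \<union> UU \<and> vl (b # v) = Suc i \<and> wsum wt (b # v) < N"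
    "w \<in> shuffles u v"
  have b: "b \<in> E" "u = [up b]" using *(1) by (auto simp: \<eta>_def lett_def fun_ap split: if_splits)
  hence "up b \<in> UU" "up b \<notin> E" using up disj by auto
  thus "set w \<subseteq> E \<union> UU \<and> vl w = i \<and> wsum wt w < N"
    using b *(2) wsum_shuffles[OF *(3), of wt] cnt_shuffles[OF *(3), of E] set_shuffles[OF *(3)]
    by (auto simp: wt_up)
qed

lemma nE_pos: "vl w \<noteq> 0 \<Longrightarrow> wsum nE w \<noteq> 0" by (induction w) (auto split: if_splits)

text \<open>Induction on the weight bound. Up to the operator \<open>numop nE\<close>, the
  contraction \<open>\<eta>\<close> solves the equation for the leading part
  \<open>\<kappa>\<close>; the error involves \<open>\<mu>\<close> and has smaller weight. At least
  one letter of \<open>E\<close> in every word keeps the eigenvalues of \<open>numop nE\<close> away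
  from 0.\<close>

theorem acyclic:
  assumes "f \<in> Lam" "hom m f" "der \<delta> f = 0"
    "supp f (wl (Suc i) N)"
  shows "\<exists>y\<in>Lam. hom (m - 1) y \<and> supp y (wl i N) \<and> der \<delta> y = f" using assms
proof (induction N arbitrary: f)
  case 0
  hence "f = 0" using supp_False[of f] by simp
  thus ?case by (intro bexI[of _ 0]) (auto simp: hom_closed supp_closed Lam_closed)
next
  case (Suc N)
  define g where "g = (\<lambda>w. inverse (of_nat (wsum nE w)) * f w)"
  have g: "g \<in> Lam" unfolding g_def by (rule Lam_weight[OF Suc.prems(1)]) (simp add: algebra_simps)
  have gh: "hom m g" using Suc.prems(2) by (auto simp: g_def hom_def)
  have gs: "supp g (wl (Suc i) (Suc N))" using Suc.prems(4) by (auto simp: g_def supp_def)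
  have f: "numop nE g = f"
  proof
    fix w show "numop nE g w = f w"
    proof (cases "f w = 0")
      case False
      hence "wsum nE w \<noteq> 0" using suppD[OF Suc.prems(4)] nE_pos by fastforce
      thus ?thesis by (simp add: numop_def g_def)
    qed (simp add: numop_def g_def)
  qed
  have \<delta>_split: "der \<delta> x = der \<kappa> x + der \<mu> x" for x
    using der_delta_add[of \<kappa> \<mu> x] by (simp add: \<mu>_def)
  let ?h = "der \<eta> g"
  have hL: "?h \<in> Lam" by (rule der_Lam[OF \<kappa>\<eta>_Lam(2) g])
  have hs: "supp ?h (wl i (Suc N))" by (rule supp_\<eta>[OF gs])
  have hh: "hom (m - 1) ?h" using hom_der[OF \<eta>_hom gh] by simp
  \<comment> \<open>Here \<open>f\<close> being a cocycle is used:
    \<open>\<kappa> f = - \<mu> f\<close>, and \<open>\<mu>\<close> lowers the weight.\<close>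
  have \<kappa>g: "supp (der \<kappa> g) (wl (Suc (Suc i)) N)" unfolding supp_def
  proof (intro allI impI)
    fix w assume w: "der \<kappa> g w \<noteq> 0"
    have vw: "vl w = Suc (Suc i)" using suppD[OF supp_\<kappa>[OF gs] w] by simp
    have "numop nE (der \<kappa> g) = - der \<mu> f"
      using numop_\<kappa>[OF g] Suc.prems(3) \<delta>_split[of f] f by (simp add: eq_neg_iff_add_eq_0)
    hence "of_nat (wsum nE w) * der \<kappa> g w = - der \<mu> f w" by (metis numop_def uminus_apply)
    moreover have "wsum nE w \<noteq> 0" using nE_pos[of w] vw by simp
    ultimately have "der \<mu> f w \<noteq> 0" using w by (metis mult_eq_0_iff neg_equal_0_iff_equal of_nat_eq_0_iff)
    thus "set w \<subseteq> E \<union> UU \<and> vl w = Suc (Suc i) \<and> wsum wt w < N"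
      using suppD[OF supp_\<mu>[OF Suc.prems(4)]] vw by simp
  qed
  let ?f = "f - der \<delta> ?h"
  \<comment> \<open>With \<open>h = \<eta> g\<close> and \<open>numop nE g = f\<close>, the homotopy
    identity reads \<open>f - \<kappa> h = \<eta> \<kappa> g\<close>.\<close>
  have feq: "?f = der \<eta> (der \<kappa> g) - der \<mu> ?h"
    using homotopy[OF g] f \<delta>_split[of ?h] by (simp add: algebra_simps)
  have fs: "supp ?f (wl (Suc i) N)" unfolding feq by (intro supp_closed supp_\<eta>[OF \<kappa>g] supp_\<mu>[OF hs])
  have dL: "der \<delta> ?h \<in> Lam" by (rule der_Lam[OF \<delta>_Lam hL])
  have fL: "?f \<in> Lam" by (rule Lam_diff[OF Suc.prems(1) dL])
  have fh: "hom m ?f" using hom_der[OF \<delta>_hom hh] Suc.prems(2) by (intro hom_closed) simp_all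
  have "der \<delta> ?f = 0"
    using der_diff[of f "der \<delta> ?h" \<delta>] Suc.prems(1,3) dL der_square_zero[OF \<delta>_hom \<delta>_Lam sq hL] by (simp add: Lam_def)
  from Suc.IH[OF fL fh this fs] obtain y where y: "y \<in> Lam" "hom (m - 1) y"
    "supp y (wl i N)" "der \<delta> y = ?f" by blast
  show ?case
  proof (intro bexI[of _ "?h + y"] conjI)
    show "supp (?h + y) (wl i (Suc N))" by (intro supp_closed hs supp_mono[OF y(3)]) auto
    show "der \<delta> (?h + y) = f" using der_add[of ?h y \<delta>] hL y by (simp add: Lam_def)
  qed (use hh y hL in \<open>auto intro: hom_closed Lam_closed\<close>)
qed

end

section \<open>Free products of quadratic algebras\<close>

text \<open>\<open>V\<close> stands for the letters of the coproduct, \<open>G\<close> and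
  \<open>H\<close> for those of its factors, and restriction to \<open>G\<close> or \<open>H\<close>
  for the map to the cochains of a factor. Nilpotence is expressed by \<open>rk\<close>, which drops
  strictly along \<open>\<delta>\<close>, and the universal property by \<open>low\<close>.\<close>

locale quadratic_coproduct = shuffle_algebra deg fld for deg :: "'b \<Rightarrow> int" and fld :: "'k::field_char_0 itself" +
  fixes V G H :: "'b set" and up :: "'b \<Rightarrow> 'b" and rk :: "'b \<Rightarrow> nat" and \<delta> :: "'b \<Rightarrow> 'b list \<Rightarrow> 'k"
  assumes inj_up: "inj_on up V" and up_V: "up ` V \<inter> V = {}" and deg_up: "v \<in> V \<Longrightarrow> deg (up v) = deg v - 1"
    and GV: "G \<subseteq> V" and HV: "H \<subseteq> V" and GH: "G \<inter> H = {}"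
    and \<delta>_Lam: "\<delta> b \<in> Lam" and \<delta>_hom: "hom (deg b + 1) (\<delta> b)"
    and \<delta>_supp: "v \<in> V \<Longrightarrow> supp (\<delta> v) (wds {b \<in> V. rk b < rk v} 2)"
    and \<delta>_out: "b \<notin> V \<Longrightarrow> \<delta> b = 0" and \<delta>_sq: "der \<delta> (\<delta> b) = 0"
    and \<delta>_G: "b \<in> V - G \<Longrightarrow> rs G (\<delta> b) = 0"
    and \<delta>_H: "b \<in> V - H \<Longrightarrow> rs H (\<delta> b) = 0"
    and low: "\<lbrakk>i = 1 \<or> i = 2; f \<in> Lam; hom m f; supp f (wds V i); der \<delta> f = 0; rs G f = 0; rs H f = 0\<rbrakk> \<Longrightarrow>
      \<exists>y. y \<in> Lam \<and> hom (m - 1) y \<and> supp y (wds V (i - 1)) \<and> rs G y = 0 \<and> rs H y = 0 \<and> der \<delta> y = f"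
begin

text \<open>Base 3 makes two letters of rank below \<open>r\<close> together weigh less than one
  letter of rank \<open>r\<close>, as \<open>2 * 3 ^ (r - 1) < 3 ^ r\<close>; with base 2 the
  extreme case would be an equality.\<close>

definition "wt b = (3::nat) ^ (if b \<in> V then rk b else rk (inv_into V up b))"

lemma wt_up: "v \<in> V \<Longrightarrow> wt (up v) = wt v" using up_V inj_up by (auto simp: wt_def)

lemma wt_V: "v \<in> V \<Longrightarrow> wt v = 3 ^ rk v" by (simp add: wt_def)

lemma wt_pos: "wt b > 0" by (simp add: wt_def)

abbreviation "vl \<equiv> cnt V"
abbreviation "vds A j \<equiv> \<lambda>w. set w \<subseteq> A \<and> vl w = j"
abbreviation "vwds A j N \<equiv> \<lambda>w. set w \<subseteq> A \<and> vl w = j \<and> wsum wt w < N"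
abbreviation rs :: "'b set \<Rightarrow> ('b list \<Rightarrow> 'k) \<Rightarrow> _" where "rs A \<equiv> rst (over A)"

abbreviation "Vr n \<equiv> {v \<in> V. rk v < n}"
abbreviation "Ur n \<equiv> up ` Vr n"

lemma up_notin: "v \<in> V \<Longrightarrow> up v \<notin> V" using up_V by blast

lemma vl_V: "set w \<subseteq> V \<Longrightarrow> vl w = length w" by (induction w) auto

lemma \<delta>_wt: "v \<in> V \<Longrightarrow> supp (\<delta> v) (vwds (Vr (rk v)) 2 (wt v))"
proof (rule supp_mono[OF \<delta>_supp])
  fix w assume v: "v \<in> V" and w: "set w \<subseteq> Vr (rk v) \<and> length w = 2"
  then obtain a b where ab: "w = [a, b]" by (metis length_0_conv length_Suc_conv numeral_2_eq_2)
  hence r: "a \<in> V" "b \<in> V" "rk a < rk v" "rk b < rk v" using w by auto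
  hence "(3::nat) ^ rk a \<le> 3 ^ (rk v - 1)" "(3::nat) ^ rk b \<le> 3 ^ (rk v - 1)"
    by (auto intro: power_increasing)
  moreover have "(3::nat) ^ rk v = 3 * 3 ^ (rk v - 1)" using r by (cases "rk v") auto
  moreover have "(3::nat) ^ (rk v - 1) > 0" by simp
  ultimately have "(3::nat) ^ rk a + 3 ^ rk b < 3 ^ rk v" by linarith
  hence "wsum wt w < wt v" using r v by (simp add: ab wt_V)
  thus "set w \<subseteq> Vr (rk v) \<and> vl w = 2 \<and> wsum wt w < wt v" using w r(1,2) by (simp add: ab)
qed

text \<open>
  \<open>D\<close> extends \<open>\<delta>\<close> to the variables \<open>up v\<close> with \<open>rk v < n\<close> and makes the extended algebra acyclic. The terms of
  \<open>D (up v)\<close> other than \<open>v\<close> have lower weight; this is what the factor 3 in \<open>wt\<close> achieves.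
\<close>

definition good :: "nat \<Rightarrow> ('b \<Rightarrow> 'b list \<Rightarrow> 'k) \<Rightarrow> bool" where
  "good n D \<longleftrightarrow> (\<forall>b. D b \<in> Lam \<and> hom (deg b + 1) (D b) \<and> der D (D b) = 0) \<and> (\<forall>b\<in>V. D b = \<delta> b) \<and>
    (\<forall>b. b \<notin> V \<union> Ur n \<longrightarrow> D b = 0) \<and>
    (\<forall>v\<in>Vr n. supp (D (up v) - lett v) (vwds (Vr n \<union> Ur n) 1 (wt v)))"

lemma goodD: assumes "good n D"
  shows "D b \<in> Lam" "hom (deg b + 1) (D b)" "der D (D b) = 0" "b \<in> V \<Longrightarrow> D b = \<delta> b" "b \<notin> V \<union> Ur n \<Longrightarrow> D b = 0"
    and "v \<in> Vr n \<Longrightarrow> supp (D (up v) - lett v) (vwds (Vr n \<union> Ur n) 1 (wt v))"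
  using assms by (auto simp: good_def)

section \<open>Adjoining the variables that make the algebra acyclic\<close>

lemma rs_union_Ur: "supp f (over V) \<Longrightarrow> A \<subseteq> V \<Longrightarrow> rs (A \<union> Ur n) f = rs A f"
proof
  fix w assume f: "supp f (over V)" and A: "A \<subseteq> V"
  show "rs (A \<union> Ur n) f w = rs A f w"
  proof (cases "f w = 0")
    case False
    hence "set w \<subseteq> A \<union> Ur n \<longleftrightarrow> set w \<subseteq> A" using suppD[OF f] up_V by blast
    thus ?thesis by (simp add: rst_def)
  qed (simp add: rst_def)
qed

lemma \<delta>_over: "supp (\<delta> b) (over V)"
  by (cases "b \<in> V") (auto simp: \<delta>_out supp_closed intro: supp_mono[OF \<delta>_supp])

lemma good_outside:
  assumes D: "good n D" and A: "A \<subseteq> V" "\<And>b. b \<in> V - A \<Longrightarrow> rs A (\<delta> b) = 0" and b: "b \<notin> A \<union> Ur n"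
  shows "rs (A \<union> Ur n) (D b) = 0"
proof (cases "b \<in> V")
  case True
  thus ?thesis using b A(2)[of b] by (simp add: goodD(4)[OF D] rs_union_Ur[OF \<delta>_over A(1)])
next
  case False
  thus ?thesis using goodD(5)[OF D] b by simp
qed

lemma good_rs_der:
  assumes D: "good n D" and A: "A \<subseteq> V" "\<And>b. b \<in> V - A \<Longrightarrow> rs A (\<delta> b) = 0" and x: "x \<in> Lam" "rs (A \<union> Ur n) x = 0"
  shows "rs (A \<union> Ur n) (der D x) = 0" using rst_der[OF x(1) good_outside[OF D A]] x(2) by simp

lemma \<delta>_supp_Vr: "v \<in> Vr n \<Longrightarrow> supp (\<delta> v) (over (Vr n))" by (rule supp_mono[OF \<delta>_supp]) auto

lemma good_up: assumes D: "good n D" and x: "x \<in> Vr n" and u: "D (up x) u \<noteq> 0"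
  shows "set u \<subseteq> Vr n \<union> Ur n \<and> vl u = 1 \<and> (u = [x] \<or> wsum wt u < wt x)"
proof (cases "u = [x]")
  case False
  hence "(D (up x) - lett x) u \<noteq> 0" using u by (simp add: fun_ap lett_def)
  thus ?thesis using suppD[OF goodD(6)[OF D x]] by blast
qed (use x in auto)

lemma good_supp: assumes D: "good n D" shows "b \<in> Vr n \<union> Ur n \<Longrightarrow> supp (D b) (over (Vr n \<union> Ur n))"
    and "b \<in> V \<union> Ur n \<Longrightarrow> supp (D b) (over (V \<union> Ur n))"
proof -
  note DV = goodD(4)[OF D]
  have 1: "supp (D b) (over (Vr n \<union> Ur n))" if "b \<in> Ur n" for b
  proof -
    from that obtain v where v: "v \<in> Vr n" "b = up v" by blast
    have "supp (D (up v) - lett v) (over (Vr n \<union> Ur n))"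
      by (rule supp_mono[OF goodD(6)[OF D v(1)]]) simp
    moreover have "supp (lett v :: 'b list \<Rightarrow> 'k) (over (Vr n \<union> Ur n))"
      using v by (auto simp: supp_def lett_def)
    ultimately have "supp (D (up v) - lett v + lett v) (over (Vr n \<union> Ur n))"
      by (rule supp_closed(2))
    thus ?thesis using v by simp
  qed
  show "supp (D b) (over (Vr n \<union> Ur n))" if "b \<in> Vr n \<union> Ur n"
  proof (cases "b \<in> Ur n")
    case False
    hence b: "b \<in> Vr n" using that by blast
    show ?thesis using supp_mono[OF \<delta>_supp_Vr[OF b], of "\<lambda>w. set w \<subseteq> Vr n \<union> Ur n"] DV[of b] b by auto
  qed (rule 1)
  show "supp (D b) (over (V \<union> Ur n))" if "b \<in> V \<union> Ur n"
  proof (cases "b \<in> Ur n")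
    case True
    show ?thesis by (rule supp_mono[OF 1[OF True]]) auto
  next
    case False
    hence b: "b \<in> V" using that by blast
    have "supp (\<delta> b) (over (V \<union> Ur n))" by (rule supp_mono[OF \<delta>_over]) auto
    thus ?thesis using DV[OF b] by simp
  qed
qed

text \<open>Used for \<open>A\<close> equal to \<open>V\<close>, \<open>G\<close> and
  \<open>H\<close>. All variables \<open>Ur n\<close> are kept, also those of letters outside
  \<open>A\<close>: restriction removes the leading term \<open>v\<close> of such an
  \<open>up v\<close>, which becomes one of the additional variables allowed in the locale
  \<open>koszul\<close>.\<close>

lemma koszul_part: assumes D: "good n D" and A: "A \<subseteq> V" and AD: "\<And>b. b \<in> V - A \<Longrightarrow> rs A (\<delta> b) = 0"
    and E: "E = A \<inter> Vr n"
    and D': "D' = (\<lambda>b. if b \<in> E \<union> Ur n then rs (A \<union> Ur n) (D b) else 0)"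
  shows "koszul deg E (Ur n) up wt D'"
    and "x \<in> Lam \<Longrightarrow> supp x (over (Vr n \<union> Ur n)) \<Longrightarrow> rs (A \<union> Ur n) (der D x) = der D' (rs (A \<union> Ur n) x)"
proof -
  note DL = goodD(1-3)[OF D] and DV = goodD(4)[OF D]
  note Dup = goodD(6)[OF D]
  have rsL: "rs B x \<in> Lam" if "x \<in> Lam" for B x by (rule Lam_rst[OF that]) auto
  show R: "rs (A \<union> Ur n) (der D x) = der D' (rs (A \<union> Ur n) x)"
    if x: "x \<in> Lam" "supp x (over (Vr n \<union> Ur n))" for x
  proof -
    have "rs (A \<union> Ur n) (der D x) = der (\<lambda>b. rs (A \<union> Ur n) (D b)) (rs (A \<union> Ur n) x)"
      by (rule rst_der[OF x(1)]) (rule good_outside[OF D A AD])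
    also have "\<dots> = der D' (rs (A \<union> Ur n) x)"
    proof (rule der_cong)
      fix b v assume "rs (A \<union> Ur n) x (b # v) \<noteq> 0"
      hence "b \<in> A \<union> Ur n" "b \<in> Vr n \<union> Ur n" using suppD[OF x(2), of "b # v"] by (auto simp: rst_def split: if_splits)
      hence "b \<in> E \<union> Ur n" using E up_V by blast
      thus "rs (A \<union> Ur n) (D b) = D' b" by (simp add: D')
    qed
    finally show ?thesis .
  qed
  have Ur: "b \<notin> V" if "b \<in> Ur n" for b using that up_V by blast
  have vlE: "cnt E w = vl w" if "set w \<subseteq> E \<union> Ur n" for w
    using that by (induction w) (auto simp: up_notin E)
  note Dsupp = good_supp(1)[OF D]
  have in_E: "set w \<subseteq> E \<union> Ur n" if "set w \<subseteq> A \<union> Ur n" "set w \<subseteq> Vr n \<union> Ur n" for w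
    using that E Ur by blast
  have rsD: "supp (rs (A \<union> Ur n) f) (kwds wt E (Ur n) i N)"
    if "supp f (vwds (Vr n \<union> Ur n) i N)" for f i N
    by (rule supp_mono[OF supp_rst[OF that]]) (use in_E vlE in auto)
  show "koszul deg E (Ur n) up wt D'"
  proof
    show "E \<inter> Ur n = {}" using E Ur by blast
    show "inj_on up E" using inj_up E by (auto simp: inj_on_def)
    show "up v \<in> Ur n" "deg (up v) = deg v - 1" "wt (up v) = wt v" if "v \<in> E" for v
      using that E by (auto simp: deg_up wt_up)
    show "hom (deg b + 1) (D' b)" "D' b \<in> Lam" for b
      using DL by (auto simp: D' hom_closed Lam_closed rsL)
    show "D' b = 0" if "b \<notin> E \<union> Ur n" for b using that by (simp add: D')
    show "der D' (D' b) = 0" for b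
    proof (cases "b \<in> E \<union> Ur n")
      case True
      hence "b \<in> Vr n \<union> Ur n" using E by blast
      thus ?thesis using True R[OF DL(1) Dsupp, of b] DL(3)[of b] by (simp add: D')
    qed (simp add: D')
    show "supp (D' v) (kwds wt E (Ur n) 2 (wt v))"
      if v: "v \<in> E" for v
    proof -
      have "v \<in> V" "rk v < n" using v E by auto
      hence "supp (D v) (vwds (Vr n \<union> Ur n) 2 (wt v))"
        unfolding DV[OF \<open>v \<in> V\<close>] by (intro supp_mono[OF \<delta>_wt]) auto
      thus ?thesis using rsD v by (simp add: D')
    qed
    show "supp (D' (up v) - lett v)
        (kwds wt E (Ur n) 1 (wt v))"
      if v: "v \<in> E" for v
    proof -
      have vn: "v \<in> Vr n" "v \<in> A" using v E by auto
      hence "rs (A \<union> Ur n) (lett v) = lett v" by (intro rst_id) (auto simp: supp_def lett_def)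
      thus ?thesis using rsD[OF Dup[OF vn(1)]] vn by (simp add: D' rst_diff)
    qed
    show "supp (D' u) (kwds wt E (Ur n) 1 (wt u))"
      if u: "u \<in> Ur n - up ` E" for u
    proof -
      from u obtain v where v: "v \<in> Vr n" "u = up v" "v \<notin> A" using E by blast
      hence "v \<notin> A \<union> Ur n" using Ur by blast
      hence "rs (A \<union> Ur n) (lett v) = 0" by (auto simp: rst_def lett_def fun_eq_iff fun_ap)
      thus ?thesis using rsD[OF Dup[OF v(1)]] v by (simp add: D' rst_diff wt_up)
    qed
  qed
qed

text \<open>For \<open>v\<close> of rank \<open>n\<close>, \<open>\<delta> v\<close> is a cocycle in
  letters of rank below \<open>n\<close>. Acyclicity of the algebra built so far gives
  \<open>Y v\<close> with \<open>D (Y v) = \<delta> v\<close>, within the weight bound of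
  \<open>\<delta> v\<close>; so \<open>v - Y v\<close> is closed and can be taken as
  \<open>D (up v)\<close>.\<close>

lemma ex_good: "\<exists>D. good n D"
proof (induction n)
  case 0
  show ?case by (rule exI[of _ \<delta>]) (simp add: good_def \<delta>_Lam \<delta>_hom \<delta>_sq \<delta>_out)
next
  case (Suc n)
  then obtain D where D: "good n D" by blast
  note DL = goodD(1-3)[OF D] and DV = goodD(4)[OF D]
  define D' where "D' = (\<lambda>b. if b \<in> V \<inter> Vr n \<union> Ur n then rs (V \<union> Ur n) (D b) else 0)"
  note K = koszul_part[OF D subset_refl _ refl D'_def]
  have kz: "koszul deg (V \<inter> Vr n) (Ur n) up wt D'" by (rule K(1)) simp
  have Ur: "b \<notin> V" if "b \<in> Ur n" for b using that up_V by blast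
  have rsV: "rs (V \<union> Ur n) x = x" if "supp x (over (Vr n \<union> Ur n))" for x
    by (rule rst_id[OF supp_mono[OF that]]) auto
  have key: "\<exists>y\<in>Lam. hom (deg v) y \<and> supp y (vwds (Vr n \<union> Ur n) 1 (wt v)) \<and> der D y = \<delta> v"
    if v: "v \<in> V" "rk v = n" for v
  proof -
    have s: "supp (\<delta> v) (vwds (Vr n \<union> Ur n) 2 (wt v))"
      by (rule supp_mono[OF \<delta>_wt[OF v(1)]]) (use v in auto)
    have dd: "der D (\<delta> v) = 0" using DL(3)[of v] unfolding DV[OF v(1)] .
    have vlE: "cnt (V \<inter> Vr n) w = vl w" if "set w \<subseteq> Vr n \<union> Ur n" for w
      using that by (induction w) (auto simp: up_notin)
    have s': "supp (\<delta> v) (kwds wt (V \<inter> Vr n) (Ur n) (Suc 1) (wt v))"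
      by (rule supp_mono[OF s]) (use vlE in auto)
    have s1: "supp (\<delta> v) (over (Vr n \<union> Ur n))" by (rule supp_mono[OF s]) simp
    have "rs (V \<union> Ur n) (der D (\<delta> v)) = der D' (rs (V \<union> Ur n) (\<delta> v))"
      by (rule K(2)[OF _ \<delta>_Lam s1]) simp
    hence d0: "der D' (\<delta> v) = 0" unfolding dd rsV[OF s1] by simp
    obtain y where y: "y \<in> Lam" "hom (deg v + 1 - 1) y"
      "supp y (kwds wt (V \<inter> Vr n) (Ur n) 1 (wt v))"
      "der D' y = \<delta> v"
      using koszul.acyclic[OF kz \<delta>_Lam \<delta>_hom d0 s'] by (elim bexE conjE) (rule that)
    have ys: "supp y (vwds (Vr n \<union> Ur n) 1 (wt v))"
    proof (rule supp_mono[OF y(3)])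
      fix w assume *: "set w \<subseteq> V \<inter> Vr n \<union> Ur n \<and> cnt (V \<inter> Vr n) w = 1 \<and> wsum wt w < wt v"
      hence sub: "set w \<subseteq> Vr n \<union> Ur n" by blast
      show "set w \<subseteq> Vr n \<union> Ur n \<and> vl w = 1 \<and> wsum wt w < wt v" using * vlE[OF sub] sub by metis
    qed
    have "der D y = der D' y"
    proof (rule der_cong)
      fix b u assume "y (b # u) \<noteq> 0"
      hence b: "b \<in> Vr n \<union> Ur n" using suppD[OF ys] by fastforce
      have "supp (D b) (over (V \<union> Ur n))" by (rule good_supp(2)[OF D]) (use b in blast)
      hence "rs (V \<union> Ur n) (D b) = D b" by (rule rst_id)
      thus "D b = D' b" using b by (auto simp: D'_def)
    qed
    thus ?thesis using y ys by auto
  qed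
  have "\<forall>v\<in>{v \<in> V. rk v = n}. \<exists>y. y \<in> Lam \<and> hom (deg v) y \<and>
      supp y (vwds (Vr n \<union> Ur n) 1 (wt v)) \<and> der D y = \<delta> v"
    by (intro ballI, rule key[unfolded Bex_def]) simp_all
  from bchoice[OF this] obtain Y where Y': "\<forall>v\<in>{v \<in> V. rk v = n}. Y v \<in> Lam \<and> hom (deg v) (Y v) \<and>
      supp (Y v) (vwds (Vr n \<union> Ur n) 1 (wt v)) \<and> der D (Y v) = \<delta> v" ..
  have Y: "Y v \<in> Lam" "hom (deg v) (Y v)" "supp (Y v) (vwds (Vr n \<union> Ur n) 1 (wt v))"
    "der D (Y v) = \<delta> v" if "v \<in> V" "rk v = n" for v using bspec[OF Y', of v] that by simp_all
  have Ys: "supp (Y v) (over (V \<union> Ur n))" if "v \<in> V" "rk v = n" for v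
    by (rule supp_mono[OF Y(3)[OF that]]) blast
  define N where "N = (\<lambda>b. if b \<in> up ` {v \<in> V. rk v = n} then lett (inv_into V up b) - Y (inv_into V up b) else D b)"
  have Nup: "N (up v) = lett v - Y v" if "v \<in> V" "rk v = n" for v
    using that inj_up by (auto simp: N_def)
  have ND: "N b = D b" if "b \<in> V \<union> Ur n" for b
  proof -
    have "b \<notin> up ` {v \<in> V. rk v = n}"
    proof
      assume "b \<in> up ` {v \<in> V. rk v = n}"
      then obtain v where v: "v \<in> V" "rk v = n" "b = up v" by blast
      hence "b \<in> Ur n" using that up_V by blast
      then obtain v' where "v' \<in> Vr n" "b = up v'" by blast
      hence "v = v'" using v inj_up by (auto simp: inj_on_def)
      thus False using v \<open>v' \<in> Vr n\<close> by simp
    qed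
    thus ?thesis unfolding N_def by (rule if_not_P)
  qed
  have derN: "der N x = der D x" if "supp x (over (V \<union> Ur n))" for x
    by (rule der_cong) (use suppD[OF that] ND in fastforce)
  have V_sub: "Vr n \<union> Ur n \<subseteq> Vr (Suc n) \<union> Ur (Suc n)" by (auto simp: less_Suc_eq)
  have "good (Suc n) N" unfolding good_def
  proof (intro conjI allI ballI impI)
    fix b
    consider v where "v \<in> V" "rk v = n" "b = up v" | "b \<in> V \<union> Ur n" | "b \<notin> V \<union> Ur n" "b \<notin> up ` {v \<in> V. rk v = n}" by blast
    hence "N b \<in> Lam \<and> hom (deg b + 1) (N b) \<and> der N (N b) = 0"
    proof cases
      case 1
      hence h: "hom (deg b + 1) (lett v)" using hom_closed(6)[of v] by (simp add: deg_up)
      have "der N (Y v) = \<delta> v" using derN[OF Ys[OF 1(1,2)]] Y(4)[OF 1(1,2)] by simp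
      moreover have "N v = \<delta> v" using ND[of v] DV 1 by simp
      moreover have "finsupp (Y v)" using Y[OF 1(1,2)] by (simp add: Lam_def)
      ultimately have "der N (lett v - Y v) = 0" by (simp add: der_diff finsupp_closed)
      thus ?thesis using 1 Y[OF 1(1,2)] h by (simp add: Nup Lam_diff Lam_closed hom_closed deg_up)
    next
      case 2
      have "supp (D b) (over (V \<union> Ur n))" by (rule good_supp(2)[OF D 2])
      thus ?thesis using DL derN ND[OF 2] by simp
    next
      case 3
      hence "N b = D b" unfolding N_def by (simp only: if_False)
      moreover have "D b = 0" using D 3(1) by (auto simp: good_def)
      ultimately show ?thesis by (simp add: hom_closed Lam_closed)
    qed
    thus "N b \<in> Lam" "hom (deg b + 1) (N b)" "der N (N b) = 0" by auto
  next
    fix b assume "b \<in> V" thus "N b = \<delta> b" using ND DV by simp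
  next
    fix b assume b: "b \<notin> V \<union> Ur (Suc n)"
    hence "b \<notin> V \<union> Ur n" "b \<notin> up ` {v \<in> V. rk v = n}" by (auto simp: less_Suc_eq)
    thus "N b = 0" using D unfolding N_def good_def by simp
  next
    fix v assume v: "v \<in> Vr (Suc n)"
    show "supp (N (up v) - lett v) (vwds (Vr (Suc n) \<union> Ur (Suc n)) 1 (wt v))"
    proof (cases "rk v = n")
      case True
      hence "supp (- Y v) (vwds (Vr (Suc n) \<union> Ur (Suc n)) 1 (wt v))"
        using v V_sub by (intro supp_closed supp_mono[OF Y(3)]) auto
      thus ?thesis using Nup[of v] v True by simp
    next
      case False
      hence "v \<in> Vr n" using v by simp
      moreover have "N (up v) = D (up v)" using \<open>v \<in> Vr n\<close> by (intro ND) blast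
      moreover have "supp (D (up v) - lett v) (vwds (Vr n \<union> Ur n) 1 (wt v))"
        using D \<open>v \<in> Vr n\<close> by (simp add: good_def)
      ultimately have "supp (N (up v) - lett v) (vwds (Vr n \<union> Ur n) 1 (wt v))" by simp
      thus ?thesis by (rule supp_mono) (use V_sub in blast)
    qed
  qed
  thus ?case by blast
qed

section \<open>Relative exactness by induction on the word length\<close>

lemma ldel_der: assumes "f \<in> Lam" "\<And>c. hom (deg c + 1) (D c)" "\<And>c. ldel b (D c) = 0"
  shows "ldel b (der D f) = sc (eps (deg b)) (der D (ldel b f))"
proof -
  let ?A = "{c. ldel c f \<noteq> 0}"
  have f: "supersym f" "finite ?A" using assms finite_ldel by (auto simp: Lam_def)
  have "ldel b (D c \<star> ldel c f) = sc (eps (deg b)) (D c \<star> ldel c (ldel b f))" for c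
  proof -
    have "eps (deg b * (deg c + 1)) * eps (deg b * deg c) = (eps (deg b) :: 'k)"
      by (simp add: distrib_left eps_add eps_sq_left eps_sq mult.commute)
    hence "eps (deg b * deg c) * eps (deg b * (deg c + 1)) = (eps (deg b) :: 'k)"
      by (simp only: mult.commute)
    thus ?thesis
      by (simp add: ldel_sp assms(3) hom_twist[OF assms(2)] supersym_ldel2[OF f(1), of b c] sp_sc_left sp_sc_right)
  qed
  hence "ldel b (der D f) = sc (eps (deg b)) (\<Sum>c\<in>?A. D c \<star> ldel c (ldel b f))"
    by (simp add: der_def ldel_sum sc_sum)
  also have "(\<Sum>c\<in>?A. D c \<star> ldel c (ldel b f)) = der D (ldel b f)"
  proof (rule der_eq[symmetric, OF f(2)], safe)
    fix c assume "ldel c (ldel b f) \<noteq> 0" "ldel c f = 0"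
    thus False using supersym_ldel2[OF f(1), of c b] by simp
  qed
  finally show ?thesis .
qed

definition exact_in :: "nat \<Rightarrow> bool" where
  "exact_in i \<longleftrightarrow> (\<forall>m z. z \<in> Lam \<longrightarrow> hom m z \<longrightarrow> supp z (wds V i) \<longrightarrow> der \<delta> z = 0 \<longrightarrow>
    rs G z = 0 \<longrightarrow> rs H z = 0 \<longrightarrow>
    (\<exists>y. y \<in> Lam \<and> hom (m - 1) y \<and> supp y (wds V (i - 1)) \<and> rs G y = 0 \<and> rs H y = 0 \<and> der \<delta> y = z))"

text \<open>The weight carried by the new variables alone, which filters the extended algebra:
  \<open>\<delta>\<close> preserves it and \<open>D - \<delta>\<close> lowers it.\<close>

definition uw :: "nat \<Rightarrow> 'b list \<Rightarrow> nat" where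
  "uw n w = wsum (\<lambda>b. if b \<in> Ur n then wt b else 0) w"

abbreviation "uwds n j s \<equiv> \<lambda>w. set w \<subseteq> V \<union> Ur n \<and> vl w = j \<and> uw n w = s"

abbreviation "rel n P m f \<equiv> f \<in> Lam \<and> hom m f \<and> supp f P \<and> rs (G \<union> Ur n) f = 0 \<and> rs (H \<union> Ur n) f = 0"

lemma uw_simps [simp]: "uw n [] = 0" "uw n (b # w) = (if b \<in> Ur n then wt b else 0) + uw n w"
  "uw n (u @ v) = uw n u + uw n v" by (auto simp: uw_def)

lemma uw_shuffles: "w \<in> shuffles u v \<Longrightarrow> uw n w = uw n u + uw n v"
  unfolding uw_def by (rule wsum_shuffles)

lemma uw_V: "set w \<subseteq> V \<Longrightarrow> uw n w = 0" using up_V by (induction w) auto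

lemma uw_0: "set w \<subseteq> V \<union> Ur n \<Longrightarrow> uw n w = 0 \<Longrightarrow> set w \<subseteq> V"
proof (induction w)
  case (Cons b w)
  hence "b \<notin> Ur n" using wt_pos[of b] by (auto split: if_splits)
  thus ?case using Cons by (auto split: if_splits)
qed simp

text \<open>Kuenneth: coefficients in the polynomials in the variables \<open>Ur n\<close>, on which \<open>\<delta>\<close> vanishes.\<close>

lemma exact_untwisted: assumes P: "exact_in i"
  assumes "f \<in> Lam" "hom m f" "supp f (uwds n i s)" "der \<delta> f = 0"
    "rs (G \<union> Ur n) f = 0" "rs (H \<union> Ur n) f = 0"
  shows "\<exists>y. rel n (uwds n (i - 1) s) (m - 1) y \<and> der \<delta> y = f" using assms(2-)
proof (induction s arbitrary: f m rule: less_induct)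
  case (less s)
  note f = less.prems
  show ?case
  proof (cases "s = 0")
    case True
    have fV: "supp f (wds V i)" by (rule supp_mono[OF f(3)]) (metis True uw_0 vl_V)
    hence fV': "supp f (over V)" by (rule supp_mono) blast
    have r: "rs G f = 0" "rs H f = 0"
      using f(5,6) unfolding rs_union_Ur[OF fV' GV] rs_union_Ur[OF fV' HV] by blast+
    from P[unfolded exact_in_def, rule_format, OF f(1,2) fV f(4) r]
    obtain y where y: "y \<in> Lam" "hom (m - 1) y" "supp y (wds V (i - 1))"
      "rs G y = 0" "rs H y = 0" "der \<delta> y = f" by (elim exE conjE) (rule that)
    have yV: "supp y (over V)" by (rule supp_mono[OF y(3)]) blast
    have "supp y (uwds n (i - 1) s)" by (rule supp_mono[OF y(3)]) (use True uw_V vl_V in auto)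
    thus ?thesis using y rs_union_Ur[OF yV GV] rs_union_Ur[OF yV HV] by (intro exI[of _ y]) simp
  next
    case False
    define A where "A = {b \<in> Ur n. ldel b f \<noteq> 0}"
    have A: "finite A" unfolding A_def using f(1) finite_ldel by (auto simp: Lam_def intro: finite_subset[rotated])
    \<comment> \<open>The derivative along a new variable \<open>b\<close> is again a relative
      cocycle, since no value of \<open>\<delta>\<close> contains \<open>b\<close> and both
      restrictions keep it; its weight in the new variables is smaller by
      \<open>wt b\<close>.\<close>
    have ex: "\<exists>y. rel n (uwds n (i - 1) (s - wt b)) (m - deg b - 1) y \<and> der \<delta> y = ldel b f" and wle: "wt b \<le> s" if b: "b \<in> A" for b
    proof -
      have bU: "b \<in> Ur n" and nz: "ldel b f \<noteq> 0" using b by (auto simp: A_def)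
      hence bV: "b \<notin> V" using up_V by blast
      have s1: "supp (ldel b f) (\<lambda>w. set w \<subseteq> V \<union> Ur n \<and> vl w = i \<and> wt b + uw n w = s)"
        unfolding supp_def ldel_def
      proof (intro allI impI)
        fix w assume "f (b # w) \<noteq> 0"
        from suppD[OF f(3) this] show "set w \<subseteq> V \<union> Ur n \<and> vl w = i \<and> wt b + uw n w = s"
          using bU bV by auto
      qed
      obtain w where "ldel b f w \<noteq> 0" using nz by (auto simp: fun_eq_iff fun_ap)
      from suppD[OF s1 this] show wle: "wt b \<le> s" by simp
      have s2: "supp (ldel b f) (uwds n i (s - wt b))" by (rule supp_mono[OF s1]) auto
      have ld0: "ldel b (\<delta> c) = 0" for c
      proof (cases "c \<in> V")
        case True
        have "\<delta> c (b # w) = 0" for w using suppD[OF \<delta>_supp[OF True], of "b # w"] bV by auto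
        thus ?thesis by (simp add: ldel_def fun_eq_iff fun_ap)
      qed (simp add: \<delta>_out)
      have "sc (eps (deg b)) (der \<delta> (ldel b f)) = 0" using ldel_der[OF f(1) \<delta>_hom ld0] f(4) by simp
      hence "sc (eps (deg b)) (sc (eps (deg b)) (der \<delta> (ldel b f))) = 0" by simp
      hence d0: "der \<delta> (ldel b f) = 0" by (simp add: eps_sq)
      have rld: "rs B (ldel b f) = 0" if "rs B f = 0" "b \<in> B" for B
      proof
        fix w show "rs B (ldel b f) w = 0 w"
          using fun_cong[OF that(1), of "b # w"] that(2) by (simp add: rst_def ldel_def fun_ap split: if_splits)
      qed
      have "s - wt b < s" using wle wt_pos[of b] by simp
      from less.IH[OF this Lam_closed(7)[OF f(1)] hom_ldel[OF f(2)] s2 d0 rld[OF f(5)] rld[OF f(6)]] bU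
      show "\<exists>y. rel n (uwds n (i - 1) (s - wt b)) (m - deg b - 1) y \<and> der \<delta> y = ldel b f" by blast
    qed
    have "\<forall>b\<in>A. \<exists>y. rel n (uwds n (i - 1) (s - wt b)) (m - deg b - 1) y \<and> der \<delta> y = ldel b f"
      by (intro ballI ex)
    from bchoice[OF this] obtain Y where Y': "\<forall>b\<in>A. rel n (uwds n (i - 1) (s - wt b)) (m - deg b - 1) (Y b) \<and> der \<delta> (Y b) = ldel b f" ..
    have Y: "Y b \<in> Lam" "hom (m - deg b - 1) (Y b)"
      "supp (Y b) (uwds n (i - 1) (s - wt b))"
      "rs (G \<union> Ur n) (Y b) = 0" "rs (H \<union> Ur n) (Y b) = 0" "der \<delta> (Y b) = ldel b f" if "b \<in> A" for b
      using bspec[OF Y' that] by simp_all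
    define t where "t b = lett b \<star> Y b" for b
    have tL: "t b \<in> Lam" if "b \<in> A" for b using Y(1)[OF that] by (simp add: t_def Lam_closed)
    have dt: "der \<delta> (t b) = sc (eps (deg b)) (lett b \<star> ldel b f)" if b: "b \<in> A" for b
    proof -
      have "b \<notin> V" using b up_V by (auto simp: A_def)
      thus ?thesis unfolding t_def der_sp[OF \<delta>_hom Lam_closed(3) Y(1)[OF b]] Y(6)[OF b]
        by (simp add: \<delta>_out twist_lett sp_sc_left)
    qed
    \<comment> \<open>The sign undoes the one from moving \<open>\<delta>\<close> past the letter
      \<open>b\<close>; the factors \<open>wt b\<close> and \<open>1 / s\<close> turn the sum into
      Euler's identity for \<open>uw\<close>.\<close>
    define c where "c b = inverse (of_nat s) * (of_nat (wt b) * eps (deg b) :: 'k)" for b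
    define y where "y = (\<Sum>b\<in>A. sc (c b) (t b))"
    have yL: "y \<in> Lam" unfolding y_def by (intro Lam_sum Lam_closed tL)
    have dy: "der \<delta> y = f"
    proof -
      have "der \<delta> y = (\<Sum>b\<in>A. sc (c b) (der \<delta> (t b)))"
        unfolding y_def by (subst der_sum) (simp_all add: tL Lam_closed der_sc)
      also have "\<dots> = (\<Sum>b\<in>A. sc (inverse (of_nat s)) (sc (of_nat (wt b)) (lett b \<star> ldel b f)))"
        by (intro sum.cong) (simp_all add: dt c_def mult.assoc eps_sq)
      also have "\<dots> = sc (inverse (of_nat s)) (\<Sum>b\<in>A. sc (of_nat (wt b)) (lett b \<star> ldel b f))"
        by (simp only: sc_sum)
      also have "(\<Sum>b\<in>A. sc (of_nat (wt b)) (lett b \<star> ldel b f)) =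
          (\<Sum>b\<in>{b. ldel b f \<noteq> 0}. sc (of_nat (if b \<in> Ur n then wt b else 0)) (lett b \<star> ldel b f))"
      proof (rule sum.mono_neutral_cong_left)
        show "finite {b. ldel b f \<noteq> 0}" using f(1) finite_ldel by (auto simp: Lam_def)
      qed (auto simp: A_def)
      also have "\<dots> = (\<lambda>w. of_nat (wsum (\<lambda>b. if b \<in> Ur n then wt b else 0) w) * f w)"
        by (rule euler[OF f(1)]) (use f(1) finite_ldel in \<open>auto simp: Lam_def\<close>)
      also have "\<dots> = (\<lambda>w. of_nat s * f w)"
      proof
        fix w show "of_nat (wsum (\<lambda>b. if b \<in> Ur n then wt b else 0) w) * f w = of_nat s * f w"
          using suppD[OF f(3), of w] unfolding uw_def by (cases "f w = 0") auto
      qed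
      also have "sc (inverse (of_nat s)) (\<lambda>w. of_nat s * f w) = f"
        using False by (simp add: fun_eq_iff fun_ap)
      finally show ?thesis .
    qed
    have bd: "b \<in> Ur n" "b \<notin> V" if "b \<in> A" for b using that up_V by (auto simp: A_def)
    have ys: "supp y (uwds n (i - 1) s)" unfolding y_def
    proof (intro supp_sum supp_closed)
      fix b assume b: "b \<in> A"
      have l: "supp (lett b :: 'b list \<Rightarrow> 'k) (\<lambda>w. w = [b])" by (auto simp: supp_def lett_def)
      show "supp (t b) (uwds n (i - 1) s)" unfolding t_def
      proof (rule supp_sp[OF l Y(3)[OF b]])
        fix u v w assume *: "u = [b]" "set v \<subseteq> V \<union> Ur n \<and> vl v = i - 1 \<and> uw n v = s - wt b" "w \<in> shuffles u v"
        show "set w \<subseteq> V \<union> Ur n \<and> vl w = i - 1 \<and> uw n w = s"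
          using * bd[OF b] wle[OF b] cnt_shuffles[OF *(3), of V] uw_shuffles[OF *(3), of n] set_shuffles[OF *(3)] by auto
      qed
    qed
    have yh: "hom (m - 1) y" unfolding y_def
    proof (intro hom_sum hom_closed)
      fix b assume b: "b \<in> A"
      have "hom (deg b + (m - deg b - 1)) (t b)" unfolding t_def by (intro hom_sp hom_closed Y(2)[OF b])
      thus "hom (m - 1) (t b)" by simp
    qed
    have "rs B y = 0" if "\<And>b. b \<in> A \<Longrightarrow> rs B (Y b) = 0" for B
      using that by (simp add: y_def rst_sum rst_sc t_def rst_letters_sp)
    thus ?thesis using yL yh ys dy Y(4,5) by (intro exI[of _ y]) blast
  qed
qed

text \<open>Induction on the weight in new variables: \<open>D - \<delta>\<close> lowers it, so the
  top component of \<open>f\<close> is a cocycle for \<open>\<delta>\<close> and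
  \<open>exact_untwisted\<close> applies. Only words with new variables are controlled, because in
  the application \<open>D f\<close> is a given function of the old letters.\<close>

lemma exact_twisted: assumes P: "exact_in i" and D: "good n D"
  assumes "f \<in> Lam" "hom m f" "supp f (\<lambda>w. set w \<subseteq> V \<union> Ur n \<and> vl w = i \<and> uw n w < N)"
    "\<forall>w. uw n w > 0 \<longrightarrow> der D f w = 0" "rs (G \<union> Ur n) f = 0" "rs (H \<union> Ur n) f = 0" and i: "i > 0"
  shows "\<exists>y. rel n (vds (V \<union> Ur n) (i - 1)) (m - 1) y \<and> (\<forall>w. uw n w > 0 \<longrightarrow> der D y w = f w)"
  using assms(3-8)
proof (induction N arbitrary: f)
  case 0
  hence "f = 0" using supp_False[of f] by simp
  thus ?case by (intro exI[of _ 0]) (simp add: Lam_closed hom_closed supp_closed)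
next
  case (Suc s)
  note f = Suc.prems
  note DL = goodD(1-3)[OF D] and DV = goodD(4)[OF D]
  show ?case
  proof (cases "s = 0")
    case True
    have "f w = 0" if "uw n w > 0" for w using suppD[OF f(3), of w] that True by auto
    hence "\<forall>w. uw n w > 0 \<longrightarrow> der D 0 w = f w" by (simp add: fun_ap)
    thus ?thesis by (intro exI[of _ 0]) (simp add: Lam_closed hom_closed supp_closed)
  next
    case False
    define F where "F = rst (\<lambda>w. uw n w = s) f"
    have FL: "F \<in> Lam" unfolding F_def by (rule Lam_rst[OF f(1)]) auto
    have Fs: "supp F (uwds n i s)" unfolding F_def by (rule supp_mono[OF supp_rst[OF f(3)]]) auto
    have fFs: "supp (f - F) (\<lambda>w. set w \<subseteq> V \<union> Ur n \<and> vl w = i \<and> uw n w < s)" unfolding supp_def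
    proof (intro allI impI)
      fix w assume "(f - F) w \<noteq> 0"
      hence "f w \<noteq> 0" "uw n w \<noteq> s" by (auto simp: F_def rst_def fun_ap split: if_splits)
      thus "set w \<subseteq> V \<union> Ur n \<and> vl w = i \<and> uw n w < s" using suppD[OF f(3), of w] by auto
    qed
    have \<delta>u: "supp (der \<delta> x) (\<lambda>w. Q (uw n w))" if "supp x (\<lambda>w. set w \<subseteq> V \<union> Ur n \<and> vl w = j \<and> Q (uw n w))" for x Q j
    proof (rule supp_der[OF that])
      fix b u v w assume *: "\<delta> b u \<noteq> 0" "set (b # v) \<subseteq> V \<union> Ur n \<and> vl (b # v) = j \<and> Q (uw n (b # v))" "w \<in> shuffles u v"
      have b: "b \<in> V" using *(1) \<delta>_out[of b] by (cases "b \<in> V") (auto simp: fun_ap)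
      hence "uw n u = 0" using suppD[OF \<delta>_supp *(1)] uw_V by blast
      moreover have "b \<notin> Ur n" using b up_V by blast
      ultimately show "Q (uw n w)" using * uw_shuffles[OF *(3), of n] by simp
    qed
    let ?\<mu> = "\<lambda>b. D b - \<delta> b"
    \<comment> \<open>\<open>D\<close> and \<open>\<delta>\<close> agree on \<open>V\<close>. On
      \<open>up x\<close> every term of \<open>D\<close> has smaller new weight than
      \<open>up x\<close>, including the leading term \<open>x\<close>, whose new weight is
      0.\<close>
    have \<mu>u: "supp (der ?\<mu> x) (\<lambda>w. set w \<subseteq> V \<union> Ur n \<and> vl w = Suc j \<and> uw n w < s')"
      if "supp x (\<lambda>w. set w \<subseteq> V \<union> Ur n \<and> vl w = j \<and> uw n w < Suc s')" for x j s'
    proof (rule supp_der[OF that])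
      fix b u v w assume *: "?\<mu> b u \<noteq> 0" "set (b # v) \<subseteq> V \<union> Ur n \<and> vl (b # v) = j \<and> uw n (b # v) < Suc s'" "w \<in> shuffles u v"
      have "b \<notin> V" using *(1) DV by (auto simp: fun_ap)
      hence "b \<in> Ur n" using *(2) by auto
      then obtain x where x: "x \<in> Vr n" "b = up x" by blast
      have bu: "D b u \<noteq> 0" using *(1) \<delta>_out[OF \<open>b \<notin> V\<close>] by (simp add: fun_ap)
      have "uw n u \<le> wsum wt u" by (induction u) auto
      moreover have "x \<notin> Ur n" using x up_V by blast
      ultimately have us: "set u \<subseteq> V \<union> Ur n \<and> vl u = 1 \<and> uw n u < wt b"
        using good_up[OF D x(1), of u] bu x wt_pos[of x] by (auto simp: wt_up)
      thus "set w \<subseteq> V \<union> Ur n \<and> vl w = Suc j \<and> uw n w < s'"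
        using *(2) \<open>b \<in> Ur n\<close> \<open>b \<notin> V\<close> cnt_shuffles[OF *(3), of V] uw_shuffles[OF *(3), of n] set_shuffles[OF *(3)] by auto
    qed
    have split: "der D x = der \<delta> x + der ?\<mu> x" for x using der_delta_add[of \<delta> ?\<mu> x] by simp
    have dF: "der \<delta> F = 0"
    proof
      fix w show "der \<delta> F w = 0 w"
      proof (cases "uw n w = s")
        case False
        thus ?thesis using suppD[OF \<delta>u[of F i "\<lambda>x. x = s", OF Fs], of w] by (auto simp: fun_ap)
      next
        case True
        have "finsupp f" "finsupp (f - F)" "finsupp F" using f(1) FL Lam_diff[OF f(1) FL] by (simp_all add: Lam_def)
        hence "der \<delta> F w = der \<delta> f w - der \<delta> (f - F) w" by (simp add: der_diff fun_ap)
        moreover have "der \<delta> (f - F) w = 0" using suppD[OF \<delta>u[of "f - F" i "\<lambda>x. x < s", OF fFs], of w] True by auto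
        moreover have "der \<delta> f w = der D f w - der ?\<mu> f w" using split[of f] by (simp add: fun_ap)
        moreover have "der ?\<mu> f w = 0" using suppD[OF \<mu>u[OF f(3)], of w] True by auto
        moreover have "der D f w = 0" using f(4) True \<open>s \<noteq> 0\<close> by simp
        ultimately show ?thesis by (simp add: fun_ap)
      qed
    qed
    have rF: "rs B F = 0" if "rs B f = 0" for B
    proof
      fix w show "rs B F w = 0 w" using fun_cong[OF that, of w] by (auto simp: F_def rst_def fun_ap)
    qed
    from exact_untwisted[OF P FL hom_closed(5)[OF f(2), of "\<lambda>w. uw n w = s", folded F_def] Fs dF rF[OF f(5)] rF[OF f(6)]]
    obtain y where y: "y \<in> Lam" "hom (m - 1) y" "supp y (uwds n (i - 1) s)"
      "rs (G \<union> Ur n) y = 0" "rs (H \<union> Ur n) y = 0" "der \<delta> y = F" by (elim exE conjE) (rule that)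
    let ?f = "f - der D y"
    have DyL: "der D y \<in> Lam" by (rule der_Lam[OF DL(1) y(1)])
    have feq: "?f = (f - F) - der ?\<mu> y" using split[of y] y(6) by simp
    have ms: "supp (der ?\<mu> y) (\<lambda>w. set w \<subseteq> V \<union> Ur n \<and> vl w = i \<and> uw n w < s)"
      using \<mu>u[of y "i - 1" s] supp_mono[OF y(3)] i by auto
    have fs: "supp ?f (\<lambda>w. set w \<subseteq> V \<union> Ur n \<and> vl w = i \<and> uw n w < s)"
      unfolding feq by (rule supp_closed(3)[OF fFs ms])
    have dd: "der D (der D y) = 0" by (rule der_square_zero[OF DL(2,1,3) y(1)])
    have df: "der D ?f = der D f" using der_diff[of f "der D y" D] f(1) DyL dd by (simp add: Lam_def)
    have r1: "rs (G \<union> Ur n) ?f = 0" using f(5) good_rs_der[OF D GV \<delta>_G y(1,4)] by (simp add: rst_diff)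
    have r2: "rs (H \<union> Ur n) ?f = 0" using f(6) good_rs_der[OF D HV \<delta>_H y(1,5)] by (simp add: rst_diff)
    have fh: "hom m ?f" using hom_der[OF DL(2) y(2)] f(2) by (intro hom_closed) simp_all
    have "\<forall>w. uw n w > 0 \<longrightarrow> der D ?f w = 0" using f(4) df by simp
    from Suc.IH[OF Lam_diff[OF f(1) DyL] fh fs this r1 r2]
    obtain x where x: "x \<in> Lam" "hom (m - 1) x" "supp x (vds (V \<union> Ur n) (i - 1))"
      "rs (G \<union> Ur n) x = 0" "rs (H \<union> Ur n) x = 0" "\<forall>w. uw n w > 0 \<longrightarrow> der D x w = ?f w"
      by (elim exE conjE) (rule that)
    show ?thesis
    proof (intro exI[of _ "x + y"] conjI allI impI)
      show "x + y \<in> Lam" "hom (m - 1) (x + y)" using x y by (simp_all add: Lam_closed hom_closed)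
      show "supp (x + y) (vds (V \<union> Ur n) (i - 1))"
        by (intro supp_closed x(3) supp_mono[OF y(3)]) blast
      show "rs (G \<union> Ur n) (x + y) = 0" "rs (H \<union> Ur n) (x + y) = 0" using x y by (simp_all add: rst_add)
      show "der D (x + y) w = f w" if "uw n w > 0" for w
        using x(1,6) y(1) that der_add[of x y D] by (simp add: Lam_def fun_ap)
    qed
  qed
qed

lemma Lam_wsum_bound:
  fixes q :: "'b \<Rightarrow> nat"
  assumes "f \<in> Lam" shows "\<exists>N. supp f (\<lambda>w. wsum q w < N)"
proof -
  have "finsupp f" using assms by (simp add: Lam_def)
  then obtain A M where A: "finite A" "\<And>w. f w \<noteq> 0 \<Longrightarrow> set w \<subseteq> A \<and> length w \<le> M"
    unfolding finsupp_def by (elim exE conjE) (rule that, auto)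
  have le: "wsum q w \<le> length w * Max (q ` A)" if "set w \<subseteq> A" for w using that
  proof (induction w)
    case (Cons a w)
    hence "q a \<le> Max (q ` A)" using A(1) by (intro Max_ge) auto
    thus ?case using Cons by simp
  qed simp
  have "wsum q w < Suc (M * Max (q ` A))" if w: "f w \<noteq> 0" for w
  proof -
    have "wsum q w \<le> length w * Max (q ` A)" using A(2)[OF w] by (intro le) blast
    also have "\<dots> \<le> M * Max (q ` A)" using A(2)[OF w] by simp
    finally show ?thesis by simp
  qed
  thus ?thesis unfolding supp_def by blast
qed

text \<open>
  A relative cocycle \<open>z\<close> is \<open>D \<beta>\<close> in the acyclic algebra of \<open>V\<close>; on \<open>G\<close> and on \<open>H\<close> the cochain \<open>\<beta>\<close> is a cocycle,
  hence a boundary, and after subtracting these boundaries \<open>\<beta>\<close> is relative. The part of \<open>\<beta>\<close> that involves the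
  new variables is then removed by exactness in word length \<open>i\<close>.
\<close>

lemma exact_step:
  assumes P: "exact_in i" and i: "i \<ge> 2" shows "exact_in (Suc i)"
  unfolding exact_in_def
proof (intro allI impI)
  fix m z assume z: "z \<in> Lam" "hom m z" "supp z (wds V (Suc i))" "der \<delta> z = 0" "rs G z = 0" "rs H z = 0"
  obtain B where B: "finite B" "\<And>w. z w \<noteq> 0 \<Longrightarrow> set w \<subseteq> B" using z(1) unfolding Lam_def finsupp_def by blast
  \<comment> \<open>Only finitely many letters occur in \<open>z\<close>, so the new variables up to
    a finite rank suffice.\<close>
  define n where "n = Suc (Max (rk ` B))"
  have rkB: "rk b < n" if "b \<in> B" for b using that B(1) by (simp add: n_def less_Suc_eq_le)
  have zn: "set w \<subseteq> Vr n \<and> length w = Suc i" if "z w \<noteq> 0" for w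
    using suppD[OF z(3) that] B(2)[OF that] rkB by auto
  obtain D where D: "good n D" using ex_good by blast
  note DL = goodD(1-3)[OF D] and DV = goodD(4)[OF D]
  have DVx: "der D x = der \<delta> x" if "supp x (over V)" for x
    by (rule der_cong) (use suppD[OF that] DV in fastforce)
  have zV: "supp z (over V)" by (rule supp_mono[OF z(3)]) blast
  have vlE: "cnt (A \<inter> Vr n) w = vl w" if "set w \<subseteq> A \<inter> Vr n \<union> Ur n" for w A
    using that by (induction w) (auto simp: up_notin)
  have zD: "der D z = 0" using DVx[OF zV] z(4) by simp
  note wb = Lam_wsum_bound
  have dG: "\<forall>b\<in>V - G. rs G (\<delta> b) = 0" and dH: "\<forall>b\<in>V - H. rs H (\<delta> b) = 0" using \<delta>_G \<delta>_H by blast+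
  \<comment> \<open>Koszul acyclicity over \<open>A\<close>, in the form applied to
    \<open>V\<close>, \<open>G\<close> and \<open>H\<close>; a primitive has one old letter
    less.\<close>
  have solve: "\<exists>y. y \<in> Lam \<and> hom (k - 1) y \<and> supp y (vds (A \<inter> Vr n \<union> Ur n) j) \<and>
      rs (A \<union> Ur n) (der D y) = x"
    if A: "A \<subseteq> V" "\<forall>b\<in>V - A. rs A (\<delta> b) = 0"
      and x: "x' \<in> Lam" "x = rs (A \<union> Ur n) x'" "hom k x" "supp x' (vds (Vr n \<union> Ur n) (Suc j))"
        "rs (A \<union> Ur n) (der D x') = 0" for A x x' k j
  proof -
    define D' where "D' = (\<lambda>b. if b \<in> A \<inter> Vr n \<union> Ur n then rs (A \<union> Ur n) (D b) else 0)"
    have kz: "koszul deg (A \<inter> Vr n) (Ur n) up wt D'" by (rule koszul_part(1)[OF D A(1) A(2)[rule_format] refl D'_def])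
    have tr: "rs (A \<union> Ur n) (der D x) = der D' (rs (A \<union> Ur n) x)"
      if "x \<in> Lam" "supp x (over (Vr n \<union> Ur n))" for x
      by (rule koszul_part(2)[OF D A(1) A(2)[rule_format] refl D'_def that])
    have xL: "x \<in> Lam" unfolding x(2) by (rule Lam_rst[OF x(1)]) auto
    have d0: "der D' x = 0" using tr[OF x(1) supp_mono[OF x(4)]] x(2,5) by simp
    obtain N where N: "supp x (\<lambda>w. wsum wt w < N)" using wb[OF xL] by blast
    have s: "supp x (kwds wt (A \<inter> Vr n) (Ur n) (Suc j) N)" unfolding supp_def
    proof (intro allI impI)
      fix w assume w: "x w \<noteq> 0"
      hence "x' w \<noteq> 0" "set w \<subseteq> A \<union> Ur n" by (auto simp: x(2) rst_def split: if_splits)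
      hence *: "set w \<subseteq> A \<inter> Vr n \<union> Ur n" "vl w = Suc j" using suppD[OF x(4)] by blast+
      thus "set w \<subseteq> A \<inter> Vr n \<union> Ur n \<and> cnt (A \<inter> Vr n) w = Suc j \<and> wsum wt w < N"
        using vlE[OF *(1)] suppD[OF N w] by simp
    qed
    obtain y where y: "y \<in> Lam" "hom (k - 1) y"
      "supp y (kwds wt (A \<inter> Vr n) (Ur n) j N)" "der D' y = x"
      using koszul.acyclic[OF kz xL x(3) d0 s] by (elim bexE conjE) (rule that)
    have ys: "supp y (vds (A \<inter> Vr n \<union> Ur n) j)"
    proof (rule supp_mono[OF y(3)])
      fix w assume *: "set w \<subseteq> A \<inter> Vr n \<union> Ur n \<and> cnt (A \<inter> Vr n) w = j \<and> wsum wt w < N"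
      thus "set w \<subseteq> A \<inter> Vr n \<union> Ur n \<and> vl w = j" using vlE[of w A] by metis
    qed
    have yr: "rs (A \<union> Ur n) y = y" by (rule rst_id[OF supp_mono[OF ys]]) blast
    have "rs (A \<union> Ur n) (der D y) = x" using tr[OF y(1) supp_mono[OF ys]] y(4) unfolding yr by blast
    thus ?thesis using y(1,2) ys by blast
  qed
  have rsV: "rs (V \<union> Ur n) x = x" if "supp x (over (V \<union> Ur n))" for x by (rule rst_id[OF that])
  have zr: "rs (V \<union> Ur n) z = z" by (rule rsV[OF supp_mono[OF zV]]) blast
  have zs: "supp z (vds (Vr n \<union> Ur n) (Suc i))" unfolding supp_def
  proof (intro allI impI)
    fix w assume "z w \<noteq> 0"
    from zn[OF this] show "set w \<subseteq> Vr n \<union> Ur n \<and> vl w = Suc i" using vl_V[of w] by auto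
  qed
  have "\<exists>y. y \<in> Lam \<and> hom (m - 1) y \<and> supp y (vds (V \<inter> Vr n \<union> Ur n) i) \<and>
      rs (V \<union> Ur n) (der D y) = z"
    by (rule solve[OF subset_refl _ z(1) zr[symmetric] z(2) zs]) (simp_all add: zD)
  then obtain \<beta> where \<beta>: "\<beta> \<in> Lam" "hom (m - 1) \<beta>" "supp \<beta> (vds (V \<inter> Vr n \<union> Ur n) i)"
    "rs (V \<union> Ur n) (der D \<beta>) = z" by (elim exE conjE) (rule that)
  have D_supp: "supp (der D x) (over (V \<union> Ur n))" if "supp x (over (V \<union> Ur n))" for x
  proof (rule supp_der[OF that])
    fix b u v w assume *: "D b u \<noteq> 0" "set (b # v) \<subseteq> V \<union> Ur n" "w \<in> shuffles u v"
    have "set u \<subseteq> V \<union> Ur n" using suppD[OF good_supp(2)[OF D] *(1)] *(2) by auto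
    thus "set w \<subseteq> V \<union> Ur n" using *(2) set_shuffles[OF *(3)] by auto
  qed
  have \<beta>s: "supp \<beta> (vds (Vr n \<union> Ur n) (Suc (i - 1)))" by (rule supp_mono[OF \<beta>(3)]) (use i in auto)
  have \<beta>V: "supp \<beta> (over (V \<union> Ur n))" by (rule supp_mono[OF \<beta>(3)]) blast
  have d\<beta>: "der D \<beta> = z" using \<beta>(4) rsV[OF D_supp[OF \<beta>V]] by simp
  have gam: "\<exists>y. y \<in> Lam \<and> hom (m - 1 - 1) y \<and> supp y (vds (A \<inter> Vr n \<union> Ur n) (i - 1)) \<and>
      rs (A \<union> Ur n) (der D y) = rs (A \<union> Ur n) \<beta>"
    if A: "A \<subseteq> V" "\<forall>b\<in>V - A. rs A (\<delta> b) = 0" "rs A z = 0" for A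
    by (rule solve[OF A(1,2) \<beta>(1) refl hom_closed(5)[OF \<beta>(2)] \<beta>s])
      (simp_all add: d\<beta> rs_union_Ur[OF zV A(1)] A(3))
  from gam[OF GV dG z(5)]
  obtain \<gamma>1 where g1: "\<gamma>1 \<in> Lam" "hom (m - 1 - 1) \<gamma>1" "supp \<gamma>1 (vds (G \<inter> Vr n \<union> Ur n) (i - 1))"
      "rs (G \<union> Ur n) (der D \<gamma>1) = rs (G \<union> Ur n) \<beta>" by (elim exE conjE) (rule that)
  from gam[OF HV dH z(6)]
  obtain \<gamma>2 where g2: "\<gamma>2 \<in> Lam" "hom (m - 1 - 1) \<gamma>2" "supp \<gamma>2 (vds (H \<inter> Vr n \<union> Ur n) (i - 1))"
      "rs (H \<union> Ur n) (der D \<gamma>2) = rs (H \<union> Ur n) \<beta>" by (elim exE conjE) (rule that)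
  note trG = good_rs_der[OF D GV \<delta>_G] and trH = good_rs_der[OF D HV \<delta>_H]
  \<comment> \<open>A word admissible for both factors consists of new variables only, whereas
    \<open>i - 1 > 0\<close> old letters are present; this is where \<open>i \<ge> 2\<close>
    enters.\<close>
  have zero: "rs (A \<union> Ur n) x = 0" if "supp x (vds (B \<inter> Vr n \<union> Ur n) (i - 1))" "A \<inter> B = {}" "A \<subseteq> V" for x A B
  proof
    fix w show "rs (A \<union> Ur n) x w = 0 w"
    proof (cases "x w = 0 \<or> \<not> set w \<subseteq> A \<union> Ur n")
      case False
      hence "set w \<subseteq> Ur n" "vl w = i - 1" using suppD[OF that(1), of w] that(2,3) up_V by blast+
      moreover from this(1) have "vl w = 0" by (induction w) (auto simp: up_notin)
      ultimately show ?thesis using i by simp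
    qed (auto simp: rst_def fun_ap)
  qed
  let ?g = "\<gamma>1 + \<gamma>2"
  let ?b = "\<beta> - der D ?g"
  have gL: "?g \<in> Lam" using g1 g2 by (simp add: Lam_closed)
  have dgL: "der D ?g \<in> Lam" by (rule der_Lam[OF DL(1) gL])
  have bL: "?b \<in> Lam" by (rule Lam_diff[OF \<beta>(1) dgL])
  have dg: "der D ?g = der D \<gamma>1 + der D \<gamma>2" using g1 g2 by (simp add: der_add Lam_def)
  have rG: "rs (G \<union> Ur n) ?b = 0"
    using g1(4) trG[OF _ g2(1) zero[OF g2(3) GH GV]] by (simp add: dg rst_diff rst_add)
  have rH: "rs (H \<union> Ur n) ?b = 0"
    using g2(4) trH[OF _ g1(1) zero[OF g1(3) _ HV]] GH by (simp add: dg rst_diff rst_add Int_commute)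
  have dd: "der D (der D x) = 0" if "x \<in> Lam" for x by (rule der_square_zero[OF DL(2,1,3) that])
  have db: "der D ?b = z" using der_diff[of \<beta> "der D ?g" D] \<beta>(1) dgL dd[OF gL] d\<beta> by (simp add: Lam_def)
  have D_vl: "supp (der D x) (vds (V \<union> Ur n) (Suc j))" if x: "supp x (vds (V \<union> Ur n) j)" for x j
  proof (rule supp_der[OF x])
    fix b u v w assume *: "D b u \<noteq> 0" "set (b # v) \<subseteq> V \<union> Ur n \<and> vl (b # v) = j" "w \<in> shuffles u v"
    have "set u \<subseteq> V \<union> Ur n" using suppD[OF good_supp(2)[OF D] *(1)] *(2) by auto
    moreover have "vl u = 1 + of_bool (b \<in> V)"
    proof (cases "b \<in> V")
      case True
      thus ?thesis using suppD[OF \<delta>_wt[OF True], of u] *(1) DV[OF True] by simp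
    next
      case False
      then obtain x where "x \<in> Vr n" "b = up x" using *(2) by auto
      thus ?thesis using good_up[OF D, of x u] *(1) False by simp
    qed
    ultimately show "set w \<subseteq> V \<union> Ur n \<and> vl w = Suc j"
      using *(2) set_shuffles[OF *(3)] cnt_shuffles[OF *(3), of V] by auto
  qed
  have gs: "supp ?g (vds (V \<union> Ur n) (i - 1))"
    by (intro supp_closed supp_mono[OF g1(3)] supp_mono[OF g2(3)]) auto
  have "supp ?b (vds (V \<union> Ur n) i)"
    by (intro supp_closed supp_mono[OF \<beta>(3)] supp_mono[OF D_vl[OF gs]]) (use i in auto)
  moreover obtain N where "supp ?b (\<lambda>w. wsum (\<lambda>b. if b \<in> Ur n then wt b else 0) w < N)" using wb[OF bL] by blast
  ultimately have bs: "supp ?b (\<lambda>w. set w \<subseteq> V \<union> Ur n \<and> vl w = i \<and> uw n w < N)"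
    unfolding supp_def uw_def by blast
  have bh: "hom (m - 1) ?b"
    using hom_der[OF DL(2), of "m - 1 - 1" ?g] g1(2) g2(2) \<beta>(2) by (intro hom_closed) (simp_all add: hom_closed)
  \<comment> \<open>\<open>D\<close> of this cochain is \<open>z\<close>, in which no new variable
    occurs.\<close>
  have dz: "\<forall>w. uw n w > 0 \<longrightarrow> der D ?b w = 0"
    using suppD[OF zV] uw_V[of _ n] unfolding db by fastforce
  have i0: "i > 0" using i by simp
  obtain y where y: "y \<in> Lam" "hom (m - 1 - 1) y" "supp y (vds (V \<union> Ur n) (i - 1))"
    "rs (G \<union> Ur n) y = 0" "rs (H \<union> Ur n) y = 0" "\<forall>w. uw n w > 0 \<longrightarrow> der D y w = ?b w"
    using exact_twisted[OF P D bL bh bs dz rG rH i0] by (elim exE conjE) (rule that)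
  let ?y = "?b - der D y"
  have dyL: "der D y \<in> Lam" by (rule der_Lam[OF DL(1) y(1)])
  have "supp ?y (vds (V \<union> Ur n) i)"
    by (intro supp_closed supp_mono[OF bs] supp_mono[OF D_vl[OF y(3)]]) (use i in auto)
  \<comment> \<open>The correction cancels every word with a new variable, so a cochain in the old
    letters alone remains.\<close>
  moreover have "uw n w = 0" if "?y w \<noteq> 0" for w using y(6) that by (auto simp: fun_ap)
  ultimately have ys: "supp ?y (wds V i)" unfolding supp_def by (metis uw_0 vl_V)
  hence yV: "supp ?y (over V)" by (rule supp_mono) blast
  have dy: "der D ?y = z"
    using der_diff[of ?b "der D y" D] bL dyL dd[OF y(1)] db by (simp add: Lam_def)
  have "rs (G \<union> Ur n) ?y = 0" "rs (H \<union> Ur n) ?y = 0"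
    using rG rH trG[OF _ y(1,4)] trH[OF _ y(1,5)] by (simp_all add: rst_diff)
  hence "rs G ?y = 0" "rs H ?y = 0" using rs_union_Ur[OF yV GV] rs_union_Ur[OF yV HV] by simp_all
  moreover have "hom (m - 1) ?y" using hom_der[OF DL(2) y(2)] by (intro hom_closed(4)[OF bh]) simp
  moreover have "der \<delta> ?y = z" using DVx[OF yV] dy by simp
  ultimately show "\<exists>y. y \<in> Lam \<and> hom (m - 1) y \<and> supp y (wds V (Suc i - 1)) \<and>
      rs G y = 0 \<and> rs H y = 0 \<and> der \<delta> y = z"
    using ys Lam_diff[OF bL dyL] by (intro exI[of _ ?y]) simp
qed

theorem exact:
  assumes "i \<ge> 1" shows "exact_in i" using assms
proof (induction i rule: less_induct)
  case (less i)
  show ?case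
  proof (cases "i = 1 \<or> i = 2")
    case True
    thus ?thesis unfolding exact_in_def using low by blast
  next
    case False
    then obtain j where "i = Suc j" "j \<ge> 2" using less.prems by (cases i) fastforce+
    thus ?thesis using exact_step[of j] less.IH[of j] by simp
  qed
qed

end

section \<open>The symmetric algebra as an algebra of functions\<close>

lemma lookup_fsmul [simp]: "lookup (fsmul c a) u = c * lookup a u"
  by (simp add: fsmul_def Poly_Mapping.map.rep_eq when_def)

lemma vector_space_fsmul: "vector_space (fsmul :: 'k::field \<Rightarrow> ('w, 'k) free_alg \<Rightarrow> _)"
  by unfold_locales (rule poly_mapping_eqI; simp add: lookup_add algebra_simps)+

interpretation FA: vector_space "fsmul :: 'k::field \<Rightarrow> ('w, 'k) free_alg \<Rightarrow> _"
  by (rule vector_space_fsmul)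

lemma single_fsmul: "Poly_Mapping.single u c = fsmul c (word u)"
  by (rule poly_mapping_eqI) (simp add: lookup_single when_def)

definition lext :: "('k::field \<Rightarrow> 'v::ab_group_add \<Rightarrow> 'v) \<Rightarrow> ((int \<times> 'w) list \<Rightarrow> 'v) \<Rightarrow> ('w, 'k) free_alg \<Rightarrow> 'v" where
  "lext s h a = (\<Sum>u\<in>keys a. s (lookup a u) (h u))"

lemma lext_superset: assumes "vector_space s" "finite S" "keys a \<subseteq> S"
  shows "lext s h a = (\<Sum>u\<in>S. s (lookup a u) (h u))"
proof -
  interpret V: vector_space s by fact
  show ?thesis unfolding lext_def
    by (rule sum.mono_neutral_left) (use assms in \<open>auto simp: in_keys_iff\<close>)
qed

lemma lext_linear: assumes "vector_space s"
  shows "lext s h (a + b) = lext s h a + lext s h b" "lext s h (fsmul c a) = s c (lext s h a)"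
    "lext s h (word u) = h u" "lext s h 0 = 0" "lext s h (a - b) = lext s h a - lext s h b"
proof -
  interpret V: vector_space s by fact
  show add: "lext s h (a + b) = lext s h a + lext s h b" for a b
  proof -
    let ?S = "keys a \<union> keys b"
    have "keys (a + b) \<subseteq> ?S" by (rule keys_add)
    thus ?thesis
      using lext_superset[OF assms, of ?S a h] lext_superset[OF assms, of ?S b h] lext_superset[OF assms, of ?S "a + b" h]
      by (simp add: lookup_add V.scale_left_distrib sum.distrib)
  qed
  show sc: "lext s h (fsmul c a) = s c (lext s h a)" for c a
  proof -
    have "keys (fsmul c a) \<subseteq> keys a" by (auto simp: in_keys_iff)
    thus ?thesis using lext_superset[OF assms, of "keys a" "fsmul c a" h]
      by (simp add: lext_def V.scale_sum_right)
  qed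
  show "lext s h (word u) = h u" by (simp add: lext_def)
  show "lext s h 0 = 0" by (simp add: lext_def)
  show "lext s h (a - b) = lext s h a - lext s h b" using add[of "a - b" b] by simp
qed

lemma free_decomp: "(\<Sum>u\<in>keys a. fsmul (lookup a u) (word u)) = a"
proof (rule poly_mapping_eqI)
  fix v
  have "lookup (\<Sum>u\<in>S. fsmul (lookup a u) (word u)) v =
      (\<Sum>u\<in>S. lookup (fsmul (lookup a u) (word u)) v)" for S
    by (induction S rule: infinite_finite_induct) (auto simp: lookup_add)
  thus "lookup (\<Sum>u\<in>keys a. fsmul (lookup a u) (word u)) v = lookup a v"
    by (simp add: lookup_single when_def in_keys_iff if_distrib[of "(*) _"] sum.delta cong: if_cong)
qed

text \<open>Turns membership in a span of words into a condition on keys, so that conditions on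
  degree, length and letters combine by plain logic.\<close>

lemma span_words: "FA.span {word u | u. P u} = {a :: ('w, 'k::field) free_alg. \<forall>u\<in>keys a. P u}"
proof
  show "FA.span {word u | u. P u} \<subseteq> {a :: ('w, 'k) free_alg. \<forall>u\<in>keys a. P u}"
  proof (rule FA.span_minimal)
    show "{word u | u. P u} \<subseteq> {a :: ('w, 'k) free_alg. \<forall>u\<in>keys a. P u}" by auto
    show "FA.subspace {a :: ('w, 'k) free_alg. \<forall>u\<in>keys a. P u}"
    proof (rule FA.subspaceI)
      show "x + y \<in> {a. \<forall>u\<in>keys a. P u}"
        if "x \<in> {a. \<forall>u\<in>keys a. P u}" "y \<in> {a. \<forall>u\<in>keys a. P u}"
        for x y :: "('w, 'k) free_alg" using that keys_add[of x y] by blast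
    qed (auto simp: in_keys_iff)
  qed
  show "{a :: ('w, 'k) free_alg. \<forall>u\<in>keys a. P u} \<subseteq> FA.span {word u | u. P u}"
  proof
    fix a :: "('w, 'k) free_alg" assume a: "a \<in> {a. \<forall>u\<in>keys a. P u}"
    have "(\<Sum>u\<in>keys a. fsmul (lookup a u) (word u)) \<in> FA.span {word u | u. P u}"
      using a by (intro FA.span_sum FA.span_scale FA.span_base) auto
    thus "a \<in> FA.span {word u | u. P u}" by (simp add: free_decomp)
  qed
qed

lemma word_in: "P u \<Longrightarrow> word u \<in> FA.span {word u | u. P u}" by (intro FA.span_base) blast

lemma fmul_lext: "fmul a b = lext fsmul (\<lambda>u. lext fsmul (\<lambda>v. word (u @ v)) b) a"
proof -
  have "Poly_Mapping.single (u @ v) (lookup a u * lookup b v) =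
      fsmul (lookup a u) (fsmul (lookup b v) (word (u @ v)))" for u v by (subst single_fsmul) simp
  thus ?thesis by (simp add: fmul_def lext_def FA.scale_sum_right)
qed

lemma fmul_simps:
  "fmul (a + b) c = fmul a c + fmul b c" "fmul c (a + b) = fmul c a + fmul c b"
  "fmul (a - b) c = fmul a c - fmul b c" "fmul c (a - b) = fmul c a - fmul c b"
  "fmul (fsmul r a) b = fsmul r (fmul a b)" "fmul a (fsmul r b) = fsmul r (fmul a b)"
  "fmul (word u) (word v) = word (u @ v)" "fmul 0 a = 0" "fmul a 0 = 0"
proof -
  note L = lext_linear[OF vector_space_fsmul]
  have add: "lext fsmul (\<lambda>u. h u + h' u) a = lext fsmul h a + lext fsmul h' a"
    "lext fsmul (\<lambda>u. h u - h' u) a = lext fsmul h a - lext fsmul h' a"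
    "lext fsmul (\<lambda>u. fsmul r (h u)) a = fsmul r (lext fsmul h a)" for h h' :: "(int \<times> 'a) list \<Rightarrow> ('a, 'b) free_alg" and a
    by (simp_all add: lext_def sum.distrib sum_subtractf FA.scale_right_distrib FA.scale_right_diff_distrib
        FA.scale_sum_right mult.commute)
  show "fmul (a + b) c = fmul a c + fmul b c" "fmul c (a + b) = fmul c a + fmul c b"
    "fmul (a - b) c = fmul a c - fmul b c" "fmul c (a - b) = fmul c a - fmul c b"
    "fmul (fsmul r a) b = fsmul r (fmul a b)" "fmul a (fsmul r b) = fsmul r (fmul a b)"
    "fmul (word u) (word v) = word (u @ v)" "fmul 0 a = 0" for a b c :: "('a, 'b) free_alg"
    by (simp_all add: fmul_lext L add)
  from this(4)[where c = a and a = 0 and b = 0] show "fmul a 0 = 0" by simp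
qed

lemma fmul_sum: "fmul c (\<Sum>i\<in>I. f i) = (\<Sum>i\<in>I. fmul c (f i))" "fmul (\<Sum>i\<in>I. f i) c = (\<Sum>i\<in>I. fmul (f i) c)"
  using additive_sum[of "fmul c"] additive_sum[of "\<lambda>a. fmul a c"] by (simp_all add: fmul_simps)

lemma free_induct [case_names add scale word]:
  assumes "\<And>a b. P a \<Longrightarrow> P b \<Longrightarrow> P (a + b)" "\<And>c a. P a \<Longrightarrow> P (fsmul c a)" "\<And>u. P (word u)"
  shows "P (a :: ('w, 'k::field) free_alg)"
proof -
  have P0: "P 0" using assms(2)[OF assms(3), of 0 "[]"] by simp
  have "P (\<Sum>u\<in>S. fsmul (lookup a u) (word u))" if "finite S" for S
    using that by (induction S) (auto intro: P0 assms)
  from this[OF finite_keys[of a]] show ?thesis by (simp add: free_decomp)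
qed

lemma free_induct_on [consumes 1, case_names zero add scale word]:
  assumes "\<forall>u\<in>keys (a :: ('w, 'k::field) free_alg). Q u"
    "P 0" "\<And>a b. P a \<Longrightarrow> P b \<Longrightarrow> P (a + b)" "\<And>c a. P a \<Longrightarrow> P (fsmul c a)" "\<And>u. Q u \<Longrightarrow> P (word u)"
  shows "P a"
proof -
  have "P (\<Sum>u\<in>S. fsmul (lookup a u) (word u))" if "finite S" "S \<subseteq> keys a" for S
    using that by (induction S) (use assms in auto)
  from this[OF finite_keys subset_refl] show ?thesis by (simp add: free_decomp)
qed

lemma free_span_induct [consumes 1, case_names zero add scale word]:
  assumes "a \<in> FA.span {word u | u. Q u}" "P 0" "\<And>a b. P a \<Longrightarrow> P b \<Longrightarrow> P (a + b)"
    "\<And>c a. P a \<Longrightarrow> P (fsmul c a)" "\<And>u. Q u \<Longrightarrow> P (word u)"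
  shows "P (a :: ('w, 'k::field) free_alg)"
  by (rule free_induct_on[of a Q]) (use assms in \<open>simp_all add: span_words\<close>)

lemma fmul_one: "fmul (word []) a = a" "fmul a (word []) = a"
  by (induction a rule: free_induct) (simp_all add: fmul_simps)

abbreviation wordsp :: "(int \<Rightarrow> 'w set) \<Rightarrow> ('w, 'k::field) free_alg set" where
  "wordsp W \<equiv> FA.span {word u | u. u \<in> words W}"

abbreviation wordspn :: "(int \<Rightarrow> 'w set) \<Rightarrow> int \<Rightarrow> ('w, 'k::field) free_alg set" where
  "wordspn W n \<equiv> FA.span {word u | u. u \<in> words W \<and> word_degree u = n}"

abbreviation wordsl :: "(int \<Rightarrow> 'w set) \<Rightarrow> nat \<Rightarrow> ('w, 'k::field) free_alg set" where
  "wordsl W k \<equiv> FA.span {word u | u. u \<in> words W \<and> length u = k}"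

abbreviation symrel :: "('k::field \<Rightarrow> 'w::ab_group_add \<Rightarrow> 'w) \<Rightarrow> (int \<Rightarrow> 'w set) \<Rightarrow> ('w, 'k) free_alg set" where
  "symrel s W \<equiv> FA.span (sym_relators s W)"

lemma words_simps [simp]: "[] \<in> words W" "(l # u) \<in> words W \<longleftrightarrow> snd l \<in> W (fst l) \<and> u \<in> words W"
  "u @ v \<in> words W \<longleftrightarrow> u \<in> words W \<and> v \<in> words W" by (auto simp: words_def case_prod_beta)

lemma word_degree_simps [simp]: "word_degree [] = 0" "word_degree (l # u) = fst l + word_degree u"
  "word_degree (u @ v) = word_degree u + word_degree v" by (auto simp: word_degree_def)

lemma wordspn_sub: "a \<in> wordspn W n \<Longrightarrow> a \<in> wordsp W" by (simp add: span_words)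

lemma fmul_in:
  assumes "a \<in> FA.span {word u | u. P u}" "b \<in> FA.span {word u | u. Q u}" "\<And>u v. P u \<Longrightarrow> Q v \<Longrightarrow> R (u @ v)"
  shows "fmul a b \<in> FA.span {word u | u. R u}" using assms(1)
proof (induction rule: free_span_induct)
  case (word u)
  from assms(2) show ?case by (induction rule: free_span_induct)
      (simp_all add: fmul_simps FA.span_zero FA.span_add FA.span_scale word_in assms(3) word)
qed (simp_all add: fmul_simps FA.span_zero FA.span_add FA.span_scale)

lemma fmul_wordsp: "a \<in> wordsp W \<Longrightarrow> b \<in> wordsp W \<Longrightarrow> fmul a b \<in> wordsp W"
  by (rule fmul_in[where P = "\<lambda>u. u \<in> words W" and Q = "\<lambda>u. u \<in> words W"]) auto

lemma fmul_wordspn: "a \<in> wordspn W m \<Longrightarrow> b \<in> wordspn W n \<Longrightarrow> fmul a b \<in> wordspn W (m + n)"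
  by (rule fmul_in[where P = "\<lambda>u. u \<in> words W \<and> word_degree u = m" and Q = "\<lambda>u. u \<in> words W \<and> word_degree u = n"]) auto

subsection \<open>Evaluation\<close>

text \<open>\<open>ev n x b\<close> is the value of the letter \<open>(n, x)\<close> at the point
  \<open>b\<close>. The locale is used in two ways: with basis vectors as points and the coordinates
  of \<open>x\<close>, and with elements of a dgla as points and the values of the functional
  \<open>x\<close>.\<close>

locale sym_eval = shuffle_algebra deg fld for deg :: "'b \<Rightarrow> int" and fld :: "'k::field_char_0 itself" +
  fixes s :: "'k \<Rightarrow> 'w::ab_group_add \<Rightarrow> 'w" and W :: "int \<Rightarrow> 'w set" and ev :: "int \<Rightarrow> 'w \<Rightarrow> 'b \<Rightarrow> 'k"
  assumes ev_deg: "x \<in> W n \<Longrightarrow> ev n x b \<noteq> 0 \<Longrightarrow> deg b = n"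
    and ev_add: "x \<in> W n \<Longrightarrow> y \<in> W n \<Longrightarrow> ev n (x + y) b = ev n x b + ev n y b"
    and ev_scale: "x \<in> W n \<Longrightarrow> ev n (s c x) b = c * ev n x b"
begin

definition gen :: "int \<Rightarrow> 'w \<Rightarrow> 'b list \<Rightarrow> 'k" where
  "gen n x = (\<lambda>w. case w of [b] \<Rightarrow> ev n x b | _ \<Rightarrow> 0)"

lemma gen_apply: "gen n x [] = 0" "gen n x [b] = ev n x b" "gen n x (a # b # w) = 0"
  by (simp_all add: gen_def)

lemma gen_hom: "x \<in> W n \<Longrightarrow> hom n (gen n x)"
  unfolding hom_def gen_def by (auto split: list.splits dest: ev_deg)

lemma gen_supp: "supp (gen n x) (len 1)" by (auto simp: supp_def gen_def split: list.splits)

lemma gen_add: "x \<in> W n \<Longrightarrow> y \<in> W n \<Longrightarrow> gen n (x + y) = gen n x + gen n y"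
  by (auto simp: gen_def fun_eq_iff fun_ap ev_add split: list.splits)

lemma gen_scale: "x \<in> W n \<Longrightarrow> gen n (s c x) = sc c (gen n x)"
  by (auto simp: gen_def fun_eq_iff fun_ap ev_scale split: list.splits)

primrec phw :: "(int \<times> 'w) list \<Rightarrow> 'b list \<Rightarrow> 'k" where
  "phw [] = onef"
| "phw (l # u) = gen (fst l) (snd l) \<star> phw u"

lemma phw_append: "phw (u @ v) = phw u \<star> phw v" by (induction u) (simp_all add: sp_assoc)

text \<open>The algebra homomorphism from the free algebra to functions; by
  \<open>Phi_symrel\<close> it descends to the symmetric algebra.\<close>

definition Phi :: "('w, 'k) free_alg \<Rightarrow> 'b list \<Rightarrow> 'k" where
  "Phi = lext sc phw"

lemma Phi_simps: "Phi (a + b) = Phi a + Phi b" "Phi (fsmul c a) = sc c (Phi a)" "Phi (word u) = phw u"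
  "Phi 0 = 0" "Phi (a - b) = Phi a - Phi b"
  by (simp_all add: Phi_def lext_linear[OF vector_space_sc])

lemma Phi_sum: "Phi (\<Sum>i\<in>I. f i) = (\<Sum>i\<in>I. Phi (f i))"
  by (rule additive_sum[of Phi]) (simp_all add: Phi_simps)

lemma Phi_fmul: "Phi (fmul a b) = Phi a \<star> Phi b"
proof (induction a rule: free_induct)
  case (word u)
  show ?case
    by (induction b rule: free_induct) (simp_all add: fmul_simps Phi_simps phw_append sp_add_right sp_sc_right)
qed (simp_all add: fmul_simps Phi_simps sp_add_left sp_sc_left)

lemma phw_hom: "u \<in> words W \<Longrightarrow> hom (word_degree u) (phw u)"
proof (induction u)
  case Nil show ?case by (simp add: hom_def onef_def)
next
  case (Cons l u)
  thus ?case using hom_sp[OF gen_hom[of "snd l" "fst l"] Cons.IH] by simp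
qed

lemma Phi_hom: assumes "a \<in> wordspn W n" shows "hom n (Phi a)"
  using assms by (induction rule: free_span_induct) (auto simp: Phi_simps hom_closed phw_hom)

lemma phw_supp: "supp (phw u) (len (length u))"
proof (induction u)
  case (Cons l u)
  show ?case unfolding phw.simps by (rule supp_sp[OF gen_supp Cons]) (auto simp: length_shuffles)
qed (auto simp: supp_def onef_def)

lemma Phi_symrel: assumes "a \<in> symrel s W" shows "Phi a = 0" using assms
proof (induction rule: FA.span_induct)
  case base
  show ?case by (rule FA.subspaceI) (simp_all add: Phi_simps)
next
  case (step r)
  have comm: "gen m x \<star> gen n y = sc (eps (m * n)) (gen n y \<star> gen m x)" if "x \<in> W m" "y \<in> W n" for m n x y
    using sp_commute[OF gen_hom[OF that(1)], of "gen n y"] hom_twist[OF gen_hom[OF that(2)], of m] by (simp add: sp_sc_left)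
  from step consider
    (a) u v n x y where "r = word (u @ [(n, x + y)] @ v) - word (u @ [(n, x)] @ v) - word (u @ [(n, y)] @ v)" "x \<in> W n" "y \<in> W n"
  | (b) u v n c x where "r = word (u @ [(n, s c x)] @ v) - fsmul c (word (u @ [(n, x)] @ v))" "x \<in> W n"
  | (c) u v m n x y where "r = word (u @ [(m, x), (n, y)] @ v) - fsmul ((-1) powi (m * n)) (word (u @ [(n, y), (m, x)] @ v))"
      "x \<in> W m" "y \<in> W n" unfolding sym_relators_def by blast
  thus ?case
  proof cases
    case a thus ?thesis
      by (simp add: Phi_simps phw_append gen_add sp_add_left sp_add_right)
  next
    case b thus ?thesis
      by (simp add: Phi_simps phw_append gen_scale sp_sc_left sp_sc_right)
  next
    case c
    have "gen m x \<star> (gen n y \<star> f) = sc (eps (m * n)) (gen n y \<star> (gen m x \<star> f))" for f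
      using comm[OF c(2,3)] by (metis sp_assoc sp_sc_left)
    thus ?thesis using c by (simp add: Phi_simps phw_append powi_eps sp_sc_right)
  qed
qed

end

lemma symrel_mult: assumes "a \<in> symrel s W" "u \<in> words W" "v \<in> words W"
  shows "fmul (word u) (fmul a (word v)) \<in> symrel s W" using assms(1)
proof (induction rule: FA.span_induct)
  case base
  show ?case by (rule FA.subspaceI) (simp_all add: fmul_simps FA.span_zero FA.span_scale FA.span_add)
next
  case (step r)
  from step consider
    (a) u' v' n x y where "r = word (u' @ [(n, x + y)] @ v') - word (u' @ [(n, x)] @ v') - word (u' @ [(n, y)] @ v')"
      "u' \<in> words W" "v' \<in> words W" "x \<in> W n" "y \<in> W n"
  | (b) u' v' n c x where "r = word (u' @ [(n, s c x)] @ v') - fsmul c (word (u' @ [(n, x)] @ v'))" "u' \<in> words W" "v' \<in> words W" "x \<in> W n"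
  | (c) u' v' m n x y where "r = word (u' @ [(m, x), (n, y)] @ v') - fsmul ((-1) powi (m * n)) (word (u' @ [(n, y), (m, x)] @ v'))"
      "u' \<in> words W" "v' \<in> words W" "x \<in> W m" "y \<in> W n" unfolding sym_relators_def by blast
  hence "fmul (word u) (fmul r (word v)) \<in> sym_relators s W"
  proof cases
    case a
    have "fmul (word u) (fmul r (word v)) = word ((u @ u') @ [(n, x + y)] @ (v' @ v)) -
      word ((u @ u') @ [(n, x)] @ (v' @ v)) - word ((u @ u') @ [(n, y)] @ (v' @ v))"
      unfolding a(1) by (simp add: fmul_simps)
    moreover have "u @ u' \<in> words W" "v' @ v \<in> words W" using a assms by simp_all
    ultimately show ?thesis using a(4,5) unfolding sym_relators_def by blast
  next
    case b
    have "fmul (word u) (fmul r (word v)) = word ((u @ u') @ [(n, s c x)] @ (v' @ v)) - fsmul c (word ((u @ u') @ [(n, x)] @ (v' @ v)))"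
      unfolding b(1) by (simp add: fmul_simps)
    moreover have "u @ u' \<in> words W" "v' @ v \<in> words W" using b assms by simp_all
    ultimately show ?thesis using b(4) unfolding sym_relators_def by blast
  next
    case c
    have "fmul (word u) (fmul r (word v)) = word ((u @ u') @ [(m, x), (n, y)] @ (v' @ v)) -
      fsmul ((-1) powi (m * n)) (word ((u @ u') @ [(n, y), (m, x)] @ (v' @ v)))"
      unfolding c(1) by (simp add: fmul_simps)
    moreover have "u @ u' \<in> words W" "v' @ v \<in> words W" using c assms by simp_all
    ultimately show ?thesis using c(4,5) unfolding sym_relators_def by blast
  qed
  thus ?case by (rule FA.span_base)
qed

lemma symrel_lmult: assumes "a \<in> symrel s W" "b \<in> wordsp W" shows "fmul b a \<in> symrel s W"
  using assms(2)
proof (induction rule: FA.span_induct)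
  case base
  show ?case by (rule FA.subspaceI) (simp_all add: fmul_simps FA.span_zero FA.span_scale FA.span_add)
next
  case (step r)
  then obtain u where "r = word u" "u \<in> words W" by blast
  thus ?case using symrel_mult[OF assms(1), of u "[]"] by (simp add: fmul_one)
qed

lemma symrel_linear:
  fixes s :: "'k::field_char_0 \<Rightarrow> 'w::ab_group_add \<Rightarrow> 'w"
  assumes s: "vector_space s" and W: "module.subspace s (W n)" and u: "u \<in> words W"
    and S: "finite S" "S \<subseteq> W n"
  shows "word ((n, \<Sum>b\<in>S. s (c b) b) # u) - (\<Sum>b\<in>S. fsmul (c b) (word ((n, b) # u))) \<in> symrel s W"
proof -
  interpret V: vector_space s by fact
  show ?thesis using S
  proof (induction S)
    case empty
    have "word ([] @ [(n, s 0 0)] @ u) - fsmul 0 (word ([] @ [(n, 0)] @ u)) \<in> symrel s W"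
      using u V.subspace_0[OF W] words_simps(1) by (intro FA.span_base) (unfold sym_relators_def, blast)
    thus ?case by simp
  next
    case (insert x F)
    have xW: "x \<in> W n" and sF: "(\<Sum>b\<in>F. s (c b) b) \<in> W n" and sx: "s (c x) x \<in> W n"
      using insert W by (auto intro!: V.subspace_sum V.subspace_scale)
    have "word ([] @ [(n, s (c x) x + (\<Sum>b\<in>F. s (c b) b))] @ u) - word ([] @ [(n, s (c x) x)] @ u)
        - word ([] @ [(n, \<Sum>b\<in>F. s (c b) b)] @ u) \<in> symrel s W"
      using u sF sx words_simps(1) by (intro FA.span_base) (unfold sym_relators_def, blast)
    moreover have "word ([] @ [(n, s (c x) x)] @ u) - fsmul (c x) (word ([] @ [(n, x)] @ u)) \<in> symrel s W"
      using u xW words_simps(1) by (intro FA.span_base) (unfold sym_relators_def, blast)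
    ultimately have "(word ((n, s (c x) x + (\<Sum>b\<in>F. s (c b) b)) # u) - word ((n, s (c x) x) # u)
        - word ((n, \<Sum>b\<in>F. s (c b) b) # u)) + (word ((n, s (c x) x) # u) - fsmul (c x) (word ((n, x) # u))) +
        (word ((n, \<Sum>b\<in>F. s (c b) b) # u) - (\<Sum>b\<in>F. fsmul (c b) (word ((n, b) # u)))) \<in> symrel s W"
      using insert by (intro FA.span_add) simp_all
    thus ?case using insert.hyps by (simp add: algebra_simps)
  qed
qed

subsection \<open>Coordinates\<close>

text \<open>
  The letter \<open>(False, n, b)\<close> stands for the basis vector \<open>b\<close> in degree \<open>n\<close>; the letters
  \<open>(True, n, b)\<close> are reserved for the additional variables of the Koszul complex.
\<close>

abbreviation ldeg :: "bool \<times> int \<times> 'w \<Rightarrow> int" where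
  "ldeg l \<equiv> (if fst l then fst (snd l) - 1 else fst (snd l))"

definition coord :: "('k::field \<Rightarrow> 'w::ab_group_add \<Rightarrow> 'w) \<Rightarrow> (int \<Rightarrow> 'w set) \<Rightarrow> int \<Rightarrow> 'w \<Rightarrow> bool \<times> int \<times> 'w \<Rightarrow> 'k" where
  "coord s B n x l = (if \<not> fst l \<and> fst (snd l) = n then module.representation s (B n) x (snd (snd l)) else 0)"

locale graded_basis =
  fixes s :: "'k::field_char_0 \<Rightarrow> 'w::ab_group_add \<Rightarrow> 'w" and W B :: "int \<Rightarrow> 'w set"
  assumes vs: "vector_space s" and W_sub: "module.subspace s (W n)"
    and B_W: "B n \<subseteq> W n" and B_ind: "\<not> module.dependent s (B n)" and W_B: "W n \<subseteq> module.span s (B n)"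

sublocale graded_basis \<subseteq> VS: vector_space s
  by (rule vs)

sublocale graded_basis \<subseteq> sym_eval ldeg "TYPE('k)" s W "coord s B"
proof
  fix x y n b c
  assume x: "x \<in> W n"
  hence xs: "x \<in> VS.span (B n)" using W_B by blast
  show "ldeg b = n" if "coord s B n x b \<noteq> 0" using that by (auto simp: coord_def split: if_splits)
  show "coord s B n (x + y) b = coord s B n x b + coord s B n y b" if "y \<in> W n"
  proof -
    have "y \<in> VS.span (B n)" using that W_B by blast
    from VS.representation_add[OF B_ind this xs] show ?thesis by (simp add: coord_def)
  qed
  show "coord s B n (s c x) b = c * coord s B n x b"
    using VS.representation_scale[OF B_ind xs, of c] by (simp add: coord_def)
qed

context graded_basis
begin

notation sp (infixl "\<star>" 70)

abbreviation VL :: "(bool \<times> int \<times> 'w) set" where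
  "VL \<equiv> {l. \<not> fst l \<and> snd (snd l) \<in> B (fst (snd l))}"

lemma gen_basis: "b \<in> B n \<Longrightarrow> gen n b = lett (False, n, b)"
proof
  fix w assume b: "b \<in> B n"
  have "coord s B n b l = (if l = (False, n, b) then 1 else 0)" for l
    using VS.representation_basis[OF B_ind b] by (cases l) (auto simp: coord_def)
  thus "gen n b w = lett (False, n, b) w" by (auto simp: gen_def lett_def split: list.splits)
qed

definition bsupp :: "int \<Rightarrow> 'w \<Rightarrow> 'w set" where
  "bsupp n x = {b. VS.representation (B n) x b \<noteq> 0}"

lemma bsupp: "finite (bsupp n x)" "bsupp n x \<subseteq> B n"
  using VS.finite_representation VS.representation_ne_zero by (auto simp: bsupp_def)

lemma bsupp_sum: "x \<in> W n \<Longrightarrow> (\<Sum>b\<in>bsupp n x. s (VS.representation (B n) x b) b) = x"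
  unfolding bsupp_def using VS.sum_nonzero_representation_eq[OF B_ind] W_B by blast

lemma gen_sum:  assumes "finite S" "S \<subseteq> W n"
  shows "gen n (\<Sum>b\<in>S. s (c b) b) = (\<Sum>b\<in>S. sc (c b) (gen n b)) \<and> (\<Sum>b\<in>S. s (c b) b) \<in> W n" using assms
proof (induction S)
  case empty
  have 0: "0 \<in> W n" using VS.subspace_0[OF W_sub] .
  hence "gen n 0 = 0" using gen_add[OF 0 0] by simp
  thus ?case using 0 by simp
next
  case (insert b S)
  thus ?case using gen_add gen_scale W_sub
    by (simp add: VS.subspace_scale[OF W_sub] VS.subspace_add[OF W_sub])
qed

lemma gen_expand: "x \<in> W n \<Longrightarrow> gen n x = (\<Sum>b\<in>bsupp n x. sc (VS.representation (B n) x b) (lett (False, n, b)))"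
proof -
  assume x: "x \<in> W n"
  have "gen n x = gen n (\<Sum>b\<in>bsupp n x. s (VS.representation (B n) x b) b)" using bsupp_sum[OF x] by simp
  also have "\<dots> = (\<Sum>b\<in>bsupp n x. sc (VS.representation (B n) x b) (gen n b))"
    using gen_sum[of "bsupp n x" n] bsupp[of n x] B_W[of n] by blast
  also have "\<dots> = (\<Sum>b\<in>bsupp n x. sc (VS.representation (B n) x b) (lett (False, n, b)))"
    by (rule sum.cong) (use bsupp(2)[of n x] in \<open>auto simp: gen_basis\<close>)
  finally show ?thesis .
qed

lemma gen_Lam: "x \<in> W n \<Longrightarrow> gen n x \<in> Lam" by (simp add: gen_expand Lam_sum Lam_closed)

lemma gen_VL: "supp (gen n x) (over VL)"
  using VS.representation_ne_zero by (fastforce simp: supp_def gen_def coord_def split: list.splits if_splits)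

lemma phw_Lam: "u \<in> words W \<Longrightarrow> phw u \<in> Lam" by (induction u) (auto simp: Lam_closed gen_Lam)

lemma phw_VL: "supp (phw u) (over VL)"
proof (induction u)
  case (Cons l u)
  show ?case unfolding phw.simps by (rule supp_sp[OF gen_VL Cons]) (auto dest!: set_shuffles)
qed (auto simp: supp_def onef_def)

lemma Phi_Lam: assumes "a \<in> wordsp W" shows "Phi a \<in> Lam" "supp (Phi a) (over VL)"
proof -
  have k: "\<forall>u\<in>keys a. u \<in> words W" using assms by (simp add: span_words)
  thus "Phi a \<in> Lam" by (induction rule: free_induct_on) (auto simp: Phi_simps Lam_closed phw_Lam)
  from k show "supp (Phi a) (over VL)"
    by (induction rule: free_induct_on) (auto simp: Phi_simps supp_closed phw_VL)
qed

text \<open>An inverse of \<open>Phi\<close> modulo the relators, on the functions of word length \<open>n\<close>.\<close>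

primrec psi :: "nat \<Rightarrow> ((bool \<times> int \<times> 'w) list \<Rightarrow> 'k) \<Rightarrow> ('w, 'k) free_alg" where
  "psi 0 f = fsmul (f []) (word [])"
| "psi (Suc n) f = fsmul (inverse (of_nat (Suc n))) (\<Sum>c\<in>{c. ldel c f \<noteq> 0}. fmul (word [snd c]) (psi n (ldel c f)))"

lemma VL_word: "c \<in> VL \<Longrightarrow> word [snd c] \<in> wordsp W" using B_W by (intro word_in) auto

lemma psi_0 [simp]: "psi n 0 = 0" by (cases n) (simp_all add: fun_ap(2))

lemma psi_eq: "finite A \<Longrightarrow> {c. ldel c f \<noteq> 0} \<subseteq> A \<Longrightarrow>
    psi (Suc n) f = fsmul (inverse (of_nat (Suc n))) (\<Sum>c\<in>A. fmul (word [snd c]) (psi n (ldel c f)))"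
  unfolding psi.simps by (rule arg_cong[of _ _ "fsmul _"], rule sum.mono_neutral_left) (auto simp: fmul_simps)

lemma psi_linear:
  "finsupp f \<Longrightarrow> finsupp g \<Longrightarrow> psi n (f + g) = psi n f + psi n g"
  "finsupp f \<Longrightarrow> psi n (sc c f) = fsmul c (psi n f)"
proof -
  show "psi n (f + g) = psi n f + psi n g" if "finsupp f" "finsupp g" using that
  proof (induction n arbitrary: f g)
    case (Suc n)
    let ?A = "{c. ldel c f \<noteq> 0} \<union> {c. ldel c g \<noteq> 0}"
    have fin: "finite ?A" using Suc.prems finite_ldel by blast
    have "{c. ldel c (f + g) \<noteq> 0} \<subseteq> ?A" by auto
    thus ?case using psi_eq[OF fin, of f n] psi_eq[OF fin, of g n] psi_eq[OF fin, of "f + g" n]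
        Suc.IH[OF finsupp_ldel finsupp_ldel, OF Suc.prems]
      by (simp add: fmul_simps sum.distrib FA.scale_right_distrib del: psi.simps)
  qed (simp add: fun_ap FA.scale_left_distrib)
  show "psi n (sc c f) = fsmul c (psi n f)" if "finsupp f" using that
  proof (induction n arbitrary: f)
    case (Suc n)
    let ?A = "{c. ldel c f \<noteq> 0}"
    have fin: "finite ?A" using Suc.prems finite_ldel by blast
    have "{d. ldel d (sc c f) \<noteq> 0} \<subseteq> ?A" by auto
    thus ?case
      using psi_eq[OF fin, of f n] psi_eq[OF fin, of "sc c f" n] Suc.IH[OF finsupp_ldel, OF Suc.prems]
      by (simp add: fmul_simps FA.scale_sum_right mult.commute del: psi.simps)
  qed (simp add: fun_ap)
qed

lemma psi_sum: "finite I \<Longrightarrow> (\<And>i. i \<in> I \<Longrightarrow> f i \<in> Lam) \<Longrightarrow> psi n (\<Sum>i\<in>I. f i) = (\<Sum>i\<in>I. psi n (f i))"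
proof (induction I rule: finite_induct)
  case (insert x F)
  have "finsupp (f x)" "finsupp (\<Sum>i\<in>F. f i)"
    using insert.prems Lam_sum[of F f] by (auto simp: Lam_def)
  thus ?case using insert by (simp add: psi_linear)
qed simp

lemma psi_length: "supp f (\<lambda>w. length w \<noteq> n) \<Longrightarrow> psi n f = 0"
proof (induction n arbitrary: f)
  case 0
  thus ?case by (auto simp: supp_def)
next
  case (Suc n)
  have "psi n (ldel c f) = 0" for c
    by (rule Suc.IH) (use Suc.prems in \<open>auto simp: supp_def ldel_def\<close>)
  thus ?case by (simp add: fmul_simps)
qed

lemma psi_in: "supp f (\<lambda>w. set w \<subseteq> VL \<and> wsum ldeg w = m) \<Longrightarrow>
    psi n f \<in> FA.span {word u | u. u \<in> words W \<and> word_degree u = m \<and> length u = n}"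
proof (induction n arbitrary: f m)
  case 0
  have "f [] = 0 \<or> m = 0" using 0 by (auto simp: supp_def)
  thus ?case
    using FA.span_scale[OF word_in[of "\<lambda>u. u \<in> words W \<and> word_degree u = m \<and> length u = 0" "[]"], of "f []"]
    by (auto simp: FA.span_zero)
next
  case (Suc n)
  have "fmul (word [snd c]) (psi n (ldel c f)) \<in> FA.span {word u | u. u \<in> words W \<and> word_degree u = m \<and> length u = Suc n}"
    if "ldel c f \<noteq> 0" for c
  proof -
    from that obtain w where "f (c # w) \<noteq> 0" by (auto simp: ldel_def fun_eq_iff fun_ap)
    hence c: "c \<in> VL" using Suc.prems by (fastforce simp: supp_def)
    have "supp (ldel c f) (\<lambda>w. set w \<subseteq> VL \<and> wsum ldeg w = m - ldeg c)"
      using Suc.prems by (fastforce simp: supp_def ldel_def)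
    from Suc.IH[OF this] show ?thesis using c B_W by (intro fmul_in[where P = "\<lambda>u. u = [snd c]"
          and Q = "\<lambda>u. u \<in> words W \<and> word_degree u = m - ldeg c \<and> length u = n"])
        (auto intro: FA.span_base)
  qed
  thus ?case by (auto intro!: FA.span_scale FA.span_sum)
qed

lemma psi_wordsp: "supp f (over VL) \<Longrightarrow> psi n f \<in> wordsp W"
proof (induction n arbitrary: f)
  case (Suc n)
  have "fmul (word [snd c]) (psi n (ldel c f)) \<in> wordsp W" if "ldel c f \<noteq> 0" for c
  proof -
    from that obtain w where "f (c # w) \<noteq> 0" by (auto simp: ldel_def fun_eq_iff fun_ap)
    hence c: "c \<in> VL" using Suc.prems by (fastforce simp: supp_def)
    have "supp (ldel c f) (over VL)" using Suc.prems by (fastforce simp: supp_def ldel_def)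
    from Suc.IH[OF this] show ?thesis using VL_word[OF c] by (intro fmul_wordsp)
  qed
  thus ?case by (auto intro!: FA.span_scale FA.span_sum)
qed (simp add: FA.span_scale[OF word_in])

text \<open>By induction, from Euler's identity with all weights 1 on the component of word length
  \<open>Suc n\<close>, where its eigenvalue is \<open>Suc n\<close>.\<close>

lemma Phi_psi: assumes "f \<in> Lam" "supp f (over VL)" shows "Phi (psi n f) = rst (len n) f"
  using assms
proof (induction n arbitrary: f)
  case 0
  show ?case by (auto simp: Phi_simps rst_def onef_def fun_eq_iff fun_ap)
next
  case (Suc n)
  let ?A = "{c. ldel c f \<noteq> 0}" and ?g = "rst (len (Suc n)) f"
  have fin: "finite ?A" using Suc.prems finite_ldel by (auto simp: Lam_def)
  have gL: "?g \<in> Lam" by (rule Lam_rst[OF Suc.prems(1)]) auto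
  have ld: "ldel c ?g = rst (len n) (ldel c f)" for c by (auto simp: ldel_def rst_def fun_eq_iff)
  have "Phi (fmul (word [snd c]) (psi n (ldel c f))) = lett c \<star> ldel c ?g" if "c \<in> ?A" for c
  proof -
    from that obtain w where "f (c # w) \<noteq> 0" by (auto simp: ldel_def fun_eq_iff fun_ap)
    hence c: "c \<in> VL" using Suc.prems by (fastforce simp: supp_def)
    have "supp (ldel c f) (over VL)" using Suc.prems by (fastforce simp: supp_def ldel_def)
    from Suc.IH[OF Lam_closed(7)[OF Suc.prems(1)] this]
    have "Phi (psi n (ldel c f)) = ldel c ?g" using ld by simp
    moreover obtain m b where "c = (False, m, b)" "b \<in> B m" using c by (cases c) auto
    ultimately show ?thesis by (simp add: Phi_fmul Phi_simps gen_basis)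
  qed
  hence "Phi (psi (Suc n) f) = sc (inverse (of_nat (Suc n))) (\<Sum>c\<in>?A. lett c \<star> ldel c ?g)"
    by (simp add: Phi_simps Phi_sum)
  also have "(\<Sum>c\<in>?A. lett c \<star> ldel c ?g) = (\<lambda>w. of_nat (wsum (\<lambda>_. 1) w) * ?g w)"
  proof -
    have "{b. ldel b ?g \<noteq> 0} \<subseteq> ?A" by (auto simp: ld)
    from euler[OF gL fin this, of "\<lambda>_. 1"] show ?thesis by simp
  qed
  also have "sc (inverse (of_nat (Suc n))) (\<lambda>w. of_nat (wsum (\<lambda>_. 1) w) * ?g w) = ?g"
  proof
    fix w :: "(bool \<times> int \<times> 'w) list"
    have "wsum (\<lambda>_. 1::nat) w = length w" by (induction w) auto
    thus "sc (inverse (of_nat (Suc n))) (\<lambda>w. of_nat (wsum (\<lambda>_. 1) w) * ?g w) w = ?g w"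
      by (auto simp: fun_ap rst_def simp del: of_nat_Suc)
  qed
  finally show ?case .
qed

lemma symrel_swap: assumes "c \<in> VL" "d \<in> VL" "a \<in> wordsp W"
  shows "fsmul (eps (ldeg d * ldeg c)) (fmul (word [snd d]) (fmul (word [snd c]) a)) - fmul (word [snd c]) (fmul (word [snd d]) a) \<in> symrel s W"
proof -
  obtain m x where c: "c = (False, m, x)" "x \<in> W m" using assms(1) B_W by (cases c) auto
  obtain n y where d: "d = (False, n, y)" "y \<in> W n" using assms(2) B_W by (cases d) auto
  show ?thesis using assms(3)
  proof (induction rule: FA.span_induct)
    case base
    show ?case
    proof (rule FA.subspaceI)
      let ?T = "\<lambda>a. fsmul (eps (ldeg d * ldeg c)) (fmul (word [snd d]) (fmul (word [snd c]) a)) - fmul (word [snd c]) (fmul (word [snd d]) a)"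
      have T: "?T (a + b) = ?T a + ?T b" "?T (fsmul r a) = fsmul r (?T a)" for a b r
        by (simp_all add: fmul_simps FA.scale_right_distrib FA.scale_right_diff_distrib mult.commute)
      show "0 \<in> {a. ?T a \<in> symrel s W}" by (simp add: fmul_simps FA.span_zero)
      show "a + b \<in> {a. ?T a \<in> symrel s W}" if "a \<in> {a. ?T a \<in> symrel s W}" "b \<in> {a. ?T a \<in> symrel s W}" for a b
        using that FA.span_add unfolding mem_Collect_eq T by blast
      show "fsmul r a \<in> {a. ?T a \<in> symrel s W}" if "a \<in> {a. ?T a \<in> symrel s W}" for r a
        using that FA.span_scale unfolding mem_Collect_eq T by blast
    qed
  next
    case (step a)
    then obtain u where u: "a = word u" "u \<in> words W" by blast
    have "word ([] @ [(n, y), (m, x)] @ u) - fsmul ((-1) powi (n * m)) (word ([] @ [(m, x), (n, y)] @ u)) \<in> symrel s W"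
      using u c d words_simps(1) by (intro FA.span_base) (unfold sym_relators_def, blast)
    from FA.span_scale[OF this, of "eps (n * m)"]
    show ?case by (simp add: c d u fmul_simps powi_eps FA.scale_right_diff_distrib eps_sq)
  qed
qed

text \<open>The Leibniz rule yields one copy of \<open>c\<close> times \<open>psi n f\<close> from
  the derivative of \<open>c\<close>. In the other terms the induction hypothesis pulls
  \<open>c\<close> out, \<open>symrel_swap\<close> moves it to the front, and the remaining sum is
  \<open>n\<close> further copies; the factor \<open>1 / (n + 1)\<close> in \<open>psi\<close> makes
  them one.\<close>

lemma psi_lett: assumes "c \<in> VL" "f \<in> Lam" "supp f (over VL)"
  shows "psi (Suc n) (lett c \<star> f) - fmul (word [snd c]) (psi n f) \<in> symrel s W" using assms(2,3)
proof (induction n arbitrary: f)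
  case 0
  let ?A = "insert c {d. ldel d f \<noteq> 0}"
  have fin: "finite ?A" using 0 finite_ldel by (auto simp: Lam_def)
  have sub: "{d. ldel d (lett c \<star> f) \<noteq> 0} \<subseteq> ?A" by (auto simp: ldel_sp ldel_lett)
  have e: "fmul (word [snd d]) (psi 0 (ldel d (lett c \<star> f))) = (if d = c then fmul (word [snd c]) (psi 0 f) else 0)" for d
    by (simp add: ldel_sp ldel_lett fun_ap fmul_simps twist_lett sp_sc_left) (simp add: lett_def)
  have "psi (Suc 0) (lett c \<star> f) = (\<Sum>d\<in>?A. if d = c then fmul (word [snd c]) (psi 0 f) else 0)"
    unfolding psi_eq[OF fin sub] e by simp
  also have "\<dots> = fmul (word [snd c]) (psi 0 f)" using fin by simp
  finally show ?case by (simp add: FA.span_zero)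
next
  case (Suc n)
  let ?A = "insert c {d. ldel d f \<noteq> 0}" and ?N = "of_nat (Suc (Suc n)) :: 'k"
  have fin: "finite ?A" using Suc.prems finite_ldel by (auto simp: Lam_def)
  have sub: "{d. ldel d (lett c \<star> f) \<noteq> 0} \<subseteq> ?A" "{d. ldel d f \<noteq> 0} \<subseteq> ?A" by (auto simp: ldel_sp ldel_lett)
  have fs: "finsupp f" "finsupp (lett c \<star> ldel d f)" for d
    using Suc.prems Lam_closed(6)[OF Lam_closed(3) Lam_closed(7)[OF Suc.prems(1)], of c d] by (auto simp: Lam_def)
  have dV: "d \<in> VL" if "ldel d f \<noteq> 0" for d
  proof -
    from that obtain w where "f (d # w) \<noteq> 0" by (auto simp: ldel_def fun_eq_iff fun_ap)
    thus ?thesis using Suc.prems by (fastforce simp: supp_def)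
  qed
  have ls: "supp (ldel d f) (over VL)" for d using Suc.prems by (fastforce simp: supp_def ldel_def)
  have ps: "psi (Suc n) (ldel d (lett c \<star> f)) = (if d = c then psi (Suc n) f else 0) +
      fsmul (eps (ldeg d * ldeg c)) (psi (Suc n) (lett c \<star> ldel d f))" for d
    using fs psi_linear finsupp_closed(4) by (simp add: ldel_sp ldel_lett twist_lett sp_sc_left del: psi.simps)
  let ?x = "\<lambda>d. fmul (word [snd d]) (fsmul (eps (ldeg d * ldeg c)) (psi (Suc n) (lett c \<star> ldel d f)))"
  let ?y = "\<lambda>d. fmul (word [snd c]) (fmul (word [snd d]) (psi n (ldel d f)))"
  have "psi (Suc (Suc n)) (lett c \<star> f) = fsmul (inverse ?N) (\<Sum>d\<in>?A. (if d = c then fmul (word [snd c]) (psi (Suc n) f) else 0) + ?x d)"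
    unfolding psi_eq[OF fin sub(1)] ps by (intro arg_cong[of _ _ "fsmul _"] sum.cong) (auto simp: fmul_simps simp del: psi.simps)
  also have "\<dots> = fsmul (inverse ?N) (fmul (word [snd c]) (psi (Suc n) f) + (\<Sum>d\<in>?A. ?x d))"
    using fin by (simp add: sum.distrib del: psi.simps)
  finally have 1: "psi (Suc (Suc n)) (lett c \<star> f) = \<dots>" .
  have xy: "?x d - ?y d \<in> symrel s W" for d
  proof (cases "ldel d f = 0")
    case True
    thus ?thesis by (simp add: fmul_simps FA.span_zero del: psi.simps)
  next
    case False
    let ?p = "psi n (ldel d f)"
    have IH: "psi (Suc n) (lett c \<star> ldel d f) - fmul (word [snd c]) ?p \<in> symrel s W"
      by (rule Suc.IH[OF Lam_closed(7)[OF Suc.prems(1)] ls])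
    from FA.span_scale[OF symrel_lmult[OF IH VL_word[OF dV[OF False]]], of "eps (ldeg d * ldeg c)"]
    have "?x d - fsmul (eps (ldeg d * ldeg c)) (fmul (word [snd d]) (fmul (word [snd c]) ?p)) \<in> symrel s W"
      by (simp only: fmul_simps FA.scale_right_diff_distrib)
    from FA.span_add[OF this symrel_swap[OF assms(1) dV[OF False] psi_wordsp[OF ls[of d], of n]]]
    show ?thesis by simp
  qed
  have "(\<Sum>d\<in>?A. ?y d) = fmul (word [snd c]) (fsmul (of_nat (Suc n)) (psi (Suc n) f))"
    unfolding psi_eq[OF fin sub(2)] by (simp add: fmul_sum fmul_simps FA.scale_sum_right del: psi.simps of_nat_Suc)
  hence 2: "fmul (word [snd c]) (psi (Suc n) f) + (\<Sum>d\<in>?A. ?y d) = fsmul ?N (fmul (word [snd c]) (psi (Suc n) f))"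
  proof -
    let ?Z = "fmul (word [snd c]) (psi (Suc n) f)"
    assume "(\<Sum>d\<in>?A. ?y d) = fmul (word [snd c]) (fsmul (of_nat (Suc n)) (psi (Suc n) f))"
    hence "?Z + (\<Sum>d\<in>?A. ?y d) = fsmul 1 ?Z + fsmul (of_nat (Suc n)) ?Z"
      by (simp only: fmul_simps FA.scale_one)
    also have "\<dots> = fsmul (1 + of_nat (Suc n)) ?Z" by (simp only: FA.scale_left_distrib)
    finally show ?thesis by (simp del: psi.simps)
  qed
  have "(\<Sum>d\<in>?A. ?x d - ?y d) \<in> symrel s W" by (rule FA.span_sum) (rule xy)
  hence "fsmul (inverse ?N) (\<Sum>d\<in>?A. ?x d - ?y d) \<in> symrel s W" by (rule FA.span_scale)
  moreover have "fsmul (inverse ?N) (\<Sum>d\<in>?A. ?x d - ?y d) =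
      fsmul (inverse ?N) (fmul (word [snd c]) (psi (Suc n) f) + (\<Sum>d\<in>?A. ?x d)) -
      fsmul (inverse ?N) (fmul (word [snd c]) (psi (Suc n) f) + (\<Sum>d\<in>?A. ?y d))"
    by (simp only: sum_subtractf FA.scale_right_diff_distrib FA.scale_right_distrib) simp
  moreover have "fsmul (inverse ?N) (fsmul ?N z) = z" for z :: "('w, 'k) free_alg"
    by (simp del: of_nat_Suc)
  ultimately show ?case unfolding 1 2 by simp
qed

lemma psi_phw: assumes "u \<in> words W" shows "psi (length u) (phw u) - word u \<in> symrel s W"
  using assms
proof (induction u)
  case Nil
  thus ?case by (simp add: FA.span_zero)
next
  case (Cons l u)
  obtain n x where l: "l = (n, x)" by (cases l)
  have x: "x \<in> W n" and u: "u \<in> words W" using Cons.prems by (simp_all add: l)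
  let ?r = "VS.representation (B n) x" and ?S = "bsupp n x"
  have uL: "phw u \<in> Lam" by (rule phw_Lam[OF u])
  have "phw (l # u) = (\<Sum>b\<in>?S. sc (?r b) (lett (False, n, b) \<star> phw u))"
    by (simp add: l gen_expand[OF x] sp_sum_left sp_sc_left)
  moreover have "finsupp (lett (False, n, b) \<star> phw u)" for b
    using Lam_closed(6)[OF Lam_closed(3) uL] by (simp add: Lam_def)
  ultimately have 1: "psi (length (l # u)) (phw (l # u)) = (\<Sum>b\<in>?S. fsmul (?r b) (psi (Suc (length u)) (lett (False, n, b) \<star> phw u)))"
    using bsupp(1) uL by (simp add: psi_sum Lam_closed psi_linear del: psi.simps phw.simps)
  have b: "b \<in> B n" "b \<in> W n" if "b \<in> ?S" for b using that bsupp(2) B_W by blast+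
  have "psi (Suc (length u)) (lett (False, n, b) \<star> phw u) - word ((n, b) # u) \<in> symrel s W" if "b \<in> ?S" for b
  proof -
    have "psi (Suc (length u)) (lett (False, n, b) \<star> phw u) - fmul (word [snd (False, n, b)]) (psi (length u) (phw u)) \<in> symrel s W"
      by (rule psi_lett[OF _ uL phw_VL]) (use b[OF that] in simp)
    moreover have "fmul (word [(n, b)]) (psi (length u) (phw u) - word u) \<in> symrel s W"
      by (rule symrel_lmult[OF Cons.IH[OF u] word_in]) (use b[OF that] in simp)
    ultimately show ?thesis using FA.span_add by (fastforce simp: fmul_simps)
  qed
  hence "(\<Sum>b\<in>?S. fsmul (?r b) (psi (Suc (length u)) (lett (False, n, b) \<star> phw u) - word ((n, b) # u))) \<in> symrel s W"
    by (intro FA.span_sum FA.span_scale)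
  hence 2: "psi (length (l # u)) (phw (l # u)) - (\<Sum>b\<in>?S. fsmul (?r b) (word ((n, b) # u))) \<in> symrel s W"
    unfolding 1 by (simp add: FA.scale_right_diff_distrib sum_subtractf del: psi.simps)
  have "word ((n, \<Sum>b\<in>?S. s (?r b) b) # u) - (\<Sum>b\<in>?S. fsmul (?r b) (word ((n, b) # u))) \<in> symrel s W"
    by (rule symrel_linear[OF vs W_sub u bsupp(1)]) (use b in blast)
  hence "word (l # u) - (\<Sum>b\<in>?S. fsmul (?r b) (word ((n, b) # u))) \<in> symrel s W"
    by (simp add: l bsupp_sum[OF x])
  from FA.span_diff[OF 2 this] show ?case by simp
qed

text \<open>The sum of the maps \<open>psi n\<close>, applied to \<open>Phi a\<close>, returns
  \<open>a\<close> modulo relators; on a word only the summand of its own length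
  contributes.\<close>

theorem Phi_kernel:
  assumes a: "a \<in> wordsp W" and 0: "Phi a = 0" shows "a \<in> symrel s W"
proof -
  define N where "N = Suc (Max (insert 0 (length ` keys a)))"
  have k: "\<forall>u\<in>keys a. u \<in> words W \<and> length u < N"
    using a by (auto simp: span_words N_def less_Suc_eq_le)
  define T where "T b = (\<Sum>n<N. psi n (Phi b))" for b
  have "finsupp (Phi b) \<and> T b - b \<in> symrel s W" if "\<forall>u\<in>keys b. u \<in> words W \<and> length u < N" for b
    using that
  proof (induction rule: free_induct_on)
    case zero
    thus ?case by (simp add: T_def Phi_simps finsupp_closed FA.span_zero)
  next
    case (add a b)
    hence eq: "T (a + b) - (a + b) = (T a - a) + (T b - b)"
      by (simp add: T_def Phi_simps psi_linear sum.distrib)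
    have "T a - a \<in> symrel s W" "T b - b \<in> symrel s W" using add by simp_all
    from FA.span_add[OF this] have "T (a + b) - (a + b) \<in> symrel s W" by (simp only: eq)
    thus ?case using add by (simp add: Phi_simps finsupp_add)
  next
    case (scale c a)
    hence eq: "T (fsmul c a) - fsmul c a = fsmul c (T a - a)"
      by (simp add: T_def Phi_simps psi_linear FA.scale_sum_right FA.scale_right_diff_distrib)
    have "T a - a \<in> symrel s W" using scale by simp
    from FA.span_scale[OF this, of c] have "T (fsmul c a) - fsmul c a \<in> symrel s W" by (simp only: eq)
    thus ?case using scale by (simp add: Phi_simps finsupp_closed)
  next
    case (word u)
    have "psi n (phw u) = 0" if "n \<noteq> length u" for n
      by (rule psi_length[OF supp_mono[OF phw_supp]]) (use that in auto)
    hence "T (word u) = (\<Sum>n<N. if n = length u then psi n (phw u) else 0)"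
      unfolding T_def Phi_simps by (intro sum.cong) auto
    also have "\<dots> = psi (length u) (phw u)" using word by simp
    finally show ?case using psi_phw word phw_Lam by (simp add: Phi_simps Lam_def)
  qed
  from this[OF k] have "- a \<in> symrel s W" by (simp add: T_def 0)
  from FA.span_neg[OF this] show ?thesis by simp
qed

end

text \<open>One functional is added at a time. Independence gives \<open>y\<close> on which the new
  functional \<open>b\<close> differs from the combination of the old ones that has the same values
  on the old dual elements; correcting \<open>y\<close> by these elements leaves an element on which
  only \<open>b\<close> is nonzero.\<close>

lemma linear_dual_elements:
  fixes s :: "'k::field \<Rightarrow> 'v::ab_group_add \<Rightarrow> 'v" and A :: "('v \<Rightarrow> 'k) set"
  assumes vs: "vector_space s" and X: "module.subspace s X" and "finite A"
    and lin: "\<forall>b\<in>A. \<forall>x\<in>X. (\<forall>y\<in>X. b (x + y) = b x + b y) \<and> (\<forall>c. b (s c x) = c * b x)"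
    and indep: "\<And>u. \<forall>x\<in>X. (\<Sum>b\<in>A. u b * b x) = 0 \<Longrightarrow> \<forall>b\<in>A. u b = 0"
  shows "\<exists>x. \<forall>b\<in>A. x b \<in> X \<and> (\<forall>c\<in>A. c (x b) = (if c = b then 1 else 0))"
proof -
  interpret vector_space s by fact
  note X' = subspace_add[OF X] subspace_scale[OF X] subspace_diff[OF X] subspace_0[OF X] subspace_sum[OF X]
  show ?thesis using assms(3-)
  proof (induction A rule: finite_induct)
    case (insert b A)
    have ind: "\<forall>c\<in>A. u c = 0" if u: "\<forall>x\<in>X. (\<Sum>c\<in>A. u c * c x) = 0" for u
    proof -
      have "(\<Sum>c\<in>insert b A. (u(b := 0)) c * c x) = 0" if "x \<in> X" for x
      proof -
        have "(\<Sum>c\<in>A. (u(b := 0)) c * c x) = (\<Sum>c\<in>A. u c * c x)"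
          by (rule sum.cong) (use insert.hyps in auto)
        thus ?thesis using insert.hyps u that by simp
      qed
      hence "\<forall>c\<in>insert b A. (u(b := 0)) c = 0" by (intro insert.prems(2)) blast
      hence "(u(b := 0)) c = 0" if "c \<in> A" for c using that by blast
      thus ?thesis using insert.hyps by (metis fun_upd_other)
    qed
    have "\<exists>x. \<forall>c\<in>A. x c \<in> X \<and> (\<forall>d\<in>A. d (x c) = (if d = c then 1 else 0))"
    proof (rule insert.IH)
      show "\<forall>b\<in>A. \<forall>x\<in>X. (\<forall>y\<in>X. b (x + y) = b x + b y) \<and> (\<forall>c. b (s c x) = c * b x)"
        using insert.prems(1) by simp
    qed (rule ind)
    then obtain x where x: "\<And>c. c \<in> A \<Longrightarrow> x c \<in> X" "\<And>c d. c \<in> A \<Longrightarrow> d \<in> A \<Longrightarrow> d (x c) = (if d = c then 1 else 0)"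
      by blast
    have "\<exists>y\<in>X. b y \<noteq> (\<Sum>c\<in>A. b (x c) * c y)"
    proof (rule ccontr)
      assume n: "\<not> ?thesis"
      have "(\<Sum>c\<in>insert b A. (if c = b then - 1 else b (x c)) * c y) = 0" if "y \<in> X" for y
      proof -
        have "(\<Sum>c\<in>A. (if c = b then - 1 else b (x c)) * c y) = (\<Sum>c\<in>A. b (x c) * c y)"
          by (rule sum.cong) (use insert.hyps in auto)
        thus ?thesis using n that insert.hyps by simp
      qed
      hence "\<forall>c\<in>insert b A. (if c = b then - 1 else b (x c)) = 0" by (intro insert.prems(2)) blast
      thus False by simp
    qed
    then obtain y where y: "y \<in> X" "b y \<noteq> (\<Sum>c\<in>A. b (x c) * c y)" by blast
    define z where "z = y - (\<Sum>c\<in>A. s (c y) (x c))"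
    have zg: "z \<in> X" unfolding z_def by (intro X' y(1) x(1))
    have add: "\<phi> (v + w) = \<phi> v + \<phi> w" and scl: "\<phi> (s c v) = c * \<phi> v" if "\<phi> \<in> insert b A" "v \<in> X" "w \<in> X" for \<phi> v w c
      using insert.prems(1) that by blast+
    have diff: "\<phi> (v - w) = \<phi> v - \<phi> w" if "\<phi> \<in> insert b A" "v \<in> X" "w \<in> X" for \<phi> v w
      using add[OF that(1) X'(3)[OF that(2,3)] that(3)] by simp
    have sum: "\<phi> (\<Sum>c\<in>C. s (c y) (x c)) = (\<Sum>c\<in>C. c y * \<phi> (x c))" if p: "\<phi> \<in> insert b A" and "finite C" "C \<subseteq> A" for \<phi> C
      using that(2,3)
    proof (induction C rule: finite_induct)
      case empty
      show ?case using scl[OF p X'(4) X'(4), of 0] by simp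
    next
      case (insert c C)
      have "s (c y) (x c) \<in> X" "(\<Sum>c\<in>C. s (c y) (x c)) \<in> X" using insert.prems x(1) by (auto intro!: X')
      thus ?case using insert add[OF p] scl[OF p x(1) X'(4)] by auto
    qed
    have val: "\<phi> z = \<phi> y - (\<Sum>c\<in>A. c y * \<phi> (x c))" if p: "\<phi> \<in> insert b A" for \<phi>
    proof -
      have "(\<Sum>c\<in>A. s (c y) (x c)) \<in> X" by (intro X' x(1))
      thus ?thesis unfolding z_def by (simp only: diff[OF p y(1)] sum[OF p insert.hyps(1) order_refl])
    qed
    have zA: "d z = 0" if d: "d \<in> A" for d
    proof -
      have "(\<Sum>c\<in>A. c y * d (x c)) = (\<Sum>c\<in>A. if c = d then d y else 0)"
        by (intro sum.cong) (auto simp: x(2) d)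
      thus ?thesis using val[of d] d insert.hyps by auto
    qed
    have zb: "b z \<noteq> 0" using val[of b] y(2) by (simp add: mult.commute)
    define x' where "x' c = (if c = b then s (inverse (b z)) z else x c - s (b (x c) * inverse (b z)) z)" for c
    have d: "\<phi> (x' c) = (if c = b then inverse (b z) * \<phi> z else \<phi> (x c) - b (x c) * inverse (b z) * \<phi> z)"
      if p: "\<phi> \<in> insert b A" "c \<in> insert b A" for \<phi> c
      using p(2) scl[OF p(1) zg zg] diff[OF p(1) x(1) X'(2)[OF zg]] by (auto simp: x'_def)
    show ?case
    proof (intro exI[of _ x'] ballI conjI)
      fix c assume c: "c \<in> insert b A"
      show "x' c \<in> X" using c x(1) zg by (auto simp: x'_def intro!: X')
      fix f assume f: "f \<in> insert b A"
      show "f (x' c) = (if f = c then 1 else 0)"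
        using c f d[OF f c] zb zA x(2)[of c f] insert.hyps by auto
    qed
  qed simp
qed

section \<open>Complete dglas and their duals\<close>

locale complete_dg = inverse_system S for S :: "('i, 'a::ab_group_add, 'k::field_char_0) inv_sys" +
  fixes g :: "('i \<Rightarrow> 'a, 'k) top_dgla"
  assumes g_eq: "g = inv_lim S"

sublocale complete_dg \<subseteq> G: dgla g
  using dgla_inv_lim by (simp add: g_eq)

sublocale complete_dg \<subseteq> GV: vector_space "scl g"
  by (rule G.vector_space)

lemma complete_dgE: assumes "complete_dgla g" obtains S where "complete_dg S g"
  using assms unfolding complete_dgla_def complete_dg_def complete_dg_axioms_def by blast

context complete_dg
begin

lemma comp: "(x + y) \<alpha> = x \<alpha> + y \<alpha>" "scl g c x \<alpha> = scl (obj S \<alpha>) c (x \<alpha>)" "dif g x \<alpha> = dif (obj S \<alpha>) (x \<alpha>)"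
  "brk g x y \<alpha> = brk (obj S \<alpha>) (x \<alpha>) (y \<alpha>)" "(0 :: 'i \<Rightarrow> 'a) \<alpha> = 0" "(x - y) \<alpha> = x \<alpha> - y \<alpha>"
  by (simp_all add: g_eq inv_lim_def fun_ap)

lemma grd_obj: "x \<in> grd g n \<Longrightarrow> x \<alpha> \<in> grd (obj S \<alpha>) n"
  and grd_trans: "x \<in> grd g n \<Longrightarrow> le S \<alpha> \<beta> \<Longrightarrow> trans_map S \<alpha> \<beta> (x \<beta>) = x \<alpha>"
  by (auto simp: g_eq inv_lim_def lim_grd_def)

lemma grd_closed: "0 \<in> grd g n" "x \<in> grd g n \<Longrightarrow> y \<in> grd g n \<Longrightarrow> x + y \<in> grd g n"
  "x \<in> grd g n \<Longrightarrow> scl g c x \<in> grd g n" "x \<in> grd g n \<Longrightarrow> y \<in> grd g n \<Longrightarrow> x - y \<in> grd g n"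
  using GV.subspace_0[OF G.subspace] GV.subspace_add[OF G.subspace] GV.subspace_scale[OF G.subspace]
    GV.subspace_diff[OF G.subspace] by blast+

lemma grd_sum: "(\<And>i. i \<in> I \<Longrightarrow> x i \<in> grd g n) \<Longrightarrow> (\<Sum>i\<in>I. x i) \<in> grd g n"
  by (rule GV.subspace_sum[OF G.subspace])

lemma zero_below: assumes x: "x \<in> grd g n" "x \<beta> = 0" and le: "le S \<alpha> \<beta>" shows "x \<alpha> = 0"
proof -
  have "trans_map S \<alpha> \<beta> (x \<beta>) = x \<alpha>" "trans_map S \<alpha> \<beta> (0 \<beta>) = 0 \<alpha>"
    using grd_trans[OF x(1) le] grd_trans[OF grd_closed(1) le] by auto
  thus ?thesis using x(2) by (simp add: comp)
qed

lemma upper_bound: "finite F \<Longrightarrow> \<exists>\<gamma>. \<forall>\<alpha>\<in>F. le S \<alpha> \<gamma>"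
proof (induction F rule: finite_induct)
  case (insert \<alpha> F)
  then obtain \<gamma> where \<gamma>: "\<forall>\<alpha>\<in>F. le S \<alpha> \<gamma>" by blast
  obtain \<delta> where "le S \<alpha> \<delta>" "le S \<gamma> \<delta>" using directed by blast
  thus ?case using \<gamma> le_trans by blast
qed simp

lemma topo_g: "topo g n = subtopology (product_topology (\<lambda>\<alpha>. discrete_topology (grd (obj S \<alpha>) n)) UNIV) (grd g n)"
  by (simp add: g_eq inv_lim_def)

text \<open>By continuity the zero set of \<open>\<phi>\<close> contains a neighbourhood of 0 that
  restricts finitely many coordinates, and directedness replaces them by one level
  \<open>\<alpha>\<close>. Conversely, a functional vanishing wherever \<open>x \<alpha> = 0\<close>
  is a function of the coordinate \<open>x \<alpha>\<close>.\<close>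

lemma dual_iff:
  "\<phi> \<in> dual g i \<longleftrightarrow>
    (\<forall>x\<in>grd g i. \<forall>y\<in>grd g i. \<phi> (x + y) = \<phi> x + \<phi> y) \<and> (\<forall>c. \<forall>x\<in>grd g i. \<phi> (scl g c x) = c * \<phi> x) \<and>
    (\<forall>x. x \<notin> grd g i \<longrightarrow> \<phi> x = 0) \<and> (\<exists>\<alpha>. \<forall>x\<in>grd g i. x \<alpha> = 0 \<longrightarrow> \<phi> x = 0)"
    (is "_ \<longleftrightarrow> ?add \<and> ?scl \<and> ?off \<and> ?fac")
proof -
  let ?P = "product_topology (\<lambda>\<alpha>. discrete_topology (grd (obj S \<alpha>) i)) UNIV"
  have "continuous_map (topo g i) (discrete_topology UNIV) \<phi> \<longleftrightarrow> ?fac" if add: ?add and scl: ?scl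
  proof
    assume c: "continuous_map (topo g i) (discrete_topology UNIV) \<phi>"
    have "openin (topo g i) {x \<in> topspace (topo g i). \<phi> x \<in> {0}}"
      by (rule openin_continuous_map_preimage[OF c]) simp
    then obtain T where T: "openin ?P T" "{x \<in> topspace (topo g i). \<phi> x \<in> {0}} = T \<inter> grd g i"
      unfolding topo_g openin_subtopology by blast
    have ts: "topspace (topo g i) = grd g i" unfolding g_eq by (rule topspace_inv_lim)
    have "\<phi> 0 = 0" using add grd_closed(1)[of i] by force
    hence "0 \<in> T" using T(2) grd_closed(1)[of i] ts by blast
    then obtain U where U: "finite {\<alpha>. U \<alpha> \<noteq> grd (obj S \<alpha>) i}" "\<And>\<alpha>. U \<alpha> \<subseteq> grd (obj S \<alpha>) i" "0 \<in> Pi\<^sub>E UNIV U" "Pi\<^sub>E UNIV U \<subseteq> T"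
      using T(1) unfolding openin_product_topology_alt by (auto 0 3)
    from upper_bound[OF U(1)] obtain \<gamma> where \<gamma>: "\<And>\<alpha>. U \<alpha> \<noteq> grd (obj S \<alpha>) i \<Longrightarrow> le S \<alpha> \<gamma>" by auto
    have "\<phi> x = 0" if x: "x \<in> grd g i" "x \<gamma> = 0" for x
    proof -
      have "x \<alpha> \<in> U \<alpha>" for \<alpha>
      proof (cases "U \<alpha> = grd (obj S \<alpha>) i")
        case False
        hence "x \<alpha> = 0" using zero_below[OF x \<gamma>] by blast
        moreover have "0 \<in> U \<alpha>" using U(3) by (auto simp: PiE_def Pi_def fun_ap)
        ultimately show ?thesis by simp
      qed (use grd_obj x in auto)
      hence "x \<in> T" using U(4) by (auto simp: PiE_def Pi_def)
      thus ?thesis using T(2) x by auto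
    qed
    thus ?fac by blast
  next
    assume ?fac
    then obtain \<alpha> where \<alpha>: "\<And>x. x \<in> grd g i \<Longrightarrow> x \<alpha> = 0 \<Longrightarrow> \<phi> x = 0" by blast
    define h where "h y = (if \<exists>x\<in>grd g i. x \<alpha> = y then \<phi> (SOME x. x \<in> grd g i \<and> x \<alpha> = y) else 0)" for y
    have h: "h (x \<alpha>) = \<phi> x" if x: "x \<in> grd g i" for x
    proof -
      define x' where "x' = (SOME x'. x' \<in> grd g i \<and> x' \<alpha> = x \<alpha>)"
      have x': "x' \<in> grd g i \<and> x' \<alpha> = x \<alpha>" unfolding x'_def by (rule someI[of _ x]) (use x in simp)
      have "h (x \<alpha>) = \<phi> x'" unfolding h_def x'_def using x by auto
      have "\<phi> (x' - x) = 0" by (rule \<alpha>) (use x x' in \<open>simp_all add: grd_closed comp\<close>)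
      moreover have "x' - x \<in> grd g i" using x x' by (simp add: grd_closed)
      hence "\<phi> (x' - x + x) = \<phi> (x' - x) + \<phi> x" using add x by blast
      ultimately show ?thesis using \<open>h (x \<alpha>) = \<phi> x'\<close> by simp
    qed
    have "continuous_map (topo g i) (discrete_topology (grd (obj S \<alpha>) i)) (\<lambda>x. x \<alpha>)"
      unfolding topo_g by (intro continuous_map_from_subtopology continuous_map_product_projection) simp
    moreover have "continuous_map (discrete_topology (grd (obj S \<alpha>) i)) (discrete_topology UNIV) h" by simp
    ultimately have "continuous_map (topo g i) (discrete_topology UNIV) (h \<circ> (\<lambda>x. x \<alpha>))"
      by (rule continuous_map_compose)
    thus "continuous_map (topo g i) (discrete_topology UNIV) \<phi>"
      by (rule continuous_map_eq) (use h topspace_inv_lim[of S i] in \<open>auto simp: g_eq\<close>)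
  qed
  thus ?thesis unfolding dual_def mem_Collect_eq by (intro conj_cong refl)
qed

lemma dualD: assumes "\<phi> \<in> dual g i"
  shows "x \<in> grd g i \<Longrightarrow> y \<in> grd g i \<Longrightarrow> \<phi> (x + y) = \<phi> x + \<phi> y" "x \<in> grd g i \<Longrightarrow> \<phi> (scl g c x) = c * \<phi> x"
    "x \<notin> grd g i \<Longrightarrow> \<phi> x = 0" "x \<in> grd g i \<Longrightarrow> y \<in> grd g i \<Longrightarrow> \<phi> (x - y) = \<phi> x - \<phi> y" "\<phi> 0 = 0"
proof -
  show add: "\<phi> (x + y) = \<phi> x + \<phi> y" if "x \<in> grd g i" "y \<in> grd g i" for x y
    using assms that unfolding dual_iff by blast
  show "x \<in> grd g i \<Longrightarrow> \<phi> (scl g c x) = c * \<phi> x" "x \<notin> grd g i \<Longrightarrow> \<phi> x = 0"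
    using assms unfolding dual_iff by blast+
  show "\<phi> (x - y) = \<phi> x - \<phi> y" if "x \<in> grd g i" "y \<in> grd g i" for x y
    using add[of "x - y" y] that by (simp add: grd_closed)
  show "\<phi> 0 = 0" using add[of 0 0] by (simp add: grd_closed)
qed

lemma dual_sum: "\<phi> \<in> dual g i \<Longrightarrow> (\<And>j. j \<in> J \<Longrightarrow> x j \<in> grd g i) \<Longrightarrow> \<phi> (\<Sum>j\<in>J. x j) = (\<Sum>j\<in>J. \<phi> (x j))"
  by (induction J rule: infinite_finite_induct) (simp_all add: dualD grd_sum)

lemma dualI: assumes "\<And>x y. x \<in> grd g i \<Longrightarrow> y \<in> grd g i \<Longrightarrow> \<phi> (x + y) = \<phi> x + \<phi> y"
    "\<And>c x. x \<in> grd g i \<Longrightarrow> \<phi> (scl g c x) = c * \<phi> x" "\<And>x. x \<notin> grd g i \<Longrightarrow> \<phi> x = 0"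
    "\<And>x. x \<in> grd g i \<Longrightarrow> x \<alpha> = 0 \<Longrightarrow> \<phi> x = 0"
  shows "\<phi> \<in> dual g i" unfolding dual_iff using assms by blast

lemma dual_factor: "\<phi> \<in> dual g i \<Longrightarrow> \<exists>\<alpha>. \<forall>\<beta>. le S \<alpha> \<beta> \<longrightarrow> (\<forall>x\<in>grd g i. x \<beta> = 0 \<longrightarrow> \<phi> x = 0)"
  unfolding dual_iff using zero_below by blast

lemma dual_subspace: "module.subspace sc (dual g i)"
proof -
  interpret F: vector_space "sc :: 'k \<Rightarrow> (('i \<Rightarrow> 'a) \<Rightarrow> 'k) \<Rightarrow> _" by (rule vector_space_sc)
  show ?thesis
  proof (rule F.subspaceI)
    show "0 \<in> dual g i" by (rule dualI) (simp_all add: fun_ap)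
    fix \<phi> assume p: "\<phi> \<in> dual g i"
    obtain \<alpha> where \<alpha>: "\<And>\<beta> x. le S \<alpha> \<beta> \<Longrightarrow> x \<in> grd g i \<Longrightarrow> x \<beta> = 0 \<Longrightarrow> \<phi> x = 0" using dual_factor[OF p] by blast
    show "sc c \<phi> \<in> dual g i" for c
      by (rule dualI[where \<alpha> = \<alpha>]) (simp_all add: fun_ap dualD[OF p] \<alpha>[OF le_refl] algebra_simps)
    fix \<psi> assume q: "\<psi> \<in> dual g i"
    obtain \<beta> where \<beta>: "\<And>\<gamma> x. le S \<beta> \<gamma> \<Longrightarrow> x \<in> grd g i \<Longrightarrow> x \<gamma> = 0 \<Longrightarrow> \<psi> x = 0" using dual_factor[OF q] by blast
    obtain \<gamma> where "le S \<alpha> \<gamma>" "le S \<beta> \<gamma>" using directed by blast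
    thus "\<phi> + \<psi> \<in> dual g i"
      by (intro dualI[where \<alpha> = \<gamma>]) (simp_all add: fun_ap dualD[OF p] dualD[OF q] \<alpha> \<beta> algebra_simps)
  qed
qed

lemma brk_closed: "x \<in> grd g m \<Longrightarrow> y \<in> grd g n \<Longrightarrow> m + n = l \<Longrightarrow> brk g x y \<in> grd g l"
  using G.brk_grd by blast

lemma brk_right: assumes "x \<in> grd g m" "y \<in> grd g n"
  shows "y' \<in> grd g n \<Longrightarrow> brk g x (y + y') = brk g x y + brk g x y'" "brk g x (scl g c y) = scl g c (brk g x y)"
proof -
  let ?e = "- ((-1) powi (m * n)) :: 'k"
  note a = G.brk_antisym[OF assms(1)]
  show "brk g x (y + y') = brk g x y + brk g x y'" if y': "y' \<in> grd g n"
    using a[of "y + y'" n] a[OF assms(2)] a[OF y'] assms y'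
    by (simp add: grd_closed G.brk_add_left GV.scale_right_distrib)
  show "brk g x (scl g c y) = scl g c (brk g x y)"
    using a[of "scl g c y" n] a[OF assms(2)] assms by (simp add: grd_closed G.brk_scl_left mult.commute)
qed

lemma brk_0: assumes "x \<in> grd g m" "y \<in> grd g n"
  shows "x \<alpha> = 0 \<Longrightarrow> brk g x y \<alpha> = 0" "y \<alpha> = 0 \<Longrightarrow> brk g x y \<alpha> = 0"
proof -
  interpret O: dgla "obj S \<alpha>" by (rule dgla_obj)
  interpret OV: vector_space "scl (obj S \<alpha>)" by (rule O.vector_space)
  have z: "0 \<in> grd (obj S \<alpha>) l" for l using OV.subspace_0[OF O.subspace] .
  have l: "brk (obj S \<alpha>) 0 v = 0" if "v \<in> grd (obj S \<alpha>) l" for v l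
    using O.brk_add_left[OF z z that] by simp
  show "brk g x y \<alpha> = 0" if "x \<alpha> = 0" using l[OF grd_obj[OF assms(2)]] that by (simp add: comp)
  show "brk g x y \<alpha> = 0" if "y \<alpha> = 0"
    using l[OF grd_obj[OF assms(1)]] that O.brk_antisym[OF grd_obj[OF assms(1)] z, where n = n] by (simp add: comp)
qed

text \<open>
  A functional that factors through level \<open>\<alpha>\<close> has only finitely many coordinates there; the dual
  of the bracket is expanded in coordinates of the first argument.
\<close>

lemma level_basis:
  obtains B e a where "finite B" "\<And>b. b \<in> B \<Longrightarrow> e b \<in> grd g i" "\<And>b. b \<in> B \<Longrightarrow> a b \<in> dual g i"
    "\<And>x. x \<in> grd g i \<Longrightarrow> (x - (\<Sum>b\<in>B. scl g (a b x) (e b))) \<alpha> = 0" "grd (obj S \<alpha>) i = {0} \<Longrightarrow> B = ({} :: 'a set)"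
proof -
  interpret O: dgla "obj S \<alpha>" by (rule dgla_obj)
  interpret OV: vector_space "scl (obj S \<alpha>)" by (rule O.vector_space)
  define D where "D = (\<lambda>x. x \<alpha>) ` grd g i"
  have D: "D \<subseteq> grd (obj S \<alpha>) i" using grd_obj by (auto simp: D_def)
  obtain B where B: "B \<subseteq> D" "OV.independent B" "D \<subseteq> OV.span B" using OV.maximal_independent_subset by blast
  obtain C where C: "finite C" "grd (obj S \<alpha>) i \<subseteq> OV.span C" using fin_dim_obj unfolding fin_dim_def by blast
  have fin: "finite B" using OV.independent_span_bound[OF C(1) B(2)] B(1) C(2) D by blast
  define e where "e b = (SOME x. x \<in> grd g i \<and> x \<alpha> = b)" for b
  have e: "e b \<in> grd g i" "e b \<alpha> = b" if "b \<in> B" for b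
  proof -
    have "\<exists>x. x \<in> grd g i \<and> x \<alpha> = b" using that B(1) by (auto simp: D_def)
    from someI_ex[OF this] show "e b \<in> grd g i" "e b \<alpha> = b" unfolding e_def by blast+
  qed
  define a where "a b x = (if x \<in> grd g i then OV.representation B (x \<alpha>) b else 0)" for b x
  have xs: "x \<alpha> \<in> OV.span B" if "x \<in> grd g i" for x using that B(3) by (auto simp: D_def)
  have a: "a b \<in> dual g i" for b by (rule dualI[where \<alpha> = \<alpha>])
      (simp_all add: a_def grd_closed comp OV.representation_add[OF B(2) xs xs] OV.representation_scale[OF B(2) xs]
        OV.representation_zero)
  have main: "(x - (\<Sum>b\<in>B. scl g (a b x) (e b))) \<alpha> = 0" if x: "x \<in> grd g i" for x
  proof -
    have "(\<Sum>b\<in>B. scl g (a b x) (e b)) \<alpha> = (\<Sum>b\<in>B. scl (obj S \<alpha>) (OV.representation B (x \<alpha>) b) b)"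
      unfolding sum_fun_apply by (intro sum.cong) (simp_all add: comp e a_def x)
    also have "\<dots> = x \<alpha>" by (rule OV.sum_representation_eq[OF B(2) xs[OF x] fin subset_refl])
    finally show ?thesis by (simp add: comp)
  qed
  have emp: "B = {}" if "grd (obj S \<alpha>) i = {0}"
  proof -
    have "B \<subseteq> {0}" using B(1) D that by simp
    moreover have "0 \<notin> B" using OV.dependent_zero B(2) by metis
    ultimately show ?thesis by blast
  qed
  show thesis by (rule that[of B e a], rule fin, erule e(1), rule a, erule main, erule emp)
qed

text \<open>With \<open>\<phi>\<close> factoring through level \<open>\<alpha>\<close>, expanding
  \<open>x\<close> there gives
  \<open>\<phi> [x, y] = \<Sum> a\<^sub>b(x) \<phi> [e\<^sub>b, y]\<close>. The list is finite
  because level \<open>\<alpha>\<close> is finite-dimensional in each degree and has only finitely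
  many nonzero degrees.\<close>

lemma dual_brk_ex: assumes \<phi>: "\<phi> \<in> dual g n"
  shows "\<exists>ps. represents_dual_brk g n \<phi> ps"
proof -
  obtain \<alpha> where \<alpha>: "\<And>x. x \<in> grd g n \<Longrightarrow> x \<alpha> = 0 \<Longrightarrow> \<phi> x = 0" using dual_factor[OF \<phi>] le_refl by blast
  have "\<forall>i. \<exists>B e a. finite B \<and> (\<forall>b\<in>B. e b \<in> grd g i \<and> a b \<in> dual g i) \<and>
      (\<forall>x\<in>grd g i. (x - (\<Sum>b\<in>B. scl g (a b x) (e b))) \<alpha> = 0) \<and> (grd (obj S \<alpha>) i = {0} \<longrightarrow> B = ({} :: 'a set))"
  proof
    fix i
    obtain B :: "'a set" and e a where "finite B" "\<And>b. b \<in> B \<Longrightarrow> e b \<in> grd g i" "\<And>b. b \<in> B \<Longrightarrow> a b \<in> dual g i"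
      "\<And>x. x \<in> grd g i \<Longrightarrow> (x - (\<Sum>b\<in>B. scl g (a b x) (e b))) \<alpha> = 0" "grd (obj S \<alpha>) i = {0} \<Longrightarrow> B = {}"
      by (rule level_basis[of i \<alpha>]) (rule that)
    thus "\<exists>B e a. finite B \<and> (\<forall>b\<in>B. e b \<in> grd g i \<and> a b \<in> dual g i) \<and>
        (\<forall>x\<in>grd g i. (x - (\<Sum>b\<in>B. scl g (a b x) (e b))) \<alpha> = 0) \<and> (grd (obj S \<alpha>) i = {0} \<longrightarrow> B = ({} :: 'a set))"
      by (intro exI[of _ B] exI[of _ e] exI[of _ a]) simp
  qed
  from choice[OF this] obtain B :: "int \<Rightarrow> 'a set" where "\<forall>i. \<exists>e a. finite (B i) \<and> (\<forall>b\<in>B i. e b \<in> grd g i \<and> a b \<in> dual g i) \<and>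
      (\<forall>x\<in>grd g i. (x - (\<Sum>b\<in>B i. scl g (a b x) (e b))) \<alpha> = 0) \<and> (grd (obj S \<alpha>) i = {0} \<longrightarrow> B i = {})" ..
  from choice[OF this] obtain e where "\<forall>i. \<exists>a. finite (B i) \<and> (\<forall>b\<in>B i. e i b \<in> grd g i \<and> a b \<in> dual g i) \<and>
      (\<forall>x\<in>grd g i. (x - (\<Sum>b\<in>B i. scl g (a b x) (e i b))) \<alpha> = 0) \<and> (grd (obj S \<alpha>) i = {0} \<longrightarrow> B i = {})" ..
  from choice[OF this] obtain a where B': "\<forall>i. finite (B i) \<and> (\<forall>b\<in>B i. e i b \<in> grd g i \<and> a i b \<in> dual g i) \<and>
      (\<forall>x\<in>grd g i. (x - (\<Sum>b\<in>B i. scl g (a i b x) (e i b))) \<alpha> = 0) \<and> (grd (obj S \<alpha>) i = {0} \<longrightarrow> B i = {})" ..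
  have B: "\<And>i. finite (B i)" "\<And>i b. b \<in> B i \<Longrightarrow> e i b \<in> grd g i" "\<And>i b. b \<in> B i \<Longrightarrow> a i b \<in> dual g i"
    "\<And>i x. x \<in> grd g i \<Longrightarrow> (x - (\<Sum>b\<in>B i. scl g (a i b x) (e i b))) \<alpha> = 0" "\<And>i. grd (obj S \<alpha>) i = {0} \<Longrightarrow> B i = {}"
    using B' by blast+
  define c where "c i b y = (if y \<in> grd g (n - i) then \<phi> (brk g (e i b) y) else 0)" for i b y
  have bg: "brk g (e i b) y \<in> grd g n" if "b \<in> B i" "y \<in> grd g (n - i)" for i b y
    by (rule brk_closed[OF B(2)[OF that(1)] that(2)]) simp
  have c: "c i b \<in> dual g (n - i)" if b: "b \<in> B i" for i b
  proof (rule dualI[where \<alpha> = \<alpha>])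
    fix x assume x: "x \<in> grd g (n - i)"
    show "c i b (x + y) = c i b x + c i b y" if "y \<in> grd g (n - i)" for y
      using x that b by (simp add: c_def grd_closed brk_right[OF B(2)[OF b] x] dualD[OF \<phi>] bg)
    show "c i b (scl g r x) = r * c i b x" for r
      using x b by (simp add: c_def grd_closed brk_right[OF B(2)[OF b] x] dualD[OF \<phi>] bg)
    show "c i b x = 0" if "x \<alpha> = 0"
      using x b that by (simp add: c_def \<alpha> bg brk_0(2)[OF B(2)[OF b] x])
  qed (simp add: c_def)
  have key: "\<phi> (brk g x y) = (\<Sum>b\<in>B i. a i b x * c i b y)" if x: "x \<in> grd g i" and y: "y \<in> grd g (n - i)" for i x y
  proof -
    let ?x = "\<Sum>b\<in>B i. scl g (a i b x) (e i b)"
    have xg: "?x \<in> grd g i" by (intro grd_sum grd_closed B(2))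
    have b: "brk g x' y \<in> grd g n" if "x' \<in> grd g i" for x' by (rule brk_closed[OF that y]) simp
    have l: "brk g (\<Sum>b\<in>F. scl g (a i b x) (e i b)) y = (\<Sum>b\<in>F. scl g (a i b x) (brk g (e i b) y))" if "F \<subseteq> B i" for F
      using finite_subset[OF that B(1)] that
    proof (induction F rule: finite_induct)
      case empty
      show ?case using G.brk_add_left[OF grd_closed(1)[of i] grd_closed(1)[of i] y] by simp
    next
      case (insert b F)
      hence b: "b \<in> B i" and F: "F \<subseteq> B i" by auto
      have Fg: "(\<Sum>b\<in>F. scl g (a i b x) (e i b)) \<in> grd g i" using F by (intro grd_sum grd_closed B(2)) blast
      have "brk g (scl g (a i b x) (e i b) + (\<Sum>b\<in>F. scl g (a i b x) (e i b))) y =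
          scl g (a i b x) (brk g (e i b) y) + (\<Sum>b\<in>F. scl g (a i b x) (brk g (e i b) y))"
        using G.brk_add_left[OF grd_closed(3)[OF B(2)[OF b]] Fg y] G.brk_scl_left[OF B(2)[OF b] y] insert.IH[OF F]
        by simp
      thus ?case using insert.hyps by simp
    qed
    have "brk g (x - ?x) y \<alpha> = 0" by (rule brk_0(1)[OF grd_closed(4)[OF x xg] y B(4)[OF x]])
    hence "\<phi> (brk g (x - ?x) y) = 0" by (intro \<alpha> b grd_closed x xg)
    moreover have "brk g (x - ?x + ?x) y = brk g (x - ?x) y + brk g ?x y"
      by (rule G.brk_add_left[OF grd_closed(4)[OF x xg] xg y])
    ultimately have "\<phi> (brk g x y) = \<phi> (brk g ?x y)"
      using dualD(1)[OF \<phi> b b] x xg by (simp add: grd_closed)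
    also have "\<dots> = (\<Sum>b\<in>B i. \<phi> (scl g (a i b x) (brk g (e i b) y)))"
      unfolding l[OF subset_refl] by (rule dual_sum[OF \<phi>]) (simp add: grd_closed bg y)
    also have "\<dots> = (\<Sum>b\<in>B i. a i b x * c i b y)"
      by (intro sum.cong) (simp_all add: dualD(2)[OF \<phi>] bg y c_def)
    finally show ?thesis .
  qed
  have "finite {i. grd (obj S \<alpha>) i \<noteq> {0}}" using fin_dim_obj unfolding fin_dim_def by blast
  from finite_distinct_list[OF this] obtain il where il: "set il = {i. grd (obj S \<alpha>) i \<noteq> {0}}" "distinct il"
    by (elim exE conjE) (rule that)
  have "\<forall>i. \<exists>bl. set bl = B i \<and> distinct bl" by (intro allI finite_distinct_list B(1))
  from choice[OF this] obtain bl where "\<forall>i. set (bl i) = B i \<and> distinct (bl i)" ..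
  hence bl: "\<And>i. set (bl i) = B i" "\<And>i. distinct (bl i)" by simp_all
  define ps where "ps = concat (map (\<lambda>i. map (\<lambda>b. (i, a i b, c i b)) (bl i)) il)"
  have "represents_dual_brk g n \<phi> ps" unfolding represents_dual_brk_def
  proof (intro conjI allI ballI)
    show "case p of (i, a, b) \<Rightarrow> a \<in> dual g i \<and> b \<in> dual g (n - i)" if "p \<in> set ps" for p
      using that B(3) c by (auto simp: ps_def bl)
    fix i x y assume x: "x \<in> grd g i" and y: "y \<in> grd g (n - i)"
    have "(\<Sum>(i', a, b)\<leftarrow>ps. if i' = i then a x * b y else 0) =
        (\<Sum>j\<leftarrow>il. \<Sum>b\<leftarrow>bl j. if j = i then a j b x * c j b y else 0)"
      unfolding ps_def by (induction il) (simp_all add: comp_def)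
    also have "\<dots> = (\<Sum>j\<in>set il. if j = i then (\<Sum>b\<in>B i. a i b x * c i b y) else 0)"
      unfolding sum_list_distinct_conv_sum_set[OF il(2)] sum_list_distinct_conv_sum_set[OF bl(2)] bl
      by (intro sum.cong) auto
    also have "\<dots> = (\<Sum>b\<in>B i. a i b x * c i b y)"
    proof (cases "i \<in> set il")
      case True
      thus ?thesis by (simp add: sum.delta)
    next
      case False
      hence "B i = {}" using B(5)[of i] il(1) by blast
      moreover have "(\<Sum>j\<in>set il. if j = i then (\<Sum>b\<in>B i. a i b x * c i b y) else 0) = 0"
        using False by (intro sum.neutral) auto
      ultimately show ?thesis by simp
    qed
    finally show "\<phi> (brk g x y) = (\<Sum>(i', a, b)\<leftarrow>ps. if i' = i then a x * b y else 0)"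
      using key[OF x y] by simp
  qed
  thus ?thesis by blast
qed

lemma dual_brk: "\<phi> \<in> dual g n \<Longrightarrow> represents_dual_brk g n \<phi> (dual_brk g n \<phi>)"
  unfolding dual_brk_def using dual_brk_ex someI_ex by metis

lemma dual_elements: assumes A: "finite A" "A \<subseteq> dual g i" "\<not> module.dependent sc A"
  shows "\<exists>x. \<forall>b\<in>A. x b \<in> grd g i \<and> (\<forall>c\<in>A. c (x b) = (if c = b then 1 else 0))"
proof (rule linear_dual_elements[OF G.vector_space G.subspace A(1)])
  interpret F: vector_space "sc :: 'k \<Rightarrow> (('i \<Rightarrow> 'a) \<Rightarrow> 'k) \<Rightarrow> _" by (rule vector_space_sc)
  show "\<forall>b\<in>A. \<forall>x\<in>grd g i. (\<forall>y\<in>grd g i. b (x + y) = b x + b y) \<and> (\<forall>c. b (scl g c x) = c * b x)"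
    using A(2) dualD(1,2) by blast
  fix u assume 0: "\<forall>x\<in>grd g i. (\<Sum>b\<in>A. u b * b x) = 0"
  have "(\<Sum>b\<in>A. sc (u b) b) = 0"
  proof
    fix x
    have "(\<Sum>b\<in>A. u b * b x) = 0"
    proof (cases "x \<in> grd g i")
      case False
      thus ?thesis using A(2) dualD(3) by (intro sum.neutral) auto
    qed (use 0 in blast)
    thus "(\<Sum>b\<in>A. sc (u b) b) x = 0 x" by (simp add: sum_fun_apply fun_ap)
  qed
  thus "\<forall>b\<in>A. u b = 0" using A F.independentD[of A A u] by blast
qed

end

section \<open>Derivations of symmetric algebras\<close>

context graded_basis
begin

abbreviation "J \<equiv> symrel s W"
abbreviation "cl \<equiv> sym_class s W"

lemma symrel_wordsp: "a \<in> J \<Longrightarrow> a \<in> wordsp W"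
proof (induction rule: FA.span_induct)
  case (step r)
  have k: "word u \<in> wordsp W" if "u \<in> words W" for u :: "(int \<times> 'w) list" using that by (rule word_in)
  from step consider
    (a) u v n x y where "r = word (u @ [(n, x + y)] @ v) - word (u @ [(n, x)] @ v) - word (u @ [(n, y)] @ v)"
      "u \<in> words W" "v \<in> words W" "x \<in> W n" "y \<in> W n"
  | (b) u v n c x where "r = word (u @ [(n, s c x)] @ v) - fsmul c (word (u @ [(n, x)] @ v))" "u \<in> words W" "v \<in> words W" "x \<in> W n"
  | (c) u v m n x y where "r = word (u @ [(m, x), (n, y)] @ v) - fsmul ((-1) powi (m * n)) (word (u @ [(n, y), (m, x)] @ v))"
      "u \<in> words W" "v \<in> words W" "x \<in> W m" "y \<in> W n" unfolding sym_relators_def by blast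
  thus ?case
  proof cases
    case a
    have "x + y \<in> W n" using VS.subspace_add[OF W_sub] a by blast
    thus ?thesis unfolding a(1) using a by (intro FA.span_diff k) simp_all
  next
    case b
    have "s c x \<in> W n" using VS.subspace_scale[OF W_sub] b by blast
    thus ?thesis unfolding b(1) using b by (intro FA.span_diff FA.span_scale k) simp_all
  next
    case c
    thus ?thesis unfolding c(1) by (intro FA.span_diff FA.span_scale k) simp_all
  qed
qed (rule FA.subspaceI; simp add: FA.span_zero FA.span_add FA.span_scale)

lemma J_iff: "a \<in> wordsp W \<Longrightarrow> a \<in> J \<longleftrightarrow> Phi a = 0" using Phi_kernel Phi_symrel by blast

lemma cl_mem: "b \<in> cl a \<longleftrightarrow> b - a \<in> J" unfolding sym_class_def by (auto intro: exI[of _ "b - a"])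

lemma cl_eq: "cl a = cl b \<longleftrightarrow> a - b \<in> J"
proof
  assume "cl a = cl b"
  moreover have "a \<in> cl a" by (simp add: cl_mem FA.span_zero)
  ultimately show "a - b \<in> J" by (simp add: cl_mem)
next
  assume ab: "a - b \<in> J"
  have "c - a \<in> J \<longleftrightarrow> c - b \<in> J" for c
  proof
    assume "c - a \<in> J" from FA.span_add[OF this ab] show "c - b \<in> J" by simp
  next
    assume "c - b \<in> J" from FA.span_diff[OF this ab] show "c - a \<in> J" by simp
  qed
  thus "cl a = cl b" by (auto simp: cl_mem)
qed

lemma cl_self: "a \<in> cl a" by (simp add: cl_mem FA.span_zero)

lemma cl_Phi: "a \<in> wordsp W \<Longrightarrow> b \<in> wordsp W \<Longrightarrow> cl a = cl b \<longleftrightarrow> Phi a = Phi b"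
  using J_iff[OF FA.span_diff, of a b] by (simp add: cl_eq Phi_simps)

text \<open>On \<open>wordsp W\<close> the relators form the kernel of the multiplicative map
  \<open>Phi\<close>, hence an ideal.\<close>

lemma J_mult: "a \<in> J \<Longrightarrow> b \<in> wordsp W \<Longrightarrow> fmul a b \<in> J" "a \<in> J \<Longrightarrow> b \<in> wordsp W \<Longrightarrow> fmul b a \<in> J"
  using J_iff[OF fmul_wordsp] symrel_wordsp Phi_symrel by (simp_all add: Phi_fmul)

lemma part_sym: "part (sym_alg s W) n = cl ` wordspn W n" by (simp add: sym_alg_def)

lemma azero_sym: "azero (sym_alg s W) = cl 0" by (simp add: sym_alg_def)

lemma aadd_cl: "aadd (sym_alg s W) (cl a) (cl b) = cl (a + b)"
proof -
  have "{x + y | x y. x \<in> cl a \<and> y \<in> cl b} = cl (a + b)"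
  proof (intro equalityI subsetI)
    fix z assume "z \<in> {x + y | x y. x \<in> cl a \<and> y \<in> cl b}"
    then obtain x y where z: "z = x + y" "x - a \<in> J" "y - b \<in> J" by (auto simp: cl_mem)
    have "(x - a) + (y - b) \<in> J" by (intro FA.span_add z)
    thus "z \<in> cl (a + b)" by (simp add: cl_mem z algebra_simps)
  next
    fix z assume "z \<in> cl (a + b)"
    hence "z - b \<in> cl a" by (simp add: cl_mem algebra_simps)
    moreover have "z = (z - b) + b" by simp
    ultimately show "z \<in> {x + y | x y. x \<in> cl a \<and> y \<in> cl b}" using cl_self[of b] by blast
  qed
  thus ?thesis by (simp add: sym_alg_def)
qed

lemma asmul_cl: "asmul (sym_alg s W) c (cl a) = cl (fsmul c a)"
proof -
  have "cl (fsmul c x) = cl (fsmul c a)" if "x \<in> cl a" for x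
    using FA.span_scale[of "x - a" _ c] that by (simp add: cl_mem cl_eq FA.scale_right_diff_distrib)
  hence "(\<Union>x\<in>cl a. cl (fsmul c x)) = cl (fsmul c a)" using cl_self by blast
  thus ?thesis by (simp add: sym_alg_def)
qed

lemma amul_cl: assumes "a \<in> wordsp W" "b \<in> wordsp W"
  shows "amul (sym_alg s W) (cl a) (cl b) = cl (fmul a b)"
proof -
  have "cl (fmul x y) = cl (fmul a b)" if x: "x \<in> cl a" and y: "y \<in> cl b" for x y
  proof -
    have "x \<in> wordsp W" using FA.span_add[OF symrel_wordsp assms(1), of "x - a"] x by (simp add: cl_mem)
    hence "fmul x (y - b) \<in> J" using J_mult(2)[of "y - b" x] y by (simp add: cl_mem)
    moreover have "fmul (x - a) b \<in> J" using J_mult(1)[of "x - a" b] x assms by (simp add: cl_mem)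
    ultimately have "fmul x (y - b) + fmul (x - a) b \<in> J" by (rule FA.span_add)
    thus ?thesis by (simp add: cl_eq fmul_simps)
  qed
  hence "(\<Union>x\<in>cl a. \<Union>y\<in>cl b. cl (fmul x y)) = cl (fmul a b)" using cl_self by blast
  thus ?thesis by (simp add: sym_alg_def)
qed

end

text \<open>The Leibniz rule on a word, with the sign of moving an operator of degree 1 past the
  first letter.\<close>

primrec dword :: "(int \<Rightarrow> 'w \<Rightarrow> ('w, 'k::field) free_alg) \<Rightarrow> (int \<times> 'w) list \<Rightarrow> ('w, 'k) free_alg" where
  "dword \<delta> [] = 0"
| "dword \<delta> (l # u) = fmul (\<delta> (fst l) (snd l)) (word u) + fsmul (eps (fst l)) (fmul (word [l]) (dword \<delta> u))"

definition dfree :: "(int \<Rightarrow> 'w \<Rightarrow> ('w, 'k::field) free_alg) \<Rightarrow> ('w, 'k) free_alg \<Rightarrow> ('w, 'k) free_alg" where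
  "dfree \<delta> = lext fsmul (dword \<delta>)"

lemma dfree_simps: "dfree \<delta> (a + b) = dfree \<delta> a + dfree \<delta> b" "dfree \<delta> (fsmul c a) = fsmul c (dfree \<delta> a)"
  "dfree \<delta> (word u) = dword \<delta> u" "dfree \<delta> 0 = 0" "dfree \<delta> (a - b) = dfree \<delta> a - dfree \<delta> b"
  by (simp_all add: dfree_def lext_linear[OF vector_space_fsmul])

text \<open>Linearity of \<open>\<delta>\<close> is required modulo relators, because
  \<open>CE_II\<close> depends on the choice of a representing list in
  \<open>dual_brk\<close>.\<close>

locale sym_der = graded_basis s W B for s :: "'k::field_char_0 \<Rightarrow> 'w::ab_group_add \<Rightarrow> 'w" and W B +
  fixes \<delta> :: "int \<Rightarrow> 'w \<Rightarrow> ('w, 'k) free_alg"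
  assumes \<delta>_in: "x \<in> W n \<Longrightarrow> \<delta> n x \<in> wordspn W (n + 1)"
    and \<delta>_add: "x \<in> W n \<Longrightarrow> y \<in> W n \<Longrightarrow> \<delta> n (x + y) - (\<delta> n x + \<delta> n y) \<in> symrel s W"
    and \<delta>_scale: "x \<in> W n \<Longrightarrow> \<delta> n (s c x) - fsmul c (\<delta> n x) \<in> symrel s W"
begin

notation sp (infixl "\<star>" 70)

definition dB :: "bool \<times> int \<times> 'w \<Rightarrow> (bool \<times> int \<times> 'w) list \<Rightarrow> 'k" where
  "dB l = (if l \<in> VL then Phi (\<delta> (fst (snd l)) (snd (snd l))) else 0)"

lemma dB_hom: "hom (ldeg l + 1) (dB l)"
  using Phi_hom[OF \<delta>_in] B_W by (auto simp: dB_def hom_closed subset_iff)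

lemma dB_Lam: "dB l \<in> Lam"
  using Phi_Lam(1)[OF wordspn_sub[OF \<delta>_in]] B_W by (auto simp: dB_def Lam_closed subset_iff)

lemma Phi_\<delta>_add: "x \<in> W n \<Longrightarrow> y \<in> W n \<Longrightarrow> Phi (\<delta> n (x + y)) = Phi (\<delta> n x) + Phi (\<delta> n y)"
  using Phi_symrel[OF \<delta>_add[of x n y]] by (simp add: Phi_simps)

lemma Phi_\<delta>_scale: "x \<in> W n \<Longrightarrow> Phi (\<delta> n (s c x)) = sc c (Phi (\<delta> n x))"
  using Phi_symrel[OF \<delta>_scale[of x n c]] by (simp add: Phi_simps)

lemma Phi_\<delta>_sum: assumes "finite S" "S \<subseteq> W n"
  shows "Phi (\<delta> n (\<Sum>b\<in>S. s (c b) b)) = (\<Sum>b\<in>S. sc (c b) (Phi (\<delta> n b)))" using assms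
proof (induction S rule: finite_induct)
  case empty
  have "0 \<in> W n" using VS.subspace_0[OF W_sub] .
  from Phi_\<delta>_scale[OF this, of 0] show ?case by simp
next
  case (insert x S)
  have "(\<Sum>b\<in>S. s (c b) b) \<in> W n" using insert by (intro VS.subspace_sum[OF W_sub] VS.subspace_scale[OF W_sub]) auto
  thus ?case using insert Phi_\<delta>_add[of "s (c x) x" n] Phi_\<delta>_scale[of x n] VS.subspace_scale[OF W_sub]
    by simp
qed

lemma der_gen: "x \<in> W n \<Longrightarrow> der dB (gen n x) = Phi (\<delta> n x)"
proof -
  assume x: "x \<in> W n"
  have b: "b \<in> B n" "b \<in> W n" if "b \<in> bsupp n x" for b using that bsupp(2) B_W by blast+
  have "der dB (gen n x) = (\<Sum>b\<in>bsupp n x. sc (VS.representation (B n) x b) (dB (False, n, b)))"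
    unfolding gen_expand[OF x] by (subst der_sum) (simp_all add: Lam_closed der_sc)
  also have "\<dots> = (\<Sum>b\<in>bsupp n x. sc (VS.representation (B n) x b) (Phi (\<delta> n b)))"
    by (intro sum.cong) (simp_all add: dB_def b)
  also have "\<dots> = Phi (\<delta> n (\<Sum>b\<in>bsupp n x. s (VS.representation (B n) x b) b))"
    by (rule Phi_\<delta>_sum[symmetric]) (use bsupp(1) b in auto)
  finally show ?thesis by (simp add: bsupp_sum[OF x])
qed

lemma Phi_dword: "u \<in> words W \<Longrightarrow> Phi (dword \<delta> u) = der dB (phw u)"
proof (induction u)
  case (Cons l u)
  hence x: "snd l \<in> W (fst l)" and u: "u \<in> words W" by simp_all
  have "der dB (phw (l # u)) = Phi (\<delta> (fst l) (snd l)) \<star> phw u + twist 1 (gen (fst l) (snd l)) \<star> der dB (phw u)"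
    using der_sp[OF dB_hom gen_Lam[OF x] phw_Lam[OF u]] der_gen[OF x] by simp
  also have "twist 1 (gen (fst l) (snd l)) = sc (eps (fst l)) (gen (fst l) (snd l))"
    using hom_twist[OF gen_hom[OF x], of 1] by simp
  finally show ?case using Cons.IH[OF u] by (simp add: Phi_simps Phi_fmul sp_sc_left)
qed (simp add: Phi_simps)

text \<open>Both sides are derivations along \<open>Phi\<close> that agree on letters. Hence
  \<open>dfree\<close> preserves the relators (\<open>dfree_J\<close>) and descends to
  classes.\<close>

lemma Phi_dfree: assumes "a \<in> wordsp W" shows "Phi (dfree \<delta> a) = der dB (Phi a)"
proof -
  have "\<forall>u\<in>keys a. u \<in> words W" using assms by (simp add: span_words)
  moreover have fs: "f \<in> Lam \<Longrightarrow> finsupp f" for f by (simp add: Lam_def)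
  ultimately have "Phi a \<in> Lam \<and> Phi (dfree \<delta> a) = der dB (Phi a)"
    by (induction rule: free_induct_on)
      (auto simp: Phi_simps dfree_simps Phi_dword Lam_closed phw_Lam der_sc der_add[OF fs fs])
  thus ?thesis ..
qed

lemma dword_in: "u \<in> words W \<Longrightarrow> dword \<delta> u \<in> wordspn W (word_degree u + 1)"
proof (induction u)
  case (Cons l u)
  hence x: "snd l \<in> W (fst l)" and u: "u \<in> words W" by simp_all
  have "word u \<in> wordspn W (word_degree u)" "word [l] \<in> wordspn W (fst l)"
    using x u by (auto intro!: word_in)
  hence "fmul (\<delta> (fst l) (snd l)) (word u) \<in> wordspn W (fst l + 1 + word_degree u)"
    "fmul (word [l]) (dword \<delta> u) \<in> wordspn W (fst l + (word_degree u + 1))"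
    using fmul_wordspn[OF \<delta>_in[OF x]] fmul_wordspn[OF _ Cons.IH[OF u]] by blast+
  thus ?case by (auto intro!: FA.span_add FA.span_scale simp: algebra_simps)
qed (simp add: FA.span_zero)

lemma dfree_in: assumes "a \<in> wordspn W n" shows "dfree \<delta> a \<in> wordspn W (n + 1)"
  using assms by (induction rule: free_span_induct)
      (auto simp: dfree_simps FA.span_zero FA.span_add FA.span_scale dest: dword_in)

lemma dfree_wordsp: assumes "a \<in> wordsp W" shows "dfree \<delta> a \<in> wordsp W"
  using assms by (induction rule: free_span_induct)
      (auto simp: dfree_simps FA.span_zero FA.span_add FA.span_scale dest: wordspn_sub[OF dword_in])

lemma dfree_J: "a \<in> J \<Longrightarrow> dfree \<delta> a \<in> J"
  using J_iff[OF dfree_wordsp] Phi_dfree symrel_wordsp Phi_symrel by simp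

lemma dfree_cl: "cl a = cl b \<Longrightarrow> cl (dfree \<delta> a) = cl (dfree \<delta> b)"
  using dfree_J[of "a - b"] by (simp add: cl_eq dfree_simps)

lemma dfree_leibniz: assumes a: "a \<in> wordspn W m" and b: "b \<in> wordspn W n"
  shows "cl (dfree \<delta> (fmul a b)) = cl (fmul (dfree \<delta> a) b + fsmul (eps m) (fmul a (dfree \<delta> b)))"
proof -
  have w: "a \<in> wordsp W" "b \<in> wordsp W" using a b wordspn_sub by blast+
  have "Phi (dfree \<delta> (fmul a b)) = der dB (Phi a \<star> Phi b)"
    by (simp add: Phi_dfree fmul_wordsp w Phi_fmul)
  also have "\<dots> = der dB (Phi a) \<star> Phi b + twist 1 (Phi a) \<star> der dB (Phi b)"
    by (rule der_sp[OF dB_hom]) (simp_all add: Phi_Lam w)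
  also have "twist 1 (Phi a) = sc (eps m) (Phi a)" using hom_twist[OF Phi_hom[OF a], of 1] by simp
  finally have "Phi (dfree \<delta> (fmul a b)) = Phi (fmul (dfree \<delta> a) b + fsmul (eps m) (fmul a (dfree \<delta> b)))"
    by (simp add: Phi_simps Phi_fmul Phi_dfree w sp_sc_left)
  thus ?thesis by (subst cl_Phi) (auto intro!: dfree_wordsp fmul_wordsp FA.span_add FA.span_scale w)
qed

text \<open>Existence comes from \<open>dfree\<close>, uniqueness from the Leibniz rule on words;
  the value 0 off the homogeneous classes pins down the function that \<open>THE\<close>
  selects.\<close>

theorem sym_derivation_cl:
  assumes "a \<in> wordspn W n" shows "sym_derivation s W \<delta> (cl a) = cl (dfree \<delta> a)"
proof -
  let ?A = "sym_alg s W"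
  define P where "P d \<longleftrightarrow> is_derivation ?A d \<and> (\<forall>n. \<forall>x\<in>W n. d (cl (word [(n, x)])) = cl (\<delta> n x)) \<and>
    (\<forall>X. X \<notin> (\<Union>n. part ?A n) \<longrightarrow> d X = azero ?A)" for d
  define d0 where "d0 X = (if X \<in> (\<Union>n. part ?A n) then cl (dfree \<delta> (SOME a. cl a = X)) else azero ?A)" for X
  have d0: "d0 (cl a) = cl (dfree \<delta> a)" if "a \<in> wordspn W n" for a n
  proof -
    have "cl (SOME b. cl b = cl a) = cl a" by (rule someI[of _ a]) simp
    hence "cl (dfree \<delta> (SOME b. cl b = cl a)) = cl (dfree \<delta> a)" by (rule dfree_cl)
    moreover have "cl a \<in> (\<Union>n. part ?A n)" using that by (auto simp: part_sym)
    ultimately show ?thesis by (simp add: d0_def)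
  qed
  have w: "word [(n, x)] \<in> wordspn W n" if "x \<in> W n" for n x using that by (auto intro!: word_in)
  have "P d0" unfolding P_def is_derivation_def
  proof (intro conjI allI ballI impI)
    fix n X assume "X \<in> part ?A n"
    then obtain a where a: "X = cl a" "a \<in> wordspn W n" by (auto simp: part_sym)
    show "d0 X \<in> part ?A (n + 1)" using a d0[OF a(2)] dfree_in[OF a(2)] by (simp add: part_sym)
    show "d0 (asmul ?A c X) = asmul ?A c (d0 X)" for c
      using a d0[OF a(2)] d0[OF FA.span_scale[OF a(2)]] by (simp add: asmul_cl dfree_simps)
    fix Y
    show "d0 (aadd ?A X Y) = aadd ?A (d0 X) (d0 Y)" if "Y \<in> part ?A n"
    proof -
      from that obtain b where b: "Y = cl b" "b \<in> wordspn W n" by (auto simp: part_sym)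
      show ?thesis using a b d0[OF a(2)] d0[OF b(2)] d0[OF FA.span_add[OF a(2) b(2)]] by (simp add: aadd_cl dfree_simps)
    qed
    fix m
    show "d0 (amul ?A X Y) = aadd ?A (amul ?A (d0 X) Y) (asmul ?A ((-1) powi n) (amul ?A X (d0 Y)))" if "Y \<in> part ?A m"
    proof -
      from that obtain b where b: "Y = cl b" "b \<in> wordspn W m" by (auto simp: part_sym)
      have ws: "a \<in> wordsp W" "b \<in> wordsp W" using a b wordspn_sub by blast+
      show ?thesis using dfree_leibniz[OF a(2) b(2)] d0[OF fmul_wordspn[OF a(2) b(2)]]
        by (simp add: a(1) b(1) d0[OF a(2)] d0[OF b(2)] amul_cl ws dfree_wordsp asmul_cl aadd_cl powi_eps)
    qed
  next
    fix n x assume x: "x \<in> W n"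
    show "d0 (cl (word [(n, x)])) = cl (\<delta> n x)"
      using d0[OF w[OF x]] by (simp add: dfree_simps fmul_simps fmul_one)
  next
    fix X assume "X \<notin> (\<Union>n. part ?A n)" thus "d0 X = azero ?A" by (simp add: d0_def)
  qed
  moreover have "d = d0" if d: "P d" for d
  proof
    fix X
    have der: "is_derivation ?A d" and dl: "\<And>n x. x \<in> W n \<Longrightarrow> d (cl (word [(n, x)])) = cl (\<delta> n x)"
      and off: "\<And>X. X \<notin> (\<Union>n. part ?A n) \<Longrightarrow> d X = azero ?A" using d unfolding P_def by blast+
    have d1: "d X \<in> part ?A (n + 1)" if "X \<in> part ?A n" for X n using der that unfolding is_derivation_def by blast
    have da: "d (aadd ?A X Y) = aadd ?A (d X) (d Y)" if "X \<in> part ?A n" "Y \<in> part ?A n" for X Y n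
      using der that unfolding is_derivation_def by blast
    have ds: "d (asmul ?A c X) = asmul ?A c (d X)" if "X \<in> part ?A n" for X c n
      using der that unfolding is_derivation_def by blast
    have dm: "d (amul ?A X Y) = aadd ?A (amul ?A (d X) Y) (asmul ?A ((-1) powi m) (amul ?A X (d Y)))"
      if "X \<in> part ?A m" "Y \<in> part ?A n" for X Y m n
      using der that unfolding is_derivation_def by blast
    have pt: "cl a \<in> part ?A n" if "a \<in> wordspn W n" for a n using that by (simp add: part_sym)
    have dw: "d (cl (word u)) = cl (dword \<delta> u)" if "u \<in> words W" for u using that
    proof (induction u)
      \<comment> \<open>\<open>d 1 = d (1 * 1) = d 1 + d 1\<close> forces
        \<open>d 1 = 0\<close>.\<close>
      case Nil
      have n: "(word [] :: ('w, 'k) free_alg) \<in> wordspn W 0" by (auto intro!: word_in)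
      from d1[OF pt[OF n]] obtain b where b: "d (cl (word [])) = cl b" "b \<in> wordspn W (0 + 1)" by (auto simp: part_sym)
      have "d (cl (word [])) = cl (b + b)"
        using dm[OF pt[OF n] pt[OF n]] wordspn_sub[OF n] wordspn_sub[OF b(2)]
        by (simp add: b(1) amul_cl fmul_one asmul_cl aadd_cl)
      hence "b - (b + b) \<in> J" by (simp only: b(1) cl_eq)
      hence "b - 0 \<in> J" using FA.span_neg[of "b - (b + b)"] by simp
      thus ?case by (simp only: b(1) cl_eq dword.simps)
    next
      case (Cons l u)
      hence x: "snd l \<in> W (fst l)" and u: "u \<in> words W" by simp_all
      have lw: "(word [l] :: ('w, 'k) free_alg) \<in> wordspn W (fst l)" and uw: "(word u :: ('w, 'k) free_alg) \<in> wordspn W (word_degree u)"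
        using x u by (auto intro!: word_in)
      have dl': "d (cl (word [l])) = cl (\<delta> (fst l) (snd l))" using dl[OF x] by simp
      have "cl (word (l # u)) = amul ?A (cl (word [l])) (cl (word u))"
        using wordspn_sub[OF lw] wordspn_sub[OF uw] by (simp add: amul_cl fmul_simps)
      thus ?case
        using dm[OF pt[OF lw] pt[OF uw]] wordspn_sub[OF lw] wordspn_sub[OF uw] wordspn_sub[OF \<delta>_in[OF x]] wordspn_sub[OF dword_in[OF u]]
        by (simp add: dl' Cons.IH[OF u] amul_cl asmul_cl aadd_cl powi_eps)
    qed
    have dc: "d (cl a) = cl (dfree \<delta> a)" if "a \<in> wordspn W n" for a n
    proof -
      from that have "a \<in> wordspn W n \<and> d (cl a) = cl (dfree \<delta> a)"
      proof (induction rule: free_span_induct)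
        case zero
        have "word [] \<in> wordspn W 0" by (auto intro!: word_in)
        from ds[OF pt[OF this], of 0] d1[OF pt[OF this]] show ?case
          by (auto simp: asmul_cl part_sym dfree_simps FA.span_zero)
      next
        case (add a b)
        thus ?case using da[OF pt pt, of a n b] by (auto simp: aadd_cl dfree_simps FA.span_add)
      next
        case (scale c a)
        thus ?case using ds[OF pt, of a n c] by (auto simp: asmul_cl dfree_simps FA.span_scale)
      next
        case (word u)
        thus ?case using dw[of u] by (auto simp: dfree_simps intro!: word_in)
      qed
      thus ?thesis ..
    qed
    show "d X = d0 X"
    proof (cases "X \<in> (\<Union>n. part ?A n)")
      case True
      then obtain n a where "X = cl a" "a \<in> wordspn W n" by (auto simp: part_sym)
      thus ?thesis using dc d0 by simp
    next
      case False
      thus ?thesis using off by (simp add: d0_def)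
    qed
  qed
  ultimately have "(THE d. P d) = d0" by (rule the_equality)
  hence "sym_derivation s W \<delta> = d0" unfolding sym_derivation_def P_def .
  thus ?thesis using d0[OF assms] by simp
qed

end

section \<open>The Chevalley--Eilenberg differential\<close>

text \<open>The shuffle product at a word is built from values at subwords and from degrees of
  letters, so a degree-preserving renaming commutes with it. This compares evaluations over
  different alphabets.\<close>

lemma sp_subst:
  fixes f1 g1 :: "'b list \<Rightarrow> 'k::field_char_0" and f2 g2 :: "'c list \<Rightarrow> 'k"
  assumes "\<And>l. l \<in> A \<Longrightarrow> deg1 (\<tau> l) = deg2 l" "set w \<subseteq> A"
    and "\<And>v. set v \<subseteq> A \<Longrightarrow> f1 (map \<tau> v) = f2 v" "\<And>v. set v \<subseteq> A \<Longrightarrow> g1 (map \<tau> v) = g2 v"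
  shows "shuffle_algebra.sp deg1 f1 g1 (map \<tau> w) = shuffle_algebra.sp deg2 f2 g2 w"
proof -
  interpret D1: shuffle_algebra deg1 "TYPE('k)" .
  interpret D2: shuffle_algebra deg2 "TYPE('k)" .
  have ws: "wsum deg1 (map \<tau> v) = wsum deg2 v" if "set v \<subseteq> A" for v
    using that by (induction v) (auto simp: assms(1))
  show ?thesis using assms(2-)
  proof (induction w arbitrary: f1 f2 g1 g2)
    case Nil
    thus ?case by (metis D1.sp_nil D2.sp_nil list.simps(8))
  next
    case (Cons b w)
    have b: "b \<in> A" "set w \<subseteq> A" using Cons.prems(1) by auto
    have c: "f (\<tau> b # map \<tau> v) = h (b # v)" if "\<And>v. set v \<subseteq> A \<Longrightarrow> f (map \<tau> v) = h v" "set v \<subseteq> A" for f :: "'b list \<Rightarrow> 'k" and h v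
      using that(1)[of "b # v"] that(2) b by simp
    have "D1.sp (ldel (\<tau> b) f1) g1 (map \<tau> w) = D2.sp (ldel b f2) g2 w"
      by (rule Cons.IH[OF b(2)]) (simp_all add: ldel_def c[of f1 f2] Cons.prems)
    moreover have "D1.sp (D1.twist (deg1 (\<tau> b)) f1) (ldel (\<tau> b) g1) (map \<tau> w) = D2.sp (D2.twist (deg2 b) f2) (ldel b g2) w"
      by (rule Cons.IH[OF b(2)]) (simp_all add: ldel_def c[of g1 g2] Cons.prems D1.twist_def D2.twist_def ws assms(1) b)
    ultimately show ?case by (simp add: D1.sp_cons D2.sp_cons)
  qed
qed

lemma span_sum_list: "(\<And>x. x \<in> set xs \<Longrightarrow> f x \<in> FA.span S) \<Longrightarrow> sum_list (map f xs) \<in> FA.span S"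
  by (induction xs) (auto simp: FA.span_zero FA.span_add)

lemma (in sym_eval) Phi_at: "Phi (a + b) w = Phi a w + Phi b w" "Phi (a - b) w = Phi a w - Phi b w"
  "Phi (fsmul c a) w = c * Phi a w" "Phi 0 w = 0" "Phi (word u) w = phw u w"
  by (simp_all add: Phi_simps fun_ap)

text \<open>The shift by one is the suspension: a letter of degree \<open>n\<close> is an element of
  degree \<open>n - 1\<close> of \<open>g\<close>.\<close>

definition valid :: "('a::ab_group_add, 'k::field) top_dgla \<Rightarrow> int \<times> 'a \<Rightarrow> bool" where
  "valid g l \<longleftrightarrow> snd l \<in> grd g (fst l - 1)"

text \<open>Evaluates functionals at elements, without a basis. The test on \<open>valid\<close>
  makes every function \<open>M.Phi a\<close> vanish at words with other letters, see
  \<open>Phi_valid\<close>.\<close>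

definition ev2 :: "('a::ab_group_add, 'k::field) top_dgla \<Rightarrow> int \<Rightarrow> ('a \<Rightarrow> 'k) \<Rightarrow> int \<times> 'a \<Rightarrow> 'k" where
  "ev2 g n \<phi> l = (if fst l = n \<and> valid g l then \<phi> (snd l) else 0)"

sublocale complete_dg \<subseteq> M: sym_eval "fst :: int \<times> ('i \<Rightarrow> 'a) \<Rightarrow> int" "TYPE('k)" sc "susp_dual g" "ev2 g"
  by unfold_locales (auto simp: ev2_def fun_ap split: if_splits)

context complete_dg
begin

abbreviation "Wg \<equiv> susp_dual g"

notation M.sp (infixl "\<star>" 70)

abbreviation "J \<equiv> symrel sc Wg"
abbreviation "cl \<equiv> sym_class sc Wg"

lemma basis_ex: "\<exists>B. graded_basis sc Wg B"
proof -
  interpret F: vector_space "sc :: 'k \<Rightarrow> (('i \<Rightarrow> 'a) \<Rightarrow> 'k) \<Rightarrow> _" by (rule vector_space_sc)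
  have "\<forall>n. \<exists>B\<subseteq>Wg n. F.independent B \<and> Wg n \<subseteq> F.span B" using F.maximal_independent_subset by metis
  from choice[OF this] obtain B where "\<forall>n. B n \<subseteq> Wg n \<and> F.independent (B n) \<and> Wg n \<subseteq> F.span (B n)" by blast
  hence "graded_basis sc Wg B" by unfold_locales (simp_all add: susp_dual_def dual_subspace)
  thus ?thesis by (rule exI[of _ B])
qed

lemma phw_valid: "M.phw u w \<noteq> 0 \<Longrightarrow> \<forall>l\<in>set w. valid g l"
proof (induction u arbitrary: w)
  case (Cons l u)
  have "supp (M.phw (l # u)) (\<lambda>w. \<forall>l\<in>set w. valid g l)" unfolding M.phw.simps
  proof (rule M.supp_sp)
    show "supp (M.gen (fst l) (snd l)) (\<lambda>w. \<forall>l\<in>set w. valid g l)"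
      by (auto simp: supp_def M.gen_def ev2_def split: list.splits if_splits)
    show "supp (M.phw u) (\<lambda>w. \<forall>l\<in>set w. valid g l)" using Cons.IH by (auto simp: supp_def)
  qed (auto simp: set_shuffles)
  from suppD[OF this Cons.prems] show ?case .
qed (auto simp: onef_def split: if_splits)

lemma Phi_valid: "M.Phi a w \<noteq> 0 \<Longrightarrow> l \<in> set w \<Longrightarrow> valid g l"
proof -
  have "supp (M.Phi a) (\<lambda>w. \<forall>l\<in>set w. valid g l)"
    by (induction a rule: free_induct) (auto simp: M.Phi_simps supp_closed, auto simp: supp_def phw_valid)
  thus "M.Phi a w \<noteq> 0 \<Longrightarrow> l \<in> set w \<Longrightarrow> valid g l" using suppD by fastforce
qed

text \<open>At elements dual to the basis functionals in \<open>A\<close>, a functional takes its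
  coordinates as values; the letters to be dualised are the finitely many occurring in
  \<open>a\<close> and \<open>w\<close>.\<close>

lemma Phi_dual_elements:
  fixes X :: "int \<Rightarrow> (('i \<Rightarrow> 'a) \<Rightarrow> 'k) \<Rightarrow> ('i \<Rightarrow> 'a)"
  assumes B: "graded_basis sc Wg B" and a: "a \<in> wordsp Wg"
    and A: "A \<subseteq> {l. \<not> fst l \<and> snd (snd l) \<in> B (fst (snd l))}" "set w \<subseteq> A"
      "\<And>u m \<phi>. u \<in> keys a \<Longrightarrow> (m, \<phi>) \<in> set u \<Longrightarrow> (\<lambda>b. (False, m, b)) ` graded_basis.bsupp sc B m \<phi> \<subseteq> A"
    and X: "\<And>n b. (False, n, b) \<in> A \<Longrightarrow> X n b \<in> grd g (n - 1)"
      "\<And>n b c. (False, n, b) \<in> A \<Longrightarrow> (False, n, c) \<in> A \<Longrightarrow> c (X n b) = (if c = b then 1 else 0)"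
  shows "M.Phi a (map (\<lambda>l. (fst (snd l), X (fst (snd l)) (snd (snd l)))) w) = sym_eval.Phi ldeg (coord sc B) a w"
proof -
  interpret GB: graded_basis sc Wg B by fact
  have ka: "\<forall>u\<in>keys a. u \<in> words Wg" using a by (simp add: span_words)
  define L where "L = (\<Union>u\<in>keys a. set u)"
  have L: "\<And>n \<phi>. (n, \<phi>) \<in> L \<Longrightarrow> \<phi> \<in> Wg n" using ka by (auto simp: L_def words_def)
  define \<tau> where "\<tau> l = (fst (snd l), X (fst (snd l)) (snd (snd l)))" for l :: "bool \<times> int \<times> (('i \<Rightarrow> 'a) \<Rightarrow> 'k)"
  have ev: "ev2 g m \<phi> (\<tau> l) = coord sc B m \<phi> l" if l: "l \<in> A" and p: "(m, \<phi>) \<in> L" for l m \<phi>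
  proof -
    obtain n b where nb: "l = (False, n, b)" using l A(1) by (cases l) auto
    have xg: "X n b \<in> grd g (n - 1)" using X(1) l nb by blast
    show ?thesis
    proof (cases "m = n")
      case True
      have pW: "\<phi> \<in> Wg n" using L[OF p] True by simp
      have sub: "(False, n, c) \<in> A" if "c \<in> GB.bsupp n \<phi>" for c using that p True A(3) by (fastforce simp: L_def)
      have "\<phi> (X n b) = (\<Sum>c\<in>GB.bsupp n \<phi>. sc (GB.VS.representation (B n) \<phi> c) c) (X n b)"
        by (simp only: GB.bsupp_sum[OF pW])
      also have "\<dots> = (\<Sum>c\<in>GB.bsupp n \<phi>. GB.VS.representation (B n) \<phi> c * c (X n b))"
        by (simp only: sum_fun_apply fun_ap)
      also have "\<dots> = (\<Sum>c\<in>GB.bsupp n \<phi>. if c = b then GB.VS.representation (B n) \<phi> b else 0)"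
      proof (rule sum.cong[OF refl])
        fix c assume c: "c \<in> GB.bsupp n \<phi>"
        have "c (X n b) = (if c = b then 1 else 0)" by (rule X(2)) (use sub[OF c] l nb in auto)
        thus "GB.VS.representation (B n) \<phi> c * c (X n b) = (if c = b then GB.VS.representation (B n) \<phi> b else 0)" by simp
      qed
      also have "\<dots> = GB.VS.representation (B n) \<phi> b"
        using GB.bsupp(1)[of n \<phi>] by (simp add: GB.bsupp_def)
      finally show ?thesis using xg True by (simp add: ev2_def valid_def coord_def \<tau>_def nb)
    qed (simp add: ev2_def coord_def \<tau>_def nb)
  qed
  have phw: "M.phw u (map \<tau> v) = GB.phw u v" if "set u \<subseteq> L" "set v \<subseteq> A" for u v using that
  proof (induction u arbitrary: v)
    case (Cons l u)
    have ge: "M.gen (fst l) (snd l) (map \<tau> v) = GB.gen (fst l) (snd l) v" if "set v \<subseteq> A" for v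
      unfolding M.gen_def GB.gen_def
      using that ev[of _ "fst l" "snd l"] Cons.prems by (auto split: list.splits)
    have dg: "fst (\<tau> l) = ldeg l" if "l \<in> A" for l using that A(1) by (auto simp: \<tau>_def)
    show ?case unfolding M.phw.simps GB.phw.simps
      by (rule sp_subst[where A = A]) (use dg ge Cons in simp_all)
  qed (auto simp: onef_def)
  have "\<forall>u\<in>keys a. set u \<subseteq> L" by (auto simp: L_def)
  hence "M.Phi a (map \<tau> w) = GB.Phi a w"
    by (induction rule: free_induct_on) (simp_all add: M.Phi_at GB.Phi_at phw[OF _ A(2)])
  thus ?thesis by (simp add: \<tau>_def[abs_def])
qed

lemma dual_elements_ex:
  assumes B: "graded_basis sc Wg B" and A: "finite A" "A \<subseteq> {l. \<not> fst l \<and> snd (snd l) \<in> B (fst (snd l))}"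
  shows "\<exists>X. \<forall>n. \<forall>b\<in>{b. (False, n, b) \<in> A}. X n b \<in> grd g (n - 1) \<and>
      (\<forall>c\<in>{b. (False, n, b) \<in> A}. c (X n b) = (if c = b then 1 else 0))"
proof -
  interpret GB: graded_basis sc Wg B by fact
  have "\<forall>n. \<exists>x. \<forall>b\<in>{b. (False, n, b) \<in> A}. x b \<in> grd g (n - 1) \<and>
      (\<forall>c\<in>{b. (False, n, b) \<in> A}. c (x b) = (if c = b then 1 else 0))"
  proof
    fix n
    have "{b. (False, n, b) \<in> A} \<subseteq> (\<lambda>l. snd (snd l)) ` A" by force
    hence "finite {b. (False, n, b) \<in> A}" using A(1) finite_surj by blast
    moreover have sub: "{b. (False, n, b) \<in> A} \<subseteq> B n" using A(2) by auto
    hence "{b. (False, n, b) \<in> A} \<subseteq> dual g (n - 1)" using GB.B_W[of n] by (auto simp: susp_dual_def)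
    moreover have "\<not> module.dependent sc {b. (False, n, b) \<in> A}"
      using GB.VS.dependent_mono[OF _ sub] GB.B_ind by blast
    ultimately show "\<exists>x. \<forall>b\<in>{b. (False, n, b) \<in> A}. x b \<in> grd g (n - 1) \<and>
      (\<forall>c\<in>{b. (False, n, b) \<in> A}. c (x b) = (if c = b then 1 else 0))" by (rule dual_elements)
  qed
  from choice[OF this] show ?thesis .
qed

lemma letters_finite:
  assumes B: "graded_basis sc Wg B" and A0: "finite A0" "A0 \<subseteq> {l. \<not> fst l \<and> snd (snd l) \<in> B (fst (snd l))}"
  obtains A where "finite A" "A0 \<subseteq> A" "A \<subseteq> {l. \<not> fst l \<and> snd (snd l) \<in> B (fst (snd l))}"
    "\<And>u m \<phi>. u \<in> keys a \<Longrightarrow> (m, \<phi>) \<in> set u \<Longrightarrow> (\<lambda>b. (False, m, b)) ` graded_basis.bsupp sc B m \<phi> \<subseteq> A"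
proof -
  interpret GB: graded_basis sc Wg B by fact
  show thesis
  proof (rule that)
    let ?A = "A0 \<union> (\<Union>(n, \<phi>)\<in>(\<Union>u\<in>keys a. set u). (\<lambda>b. (False, n, b)) ` GB.bsupp n \<phi>)"
    show "finite ?A" using A0(1) GB.bsupp(1) by auto
    show "?A \<subseteq> GB.VL" using A0(2) GB.bsupp(2)[THEN subsetD] by auto
  qed auto
qed

text \<open>Every coordinate of \<open>a\<close> is a value at dual elements, so vanishing at all
  elements implies vanishing in coordinates, where \<open>Phi_kernel\<close> applies.\<close>

theorem M_kernel:
  assumes a: "a \<in> wordsp Wg" and 0: "M.Phi a = 0" shows "a \<in> J"
proof -
  obtain B where B: "graded_basis sc Wg B" using basis_ex by blast
  then interpret GB: graded_basis sc Wg B .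
  have "GB.Phi a w = 0" if w: "set w \<subseteq> GB.VL" for w
  proof -
    obtain A where A: "finite A" "set w \<subseteq> A" "A \<subseteq> GB.VL"
      "\<And>u m \<phi>. u \<in> keys a \<Longrightarrow> (m, \<phi>) \<in> set u \<Longrightarrow> (\<lambda>b. (False, m, b)) ` GB.bsupp m \<phi> \<subseteq> A"
      by (rule letters_finite[OF B List.finite_set w, of a]) (rule that)
    obtain X where X: "\<forall>n. \<forall>b\<in>{b. (False, n, b) \<in> A}. X n b \<in> grd g (n - 1) \<and>
      (\<forall>c\<in>{b. (False, n, b) \<in> A}. c (X n b) = (if c = b then 1 else 0))"
      using dual_elements_ex[OF B A(1,3)] by (elim exE)
    have "M.Phi a (map (\<lambda>l. (fst (snd l), X (fst (snd l)) (snd (snd l)))) w) = GB.Phi a w"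
      by (rule Phi_dual_elements[OF B a A(3,2,4)]) (use X in blast)+
    thus ?thesis using 0 by (simp add: fun_ap)
  qed
  moreover have "GB.Phi a w = 0" if "\<not> set w \<subseteq> GB.VL" for w
    using suppD[OF GB.Phi_Lam(2)[OF a]] that by blast
  ultimately have "GB.Phi a = 0" by (auto simp: fun_eq_iff fun_ap)
  thus ?thesis by (rule GB.Phi_kernel[OF a])
qed

lemma M_eq_J: "a \<in> wordsp Wg \<Longrightarrow> b \<in> wordsp Wg \<Longrightarrow> M.Phi a = M.Phi b \<Longrightarrow> a - b \<in> J"
  by (rule M_kernel) (simp_all add: M.Phi_simps FA.span_diff)

section \<open>The two differentials on linear and quadratic cochains\<close>

lemma two_gen: "(M.gen m \<phi> \<star> M.gen n \<psi>) [l1, l2] =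
    ev2 g m \<phi> l1 * ev2 g n \<psi> l2 + eps (fst l1 * fst l2) * ev2 g m \<phi> l2 * ev2 g n \<psi> l1"
  by (simp add: M.sp_cons ldel_def M.gen_apply M.twist_def eps_0)

text \<open>The bracket on suspended letters, hence of degree -1; \<open>d_II\<close> is dual to it
  up to the sign \<open>sgn2\<close>.\<close>

definition merge :: "int \<times> ('i \<Rightarrow> 'a) \<Rightarrow> int \<times> ('i \<Rightarrow> 'a) \<Rightarrow> int \<times> ('i \<Rightarrow> 'a)" where
  "merge l1 l2 = (fst l1 + fst l2 - 1, brk g (snd l1) (snd l2))"

definition sgn2 :: "int \<times> ('i \<Rightarrow> 'a) \<Rightarrow> int \<times> ('i \<Rightarrow> 'a) \<Rightarrow> 'k" where
  "sgn2 l1 l2 = - eps ((fst l1 - 1) * fst l2)"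

definition dlet :: "int \<times> ('i \<Rightarrow> 'a) \<Rightarrow> int \<times> ('i \<Rightarrow> 'a)" where
  "dlet l = (fst l - 1, dif g (snd l))"

lemma valid_merge: "valid g l1 \<Longrightarrow> valid g l2 \<Longrightarrow> valid g (merge l1 l2)"
  unfolding valid_def merge_def by (auto intro: brk_closed)

lemma valid_dlet: "valid g l \<Longrightarrow> valid g (dlet l)"
  unfolding valid_def dlet_def using G.dif_grd[of "snd l" "fst l - 1"] by simp

lemma CE_II_in: assumes "\<phi> \<in> Wg n" shows "CE_II g n \<phi> \<in> FA.span {word u | u. u \<in> words Wg \<and> word_degree u = n + 1 \<and> length u = 2}"
proof -
  have "\<forall>(i, a, b)\<in>set (dual_brk g (n - 1) \<phi>). a \<in> dual g i \<and> b \<in> dual g (n - 1 - i)"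
    using dual_brk[of \<phi> "n - 1"] assms by (simp add: represents_dual_brk_def susp_dual_def)
  moreover have "n - 1 - i = n - i - 1" for i by simp
  ultimately have "a \<in> Wg (i + 1) \<and> b \<in> Wg (n - i)" if "(i, a, b) \<in> set (dual_brk g (n - 1) \<phi>)" for i a b
    using that by (fastforce simp: susp_dual_def)
  thus ?thesis unfolding CE_II_def
    by (intro span_sum_list, clarsimp simp del: FA.scale_minus_left, intro FA.span_scale word_in) simp
qed

lemma Phi_sum_list: "M.Phi (sum_list (map f xs)) w = (\<Sum>x\<leftarrow>xs. M.Phi (f x) w)"
  by (induction xs) (simp_all add: M.Phi_at)

lemma Phi_length: assumes "a \<in> FA.span {word u | u. Q u \<and> length u = k}"
  shows "supp (M.Phi a) (len k)"
  using assms by (induction rule: free_span_induct) (auto simp: M.Phi_simps supp_closed intro: M.phw_supp)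

lemma CE_II_wordspn: "\<phi> \<in> Wg n \<Longrightarrow> CE_II g n \<phi> \<in> wordspn Wg (n + 1)"
  using CE_II_in[of \<phi> n] by (simp add: span_words)

text \<open>The tensors of the dual bracket contribute in both orders of the two letters. By
  antisymmetry of the bracket the two contributions agree, which absorbs the factor 1/2 in
  \<open>CE_II\<close> and makes the value independent of the chosen list.\<close>

lemma d2_len1: assumes \<phi>: "\<phi> \<in> Wg n" and l: "valid g l1" "valid g l2"
  shows "M.Phi (CE_II g n \<phi>) [l1, l2] = sgn2 l1 l2 * ev2 g n \<phi> (merge l1 l2)"
proof -
  obtain m1 x m2 y where xy: "l1 = (m1, x)" "l2 = (m2, y)" by (cases l1, cases l2)
  have x: "x \<in> grd g (m1 - 1)" and y: "y \<in> grd g (m2 - 1)" using l by (auto simp: valid_def xy)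
  let ?ps = "dual_brk g (n - 1) \<phi>"
  have \<phi>': "\<phi> \<in> dual g (n - 1)" using \<phi> by (simp add: susp_dual_def)
  have R: "\<phi> (brk g u v) = (\<Sum>(i', a, b)\<leftarrow>?ps. if i' = i then a u * b v else 0)"
    if "u \<in> grd g i" "v \<in> grd g (n - 1 - i)" for u v i
    using dual_brk[OF \<phi>'] that unfolding represents_dual_brk_def by blast
  define c :: "int \<Rightarrow> 'k" where "c i = - (1/2) * eps (i * (n - i))" for i
  let ?t = "\<lambda>(i', a, b). c i' * (ev2 g (i' + 1) a l1 * ev2 g (n - i') b l2 + eps (m1 * m2) * ev2 g (i' + 1) a l2 * ev2 g (n - i') b l1)"
  have "M.Phi (CE_II g n \<phi>) [l1, l2] = (\<Sum>p\<leftarrow>?ps. ?t p)" unfolding CE_II_def Phi_sum_list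
  proof (intro arg_cong[of _ _ sum_list] map_cong refl)
    fix p :: "int \<times> (('i \<Rightarrow> 'a) \<Rightarrow> 'k) \<times> (('i \<Rightarrow> 'a) \<Rightarrow> 'k)"
    obtain i a b where p: "p = (i, a, b)" by (cases p)
    show "M.Phi (case p of (i, a, b) \<Rightarrow> fsmul (- (1 / 2) * (- 1) powi (i * (n - i))) (word [(i + 1, a), (n - i, b)])) [l1, l2] = ?t p"
      unfolding p prod.case M.Phi_at M.phw.simps M.sp_onef two_gen fst_conv snd_conv
      by (simp only: c_def powi_eps xy fst_conv mult.assoc)
  qed
  also have "\<dots> = sgn2 l1 l2 * ev2 g n \<phi> (merge l1 l2)"
  proof (cases "m1 + m2 = n + 1")
    case False
    have "(\<Sum>p\<leftarrow>?ps. ?t p) = (\<Sum>p\<leftarrow>?ps. 0)"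
      by (intro arg_cong[of _ _ sum_list] map_cong) (use False in \<open>auto simp: ev2_def xy\<close>)
    thus ?thesis using False by (simp add: ev2_def merge_def xy)
  next
    case True
    have "(\<Sum>p\<leftarrow>?ps. ?t p) = (\<Sum>p\<leftarrow>?ps. c (m1 - 1) * (case p of (i', a, b) \<Rightarrow> if i' = m1 - 1 then a x * b y else 0)
        + c (m2 - 1) * eps (m1 * m2) * (case p of (i', a, b) \<Rightarrow> if i' = m2 - 1 then a y * b x else 0))"
      by (intro arg_cong[of _ _ sum_list] map_cong) (use True l in \<open>auto simp: ev2_def xy algebra_simps\<close>)
    also have "\<dots> = c (m1 - 1) * (\<Sum>(i', a, b)\<leftarrow>?ps. if i' = m1 - 1 then a x * b y else 0)
        + c (m2 - 1) * eps (m1 * m2) * (\<Sum>(i', a, b)\<leftarrow>?ps. if i' = m2 - 1 then a y * b x else 0)"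
      by (simp only: sum_list_addf sum_list_const_mult)
    also have "(\<Sum>(i', a, b)\<leftarrow>?ps. if i' = m1 - 1 then a x * b y else 0) = \<phi> (brk g x y)"
    proof -
      have "n - 1 - (m1 - 1) = m2 - 1" using True by simp
      thus ?thesis using R[OF x, of y] y by simp
    qed
    also have "(\<Sum>(i', a, b)\<leftarrow>?ps. if i' = m2 - 1 then a y * b x else 0) = \<phi> (brk g y x)"
    proof -
      have "n - 1 - (m2 - 1) = m1 - 1" using True by simp
      thus ?thesis using R[OF y, of x] x by simp
    qed
    also have "\<phi> (brk g y x) = - eps ((m1 - 1) * (m2 - 1)) * \<phi> (brk g x y)"
    proof -
      have b: "brk g x y \<in> grd g (n - 1)" by (rule brk_closed[OF x y]) (use True in simp)
      have "\<phi> (brk g y x) = \<phi> (scl g (- ((-1) powi ((m2 - 1) * (m1 - 1)))) (brk g x y))"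
        by (rule arg_cong[OF G.brk_antisym[OF y x]])
      thus ?thesis unfolding dualD(2)[OF \<phi>' b] powi_eps by (simp only: mult.commute)
    qed
    also have "c (m1 - 1) * \<phi> (brk g x y) + c (m2 - 1) * eps (m1 * m2) * (- eps ((m1 - 1) * (m2 - 1)) * \<phi> (brk g x y)) =
        sgn2 l1 l2 * \<phi> (brk g x y)"
    proof -
      have n: "n = m1 + m2 - 1" using True by simp
      have "c (m1 - 1) = - (1/2) * eps ((m1 - 1) * m2)" "c (m2 - 1) = - (1/2) * eps ((m2 - 1) * m1)"
        by (simp_all add: c_def n)
      moreover have "eps ((m2 - 1) * m1) * eps (m1 * m2) * eps ((m1 - 1) * (m2 - 1)) = - (eps ((m1 - 1) * m2) :: 'k)"
        by (auto simp: eps_def)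
      ultimately show ?thesis by (simp add: sgn2_def xy algebra_simps)
    qed
    also have "\<phi> (brk g x y) = ev2 g n \<phi> (merge l1 l2)"
      using valid_merge[OF l] True by (simp add: ev2_def merge_def xy)
    finally show ?thesis .
  qed
  finally show ?thesis .
qed

lemma sp21:  assumes "supp F (len 2)"
  shows "(F \<star> M.gen n \<phi>) [l1, l2, l3] = F [l1, l2] * ev2 g n \<phi> l3 + eps (fst l2 * fst l3) * F [l1, l3] * ev2 g n \<phi> l2
    + eps (fst l1 * (fst l2 + fst l3)) * F [l2, l3] * ev2 g n \<phi> l1"
proof -
  have F: "F [] = 0" "F [x] = 0" "F [x, y, z] = 0" for x y z using assms by (auto simp: supp_def)
  show ?thesis
    by (simp add: M.sp_cons ldel_def M.gen_apply M.twist_def F eps_add eps_0 distrib_left algebra_simps)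
qed

lemma CE_II_len: "\<phi> \<in> Wg n \<Longrightarrow> supp (M.Phi (CE_II g n \<phi>)) (len 2)"
proof -
  assume "\<phi> \<in> Wg n"
  from CE_II_in[OF this] have "CE_II g n \<phi> \<in> FA.span {word u | u. (u \<in> words Wg \<and> word_degree u = n + 1) \<and> length u = 2}"
    by (simp add: span_words)
  thus ?thesis by (rule Phi_length)
qed

abbreviation "two_words \<equiv> wordsl Wg 2"

lemma two_wordE: assumes "u \<in> words Wg" "length u = 2"
  obtains p a q b where "u = [(p, a), (q, b)]" "a \<in> Wg p" "b \<in> Wg q"
proof -
  obtain l1 l2 where "u = [l1, l2]" using assms(2) by (auto simp: numeral_2_eq_2 length_Suc_conv)
  thus thesis using that[of "fst l1" "snd l1" "fst l2" "snd l2"] assms(1) by simp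
qed

text \<open>By linearity one may take a product of two letters; then the Leibniz rule and
  \<open>d2_len1\<close> produce one term per pair of arguments, with the Koszul sign of moving the
  pair to the front.\<close>

lemma d2_len2: assumes a: "a \<in> two_words" and l: "valid g l1" "valid g l2" "valid g l3"
  shows "M.Phi (dfree (CE_II g) a) [l1, l2, l3] = sgn2 l1 l2 * M.Phi a [merge l1 l2, l3]
    + eps (fst l2 * fst l3) * sgn2 l1 l3 * M.Phi a [merge l1 l3, l2]
    + eps (fst l1 * (fst l2 + fst l3)) * sgn2 l2 l3 * M.Phi a [merge l2 l3, l1]" using a
proof (induction rule: free_span_induct)
  case (word u)
  then obtain p a q b where u: "u = [(p, a), (q, b)]" "a \<in> Wg p" "b \<in> Wg q" using two_wordE by blast
  let ?A = "M.Phi (CE_II g p a)" and ?B = "M.Phi (CE_II g q b)"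
  have Ah: "M.hom (p + 1) ?A" and Bh: "M.hom (q + 1) ?B" using M.Phi_hom CE_II_wordspn u by blast+
  have "M.gen p a \<star> ?B = M.twist p ?B \<star> M.gen p a" by (rule M.sp_commute[OF M.gen_hom[OF u(2)]])
  also have "M.twist p ?B = sc (eps (p * (q + 1))) ?B" by (rule M.hom_twist[OF Bh])
  finally have sw: "M.gen p a \<star> ?B = sc (eps (p * (q + 1))) (?B \<star> M.gen p a)" by (simp add: M.sp_sc_left)
  have "M.Phi (dfree (CE_II g) (word u)) = ?A \<star> M.gen q b + sc (eps p) (M.gen p a \<star> ?B)"
    by (simp add: dfree_simps u(1) M.Phi_simps M.Phi_fmul)
  also have "sc (eps p) (M.gen p a \<star> ?B) = sc (eps (p * q)) (?B \<star> M.gen p a)"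
    unfolding sw by (simp add: distrib_left eps_add mult.commute[of _ "eps p"] eps_sq eps_sq_left)
  finally have E: "M.Phi (dfree (CE_II g) (word u)) w = (?A \<star> M.gen q b) w + eps (p * q) * (?B \<star> M.gen p a) w" for w
    by (simp add: fun_ap)
  have F: "M.Phi (word u) [m, l] = ev2 g p a m * ev2 g q b l + eps (p * q) * ev2 g q b m * ev2 g p a l" for m l
    unfolding u(1) M.Phi_at using two_gen[of p a q b m l] by (auto simp: ev2_def eps_def algebra_simps)
  show ?case unfolding E sp21[OF CE_II_len[OF u(2)]] sp21[OF CE_II_len[OF u(3)]] F
      d2_len1[OF u(2) l(1,2)] d2_len1[OF u(2) l(1,3)] d2_len1[OF u(2) l(2,3)]
      d2_len1[OF u(3) l(1,2)] d2_len1[OF u(3) l(1,3)] d2_len1[OF u(3) l(2,3)]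
    by (simp add: algebra_simps)
qed (simp_all add: dfree_simps M.Phi_at algebra_simps)

lemma dual_dif_in: assumes "\<phi> \<in> Wg n" shows "dual_dif g (n - 1) \<phi> \<in> Wg (n + 1)"
proof -
  have \<phi>: "\<phi> \<in> dual g (n - 1)" using assms by (simp add: susp_dual_def)
  obtain \<alpha> where \<alpha>: "\<And>x. x \<in> grd g (n - 1) \<Longrightarrow> x \<alpha> = 0 \<Longrightarrow> \<phi> x = 0" using dual_factor[OF \<phi>] le_refl by blast
  interpret O: dgla "obj S \<alpha>" by (rule dgla_obj)
  interpret OV: vector_space "scl (obj S \<alpha>)" by (rule O.vector_space)
  have "0 \<in> grd (obj S \<alpha>) n" using OV.subspace_0[OF O.subspace] .
  hence d0: "dif (obj S \<alpha>) 0 = 0" using O.dif_add[of 0 n 0] by simp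
  show ?thesis unfolding susp_dual_def
  proof (rule dualI[where \<alpha> = \<alpha>])
    fix x assume x: "x \<in> grd g (n + 1 - 1)"
    hence x': "x \<in> grd g n" "dif g x \<in> grd g (n - 1)" using G.dif_grd by simp_all
    show "dual_dif g (n - 1) \<phi> (x + y) = dual_dif g (n - 1) \<phi> x + dual_dif g (n - 1) \<phi> y" if "y \<in> grd g (n + 1 - 1)" for y
      using x' that G.dif_add[OF x'(1)] G.dif_grd[of y n] by (simp add: dual_dif_def grd_closed dualD[OF \<phi>])
    show "dual_dif g (n - 1) \<phi> (scl g c x) = c * dual_dif g (n - 1) \<phi> x" for c
      using x' by (simp add: dual_dif_def grd_closed G.dif_scl dualD[OF \<phi>])
    show "dual_dif g (n - 1) \<phi> x = 0" if "x \<alpha> = 0"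
      using x' that by (simp add: dual_dif_def \<alpha> comp d0)
  qed (simp add: dual_dif_def)
qed

lemma CE_I_in: "\<phi> \<in> Wg n \<Longrightarrow> CE_I g n \<phi> \<in> wordspn Wg (n + 1)"
  unfolding CE_I_def using dual_dif_in by (intro FA.span_scale word_in) simp

lemma d1_len1: "\<phi> \<in> Wg n \<Longrightarrow> valid g l \<Longrightarrow> M.Phi (CE_I g n \<phi>) [l] = eps (fst l - 1) * ev2 g n \<phi> (dlet l)"
  using valid_dlet[of l]
  by (auto simp: CE_I_def M.Phi_at powi_eps M.gen_apply ev2_def dual_dif_def dlet_def valid_def eps_def)

lemma Phi_CE_I: "M.Phi (CE_I g n \<phi>) = sc (eps n) (M.gen (n + 1) (dual_dif g (n - 1) \<phi>))"
  by (simp add: CE_I_def M.Phi_simps powi_eps)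

lemma d1_len2: assumes a: "a \<in> two_words" and l: "valid g l1" "valid g l2"
  shows "M.Phi (dfree (CE_I g) a) [l1, l2] = eps (fst l1 - 1) * M.Phi a [dlet l1, l2] + eps (fst l1 + fst l2 - 1) * M.Phi a [l1, dlet l2]"
  using a
proof (induction rule: free_span_induct)
  case (word u)
  then obtain p a q b where u: "u = [(p, a), (q, b)]" "a \<in> Wg p" "b \<in> Wg q" using two_wordE by blast
  have E: "M.Phi (dfree (CE_I g) (word u)) [l1, l2] = eps p * (M.gen (p + 1) (dual_dif g (p - 1) a) \<star> M.gen q b) [l1, l2]
      + eps p * eps q * (M.gen p a \<star> M.gen (q + 1) (dual_dif g (q - 1) b)) [l1, l2]"
    by (simp add: dfree_simps u(1) M.Phi_at M.Phi_fmul Phi_CE_I M.Phi_simps M.sp_sc_left M.sp_sc_right fun_ap)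
  have D: "ev2 g (p + 1) (dual_dif g (p - 1) a) l = ev2 g p a (dlet l)" "ev2 g (q + 1) (dual_dif g (q - 1) b) l = ev2 g q b (dlet l)"
    if "valid g l" for l
    using valid_dlet[OF that] that by (auto simp: ev2_def dual_dif_def dlet_def valid_def)
  let ?a = "ev2 g p a" and ?b = "ev2 g q b" and ?d1 = "fst l1" and ?d2 = "fst l2"
  have dg: "ev2 g n \<phi> l \<noteq> 0 \<Longrightarrow> fst l = n" for n \<phi> l by (auto simp: ev2_def split: if_splits)
  have fd: "fst (dlet l) = fst l - 1" for l by (simp add: dlet_def)
  have T1: "eps p * (?a (dlet l1) * ?b l2) = eps (?d1 - 1) * (?a (dlet l1) * ?b l2)"
    using dg[of p a "dlet l1"] by (cases "?a (dlet l1) = 0") (simp_all add: fd)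
  have T2: "eps p * (eps (?d1 * ?d2) * ?a (dlet l2) * ?b l1) = eps (?d1 + ?d2 - 1) * (eps (?d1 * (?d2 - 1)) * ?a (dlet l2) * ?b l1)"
    using dg[of p a "dlet l2"] by (cases "?a (dlet l2) = 0") (auto simp: fd eps_def)
  have T3: "eps p * eps q * (?a l1 * ?b (dlet l2)) = eps (?d1 + ?d2 - 1) * (?a l1 * ?b (dlet l2))"
    using dg[of p a l1] dg[of q b "dlet l2"] by (cases "?a l1 = 0"; cases "?b (dlet l2) = 0") (auto simp: fd eps_def)
  have T4: "eps p * eps q * (eps (?d1 * ?d2) * ?a l2 * ?b (dlet l1)) = eps (?d1 - 1) * (eps ((?d1 - 1) * ?d2) * ?a l2 * ?b (dlet l1))"
    using dg[of p a l2] dg[of q b "dlet l1"] by (cases "?a l2 = 0"; cases "?b (dlet l1) = 0") (auto simp: fd eps_def)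
  have F: "M.Phi (word u) [m, l] = ?a m * ?b l + eps (fst m * fst l) * ?a l * ?b m" for m l
    unfolding u(1) M.Phi_at M.phw.simps M.sp_onef two_gen fst_conv snd_conv ..
  show ?case
    unfolding E two_gen F D[OF l(1)] D[OF l(2)] fd distrib_left T1 T2 T3 T4 by (simp add: algebra_simps)
qed (simp_all add: dfree_simps M.Phi_at algebra_simps)

end

lemma dfree_letter: "dfree \<delta> (word [(n, x)]) = \<delta> n x" by (simp add: dfree_simps fmul_simps fmul_one)

lemma dfree_length: assumes "\<And>n x. x \<in> W n \<Longrightarrow> \<delta> n x \<in> wordsl W (Suc j)" and "a \<in> wordsl W k"
  shows "dfree \<delta> a \<in> wordsl W (k + j)"
proof -
  have dw: "dword \<delta> u \<in> wordsl W (length u + j)" if "u \<in> words W" for u using that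
  proof (induction u)
    case (Cons l u)
    hence x: "snd l \<in> W (fst l)" and u: "u \<in> words W" by simp_all
    have "fmul (\<delta> (fst l) (snd l)) (word u) \<in> wordsl W (length (l # u) + j)"
      by (rule fmul_in[where Q = "\<lambda>v. v = u", OF assms(1)[OF x] word_in]) (use u in auto)
    moreover have "fmul (word [l]) (dword \<delta> u) \<in> wordsl W (length (l # u) + j)"
      by (rule fmul_in[where P = "\<lambda>v. v = [l]", OF word_in Cons.IH[OF u]]) (use x in auto)
    ultimately show ?case by (auto intro!: FA.span_add FA.span_scale)
  qed (simp add: FA.span_zero)
  from assms(2) show ?thesis
  proof (induction rule: free_span_induct)
    case (word u)
    thus ?case using dw[of u] by (simp add: dfree_simps)
  qed (simp_all add: dfree_simps FA.span_zero FA.span_add FA.span_scale)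
qed

section \<open>The square of the differential\<close>

context complete_dg
begin

notation M.sp (infixl "\<star>" 70)

lemma len_ext: assumes "supp f (len k)" "supp h (len k)"
    "\<And>l w. f w \<noteq> 0 \<Longrightarrow> l \<in> set w \<Longrightarrow> valid g l" "\<And>l w. h w \<noteq> 0 \<Longrightarrow> l \<in> set w \<Longrightarrow> valid g l"
    "\<And>w. length w = k \<Longrightarrow> \<forall>l\<in>set w. valid g l \<Longrightarrow> f w = h w"
  shows "f = (h :: _ \<Rightarrow> 'k)"
proof
  fix w show "f w = h w"
  proof (cases "f w = 0 \<and> h w = 0")
    case False
    hence "length w = k \<and> (\<forall>l\<in>set w. valid g l)" using assms(1-4) unfolding supp_def by metis
    thus ?thesis using assms(5) by blast
  qed simp
qed

lemma len1_ext: assumes "supp f (len 1)" "supp h (len 1)"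
    "\<And>l w. f w \<noteq> 0 \<Longrightarrow> l \<in> set w \<Longrightarrow> valid g l" "\<And>l w. h w \<noteq> 0 \<Longrightarrow> l \<in> set w \<Longrightarrow> valid g l"
    "\<And>l. valid g l \<Longrightarrow> f [l] = h [l]"
  shows "f = (h :: _ \<Rightarrow> 'k)" by (rule len_ext[OF assms(1-4)]) (auto simp: length_Suc_conv assms(5))

lemma len2_ext: assumes "supp f (len 2)" "supp h (len 2)"
    "\<And>l w. f w \<noteq> 0 \<Longrightarrow> l \<in> set w \<Longrightarrow> valid g l" "\<And>l w. h w \<noteq> 0 \<Longrightarrow> l \<in> set w \<Longrightarrow> valid g l"
    "\<And>l1 l2. valid g l1 \<Longrightarrow> valid g l2 \<Longrightarrow> f [l1, l2] = h [l1, l2]"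
  shows "f = (h :: _ \<Rightarrow> 'k)"
  by (rule len_ext[OF assms(1-4)]) (auto simp: length_Suc_conv numeral_2_eq_2 assms(5))

lemma len3_zero: assumes "supp f (len 3)" "\<And>l w. f w \<noteq> 0 \<Longrightarrow> l \<in> set w \<Longrightarrow> valid g l"
    "\<And>l1 l2 l3. valid g l1 \<Longrightarrow> valid g l2 \<Longrightarrow> valid g l3 \<Longrightarrow> f [l1, l2, l3] = 0"
  shows "f = (0 :: _ \<Rightarrow> 'k)"
  by (rule len_ext[OF assms(1) _ assms(2)]) (auto simp: length_Suc_conv numeral_3_eq_3 fun_ap assms(3) supp_closed)

lemma susp_dual_closed: "\<phi> \<in> Wg n \<Longrightarrow> \<psi> \<in> Wg n \<Longrightarrow> \<phi> + \<psi> \<in> Wg n"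
  "\<phi> \<in> Wg n \<Longrightarrow> sc c \<phi> \<in> Wg n" "0 \<in> Wg n"
proof -
  interpret F: vector_space "sc :: 'k \<Rightarrow> (('i \<Rightarrow> 'a) \<Rightarrow> 'k) \<Rightarrow> _" by (rule vector_space_sc)
  show "\<phi> \<in> Wg n \<Longrightarrow> \<psi> \<in> Wg n \<Longrightarrow> \<phi> + \<psi> \<in> Wg n"
    "\<phi> \<in> Wg n \<Longrightarrow> sc c \<phi> \<in> Wg n" "0 \<in> Wg n"
    using F.subspace_add[OF dual_subspace] F.subspace_scale[OF dual_subspace] F.subspace_0[OF dual_subspace]
    unfolding susp_dual_def by blast+
qed

text \<open>The lists chosen for \<open>\<phi>\<close>, \<open>\<psi>\<close> and their sum are
  unrelated, but by \<open>d2_len1\<close> the values at pairs of elements do not depend on them;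
  hence linearity modulo relators.\<close>

lemma CE_II_linear: assumes p: "\<phi> \<in> Wg n"
  shows "\<psi> \<in> Wg n \<Longrightarrow> CE_II g n (\<phi> + \<psi>) - (CE_II g n \<phi> + CE_II g n \<psi>) \<in> J"
    and "CE_II g n (sc c \<phi>) - fsmul c (CE_II g n \<phi>) \<in> J"
proof -
  note w = wordspn_sub[OF CE_II_wordspn]
  show "CE_II g n (\<phi> + \<psi>) - (CE_II g n \<phi> + CE_II g n \<psi>) \<in> J" if q: "\<psi> \<in> Wg n"
  proof (rule M_eq_J)
    have s: "\<phi> + \<psi> \<in> Wg n" by (rule susp_dual_closed(1)[OF p q])
    show "M.Phi (CE_II g n (\<phi> + \<psi>)) = M.Phi (CE_II g n \<phi> + CE_II g n \<psi>)"
    proof (rule len2_ext)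
      show "supp (M.Phi (CE_II g n \<phi> + CE_II g n \<psi>)) (len 2)"
        unfolding M.Phi_simps by (intro supp_closed CE_II_len p q)
      show "M.Phi (CE_II g n (\<phi> + \<psi>)) [l1, l2] = M.Phi (CE_II g n \<phi> + CE_II g n \<psi>) [l1, l2]" if l: "valid g l1" "valid g l2" for l1 l2
        unfolding M.Phi_at d2_len1[OF p l] d2_len1[OF q l] d2_len1[OF s l] by (simp add: ev2_def plus_fun_apply algebra_simps)
    qed (use CE_II_len[OF s] Phi_valid in blast)+
    show "CE_II g n (\<phi> + \<psi>) \<in> wordsp Wg" "CE_II g n \<phi> + CE_II g n \<psi> \<in> wordsp Wg"
      by (intro FA.span_add w p q s)+
  qed
  show "CE_II g n (sc c \<phi>) - fsmul c (CE_II g n \<phi>) \<in> J"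
  proof (rule M_eq_J)
    have s: "sc c \<phi> \<in> Wg n" by (rule susp_dual_closed(2)[OF p])
    have e: "ev2 g n (sc c \<phi>) l = c * ev2 g n \<phi> l" for l by (simp add: ev2_def fun_scale_def)
    show "M.Phi (CE_II g n (sc c \<phi>)) = M.Phi (fsmul c (CE_II g n \<phi>))"
    proof (rule len2_ext)
      show "supp (M.Phi (fsmul c (CE_II g n \<phi>))) (len 2)"
        unfolding M.Phi_simps by (intro supp_closed CE_II_len p)
      show "M.Phi (CE_II g n (sc c \<phi>)) [l1, l2] = M.Phi (fsmul c (CE_II g n \<phi>)) [l1, l2]" if l: "valid g l1" "valid g l2" for l1 l2
        unfolding M.Phi_at d2_len1[OF p l] d2_len1[OF s l] e by simp
    qed (use CE_II_len[OF s] Phi_valid in blast)+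
    show "CE_II g n (sc c \<phi>) \<in> wordsp Wg" "fsmul c (CE_II g n \<phi>) \<in> wordsp Wg"
      by (intro FA.span_scale w p s)+
  qed
qed

lemma CE_I_linear: assumes p: "\<phi> \<in> Wg n"
  shows "\<psi> \<in> Wg n \<Longrightarrow> CE_I g n (\<phi> + \<psi>) - (CE_I g n \<phi> + CE_I g n \<psi>) \<in> J"
    and "CE_I g n (sc c \<phi>) - fsmul c (CE_I g n \<phi>) \<in> J"
proof -
  note w = wordspn_sub[OF CE_I_in]
  show "CE_I g n (\<phi> + \<psi>) - (CE_I g n \<phi> + CE_I g n \<psi>) \<in> J" if q: "\<psi> \<in> Wg n"
  proof (rule M_eq_J)
    have "dual_dif g (n - 1) (\<phi> + \<psi>) = dual_dif g (n - 1) \<phi> + dual_dif g (n - 1) \<psi>"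
      by (auto simp: dual_dif_def fun_eq_iff plus_fun_apply)
    thus "M.Phi (CE_I g n (\<phi> + \<psi>)) = M.Phi (CE_I g n \<phi> + CE_I g n \<psi>)"
      by (simp add: Phi_CE_I M.Phi_simps M.gen_add[OF dual_dif_in[OF p] dual_dif_in[OF q]])
    show "CE_I g n (\<phi> + \<psi>) \<in> wordsp Wg" "CE_I g n \<phi> + CE_I g n \<psi> \<in> wordsp Wg"
      by (intro FA.span_add w p q susp_dual_closed)+
  qed
  show "CE_I g n (sc c \<phi>) - fsmul c (CE_I g n \<phi>) \<in> J"
  proof (rule M_eq_J)
    have "dual_dif g (n - 1) (sc c \<phi>) = sc c (dual_dif g (n - 1) \<phi>)"
      by (auto simp: dual_dif_def fun_eq_iff fun_scale_def)
    thus "M.Phi (CE_I g n (sc c \<phi>)) = M.Phi (fsmul c (CE_I g n \<phi>))"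
      by (simp add: Phi_CE_I M.Phi_simps M.gen_scale[OF dual_dif_in[OF p]] mult.commute)
    show "CE_I g n (sc c \<phi>) \<in> wordsp Wg" "fsmul c (CE_I g n \<phi>) \<in> wordsp Wg"
      by (intro FA.span_scale w p susp_dual_closed)+
  qed
qed

lemma sym_der_CE: assumes "graded_basis sc Wg B"
  shows "sym_der sc Wg B (CE_I g)" "sym_der sc Wg B (CE_II g)"
proof -
  show "sym_der sc Wg B (CE_I g)"
    by (intro sym_der.intro assms sym_der_axioms.intro CE_I_in CE_I_linear)
  show "sym_der sc Wg B (CE_II g)"
    by (intro sym_der.intro assms sym_der_axioms.intro CE_II_wordspn CE_II_linear)
qed

lemma CE_II_two: "\<phi> \<in> Wg n \<Longrightarrow> CE_II g n \<phi> \<in> two_words"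
  using CE_II_in[of \<phi> n] by (simp add: span_words)

lemma CE_I_one: "\<phi> \<in> Wg n \<Longrightarrow> CE_I g n \<phi> \<in> wordsl Wg (Suc 0)"
  unfolding CE_I_def using dual_dif_in by (intro FA.span_scale word_in) simp

lemma square_I: "\<phi> \<in> Wg n \<Longrightarrow> M.Phi (dfree (CE_I g) (CE_I g n \<phi>)) = 0"
proof -
  assume p: "\<phi> \<in> Wg n"
  hence p': "\<phi> \<in> dual g (n - 1)" by (simp add: susp_dual_def)
  have "dual_dif g (n + 1 - 1) (dual_dif g (n - 1) \<phi>) = 0"
  proof
    fix x
    have "\<phi> (dif g (dif g x)) = 0" if "x \<in> grd g (n + 1)" using G.dif_dif[OF that] dualD(5)[OF p'] by simp
    thus "dual_dif g (n + 1 - 1) (dual_dif g (n - 1) \<phi>) x = 0 x"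
      using G.dif_grd[of x "n + 1"] by (auto simp: dual_dif_def fun_ap)
  qed
  moreover have "M.gen m 0 = 0" for m
    by (auto simp: M.gen_def ev2_def fun_eq_iff zero_fun_apply split: list.splits)
  ultimately have "M.Phi (CE_I g (n + 1) (dual_dif g (n - 1) \<phi>)) = 0" by (simp add: Phi_CE_I)
  thus ?thesis by (simp add: CE_I_def[of g n] dfree_simps(2) dfree_letter M.Phi_simps)
qed

text \<open>At three elements the terms of \<open>d2_len2\<close> are the three nested brackets;
  antisymmetry brings them into the form of the graded Jacobi identity.\<close>

lemma square_II: "\<phi> \<in> Wg n \<Longrightarrow> M.Phi (dfree (CE_II g) (CE_II g n \<phi>)) = 0"
proof (rule len3_zero)
  assume p: "\<phi> \<in> Wg n"
  hence p': "\<phi> \<in> dual g (n - 1)" by (simp add: susp_dual_def)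
  have "dfree (CE_II g) (CE_II g n \<phi>) \<in> wordsl Wg (2 + 1)"
    by (rule dfree_length[OF _ CE_II_two[OF p]]) (use CE_II_two in \<open>simp add: numeral_2_eq_2\<close>)
  thus "supp (M.Phi (dfree (CE_II g) (CE_II g n \<phi>))) (len 3)"
    by (intro Phi_length[where Q = "\<lambda>u. u \<in> words Wg"]) simp
  fix l1 l2 l3 assume l: "valid g l1" "valid g l2" "valid g l3"
  note E = d2_len2[OF CE_II_two[OF p] l, unfolded d2_len1[OF p valid_merge[OF l(1,2)] l(3)]
      d2_len1[OF p valid_merge[OF l(1,3)] l(2)] d2_len1[OF p valid_merge[OF l(2,3)] l(1)]]
  show "M.Phi (dfree (CE_II g) (CE_II g n \<phi>)) [l1, l2, l3] = 0"
  proof (cases "fst l1 + fst l2 + fst l3 - 2 = n")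
    case False
    thus ?thesis unfolding E by (simp add: ev2_def merge_def)
  next
    case True
    obtain d1 x d2 y d3 z where xyz: "l1 = (d1, x)" "l2 = (d2, y)" "l3 = (d3, z)" by (cases l1, cases l2, cases l3)
    have x: "x \<in> grd g (d1 - 1)" and y: "y \<in> grd g (d2 - 1)" and z: "z \<in> grd g (d3 - 1)"
      using l by (auto simp: valid_def xyz)
    have n: "n = d1 + d2 + d3 - 2" using True by (simp add: xyz)
    have xy: "brk g x y \<in> grd g (d1 + d2 - 2)" by (rule brk_closed[OF x y]) simp
    have xz: "brk g x z \<in> grd g (d1 + d3 - 2)" by (rule brk_closed[OF x z]) simp
    have yz: "brk g y z \<in> grd g (d2 + d3 - 2)" by (rule brk_closed[OF y z]) simp
    have xyz': "brk g (brk g x y) z \<in> grd g (n - 1)" by (rule brk_closed[OF xy z]) (simp add: n)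
    have yxz': "brk g y (brk g x z) \<in> grd g (n - 1)" by (rule brk_closed[OF y xz]) (simp add: n)
    have x_yz: "brk g x (brk g y z) \<in> grd g (n - 1)" by (rule brk_closed[OF x yz]) (simp add: n)
    have ev: "ev2 g n \<phi> (merge (merge l1 l2) l3) = \<phi> (brk g (brk g x y) z)"
      "ev2 g n \<phi> (merge (merge l1 l3) l2) = \<phi> (brk g (brk g x z) y)"
      "ev2 g n \<phi> (merge (merge l2 l3) l1) = \<phi> (brk g (brk g y z) x)"
      using valid_merge[OF valid_merge[OF l(1,2)] l(3)] valid_merge[OF valid_merge[OF l(1,3)] l(2)]
        valid_merge[OF valid_merge[OF l(2,3)] l(1)]
      by (simp_all add: ev2_def merge_def xyz n algebra_simps)
    have a1: "\<phi> (brk g (brk g x z) y) = - eps ((d1 + d3 - 2) * (d2 - 1)) * \<phi> (brk g y (brk g x z))"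
      using arg_cong[OF G.brk_antisym[OF xz y], of \<phi>] unfolding dualD(2)[OF p' yxz'] powi_eps .
    have a2: "\<phi> (brk g (brk g y z) x) = - eps ((d2 + d3 - 2) * (d1 - 1)) * \<phi> (brk g x (brk g y z))"
      using arg_cong[OF G.brk_antisym[OF yz x], of \<phi>] unfolding dualD(2)[OF p' x_yz] powi_eps .
    have "\<phi> (brk g x (brk g y z)) = \<phi> (brk g (brk g x y) z + scl g ((-1) powi ((d1 - 1) * (d2 - 1))) (brk g y (brk g x z)))"
      by (rule arg_cong[OF G.jacobi[OF x y z]])
    also have "\<dots> = \<phi> (brk g (brk g x y) z) + eps ((d1 - 1) * (d2 - 1)) * \<phi> (brk g y (brk g x z))"
      unfolding dualD(1)[OF p' xyz' grd_closed(3)[OF yxz']] dualD(2)[OF p' yxz'] powi_eps ..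
    finally have a3: "\<phi> (brk g x (brk g y z)) = \<phi> (brk g (brk g x y) z) + eps ((d1 - 1) * (d2 - 1)) * \<phi> (brk g y (brk g x z))" .
    show ?thesis unfolding E ev a1 a2 a3 by (auto simp: sgn2_def merge_def xyz eps_def)
  qed
qed (rule Phi_valid)

text \<open>At two elements this is the Leibniz rule of the differential of \<open>g\<close> for the
  bracket.\<close>

lemma square_mixed: assumes p: "\<phi> \<in> Wg n"
  shows "M.Phi (dfree (CE_I g) (CE_II g n \<phi>) + dfree (CE_II g) (CE_I g n \<phi>)) = 0"
proof -
  have p': "\<phi> \<in> dual g (n - 1)" using p by (simp add: susp_dual_def)
  let ?\<phi>' = "dual_dif g (n - 1) \<phi>"
  let ?a = "dfree (CE_I g) (CE_II g n \<phi>)"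
  have q: "?\<phi>' \<in> Wg (n + 1)" by (rule dual_dif_in[OF p])
  have b: "dfree (CE_II g) (CE_I g n \<phi>) = fsmul (eps n) (CE_II g (n + 1) ?\<phi>')"
    by (simp add: CE_I_def dfree_simps(2) dfree_letter powi_eps)
  have "?a \<in> wordsl Wg (2 + 0)" by (rule dfree_length[OF _ CE_II_two[OF p]]) (use CE_I_one in simp)
  hence s: "supp (M.Phi ?a) (len 2)" by (intro Phi_length[where Q = "\<lambda>u. u \<in> words Wg"]) simp
  have "M.Phi ?a = M.Phi (fsmul (- eps n) (CE_II g (n + 1) ?\<phi>'))"
  proof (rule len2_ext[OF s])
    show "supp (M.Phi (fsmul (- eps n) (CE_II g (n + 1) ?\<phi>'))) (len 2)"
      unfolding M.Phi_simps(2) by (intro supp_closed CE_II_len q)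
    fix l1 l2 assume l: "valid g l1" "valid g l2"
    note E = d1_len2[OF CE_II_two[OF p] l, unfolded d2_len1[OF p valid_dlet[OF l(1)] l(2)] d2_len1[OF p l(1) valid_dlet[OF l(2)]]]
    show "M.Phi ?a [l1, l2] = M.Phi (fsmul (- eps n) (CE_II g (n + 1) ?\<phi>')) [l1, l2]"
    proof (cases "fst l1 + fst l2 - 2 = n")
      case False
      thus ?thesis unfolding E M.Phi_at d2_len1[OF q l] by (simp add: ev2_def merge_def dlet_def)
    next
      case True
      obtain d1 x d2 y where xy: "l1 = (d1, x)" "l2 = (d2, y)" by (cases l1, cases l2)
      have x: "x \<in> grd g (d1 - 1)" and y: "y \<in> grd g (d2 - 1)" using l by (auto simp: valid_def xy)
      have n: "n = d1 + d2 - 2" using True by (simp add: xy)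
      have dx: "dif g x \<in> grd g (d1 - 2)" and dy: "dif g y \<in> grd g (d2 - 2)"
        using G.dif_grd[OF x] G.dif_grd[OF y] by simp_all
      have b1: "brk g (dif g x) y \<in> grd g (n - 1)" by (rule brk_closed[OF dx y]) (simp add: n)
      have b2: "brk g x (dif g y) \<in> grd g (n - 1)" by (rule brk_closed[OF x dy]) (simp add: n)
      have b3: "brk g x y \<in> grd g n" by (rule brk_closed[OF x y]) (simp add: n)
      have ev: "ev2 g n \<phi> (merge (dlet l1) l2) = \<phi> (brk g (dif g x) y)" "ev2 g n \<phi> (merge l1 (dlet l2)) = \<phi> (brk g x (dif g y))"
        using b1 b2 by (simp_all add: ev2_def merge_def dlet_def valid_def xy n algebra_simps)
      have ev3: "ev2 g (n + 1) ?\<phi>' (merge l1 l2) = \<phi> (dif g (brk g x y))"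
        using b3 by (simp add: ev2_def merge_def valid_def xy n dual_dif_def)
      have "\<phi> (dif g (brk g x y)) = \<phi> (brk g (dif g x) y + scl g ((-1) powi (d1 - 1)) (brk g x (dif g y)))"
        by (rule arg_cong[OF G.dif_brk[OF x y]])
      also have "\<dots> = \<phi> (brk g (dif g x) y) + eps (d1 - 1) * \<phi> (brk g x (dif g y))"
        unfolding dualD(1)[OF p' b1 grd_closed(3)[OF b2]] dualD(2)[OF p' b2] powi_eps ..
      finally have d: "\<phi> (dif g (brk g x y)) = \<phi> (brk g (dif g x) y) + eps (d1 - 1) * \<phi> (brk g x (dif g y))" .
      show ?thesis
        unfolding E M.Phi_at d2_len1[OF q l] ev ev3 d by (auto simp: sgn2_def dlet_def xy n eps_def)
    qed
  qed (rule Phi_valid, assumption+)+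
  hence "M.Phi ?a w = M.Phi (fsmul (- eps n) (CE_II g (n + 1) ?\<phi>')) w" for w by (rule fun_cong)
  hence "M.Phi (?a + fsmul (eps n) (CE_II g (n + 1) ?\<phi>')) w = 0" for w
    unfolding M.Phi_at(1,3) by simp
  thus ?thesis unfolding b by (auto simp: zero_fun_apply)
qed

end

section \<open>The Chevalley--Eilenberg complex and its functoriality\<close>

text \<open>The total differential on representatives; \<open>CE_ops\<close> shows that it induces
  \<open>adiff\<close>.\<close>

definition dtot :: "('a::ab_group_add, 'k::field) top_dgla \<Rightarrow> ('a \<Rightarrow> 'k, 'k) free_alg \<Rightarrow> ('a \<Rightarrow> 'k, 'k) free_alg" where
  "dtot g a = dfree (CE_I g) a + dfree (CE_II g) a"

lemma dtot_simps: "dtot g (a + b) = dtot g a + dtot g b" "dtot g (fsmul c a) = fsmul c (dtot g a)"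
  "dtot g 0 = 0" "dtot g (a - b) = dtot g a - dtot g b"
  by (simp_all add: dtot_def dfree_simps FA.scale_right_distrib)

lemma (in sym_eval) Phi_nil: "Phi a [] = lookup a []"
proof (induction a rule: free_induct)
  case (word u)
  thus ?case by (cases u) (simp_all add: Phi_at lookup_single onef_def sp_nil gen_apply)
qed (simp_all add: Phi_at lookup_add)

context complete_dg
begin

text \<open>Both evaluations have the relators as kernel, so vanishing can be transferred between
  coordinates and elements.\<close>

lemma Phi_basis_iff: assumes B: "graded_basis sc Wg B" and a: "a \<in> wordsp Wg"
  shows "sym_eval.Phi ldeg (coord sc B) a = 0 \<longleftrightarrow> M.Phi a = 0"
    and "a \<in> J \<longleftrightarrow> M.Phi a = 0"
proof -
  interpret GB: graded_basis sc Wg B by fact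
  show "GB.Phi a = 0 \<longleftrightarrow> M.Phi a = 0" "a \<in> J \<longleftrightarrow> M.Phi a = 0"
    using GB.J_iff[OF a] M_kernel[OF a] M.Phi_symrel[of a] by blast+
qed

lemma cl_eq: "cl a = cl b \<longleftrightarrow> a - b \<in> J" and J_wordsp: "a \<in> J \<Longrightarrow> a \<in> wordsp Wg"
  and cl_mem: "b \<in> cl a \<longleftrightarrow> b - a \<in> J"
proof -
  obtain B where "graded_basis sc Wg B" using basis_ex by blast
  then interpret GB: graded_basis sc Wg B .
  show "cl a = cl b \<longleftrightarrow> a - b \<in> J" "a \<in> J \<Longrightarrow> a \<in> wordsp Wg" "b \<in> cl a \<longleftrightarrow> b - a \<in> J"
    by (rule GB.cl_eq GB.symrel_wordsp GB.cl_mem; assumption)+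
qed

lemma cl_Phi: "a \<in> wordsp Wg \<Longrightarrow> b \<in> wordsp Wg \<Longrightarrow> cl a = cl b \<longleftrightarrow> M.Phi a = M.Phi b"
  using M_eq_J M.Phi_symrel[of "a - b"] by (auto simp: cl_eq M.Phi_simps)

lemma dtot_in: "a \<in> wordspn Wg n \<Longrightarrow> dtot g a \<in> wordspn Wg (n + 1)"
  and dtot_wordsp: "b \<in> wordsp Wg \<Longrightarrow> dtot g b \<in> wordsp Wg"
proof -
  obtain B where "graded_basis sc Wg B" using basis_ex by blast
  note s = sym_der_CE[OF this]
  show "dtot g a \<in> wordspn Wg (n + 1)" if "a \<in> wordspn Wg n"
    unfolding dtot_def by (intro FA.span_add sym_der.dfree_in[OF s(1)] sym_der.dfree_in[OF s(2)] that)
  show "dtot g b \<in> wordsp Wg" if "b \<in> wordsp Wg"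
    unfolding dtot_def by (intro FA.span_add sym_der.dfree_wordsp[OF s(1)] sym_der.dfree_wordsp[OF s(2)] that)
qed

lemma Phi_dword_nil: assumes "\<And>n x. x \<in> Wg n \<Longrightarrow> M.Phi (\<delta> n x) [] = 0" "u \<in> words Wg"
  shows "M.Phi (dword \<delta> u) [] = 0"
  using assms(2) by (induction u) (simp_all add: M.Phi_at M.Phi_fmul M.sp_nil assms(1) M.gen_apply)

lemma dtot_nil: assumes "a \<in> wordsp Wg" shows "lookup (dtot g a) [] = 0"
proof -
  from assms have "M.Phi (dtot g a) [] = 0"
  proof (induction rule: free_span_induct)
    case (word u)
    have "M.Phi (CE_I g n x) [] = 0" "M.Phi (CE_II g n x) [] = 0" if "x \<in> Wg n" for n x
      using CE_II_len[OF that] Phi_CE_I[of n x] by (auto simp: supp_def fun_ap M.gen_apply)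
    thus ?case using Phi_dword_nil[OF _ word] by (simp add: dtot_def M.Phi_at dfree_simps)
  qed (simp_all add: M.Phi_at dtot_simps)
  thus ?thesis by (simp add: M.Phi_nil)
qed

text \<open>The squares of \<open>d_I\<close> and \<open>d_II\<close> and their anticommutator are
  derivations, so basis letters suffice; there \<open>square_I\<close>, \<open>square_II\<close> and
  \<open>square_mixed\<close> apply.\<close>

lemma dtot_square: assumes a: "a \<in> wordsp Wg" shows "M.Phi (dtot g (dtot g a)) = 0"
proof -
  obtain B where B: "graded_basis sc Wg B" using basis_ex by blast
  interpret I: sym_der sc Wg B "CE_I g" by (rule sym_der_CE[OF B])
  interpret II: sym_der sc Wg B "CE_II g" by (rule sym_der_CE[OF B])
  have L: "I.Phi x \<in> I.Lam" if "x \<in> wordsp Wg" for x by (rule I.Phi_Lam[OF that])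
  note dw = I.dfree_wordsp II.dfree_wordsp
  have letI: "I.Phi (dfree (CE_I g) (CE_I g n b)) = 0" "I.Phi (dfree (CE_II g) (CE_II g n b)) = 0"
    "I.Phi (dfree (CE_I g) (CE_II g n b) + dfree (CE_II g) (CE_I g n b)) = 0" if "b \<in> Wg n" for n b
    using square_I[OF that] square_II[OF that] square_mixed[OF that]
      wordspn_sub[OF CE_I_in[OF that]] wordspn_sub[OF CE_II_wordspn[OF that]]
    by (subst Phi_basis_iff[OF B]; auto intro!: dw FA.span_add)+
  have BW: "snd (snd l) \<in> Wg (fst (snd l))" if "l \<in> I.VL" for l using that I.B_W by blast
  have sq: "I.der I.dB (I.dB l) = 0" "I.der II.dB (II.dB l) = 0" "I.der I.dB (II.dB l) + I.der II.dB (I.dB l) = 0" for l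
  proof -
    consider "l \<notin> I.VL" | "l \<in> I.VL" by blast
    hence "I.der I.dB (I.dB l) = 0 \<and> I.der II.dB (II.dB l) = 0 \<and> I.der I.dB (II.dB l) + I.der II.dB (I.dB l) = 0"
    proof cases
      case 1
      hence "I.dB l = 0" "II.dB l = 0" by (auto simp: I.dB_def II.dB_def)
      thus ?thesis by simp
    next
      case 2
      let ?n = "fst (snd l)" and ?b = "snd (snd l)"
      note w = wordspn_sub[OF CE_I_in[OF BW[OF 2]]] wordspn_sub[OF CE_II_wordspn[OF BW[OF 2]]]
      have "I.dB l = I.Phi (CE_I g ?n ?b)" "II.dB l = I.Phi (CE_II g ?n ?b)" using 2 by (simp_all add: I.dB_def II.dB_def)
      thus ?thesis
        using letI[OF BW[OF 2]] w by (simp add: I.Phi_dfree[symmetric] II.Phi_dfree[symmetric] I.Phi_simps)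
    qed
    thus "I.der I.dB (I.dB l) = 0" "I.der II.dB (II.dB l) = 0" "I.der I.dB (II.dB l) + I.der II.dB (I.dB l) = 0" by blast+
  qed
  let ?f = "I.Phi a"
  have f: "?f \<in> I.Lam" by (rule L[OF a])
  have "I.Phi (dtot g (dtot g a)) = (I.der I.dB (I.der I.dB ?f) + I.der II.dB (I.der II.dB ?f)) + (I.der I.dB (I.der II.dB ?f) + I.der II.dB (I.der I.dB ?f))"
    using a by (simp add: dtot_def dfree_simps I.Phi_simps I.Phi_dfree II.Phi_dfree dw)
  moreover have "I.der I.dB (I.der I.dB ?f) = 0" by (rule I.der_square_zero[OF I.dB_hom I.dB_Lam sq(1) f])
  moreover have "I.der II.dB (I.der II.dB ?f) = 0" by (rule I.der_square_zero[OF II.dB_hom II.dB_Lam sq(2) f])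
  moreover have "I.der I.dB (I.der II.dB ?f) + I.der II.dB (I.der I.dB ?f) = I.numop (\<lambda>_. 0) ?f"
    by (rule I.der_der_anticomm[OF I.dB_hom I.dB_Lam II.dB_hom II.dB_Lam _ _ _ f]) (simp_all add: sq)
  moreover have "I.numop (\<lambda>_. 0) ?f = 0"
  proof -
    have "wsum (\<lambda>_. 0::nat) w = 0" for w :: "(bool \<times> int \<times> (('i \<Rightarrow> 'a) \<Rightarrow> 'k)) list" by (induction w) auto
    thus ?thesis by (simp add: I.numop_def fun_eq_iff fun_ap)
  qed
  ultimately have "I.Phi (dtot g (dtot g a)) = 0" by simp
  thus ?thesis using Phi_basis_iff(1)[OF B, of "dtot g (dtot g a)"] dtot_wordsp[OF dtot_wordsp[OF a]] by simp
qed

lemma CE_ops: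
  "azero (CE_plus g) = cl 0" "aadd (CE_plus g) (cl a) (cl b) = cl (a + b)" "asmul (CE_plus g) c (cl a) = cl (fsmul c a)"
  "a \<in> wordsp Wg \<Longrightarrow> b \<in> wordsp Wg \<Longrightarrow> amul (CE_plus g) (cl a) (cl b) = cl (fmul a b)"
  "a \<in> wordspn Wg n \<Longrightarrow> adiff (CE_plus g) (cl a) = cl (dtot g a)"
proof -
  obtain B where B: "graded_basis sc Wg B" using basis_ex by blast
  then interpret GB: graded_basis sc Wg B .
  note s = sym_der_CE[OF B]
  show "azero (CE_plus g) = cl 0" "aadd (CE_plus g) (cl a) (cl b) = cl (a + b)" "asmul (CE_plus g) c (cl a) = cl (fsmul c a)"
    "a \<in> wordsp Wg \<Longrightarrow> b \<in> wordsp Wg \<Longrightarrow> amul (CE_plus g) (cl a) (cl b) = cl (fmul a b)"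
    by (simp_all add: CE_plus_def augmentation_ideal_def CE_def Let_def GB.azero_sym GB.aadd_cl GB.asmul_cl GB.amul_cl)
  show "adiff (CE_plus g) (cl a) = cl (dtot g a)" if "a \<in> wordspn Wg n"
    using sym_der.sym_derivation_cl[OF s(1) that] sym_der.sym_derivation_cl[OF s(2) that]
    by (simp add: CE_plus_def augmentation_ideal_def CE_def Let_def GB.aadd_cl dtot_def)
qed

text \<open>Relators have coefficient 0 at the empty word, so all representatives of a class have
  the same constant term.\<close>

lemma aug_cl: "aug (CE g) (cl a) = lookup a []"
proof -
  have "lookup x [] = lookup a []" if "x \<in> cl a" for x
  proof -
    have "M.Phi (x - a) = 0" using that M.Phi_symrel by (simp add: cl_mem)
    hence "M.Phi (x - a) [] = 0" by (simp add: zero_fun_apply)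
    thus ?thesis by (simp add: M.Phi_nil lookup_minus)
  qed
  moreover have "a \<in> cl a" by (simp add: cl_mem FA.span_zero)
  ultimately have "(THE c. \<forall>x\<in>cl a. lookup x [] = c) = lookup a []"
    by (intro the_equality ballI) (assumption, rule sym, erule (1) bspec)
  thus ?thesis by (simp add: CE_def Let_def)
qed

lemma part_CE: "part (CE_plus g) n = cl ` {a \<in> wordspn Wg n. lookup a [] = 0}"
proof -
  have "part (CE g) n = cl ` wordspn Wg n" by (simp add: CE_def Let_def sym_alg_def)
  thus ?thesis by (auto simp: CE_plus_def augmentation_ideal_def aug_cl)
qed

end

subsection \<open>Pullback of cochains\<close>

definition pull :: "('a::ab_group_add, 'k::field) top_dgla \<Rightarrow> ('a \<Rightarrow> 'b) \<Rightarrow> int \<Rightarrow> ('b \<Rightarrow> 'k) \<Rightarrow> 'a \<Rightarrow> 'k" where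
  "pull g f n \<phi> = (\<lambda>x. if x \<in> grd g (n - 1) then \<phi> (f x) else 0)"

definition fmap :: "('a::ab_group_add, 'k::field) top_dgla \<Rightarrow> ('a \<Rightarrow> 'b) \<Rightarrow> ('b \<Rightarrow> 'k, 'k) free_alg \<Rightarrow> ('a \<Rightarrow> 'k, 'k) free_alg" where
  "fmap g f = lext fsmul (\<lambda>u. word (map (\<lambda>l. (fst l, pull g f (fst l) (snd l))) u))"

lemma fmap_simps: "fmap g f (a + b) = fmap g f a + fmap g f b" "fmap g f (fsmul c a) = fsmul c (fmap g f a)"
  "fmap g f (word u) = word (map (\<lambda>l. (fst l, pull g f (fst l) (snd l))) u)" "fmap g f 0 = 0" "fmap g f (a - b) = fmap g f a - fmap g f b"
  by (simp_all add: fmap_def lext_linear[OF vector_space_fsmul])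

lemma fmap_fmul: "fmap g f (fmul a b) = fmul (fmap g f a) (fmap g f b)"
proof (induction a rule: free_induct)
  case (word u)
  show ?case by (induction b rule: free_induct) (simp_all add: fmul_simps fmap_simps)
qed (simp_all add: fmul_simps fmap_simps)

lemma fmap_nil: "lookup (fmap g f a) [] = lookup a []"
  by (induction a rule: free_induct) (simp_all add: fmap_simps lookup_add lookup_single)

definition flet :: "('a \<Rightarrow> 'b) \<Rightarrow> int \<times> 'a \<Rightarrow> int \<times> 'b" where
  "flet f l = (fst l, f (snd l))"

locale cont_map = A: complete_dg S g + B: complete_dg S' g'
  for S :: "('i, 'a::ab_group_add, 'k::field_char_0) inv_sys" and g
    and S' :: "('j, 'b::ab_group_add, 'k) inv_sys" and g' +
  fixes f
  assumes cont: "cont_hom g g' f"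
begin

lemma f_hom: "x \<in> grd g n \<Longrightarrow> f x \<in> grd g' n" "x \<in> grd g n \<Longrightarrow> y \<in> grd g n \<Longrightarrow> f (x + y) = f x + f y"
  "x \<in> grd g n \<Longrightarrow> f (scl g c x) = scl g' c (f x)" "x \<in> grd g n \<Longrightarrow> f (dif g x) = dif g' (f x)"
  "x \<in> grd g n \<Longrightarrow> y \<in> grd g m \<Longrightarrow> f (brk g x y) = brk g' (f x) (f y)"
  using cont unfolding cont_hom_def dgla_hom_def by blast+

lemma pull_in: assumes "\<phi> \<in> susp_dual g' n" shows "pull g f n \<phi> \<in> susp_dual g n"
proof -
  have p: "\<phi> \<in> dual g' (n - 1)" using assms by (simp add: susp_dual_def)
  have "continuous_map (topo g' (n - 1)) (discrete_topology UNIV) \<phi>" using p by (simp add: dual_def)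
  moreover have "continuous_map (topo g (n - 1)) (topo g' (n - 1)) f" using cont by (simp add: cont_hom_def)
  ultimately have "continuous_map (topo g (n - 1)) (discrete_topology UNIV) (\<phi> \<circ> f)"
    using continuous_map_compose by blast
  hence "continuous_map (topo g (n - 1)) (discrete_topology UNIV) (pull g f n \<phi>)"
    by (rule continuous_map_eq) (simp add: pull_def A.topo_g A.grd_obj)
  thus ?thesis unfolding susp_dual_def dual_def
    using A.grd_closed B.dualD(1,2)[OF p] f_hom by (simp add: pull_def)
qed

lemma valid_flet: "valid g l \<Longrightarrow> valid g' (flet f l)" using f_hom(1) by (simp add: valid_def flet_def)

lemma ev2_pull: "valid g l \<Longrightarrow> ev2 g n (pull g f n \<phi>) l = ev2 g' n \<phi> (flet f l)"
  using valid_flet[of l] by (auto simp: ev2_def pull_def valid_def flet_def)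

lemma flet_merge: "valid g l1 \<Longrightarrow> valid g l2 \<Longrightarrow> flet f (A.merge l1 l2) = B.merge (flet f l1) (flet f l2)"
  and flet_dlet: "valid g l1 \<Longrightarrow> flet f (A.dlet l1) = B.dlet (flet f l1)"
  and sgn_flet: "B.sgn2 (flet f l1) (flet f l2) = A.sgn2 l1 l2"
  using f_hom(4,5) by (auto simp: flet_def A.merge_def B.merge_def A.dlet_def B.dlet_def A.sgn2_def B.sgn2_def valid_def)

lemma words_pull: "u \<in> words (susp_dual g') \<Longrightarrow> map (\<lambda>l. (fst l, pull g f (fst l) (snd l))) u \<in> words (susp_dual g)"
  using pull_in by (induction u) auto

lemma degree_pull: "word_degree (map (\<lambda>l. (fst l, pull g f (fst l) (snd l))) u) = word_degree u"
  by (induction u) simp_all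

lemma fmap_in: assumes "a \<in> wordspn (susp_dual g') n" shows "fmap g f a \<in> wordspn (susp_dual g) n"
  using assms by (induction rule: free_span_induct)
      (auto simp: fmap_simps FA.span_zero FA.span_add FA.span_scale degree_pull intro!: word_in words_pull)

lemma fmap_wordsp: assumes "a \<in> wordsp (susp_dual g')" shows "fmap g f a \<in> wordsp (susp_dual g)"
  using assms by (induction rule: free_span_induct)
      (auto simp: fmap_simps FA.span_zero FA.span_add FA.span_scale intro!: word_in words_pull)

text \<open>In the evaluation at elements, pullback of cochains is composition with
  \<open>f\<close>, provided the letters are valid: \<open>pull\<close> is cut off outside its
  degree.\<close>

lemma Phi_fmap: assumes "\<forall>l\<in>set w. valid g l"
  shows "A.M.Phi (fmap g f a) w = B.M.Phi a (map (flet f) w)"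
proof (induction a rule: free_induct)
  case (word u)
  have "A.M.phw (map (\<lambda>l. (fst l, pull g f (fst l) (snd l))) u) w = B.M.phw u (map (flet f) w)"
    using assms
  proof (induction u arbitrary: w)
    case (Cons l u)
    have ge: "A.M.gen (fst l) (pull g f (fst l) (snd l)) v = B.M.gen (fst l) (snd l) (map (flet f) v)"
      if "set v \<subseteq> {l. valid g l}" for v
      unfolding A.M.gen_def B.M.gen_def using that by (auto simp: ev2_pull split: list.splits)
    have "B.M.sp (B.M.gen (fst l) (snd l)) (B.M.phw u) (map (flet f) w) =
        A.M.sp (A.M.gen (fst l) (pull g f (fst l) (snd l))) (A.M.phw (map (\<lambda>l. (fst l, pull g f (fst l) (snd l))) u)) w"
    proof (rule sp_subst[where A = "{l. valid g l}"])
      show "B.M.phw u (map (flet f) v) = A.M.phw (map (\<lambda>l. (fst l, pull g f (fst l) (snd l))) u) v" if "set v \<subseteq> {l. valid g l}" for v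
        by (rule Cons.IH[symmetric]) (use that in blast)
    qed (use Cons.prems ge in \<open>auto simp: flet_def\<close>)
    thus ?case by simp
  qed (auto simp: onef_def)
  thus ?case by (simp add: fmap_simps A.M.Phi_at B.M.Phi_at)
qed (simp_all add: fmap_simps A.M.Phi_at B.M.Phi_at)

lemma Phi_fmap_0: "B.M.Phi a = 0 \<Longrightarrow> A.M.Phi (fmap g f a) = 0"
proof
  fix w assume 0: "B.M.Phi a = 0"
  show "A.M.Phi (fmap g f a) w = 0 w"
  proof (cases "\<forall>l\<in>set w. valid g l")
    case True
    thus ?thesis using Phi_fmap 0 by (simp add: zero_fun_apply)
  next
    case False
    thus ?thesis using A.Phi_valid by (fastforce simp: zero_fun_apply)
  qed
qed

lemma fmap_J: "a \<in> B.J \<Longrightarrow> fmap g f a \<in> A.J"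
  using A.M_kernel[OF fmap_wordsp] B.J_wordsp Phi_fmap_0 B.M.Phi_symrel by blast

lemma fmap_cl: "B.cl a = B.cl b \<Longrightarrow> A.cl (fmap g f a) = A.cl (fmap g f b)"
  using fmap_J[of "a - b"] by (simp add: A.cl_eq B.cl_eq fmap_simps)

lemma dfree_fmap:
  assumes \<delta>: "\<And>n \<phi>. \<phi> \<in> susp_dual g' n \<Longrightarrow> A.M.Phi (fmap g f (\<delta>' n \<phi>)) = A.M.Phi (\<delta> n (pull g f n \<phi>))"
    and a: "a \<in> wordsp (susp_dual g')"
  shows "A.M.Phi (fmap g f (dfree \<delta>' a)) = A.M.Phi (dfree \<delta> (fmap g f a))" using a
proof (induction rule: free_span_induct)
  case (word u)
  hence "A.M.Phi (fmap g f (dword \<delta>' u)) = A.M.Phi (dword \<delta> (map (\<lambda>l. (fst l, pull g f (fst l) (snd l))) u))"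
  proof (induction u)
    case (Cons l u)
    thus ?case by (simp add: fmap_simps fmap_fmul A.M.Phi_simps A.M.Phi_fmul \<delta>)
  qed (simp add: fmap_simps)
  thus ?case by (simp add: dfree_simps fmap_simps)
qed (simp_all add: dfree_simps fmap_simps A.M.Phi_simps)

text \<open>\<open>f\<close> commutes with differential and bracket, and equality is tested at
  elements; the representing lists of the dual brackets need not correspond.\<close>

lemma fmap_CE: assumes p: "\<phi> \<in> susp_dual g' n"
  shows "A.M.Phi (fmap g f (CE_I g' n \<phi>)) = A.M.Phi (CE_I g n (pull g f n \<phi>))"
    and "A.M.Phi (fmap g f (CE_II g' n \<phi>)) = A.M.Phi (CE_II g n (pull g f n \<phi>))"
proof -
  note q = pull_in[OF p]
  have len: "supp (A.M.Phi (fmap g f a)) (len k)" if "supp (B.M.Phi a) (len k)" for a k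
    unfolding supp_def
  proof (intro allI impI)
    fix w assume w: "A.M.Phi (fmap g f a) w \<noteq> 0"
    hence "\<forall>l\<in>set w. valid g l" using A.Phi_valid by blast
    thus "length w = k" using w suppD[OF that, of "map (flet f) w"] by (simp add: Phi_fmap)
  qed
  have l1: "supp (A.M.Phi (CE_I g n \<psi>)) (len 1)" if "\<psi> \<in> susp_dual g n" for \<psi> n
    unfolding A.Phi_CE_I by (intro supp_closed A.M.gen_supp)
  have l1': "supp (B.M.Phi (CE_I g' n \<psi>)) (len 1)" if "\<psi> \<in> susp_dual g' n" for \<psi> n
    unfolding B.Phi_CE_I by (intro supp_closed B.M.gen_supp)
  show "A.M.Phi (fmap g f (CE_I g' n \<phi>)) = A.M.Phi (CE_I g n (pull g f n \<phi>))"
  proof (rule A.len1_ext[OF len[OF l1'[OF p]] l1[OF q]])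
    show "A.M.Phi (fmap g f (CE_I g' n \<phi>)) [l] = A.M.Phi (CE_I g n (pull g f n \<phi>)) [l]" if l: "valid g l" for l
      using l by (simp add: Phi_fmap B.d1_len1[OF p valid_flet[OF l]] A.d1_len1[OF q l] ev2_pull[OF A.valid_dlet] flet_dlet)
        (simp add: flet_def)
  qed (rule A.Phi_valid; assumption)+
  show "A.M.Phi (fmap g f (CE_II g' n \<phi>)) = A.M.Phi (CE_II g n (pull g f n \<phi>))"
  proof (rule A.len2_ext[OF len[OF B.CE_II_len[OF p]] A.CE_II_len[OF q]])
    show "A.M.Phi (fmap g f (CE_II g' n \<phi>)) [l1, l2] = A.M.Phi (CE_II g n (pull g f n \<phi>)) [l1, l2]"
      if l: "valid g l1" "valid g l2" for l1 l2
      using l by (simp add: Phi_fmap B.d2_len1[OF p valid_flet[OF l(1)] valid_flet[OF l(2)]] A.d2_len1[OF q l]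
          ev2_pull[OF A.valid_merge] flet_merge sgn_flet)
  qed (rule A.Phi_valid; assumption)+
qed

lemma Phi_fmap_dfree:  assumes "a \<in> wordsp (susp_dual g')"
  shows "A.M.Phi (fmap g f (dfree (CE_I g') a)) = A.M.Phi (dfree (CE_I g) (fmap g f a))"
    and "A.M.Phi (fmap g f (dfree (CE_II g') a)) = A.M.Phi (dfree (CE_II g) (fmap g f a))"
  by (rule dfree_fmap[OF _ assms]; rule fmap_CE; assumption)+

lemma Phi_fmap_dtot:  assumes "a \<in> wordsp (susp_dual g')"
  shows "A.M.Phi (fmap g f (dtot g' a)) = A.M.Phi (dtot g (fmap g f a))"
  by (simp add: dtot_def fmap_simps A.M.Phi_simps Phi_fmap_dfree[OF assms])

end

section \<open>Central extensions\<close>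

text \<open>\<open>\<omega>\<close> is a 2-cocycle of the underlying graded Lie algebra with values
  in the field, placed in degree \<open>r\<close>.\<close>

locale central_ext = dgla L for L :: "('c::ab_group_add, 'k::field_char_0) dgla_struct" +
  fixes \<omega> :: "'c \<Rightarrow> 'c \<Rightarrow> 'k" and r :: int
  assumes om_add: "x \<in> grd L i \<Longrightarrow> x' \<in> grd L i \<Longrightarrow> y \<in> grd L j \<Longrightarrow> \<omega> (x + x') y = \<omega> x y + \<omega> x' y"
    and om_scl: "x \<in> grd L i \<Longrightarrow> y \<in> grd L j \<Longrightarrow> \<omega> (scl L c x) y = c * \<omega> x y"
    and om_anti: "x \<in> grd L i \<Longrightarrow> y \<in> grd L j \<Longrightarrow> \<omega> x y = - eps (i * j) * \<omega> y x"
    and om_jac: "x \<in> grd L i \<Longrightarrow> y \<in> grd L j \<Longrightarrow> z \<in> grd L l \<Longrightarrow>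
      \<omega> x (brk L y z) = \<omega> (brk L x y) z + eps (i * j) * \<omega> y (brk L x z)"
    and om_zero: "x \<in> grd L i \<Longrightarrow> y \<in> grd L j \<Longrightarrow> i + j \<noteq> r \<Longrightarrow> \<omega> x y = 0"
begin

sublocale LV: vector_space "scl L" by (rule vector_space)

lemma zero_grd: "0 \<in> grd L n" using LV.subspace_0[OF subspace] .

lemma grd_op: "x \<in> grd L n \<Longrightarrow> y \<in> grd L n \<Longrightarrow> x + y \<in> grd L n" "x \<in> grd L n \<Longrightarrow> scl L c x \<in> grd L n"
  using LV.subspace_add[OF subspace] LV.subspace_scale[OF subspace] by blast+

lemma om_0: "y \<in> grd L j \<Longrightarrow> \<omega> 0 y = 0" "x \<in> grd L i \<Longrightarrow> \<omega> x 0 = 0"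
proof -
  show a: "\<omega> 0 y = 0" if "y \<in> grd L j" for y j using om_add[OF zero_grd zero_grd that] by simp
  show "\<omega> x 0 = 0" if "x \<in> grd L i" using om_anti[OF that zero_grd] a[OF that] by simp
qed

lemma om_add_right: "x \<in> grd L i \<Longrightarrow> y \<in> grd L j \<Longrightarrow> y' \<in> grd L j \<Longrightarrow> \<omega> x (y + y') = \<omega> x y + \<omega> x y'"
  using om_anti[of x i y j] om_anti[of x i y' j] om_anti[of x i "y + y'" j] om_add[of y j y' x i] grd_op
  by (simp add: algebra_simps)

lemma om_scl_right: "x \<in> grd L i \<Longrightarrow> y \<in> grd L j \<Longrightarrow> \<omega> x (scl L c y) = c * \<omega> x y"
  using om_anti[of x i y j] om_anti[of x i "scl L c y" j] om_scl[of y j x i c] grd_op by simp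

text \<open>The bracket of a \<open>dgla_struct\<close> does not receive degrees, so the sign of
  \<open>x\<close> is recovered from the degree in which it lies. That degree is unique unless
  \<open>x = 0\<close>, where the factor \<open>\<omega> x\<close> vanishes on homogeneous
  elements.\<close>

definition sg :: "'c \<Rightarrow> 'k" where "sg x = eps (SOME i. x \<in> grd L i)"

lemma sg: assumes "x \<in> grd L i" "y \<in> grd L j" shows "sg x * \<omega> x y = eps i * \<omega> x y"
proof (cases "x = 0")
  case False
  have "(SOME i. x \<in> grd L i) = i"
  proof (rule some_equality)
    show "i' = i" if "x \<in> grd L i'" for i' using disjoint[of i' i] assms(1) that False by blast
  qed (fact assms(1))
  thus ?thesis by (simp add: sg_def)
qed (simp add: om_0[OF assms(2)])

definition \<eta> :: "'c \<Rightarrow> 'c \<Rightarrow> 'k" where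
  "\<eta> x y = \<omega> (dif L x) y + sg x * \<omega> x (dif L y)"

lemma eta: "x \<in> grd L i \<Longrightarrow> y \<in> grd L j \<Longrightarrow> \<eta> x y = \<omega> (dif L x) y + eps i * \<omega> x (dif L y)"
  using sg[of x i "dif L y" "j - 1"] dif_grd by (simp add: \<eta>_def)

lemma eta_add:
  assumes "x \<in> grd L i" "x' \<in> grd L i" "y \<in> grd L j" shows "\<eta> (x + x') y = \<eta> x y + \<eta> x' y"
  unfolding eta[OF assms(1,3)] eta[OF assms(2,3)] eta[OF grd_op(1)[OF assms(1,2)] assms(3)] dif_add[OF assms(1,2)]
    om_add[OF dif_grd[OF assms(1)] dif_grd[OF assms(2)] assms(3)] om_add[OF assms(1,2) dif_grd[OF assms(3)]]
  by (simp add: algebra_simps)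

lemma eta_scl: assumes "x \<in> grd L i" "y \<in> grd L j" shows "\<eta> (scl L c x) y = c * \<eta> x y"
  unfolding eta[OF assms] eta[OF grd_op(2)[OF assms(1)] assms(2)] dif_scl[OF assms(1)]
    om_scl[OF dif_grd[OF assms(1)] assms(2)] om_scl[OF assms(1) dif_grd[OF assms(2)]]
  by (simp add: algebra_simps)

lemma eta_0: "y \<in> grd L j \<Longrightarrow> \<eta> 0 y = 0" "x \<in> grd L i \<Longrightarrow> \<eta> x 0 = 0"
proof -
  have d0: "dif L 0 = 0" using dif_add[OF zero_grd zero_grd] by simp
  show "\<eta> 0 y = 0" if "y \<in> grd L j"
    using eta[OF zero_grd that] om_0(1)[OF that] om_0(1)[OF dif_grd[OF that]] by (simp add: d0)
  show "\<eta> x 0 = 0" if "x \<in> grd L i"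
    using eta[OF that zero_grd] om_0(2)[OF that] om_0(2)[OF dif_grd[OF that]] by (simp add: d0)
qed

lemma eta_anti: assumes "x \<in> grd L i" "y \<in> grd L j" shows "\<eta> x y = - eps (i * j) * \<eta> y x"
  using om_anti[OF dif_grd[OF assms(1)] assms(2)] om_anti[OF assms(1) dif_grd[OF assms(2)]]
  by (simp add: eta[OF assms] eta[OF assms(2,1)]) (auto simp: eps_def)

lemma eta_zero: "x \<in> grd L i \<Longrightarrow> y \<in> grd L j \<Longrightarrow> i + j \<noteq> r + 1 \<Longrightarrow> \<eta> x y = 0"
  using om_zero[OF dif_grd, of x i y j] om_zero[OF _ dif_grd, of x i y j] by (simp add: eta)

text \<open>Expanding the differential of a bracket by the Leibniz rule leaves the cocycle identity
  of \<open>\<omega>\<close> for the three triples in which one entry is differentiated.\<close>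

lemma eta_jac: assumes x: "x \<in> grd L i" and y: "y \<in> grd L j" and z: "z \<in> grd L l"
  shows "\<eta> x (brk L y z) = \<eta> (brk L x y) z + eps (i * j) * \<eta> y (brk L x z)"
proof -
  note dx = dif_grd[OF x] and dy = dif_grd[OF y] and dz = dif_grd[OF z]
  have g: "brk L (dif L y) z \<in> grd L (j + l - 1)" "brk L y (dif L z) \<in> grd L (j + l - 1)"
    "brk L (dif L x) y \<in> grd L (i + j - 1)" "brk L x (dif L y) \<in> grd L (i + j - 1)"
    "brk L (dif L x) z \<in> grd L (i + l - 1)" "brk L x (dif L z) \<in> grd L (i + l - 1)"
    using brk_grd[OF dy z] brk_grd[OF y dz] brk_grd[OF dx y] brk_grd[OF x dy] brk_grd[OF dx z] brk_grd[OF x dz]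
    by (simp_all add: algebra_simps)
  have 1: "\<omega> x (dif L (brk L y z)) = \<omega> x (brk L (dif L y) z) + eps j * \<omega> x (brk L y (dif L z))"
    using om_add_right[OF x g(1) grd_op(2)[OF g(2)]] om_scl_right[OF x g(2)] dif_brk[OF y z] by (simp add: powi_eps)
  have 2: "\<omega> (dif L (brk L x y)) z = \<omega> (brk L (dif L x) y) z + eps i * \<omega> (brk L x (dif L y)) z"
    using om_add[OF g(3) grd_op(2)[OF g(4)] z] om_scl[OF g(4) z] dif_brk[OF x y] by (simp add: powi_eps)
  have 3: "\<omega> y (dif L (brk L x z)) = \<omega> y (brk L (dif L x) z) + eps i * \<omega> y (brk L x (dif L z))"
    using om_add_right[OF y g(5) grd_op(2)[OF g(6)]] om_scl_right[OF y g(6)] dif_brk[OF x z] by (simp add: powi_eps)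
  show ?thesis
    unfolding eta[OF x brk_grd[OF y z]] eta[OF brk_grd[OF x y] z] eta[OF y brk_grd[OF x z]] 1 2 3
      om_jac[OF dx y z] om_jac[OF x dy z] om_jac[OF x y dz] by (auto simp: eps_def)
qed

text \<open>
  The extension of \<open>L\<close> by the acyclic complex \<open>t \<mapsto> s\<close>: the 2-cocycle \<open>\<omega>\<close> of the bracket need not be closed for
  the differential, and \<open>\<eta> = d \<omega>\<close> in the second coordinate makes up for it.
\<close>

definition E :: "('c \<times> 'k \<times> 'k, 'k) dgla_struct" where
  "E = \<lparr> scl = (\<lambda>c (x, s, t). (scl L c x, c * s, c * t)),
    grd = (\<lambda>n. {(x, s, t). x \<in> grd L n \<and> (n \<noteq> r \<longrightarrow> s = 0) \<and> (n \<noteq> r + 1 \<longrightarrow> t = 0)}),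
    dif = (\<lambda>(x, s, t). (dif L x, t, 0)),
    brk = (\<lambda>(x, _) (y, _). (brk L x y, \<omega> x y, \<eta> x y)) \<rparr>"

lemma E_simps [simp]: "scl E c (x, s, t) = (scl L c x, c * s, c * t)" "dif E (x, s, t) = (dif L x, t, 0)"
  "brk E (x, s, t) (y, s', t') = (brk L x y, \<omega> x y, \<eta> x y)"
  "(x, s, t) \<in> grd E n \<longleftrightarrow> x \<in> grd L n \<and> (n \<noteq> r \<longrightarrow> s = 0) \<and> (n \<noteq> r + 1 \<longrightarrow> t = 0)"
  by (simp_all add: E_def)

lemma vector_space_E: "vector_space (scl E)"
  by unfold_locales (auto simp: E_def algebra_simps LV.scale_right_distrib LV.scale_left_distrib)

sublocale EV: vector_space "scl E" by (rule vector_space_E)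

lemma dgla_E: "dgla E"
proof (rule dgla.intro)
  show "vector_space (scl E)" by (rule vector_space_E)
  show "module.subspace (scl E) (grd E n)" for n
    unfolding EV.subspace_def by (auto simp: zero_prod_def zero_grd grd_op)
  show "grd E m \<inter> grd E n = {0}" if "m \<noteq> n" for m n
    using disjoint[OF that] that zero_grd by (auto simp: zero_prod_def E_def)
  fix x :: "'c \<times> 'k \<times> 'k" and n assume x: "x \<in> grd E n"
  obtain x1 s t where xs: "x = (x1, s, t)" by (cases x)
  have x1: "x1 \<in> grd L n" using x by (simp add: xs)
  show "dif E x \<in> grd E (n - 1)" using x dif_grd by (auto simp: xs)
  show "dif E (scl E c x) = scl E c (dif E x)" for c by (simp add: xs dif_scl[OF x1])
  show "dif E (dif E x) = 0" by (simp add: xs dif_dif[OF x1] zero_prod_def)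
  fix y :: "'c \<times> 'k \<times> 'k" and m
  obtain y1 s' t' where ys: "y = (y1, s', t')" by (cases y)
  show "dif E (x + y) = dif E x + dif E y" if "y \<in> grd E n"
    using dif_add[OF x1, of y1] that by (simp add: xs ys)
  assume "y \<in> grd E m"
  hence y1: "y1 \<in> grd L m" by (simp add: ys)
  show "brk E x y \<in> grd E (n + m)" using brk_grd[OF x1 y1] om_zero[OF x1 y1] eta_zero[OF x1 y1] by (simp add: xs ys)
  show "brk E (scl E c x) y = scl E c (brk E x y)" for c
    by (simp add: xs ys brk_scl_left[OF x1 y1] om_scl[OF x1 y1] eta_scl[OF x1 y1])
  show "brk E x y = scl E (- ((-1) powi (n * m))) (brk E y x)"
    using brk_antisym[OF x1 y1] om_anti[OF x1 y1] eta_anti[OF x1 y1]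
    by (simp add: xs ys powi_eps del: LV.scale_minus_left EV.scale_minus_left)
  show "dif E (brk E x y) = brk E (dif E x) y + scl E ((-1) powi n) (brk E x (dif E y))"
    using eta[OF dif_grd[OF x1] y1] eta[OF x1 dif_grd[OF y1]] om_0[of y1 m] om_0(2)[of x1 n] x1 y1
    by (simp add: xs ys dif_brk[OF x1 y1] eta[OF x1 y1] dif_dif powi_eps eps_diff) (simp add: eps_def[of 1])
  fix z :: "'c \<times> 'k \<times> 'k" and l
  obtain z1 s'' t'' where zs: "z = (z1, s'', t'')" by (cases z)
  show "brk E (x + z) y = brk E x y + brk E z y" if "z \<in> grd E n"
    using that brk_add_left[OF x1 _ y1] om_add[OF x1 _ y1] eta_add[OF x1 _ y1] by (simp add: xs ys zs)
  assume "z \<in> grd E l"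
  hence z1: "z1 \<in> grd L l" by (simp add: zs)
  show "brk E x (brk E y z) = brk E (brk E x y) z + scl E ((-1) powi (n * m)) (brk E y (brk E x z))"
    using jacobi[OF x1 y1 z1] om_jac[OF x1 y1 z1] eta_jac[OF x1 y1 z1] by (simp add: xs ys zs powi_eps)
qed

lemma fin_dim_E: assumes "fin_dim L" shows "fin_dim E" unfolding fin_dim_def
proof
  have "{n. grd E n \<noteq> {0}} \<subseteq> {n. grd L n \<noteq> {0}} \<union> {r, r + 1}"
    using zero_grd by (auto simp: E_def zero_prod_def)
  thus "finite {n. grd E n \<noteq> {0}}" using assms finite_subset unfolding fin_dim_def by blast
  show "\<forall>n. \<exists>B. finite B \<and> grd E n \<subseteq> EV.span B"
  proof
    fix n
    obtain B where B: "finite B" "grd L n \<subseteq> LV.span B" using assms unfolding fin_dim_def by blast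
    let ?B = "(\<lambda>b. (b, 0, 0)) ` B \<union> {(0, 1, 0), (0, 0, 1)}"
    have "(x, 0, 0) \<in> EV.span ?B" if "x \<in> LV.span B" for x using that
    proof (induction rule: LV.span_induct)
      case base
      have "(x, 0, 0) + (y, 0, 0) \<in> EV.span ?B" if "(x, 0, 0) \<in> EV.span ?B" "(y, 0, 0) \<in> EV.span ?B" for x y
        using EV.span_add[OF that] .
      moreover have "scl E c (x, 0, 0) \<in> EV.span ?B" if "(x, 0, 0) \<in> EV.span ?B" for x c
        using EV.span_scale[OF that] .
      ultimately show ?case using EV.span_zero[of ?B] by (auto simp: LV.subspace_def zero_prod_def)
    next
      case (step x)
      thus ?case by (intro EV.span_base) auto
    qed
    moreover have "scl E s (0, 1, 0) \<in> EV.span ?B" "scl E t (0, 0, 1) \<in> EV.span ?B" for s t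
      by (rule EV.span_scale[OF EV.span_base]; simp)+
    moreover have "(x, s, t) = (x, 0, 0) + (scl E s (0, 1, 0) + scl E t (0, 0, 1))" for x s t by simp
    ultimately have "(x, s, t) \<in> EV.span ?B" if "x \<in> LV.span B" for x s t
      using that EV.span_add by metis
    thus "\<exists>B. finite B \<and> grd E n \<subseteq> EV.span B" using B by (intro exI[of _ ?B]) auto
  qed
qed

text \<open>The lower central series of \<open>E\<close> projects into that of \<open>L\<close>.
  Once the latter vanishes, only central elements are left, and one further bracket kills
  them.\<close>

lemma nilpotent_E: assumes "nilpotent L" shows "nilpotent E"
proof -
  have sub: "lower_central E k n \<subseteq> {(x, s, t). x \<in> lower_central L k n \<and> (x, s, t) \<in> grd E n}" for k n
  proof (induction k arbitrary: n)
    case (Suc k)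
    let ?T = "{(x, s, t). x \<in> lower_central L (Suc k) n \<and> (x, s, t) \<in> grd E n}"
    have "{brk E x y | x y i j. x \<in> grd E i \<and> y \<in> lower_central E k j \<and> i + j = n} \<subseteq> ?T"
    proof (rule subsetI, elim CollectE exE conjE)
      fix v x y i j
      assume v: "v = brk E x y" and x: "x \<in> grd E i" and y: "y \<in> lower_central E k j" and n: "i + j = n"
      have y': "fst y \<in> lower_central L k j" "y \<in> grd E j" using Suc.IH[of j] y by auto
      have "v \<in> grd E n" using dgla.brk_grd[OF dgla_E x y'(2)] by (simp add: v n)
      moreover have "brk L (fst x) (fst y) \<in> lower_central L (Suc k) n"
        using x y'(1) n by (cases x) (auto intro!: LV.span_base)
      moreover have "fst v = brk L (fst x) (fst y)" by (cases x; cases y) (simp add: v)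
      ultimately show "v \<in> ?T" by (cases v) simp
    qed
    moreover have "EV.subspace ?T"
      unfolding EV.subspace_def by (auto simp: zero_prod_def zero_grd grd_op LV.span_zero LV.span_add LV.span_scale)
    ultimately show ?case using EV.span_minimal by simp
  qed auto
  obtain k where k: "\<And>n. lower_central L k n = {0}" using assms unfolding nilpotent_def by blast
  have "{brk E x y | x y i j. x \<in> grd E i \<and> y \<in> lower_central E k j \<and> i + j = n} \<subseteq> {0}" for n
  proof (rule subsetI, elim CollectE exE conjE)
    fix v X Y i j
    assume v: "v = brk E X Y" and X: "X \<in> grd E i" and Y: "Y \<in> lower_central E k j"
    obtain x s t where x: "X = (x, s, t)" by (cases X)
    have x': "x \<in> grd L i" using X by (simp add: x)
    have "fst Y = 0" using sub[of k j] k Y by auto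
    then obtain s' t' where y: "Y = (0, s', t')" by (cases Y) auto
    have "brk L 0 x = 0" using brk_scl_left[OF zero_grd x', where c = 0] by simp
    hence "brk L x 0 = 0" using brk_antisym[OF x' zero_grd] by simp
    thus "v \<in> {0}" using om_0(2)[OF x'] eta_0(2)[OF x'] by (simp add: v x y zero_prod_def)
  qed
  hence "lower_central E (Suc k) n \<subseteq> {0}" for n using EV.span_mono[of _ "{0}"] by simp
  moreover have "0 \<in> lower_central E (Suc k) n" for n by (simp add: EV.span_zero)
  ultimately show ?thesis unfolding nilpotent_def by blast
qed

end

section \<open>Finite-dimensional levels and maps into their extensions\<close>

lemma lower_central_grd: "dgla L \<Longrightarrow> lower_central L k n \<subseteq> grd L n"
proof (induction k arbitrary: n)
  case (Suc k)
  interpret L: dgla L by fact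
  interpret VL: vector_space "scl L" by (rule L.vector_space)
  have "{brk L x y |x y i j. x \<in> grd L i \<and> y \<in> lower_central L k j \<and> i + j = n} \<subseteq> grd L n"
    using Suc L.brk_grd by blast
  thus ?case using VL.span_minimal[OF _ L.subspace] by simp
qed simp

lemma subalgebra:
  fixes L :: "('c::ab_group_add, 'k::field_char_0) dgla_struct"
  assumes L: "dgla L" "fin_dim L" "nilpotent L"
    and sub: "\<And>n. H n \<subseteq> grd L n" "\<And>n. module.subspace (scl L) (H n)"
    and cl: "\<And>n x. x \<in> H n \<Longrightarrow> dif L x \<in> H (n - 1)" "\<And>m n x y. x \<in> H m \<Longrightarrow> y \<in> H n \<Longrightarrow> brk L x y \<in> H (m + n)"
  defines "M \<equiv> L\<lparr>grd := H\<rparr>"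
  shows "dgla M" "fin_dim M" "nilpotent M"
proof -
  interpret L: dgla L by fact
  interpret VL: vector_space "scl L" by (rule L.vector_space)
  have M: "scl M = scl L" "grd M = H" "dif M = dif L" "brk M = brk L" by (simp_all add: M_def)
  have s: "x \<in> H n \<Longrightarrow> x \<in> grd L n" for x n using sub(1) by blast
  have 0: "0 \<in> H n" for n using VL.subspace_0[OF sub(2)] .
  show D: "dgla M"
  proof (rule dgla.intro, unfold M)
    show "H m \<inter> H n = {0}" if "m \<noteq> n" for m n using L.disjoint[OF that] sub(1) 0 by blast
  qed (rule L.vector_space sub(2) cl L.dif_add L.dif_scl L.dif_dif L.brk_add_left L.brk_scl_left L.brk_antisym L.jacobi L.dif_brk; (rule s)?; assumption)+
  have "grd L n \<noteq> {0}" if "H n \<noteq> {0}" for n using that sub(1)[of n] 0[of n] by blast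
  hence "{n. H n \<noteq> {0}} \<subseteq> {n. grd L n \<noteq> {0}}" by blast
  moreover have "finite {n. grd L n \<noteq> {0}}" using L(2) unfolding fin_dim_def by blast
  ultimately have "finite {n. H n \<noteq> {0}}" by (rule finite_subset)
  moreover have "\<exists>B. finite B \<and> H n \<subseteq> VL.span B" for n
  proof -
    have "\<exists>B. finite B \<and> grd L n \<subseteq> VL.span B" using L(2) unfolding fin_dim_def by blast
    then obtain B where "finite B" "grd L n \<subseteq> VL.span B" by (elim exE conjE)
    thus ?thesis using sub(1)[of n] by (intro exI[of _ B]) auto
  qed
  ultimately show "fin_dim M" unfolding fin_dim_def M by simp
  have lc: "lower_central M k n \<subseteq> lower_central L k n" for k n
  proof (induction k arbitrary: n)
    case (Suc k)
    have "{brk M x y |x y i j. x \<in> grd M i \<and> y \<in> lower_central M k j \<and> i + j = n} \<subseteq>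
      {brk L x y |x y i j. x \<in> grd L i \<and> y \<in> lower_central L k j \<and> i + j = n}"
      using Suc s unfolding M by blast
    thus ?case using VL.span_mono by (simp add: M(1))
  qed (simp add: M sub(1))
  obtain k where "\<And>n. lower_central L k n = {0}" using L(3) unfolding nilpotent_def by blast
  moreover have "0 \<in> lower_central M k n" for n using 0 by (cases k) (simp_all add: M VL.span_zero)
  ultimately show "nilpotent M" using lc[of k] unfolding nilpotent_def by (intro exI[of _ k]) blast
qed

lemma (in complete_dg) cont_coord:
  assumes "cont_hom t g f" shows "continuous_map (topo t n) (discrete_topology UNIV) (\<lambda>x. H (f x \<alpha>))"
proof -
  have "continuous_map (topo t n) (product_topology (\<lambda>\<alpha>. discrete_topology (grd (obj S \<alpha>) n)) UNIV) f"
    using assms unfolding cont_hom_def topo_g by (auto simp: continuous_map_in_subtopology)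
  hence "continuous_map (topo t n) (discrete_topology (grd (obj S \<alpha>) n)) (\<lambda>x. f x \<alpha>)"
    by (simp add: continuous_map_componentwise_UNIV)
  moreover have "continuous_map (discrete_topology (grd (obj S \<alpha>) n)) (discrete_topology UNIV) H" by simp
  ultimately show ?thesis using continuous_map_compose[unfolded comp_def] by blast
qed

lemma cont_hom_const:
  assumes h: "dgla_hom t M F" and c: "\<And>n. continuous_map (topo t n) (discrete_topology UNIV) F"
    and top: "\<And>n. topspace (topo t n) = grd t n"
  shows "cont_hom t (inv_lim (const_sys M)) (\<lambda>x _. F x)"
proof -
  have "dgla_hom t (inv_lim (const_sys M)) (\<lambda>x _. F x)"
    using h unfolding dgla_hom_def by (auto simp: inv_lim_def const_sys_def lim_grd_def fun_eq_iff plus_fun_apply)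
  moreover have "continuous_map (topo t n) (topo (inv_lim (const_sys M)) n) (\<lambda>x _. F x)" for n
  proof -
    have "continuous_map (topo t n) (discrete_topology (grd M n)) F"
      using c[of n] h unfolding dgla_hom_def by (simp add: continuous_map_def Pi_iff top)
    thus ?thesis using h unfolding dgla_hom_def
      by (auto simp: inv_lim_def const_sys_def continuous_map_in_subtopology
          continuous_map_componentwise_UNIV lim_grd_def top)
  qed
  ultimately show ?thesis by (simp add: cont_hom_def)
qed

lemma dgla_0: assumes "dgla L" shows "0 \<in> grd L n" "dif L 0 = 0" "x \<in> grd L n \<Longrightarrow> brk L 0 x = 0" "x \<in> grd L n \<Longrightarrow> brk L x 0 = 0"
proof -
  interpret dgla L by fact
  interpret LV: vector_space "scl L" by (rule vector_space)
  show z: "0 \<in> grd L n" for n using LV.subspace_0[OF subspace] .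
  show "dif L 0 = 0" using dif_add[OF z z] by simp
  show b: "brk L 0 x = 0" if "x \<in> grd L n" using brk_scl_left[OF z that, where c = 0] by simp
  show "brk L x 0 = 0" if "x \<in> grd L n" using brk_antisym[OF that z] b[OF that] by simp
qed

lemma cont_hom_comp: assumes "cont_hom a b f" "cont_hom b c f'" shows "cont_hom a c (\<lambda>x. f' (f x))"
proof -
  have "dgla_hom a c (\<lambda>x. f' (f x))" using assms dgla_hom_comp[of a b f c f'] by (simp add: cont_hom_def)
  moreover have "continuous_map (topo a n) (topo c n) (\<lambda>x. f' (f x))" for n
    by (rule continuous_map_compose[of _ "topo b n" f _ f', unfolded comp_def]) (use assms in \<open>simp_all add: cont_hom_def\<close>)
  ultimately show ?thesis by (simp add: cont_hom_def)
qed

context complete_dg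
begin

text \<open>The projection of \<open>g\<close> to a level need not be onto. A form on
  \<open>g\<close> that factors through the level is determined on this image only, which is again a
  finite-dimensional nilpotent dgla.\<close>

definition img :: "'i \<Rightarrow> ('a, 'k) dgla_struct" where
  "img \<alpha> = (obj S \<alpha>)\<lparr>grd := \<lambda>n. (\<lambda>x. x \<alpha>) ` grd g n\<rparr>"

lemma img_simps: "scl (img \<alpha>) = scl (obj S \<alpha>)" "grd (img \<alpha>) n = (\<lambda>x. x \<alpha>) ` grd g n" "dif (img \<alpha>) = dif (obj S \<alpha>)"
  "brk (img \<alpha>) = brk (obj S \<alpha>)" by (simp_all add: img_def)

lemma img: "dgla (img \<alpha>)" "fin_dim (img \<alpha>)" "nilpotent (img \<alpha>)"
proof -
  interpret OV: vector_space "scl (obj S \<alpha>)" by (rule dgla.vector_space[OF dgla_obj])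
  have 1: "(\<lambda>x. x \<alpha>) ` grd g n \<subseteq> grd (obj S \<alpha>) n" for n using grd_obj by blast
  have 2: "OV.subspace ((\<lambda>x. x \<alpha>) ` grd g n)" for n
  proof (rule OV.subspaceI)
    show "0 \<in> (\<lambda>x. x \<alpha>) ` grd g n" using grd_closed(1)[of n] by (auto intro!: image_eqI[of _ _ 0] simp: comp)
    show "x + y \<in> (\<lambda>x. x \<alpha>) ` grd g n" if "x \<in> (\<lambda>x. x \<alpha>) ` grd g n" "y \<in> (\<lambda>x. x \<alpha>) ` grd g n" for x y
      using that grd_closed(2) by (auto simp flip: comp(1))
    show "scl (obj S \<alpha>) c x \<in> (\<lambda>x. x \<alpha>) ` grd g n" if "x \<in> (\<lambda>x. x \<alpha>) ` grd g n" for x c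
      using that grd_closed(3) by (auto simp flip: comp(2))
  qed
  have 3: "dif (obj S \<alpha>) x \<in> (\<lambda>x. x \<alpha>) ` grd g (n - 1)" if "x \<in> (\<lambda>x. x \<alpha>) ` grd g n" for x n
    using that G.dif_grd by (auto simp flip: comp(3))
  have 4: "brk (obj S \<alpha>) x y \<in> (\<lambda>x. x \<alpha>) ` grd g (m + n)" if "x \<in> (\<lambda>x. x \<alpha>) ` grd g m" "y \<in> (\<lambda>x. x \<alpha>) ` grd g n" for x y m n
    using that G.brk_grd by (auto simp flip: comp(4))
  note sub = subalgebra[OF dgla_obj fin_dim_obj nilpotent_obj 1 2 3 4, folded img_def]
  show "dgla (img \<alpha>)" "fin_dim (img \<alpha>)" "nilpotent (img \<alpha>)" by (rule sub; assumption)+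
qed

lemma cont_id: "cont_hom g g (\<lambda>x. x)" by (simp add: cont_hom_def dgla_hom_def)

lemma cont_level: assumes "\<And>x y. x \<in> grd g n \<Longrightarrow> y \<in> grd g n \<Longrightarrow> x \<alpha> = y \<alpha> \<Longrightarrow> F x = F y"
  shows "continuous_map (topo g n) (discrete_topology UNIV) F"
proof (rule continuous_map_eq[OF cont_coord[OF cont_id]])
  fix x assume "x \<in> topspace (topo g n)"
  hence x: "x \<in> grd g n" by (simp add: g_eq topspace_inv_lim)
  hence "(SOME y. y \<in> grd g n \<and> y \<alpha> = x \<alpha>) \<in> grd g n \<and> (SOME y. y \<in> grd g n \<and> y \<alpha> = x \<alpha>) \<alpha> = x \<alpha>"
    using someI[of "\<lambda>y. y \<in> grd g n \<and> y \<alpha> = x \<alpha>" x] by simp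
  thus "F (SOME y. y \<in> grd g n \<and> y \<alpha> = x \<alpha>) = F x" using assms x by blast
qed

text \<open>Where \<open>\<omega>\<close> vanishes on the image of \<open>\<kappa>\<close>, so does
  \<open>\<eta>\<close>, because that image is stable under the differential; hence the lift with
  zero central components respects brackets.\<close>

lemma central_lift:
  assumes C: "central_ext (img \<alpha>) \<omega> r" and t: "dgla t" "\<And>n. topspace (topo t n) = grd t n" and k: "cont_hom t g \<kappa>"
    and 0: "\<And>i j x y. x \<in> grd t i \<Longrightarrow> y \<in> grd t j \<Longrightarrow> \<omega> (\<kappa> x \<alpha>) (\<kappa> y \<alpha>) = 0"
  shows "cont_hom t (inv_lim (const_sys (central_ext.E (img \<alpha>) \<omega> r))) (\<lambda>x _. (\<kappa> x \<alpha>, 0, 0))"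
proof (rule cont_hom_const[OF _ cont_coord[OF k] t(2)])
  interpret C: central_ext "img \<alpha>" \<omega> r by fact
  have hk: "\<kappa> x \<in> grd g n" "y \<in> grd t n \<Longrightarrow> \<kappa> (x + y) = \<kappa> x + \<kappa> y" "\<kappa> (scl t c x) = scl g c (\<kappa> x)" "\<kappa> (dif t x) = dif g (\<kappa> x)"
    "z \<in> grd t m \<Longrightarrow> \<kappa> (brk t x z) = brk g (\<kappa> x) (\<kappa> z)" if "x \<in> grd t n" for x y z n m c
    using k that unfolding cont_hom_def dgla_hom_def by blast+
  show "dgla_hom t C.E (\<lambda>x. (\<kappa> x \<alpha>, 0, 0))" unfolding dgla_hom_def
  proof (intro conjI allI ballI)
    fix n m c x y assume x: "x \<in> grd t n"
    show "(\<kappa> x \<alpha>, 0, 0) \<in> grd C.E n" using hk(1)[OF x] by (simp add: img_simps)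
    show "(\<kappa> (scl t c x) \<alpha>, 0, 0) = scl C.E c (\<kappa> x \<alpha>, 0, 0)" by (simp add: hk[OF x] img_simps comp)
    show "(\<kappa> (dif t x) \<alpha>, 0, 0) = dif C.E (\<kappa> x \<alpha>, 0, 0)" by (simp add: hk[OF x] img_simps comp)
    show "(\<kappa> (x + y) \<alpha>, 0 :: 'k, 0 :: 'k) = (\<kappa> x \<alpha>, 0, 0) + (\<kappa> y \<alpha>, 0, 0)" if "y \<in> grd t n"
      by (simp add: hk(2)[OF x that] comp)
    show "(\<kappa> (brk t x y) \<alpha>, 0, 0) = brk C.E (\<kappa> x \<alpha>, 0, 0) (\<kappa> y \<alpha>, 0, 0)" if y: "y \<in> grd t m"
    proof -
      have "\<kappa> x \<alpha> \<in> grd (img \<alpha>) n" "\<kappa> y \<alpha> \<in> grd (img \<alpha>) m" using hk(1) x y by (auto simp: img_simps)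
      moreover have "dif (img \<alpha>) (\<kappa> x \<alpha>) = \<kappa> (dif t x) \<alpha>" "dif (img \<alpha>) (\<kappa> y \<alpha>) = \<kappa> (dif t y) \<alpha>"
        by (simp_all add: hk(4)[OF x] hk(4)[OF y] img_simps comp)
      ultimately have "C.\<eta> (\<kappa> x \<alpha>) (\<kappa> y \<alpha>) = 0"
        using 0[OF dgla.dif_grd[OF t(1) x] y] 0[OF x dgla.dif_grd[OF t(1) y]] by (simp add: C.eta)
      thus ?thesis using 0[OF x y] by (simp add: hk(5)[OF x y] img_simps comp)
    qed
  qed
qed

end

section \<open>Consequences of the universal property\<close>

locale coprod = G: complete_dg SG g + H: complete_dg SH h + P: complete_dg S p
  for SG :: "('i, 'a::ab_group_add, 'k::field_char_0) inv_sys" and g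
    and SH :: "('j, 'b::ab_group_add, 'k) inv_sys" and h
    and S :: "('l, 'c::ab_group_add, 'k) inv_sys" and p +
  fixes \<iota>1 \<iota>2
  assumes cop: "is_coproduct g h p \<iota>1 \<iota>2"
begin

lemma complete: "complete_dgla g" "complete_dgla h" "complete_dgla p"
  using G.inverse_system_axioms G.g_eq H.inverse_system_axioms H.g_eq P.inverse_system_axioms P.g_eq
  unfolding complete_dgla_def by blast+

lemma inclusions: "cont_hom g p \<iota>1" "cont_hom h p \<iota>2" using cop unfolding is_coproduct_def by blast+

lemmas tops = topspace_complete[OF complete(1)] topspace_complete[OF complete(2)] topspace_complete[OF complete(3)]

text \<open>The uniqueness half of \<open>coproduct_universal\<close>, for targets that are constant
  systems.\<close>

lemma hom_unique:
  fixes M :: "('d::ab_group_add, 'k) dgla_struct"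
  assumes M: "dgla M" "fin_dim M" "nilpotent M"
    and u: "cont_hom p (inv_lim (const_sys M)) u" and v: "cont_hom p (inv_lim (const_sys M)) v"
    and e: "\<And>n x. x \<in> grd g n \<Longrightarrow> u (\<iota>1 x) = v (\<iota>1 x)" "\<And>n x. x \<in> grd h n \<Longrightarrow> u (\<iota>2 x) = v (\<iota>2 x)"
    and z: "z \<in> grd p n"
  shows "u z = v z"
proof -
  let ?t = "inv_lim (const_sys M)"
  have t: "complete_dgla ?t" unfolding complete_dgla_def using inverse_system_const_sys[OF M] by blast
  have "topspace (topo ?t n) = grd ?t n" for n by (rule topspace_inv_lim)
  from coproduct_universal[OF cop complete(1,2) t cont_hom_comp[OF inclusions(1) v] cont_hom_comp[OF inclusions(2) v]]
  obtain w where w0: "\<forall>u'. mediates g h p \<iota>1 \<iota>2 ?t (\<lambda>x. v (\<iota>1 x)) (\<lambda>x. v (\<iota>2 x)) u' \<longrightarrow> (\<forall>n. \<forall>z\<in>grd p n. u' z = w z)"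
    by (elim exE conjE) (rule that, assumption)
  have w: "u' z = w z" if "mediates g h p \<iota>1 \<iota>2 ?t (\<lambda>x. v (\<iota>1 x)) (\<lambda>x. v (\<iota>2 x)) u'" for u'
    using w0[rule_format, OF that z] .
  have "u z = w z" by (rule w) (use u e in \<open>simp add: mediates_def\<close>)
  moreover have "v z = w z" by (rule w) (use v in \<open>simp add: mediates_def\<close>)
  ultimately show ?thesis by simp
qed

text \<open>As \<open>f\<close> kills brackets,
  \<open>x \<mapsto> (x \<alpha>, f x, f (d x))\<close> is a map to the extension with
  \<open>\<omega> = 0\<close>; the last entry makes it compatible with the differential although
  \<open>f\<close> need not be closed. It agrees with \<open>x \<mapsto> (x \<alpha>, 0, 0)\<close>
  on both factors, hence everywhere.\<close>

lemma dual_zero: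
  assumes f: "f \<in> dual p n" and i: "\<And>x. x \<in> grd g n \<Longrightarrow> f (\<iota>1 x) = 0" "\<And>x. x \<in> grd h n \<Longrightarrow> f (\<iota>2 x) = 0"
    and b: "\<And>i x y. x \<in> grd p i \<Longrightarrow> y \<in> grd p (n - i) \<Longrightarrow> f (brk p x y) = 0"
  shows "f = 0"
proof -
  obtain \<alpha> where \<alpha>: "\<And>x. x \<in> grd p n \<Longrightarrow> x \<alpha> = 0 \<Longrightarrow> f x = 0" using P.dual_factor[OF f] P.le_refl by blast
  interpret C: central_ext "P.img \<alpha>" "\<lambda>_ _. 0" n
    by (simp add: central_ext_def central_ext_axioms_def P.img)
  note E = C.dgla_E C.fin_dim_E[OF P.img(2)] C.nilpotent_E[OF P.img(3)]
  have f0: "f x = 0" if "x \<in> grd p m" "m \<noteq> n" for x m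
  proof (cases "x \<in> grd p n")
    case True
    hence "x = 0" using P.G.disjoint[OF that(2)] that(1) by blast
    thus ?thesis using P.dualD(5)[OF f] by simp
  qed (rule P.dualD(3)[OF f])
  have fadd: "f (x + y) = f x + f y" if "x \<in> grd p m" "y \<in> grd p m" for x y m
    using P.dualD(1)[OF f, of x y] that f0[OF that(1)] f0[OF that(2)] f0[OF P.grd_closed(2)[OF that]] by (cases "m = n") auto
  have fscl: "f (scl p c x) = c * f x" if "x \<in> grd p m" for x c m
    using P.dualD(2)[OF f, of x c] that f0[OF that] f0[OF P.grd_closed(3)[OF that], of c] by (cases "m = n") auto
  have fb: "f (brk p x y) = 0" if "x \<in> grd p i" "y \<in> grd p j" for x y i j
    using b[OF that(1), of y] that f0[OF P.G.brk_grd[OF that]] by (cases "i + j = n") (auto simp: algebra_simps)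
  have lev: "F x = F y" if "x \<in> grd p m" "y \<in> grd p m" "x \<alpha> = y \<alpha>" "F = (\<lambda>x. (x \<alpha>, f x, f (dif p x)))" for x y m F
  proof -
    have d: "x - y \<in> grd p m" "(x - y) \<alpha> = 0" using that P.grd_closed(4) by (auto simp: P.comp)
    have "f z = 0" if "z \<in> grd p l" "z \<alpha> = 0" for z l using \<alpha> f0 that by (cases "l = n") auto
    moreover have "dif p (x - y) \<alpha> = 0" using d dgla_0(2)[OF P.dgla_obj] by (simp add: P.comp)
    ultimately have z: "f (x - y) = 0" "f (dif p (x - y)) = 0" using d P.G.dif_grd[OF d(1)] by blast+
    have x: "x = (x - y) + y" by simp
    have "f x = f (x - y) + f y" by (subst x) (rule fadd[OF d(1) that(2)])
    moreover have "f (dif p x) = f (dif p (x - y)) + f (dif p y)"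
      by (subst x) (simp only: P.G.dif_add[OF d(1) that(2)] fadd[OF P.G.dif_grd[OF d(1)] P.G.dif_grd[OF that(2)]])
    ultimately show ?thesis using z that by simp
  qed
  have u: "cont_hom p (inv_lim (const_sys C.E)) (\<lambda>x _. (x \<alpha>, f x, f (dif p x)))"
  proof (rule cont_hom_const[OF _ P.cont_level[OF lev[OF _ _ _ refl]] tops(3)])
    show "dgla_hom p C.E (\<lambda>x. (x \<alpha>, f x, f (dif p x)))" unfolding dgla_hom_def
    proof (intro conjI allI ballI)
      fix m l c x y assume x: "x \<in> grd p m"
      note dx = P.G.dif_grd[OF x]
      show "(x \<alpha>, f x, f (dif p x)) \<in> grd C.E m" using x f0[OF x] f0[OF dx] by (auto simp: P.img_simps)
      show "(scl p c x \<alpha>, f (scl p c x), f (dif p (scl p c x))) = scl C.E c (x \<alpha>, f x, f (dif p x))"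
        by (simp add: P.img_simps P.comp(2) fscl[OF x] fscl[OF dx] P.G.dif_scl[OF x])
      show "(dif p x \<alpha>, f (dif p x), f (dif p (dif p x))) = dif C.E (x \<alpha>, f x, f (dif p x))"
        using P.dualD(5)[OF f] by (simp add: P.img_simps P.comp(3) P.G.dif_dif[OF x])
      show "((x + y) \<alpha>, f (x + y), f (dif p (x + y))) = (x \<alpha>, f x, f (dif p x)) + (y \<alpha>, f y, f (dif p y))" if y: "y \<in> grd p m"
        by (simp add: P.comp(1) fadd[OF x y] P.G.dif_add[OF x y] fadd[OF dx P.G.dif_grd[OF y]])
      show "(brk p x y \<alpha>, f (brk p x y), f (dif p (brk p x y))) = brk C.E (x \<alpha>, f x, f (dif p x)) (y \<alpha>, f y, f (dif p y))" if y: "y \<in> grd p l"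
      proof -
        note dy = P.G.dif_grd[OF y]
        have g: "brk p (dif p x) y \<in> grd p (m + l - 1)" "brk p x (dif p y) \<in> grd p (m + l - 1)"
          by (rule P.brk_closed[OF dx y] P.brk_closed[OF x dy]; simp)+
        have "f (dif p (brk p x y)) = 0"
          unfolding P.G.dif_brk[OF x y] fadd[OF g(1) P.grd_closed(3)[OF g(2)]] fscl[OF g(2)] fb[OF dx y] fb[OF x dy] by simp
        moreover have "C.\<eta> (x \<alpha>) (y \<alpha>) = 0" using x y by (subst C.eta) (auto simp: P.img_simps)
        ultimately show ?thesis by (simp add: fb[OF x y] P.img_simps P.comp(4))
      qed
    qed
  qed
  have v: "cont_hom p (inv_lim (const_sys C.E)) (\<lambda>x _. (x \<alpha>, 0, 0))"
    by (rule P.central_lift[OF C.central_ext_axioms P.G.dgla_axioms tops(3) P.cont_id]) simp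
  have k: "f (\<iota>1 x) = 0" "f (dif p (\<iota>1 x)) = 0" if "x \<in> grd g m" for x m
  proof -
    have *: "f (\<iota>1 x) = 0" if "x \<in> grd g m" for x m
      using i(1)[of x] f0[of "\<iota>1 x" m] inclusions(1) that unfolding cont_hom_def dgla_hom_def by (cases "m = n") blast+
    show "f (\<iota>1 x) = 0" by (rule *[OF that])
    have "dif p (\<iota>1 x) = \<iota>1 (dif g x)" using inclusions(1) that unfolding cont_hom_def dgla_hom_def by metis
    thus "f (dif p (\<iota>1 x)) = 0" using *[OF G.G.dif_grd[OF that]] by simp
  qed
  have l: "f (\<iota>2 x) = 0" "f (dif p (\<iota>2 x)) = 0" if "x \<in> grd h m" for x m
  proof -
    have *: "f (\<iota>2 x) = 0" if "x \<in> grd h m" for x m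
      using i(2)[of x] f0[of "\<iota>2 x" m] inclusions(2) that unfolding cont_hom_def dgla_hom_def by (cases "m = n") blast+
    show "f (\<iota>2 x) = 0" by (rule *[OF that])
    have "dif p (\<iota>2 x) = \<iota>2 (dif h x)" using inclusions(2) that unfolding cont_hom_def dgla_hom_def by metis
    thus "f (dif p (\<iota>2 x)) = 0" using *[OF H.G.dif_grd[OF that]] by simp
  qed
  have "f z = 0" if "z \<in> grd p n" for z
  proof -
    have "(\<lambda>_::nat. (z \<alpha>, f z, f (dif p z))) = (\<lambda>_. (z \<alpha>, 0, 0))"
      by (rule hom_unique[OF E u v _ _ that]) (simp_all add: k l)
    from fun_cong[OF this] show ?thesis by simp
  qed
  thus ?thesis using P.dualD(3)[OF f] by (auto simp: fun_eq_iff zero_fun_apply)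
qed

text \<open>\<open>\<omega>\<close> defines a central extension of the image of \<open>p\<close> at
  level \<open>\<alpha>\<close>. Since it vanishes on both factors, their maps to the image lift
  with zero central components. The first central coordinate of the induced map on \<open>p\<close>
  is \<open>y\<close>, and preservation of brackets says that \<open>y\<close> of a bracket is
  \<open>\<omega>\<close>.\<close>

lemma dual_exists:
  fixes \<omega> :: "int \<Rightarrow> int \<Rightarrow> ('l \<Rightarrow> 'c) \<Rightarrow> ('l \<Rightarrow> 'c) \<Rightarrow> 'k"
  assumes om_add: "\<And>i j x x' y. x \<in> grd p i \<Longrightarrow> x' \<in> grd p i \<Longrightarrow> y \<in> grd p j \<Longrightarrow> \<omega> i j (x + x') y = \<omega> i j x y + \<omega> i j x' y"
    and om_scl: "\<And>i j c x y. x \<in> grd p i \<Longrightarrow> y \<in> grd p j \<Longrightarrow> \<omega> i j (scl p c x) y = c * \<omega> i j x y"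
    and om_anti: "\<And>i j x y. x \<in> grd p i \<Longrightarrow> y \<in> grd p j \<Longrightarrow> \<omega> i j x y = - eps (i * j) * \<omega> j i y x"
    and om_jac: "\<And>i j l x y z. x \<in> grd p i \<Longrightarrow> y \<in> grd p j \<Longrightarrow> z \<in> grd p l \<Longrightarrow>
      \<omega> i (j + l) x (brk p y z) = \<omega> (i + j) l (brk p x y) z + eps (i * j) * \<omega> j (i + l) y (brk p x z)"
    and om_zero: "\<And>i j x y. x \<in> grd p i \<Longrightarrow> y \<in> grd p j \<Longrightarrow> i + j \<noteq> r \<Longrightarrow> \<omega> i j x y = 0"
    and om_lev: "\<And>i j x y. x \<in> grd p i \<Longrightarrow> y \<in> grd p j \<Longrightarrow> x \<alpha> = 0 \<Longrightarrow> \<omega> i j x y = 0"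
    and om_1: "\<And>i j x y. x \<in> grd g i \<Longrightarrow> y \<in> grd g j \<Longrightarrow> \<omega> i j (\<iota>1 x) (\<iota>1 y) = 0"
    and om_2: "\<And>i j x y. x \<in> grd h i \<Longrightarrow> y \<in> grd h j \<Longrightarrow> \<omega> i j (\<iota>2 x) (\<iota>2 y) = 0"
  obtains y where "y \<in> dual p r" "\<And>i j a b. a \<in> grd p i \<Longrightarrow> b \<in> grd p j \<Longrightarrow> i + j = r \<Longrightarrow> y (brk p a b) = \<omega> i j a b"
    "\<And>x. x \<in> grd g r \<Longrightarrow> y (\<iota>1 x) = 0" "\<And>x. x \<in> grd h r \<Longrightarrow> y (\<iota>2 x) = 0"
proof -
  \<comment> \<open>\<open>\<omega>\<close> carries degrees and lives on \<open>p\<close>, whereas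
    the extension takes one function on level \<open>\<alpha>\<close>. The choice of degrees and
    preimages does not matter: if degrees of preimages differ, the common value at level
    \<open>\<alpha>\<close> is 0, and so is \<open>\<omega>\<close>.\<close>
  define om where "om a b = (SOME c. \<exists>i j x y. x \<in> grd p i \<and> y \<in> grd p j \<and> x \<alpha> = a \<and> y \<alpha> = b \<and> c = \<omega> i j x y)" for a b
  have lev2: "\<omega> i j x y = 0" if "x \<in> grd p i" "y \<in> grd p j" "y \<alpha> = 0" for i j x y
    using om_anti[OF that(1,2)] om_lev[OF that(2,1,3)] by simp
  have add2: "\<omega> i j x (y + y') = \<omega> i j x y + \<omega> i j x y'" if "x \<in> grd p i" "y \<in> grd p j" "y' \<in> grd p j" for i j x y y'
    unfolding om_anti[OF that(1) P.grd_closed(2)[OF that(2,3)]] om_anti[OF that(1,2)] om_anti[OF that(1,3)] om_add[OF that(2,3,1)]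
    by (simp add: algebra_simps)
  have same: "\<omega> i j x y = \<omega> i j x' y'" if "x \<in> grd p i" "x' \<in> grd p i" "y \<in> grd p j" "y' \<in> grd p j" "x \<alpha> = x' \<alpha>" "y \<alpha> = y' \<alpha>"
    for i j x y x' y'
  proof -
    have dx: "x - x' \<in> grd p i" "(x - x') \<alpha> = 0" and dy: "y - y' \<in> grd p j" "(y - y') \<alpha> = 0"
      using that P.grd_closed(4) by (simp_all add: P.comp)
    have "\<omega> i j ((x - x') + x') y = \<omega> i j x' y" using om_add[OF dx(1) that(2,3)] om_lev[OF dx(1) that(3) dx(2)] by simp
    moreover have "\<omega> i j x' ((y - y') + y') = \<omega> i j x' y'" using add2[OF that(2) dy(1) that(4)] lev2[OF that(2) dy] by simp
    ultimately show ?thesis by simp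
  qed
  have om: "om (x \<alpha>) (y \<alpha>) = \<omega> i j x y" if x: "x \<in> grd p i" and y: "y \<in> grd p j" for i j x y
    unfolding om_def
  proof (rule some_equality)
    show "\<exists>i' j' x' y'. x' \<in> grd p i' \<and> y' \<in> grd p j' \<and> x' \<alpha> = x \<alpha> \<and> y' \<alpha> = y \<alpha> \<and> \<omega> i j x y = \<omega> i' j' x' y'"
      using x y by blast
  next
    fix c assume "\<exists>i' j' x' y'. x' \<in> grd p i' \<and> y' \<in> grd p j' \<and> x' \<alpha> = x \<alpha> \<and> y' \<alpha> = y \<alpha> \<and> c = \<omega> i' j' x' y'"
    then obtain i' j' x' y' where c: "x' \<in> grd p i'" "y' \<in> grd p j'" "x' \<alpha> = x \<alpha>" "y' \<alpha> = y \<alpha>" "c = \<omega> i' j' x' y'" by (elim exE conjE) (rule that)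
    have z: "u \<alpha> = 0" if "u \<in> grd p k" "v \<in> grd p l" "u \<alpha> = v \<alpha>" "k \<noteq> l" for u v k l
      using dgla.disjoint[OF P.dgla_obj that(4), of \<alpha>] P.grd_obj[OF that(1), of \<alpha>] P.grd_obj[OF that(2), of \<alpha>] that(3) by auto
    consider "i = i'" "j = j'" | "i \<noteq> i'" | "j \<noteq> j'" by blast
    thus "c = \<omega> i j x y"
    proof cases
      case 1
      thus ?thesis using same[of x' i x y' j y] c x y by simp
    next
      case 2
      have "x \<alpha> = 0" "x' \<alpha> = 0" using z[OF x c(1)] c 2 by auto
      thus ?thesis using om_lev[OF x y] om_lev[OF c(1,2)] c(5) by simp
    next
      case 3
      have "y \<alpha> = 0" "y' \<alpha> = 0" using z[OF y c(2)] c 3 by auto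
      thus ?thesis using lev2[OF x y] lev2[OF c(1,2)] c(5) by simp
    qed
  qed
  interpret C: central_ext "P.img \<alpha>" om r
  proof (intro central_ext.intro P.img central_ext_axioms.intro)
    fix x y i j assume "x \<in> grd (P.img \<alpha>) i" "y \<in> grd (P.img \<alpha>) j"
    then obtain a b where a: "a \<in> grd p i" "x = a \<alpha>" and b: "b \<in> grd p j" "y = b \<alpha>" by (auto simp: P.img_simps)
    show "om (x + x') y = om x y + om x' y" if x': "x' \<in> grd (P.img \<alpha>) i" for x'
    proof -
      obtain a' where a': "a' \<in> grd p i" "x' = a' \<alpha>" using x' by (auto simp: P.img_simps)
      show ?thesis using om_add[OF a(1) a'(1) b(1)]
        by (simp add: a(2) a'(2) b(2) om[OF a(1) b(1)] om[OF a'(1) b(1)] om[OF P.grd_closed(2)[OF a(1) a'(1)] b(1)] flip: P.comp(1))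
    qed
    show "om (scl (P.img \<alpha>) c x) y = c * om x y" for c
      using om_scl[OF a(1) b(1)] by (simp add: P.img_simps a(2) b(2) om[OF a(1) b(1)] om[OF P.grd_closed(3)[OF a(1)] b(1)] flip: P.comp(2))
    show "om x y = - eps (i * j) * om y x"
      using om_anti[OF a(1) b(1)] by (simp add: a(2) b(2) om[OF a(1) b(1)] om[OF b(1) a(1)])
    show "om x y = 0" if "i + j \<noteq> r" using om_zero[OF a(1) b(1) that] by (simp add: a(2) b(2) om[OF a(1) b(1)])
    show "om x (brk (P.img \<alpha>) y z) = om (brk (P.img \<alpha>) x y) z + eps (i * j) * om y (brk (P.img \<alpha>) x z)"
      if z: "z \<in> grd (P.img \<alpha>) l" for z l
    proof -
      obtain c where c: "c \<in> grd p l" "z = c \<alpha>" using z by (auto simp: P.img_simps)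
      note br = P.G.brk_grd[OF b(1) c(1)] P.G.brk_grd[OF a(1) b(1)] P.G.brk_grd[OF a(1) c(1)]
      show ?thesis using om_jac[OF a(1) b(1) c(1)]
        by (simp add: P.img_simps a(2) b(2) c(2) om[OF a(1) br(1)] om[OF br(2) c(1)] om[OF b(1) br(3)] flip: P.comp(4))
    qed
  qed
  note E = C.dgla_E C.fin_dim_E[OF P.img(2)] C.nilpotent_E[OF P.img(3)]
  let ?t = "inv_lim (const_sys C.E)"
  have t: "complete_dgla ?t" unfolding complete_dgla_def using inverse_system_const_sys[OF E] by blast
  have gr: "\<iota>1 x \<in> grd p i" if "x \<in> grd g i" for x i using inclusions(1) that unfolding cont_hom_def dgla_hom_def by blast
  have hr: "\<iota>2 x \<in> grd p i" if "x \<in> grd h i" for x i using inclusions(2) that unfolding cont_hom_def dgla_hom_def by blast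
  have f1: "cont_hom g ?t (\<lambda>x _. (\<iota>1 x \<alpha>, 0, 0))"
    by (rule P.central_lift[OF C.central_ext_axioms G.G.dgla_axioms tops(1) inclusions(1)]) (simp add: om[OF gr gr] om_1)
  have f2: "cont_hom h ?t (\<lambda>x _. (\<iota>2 x \<alpha>, 0, 0))"
    by (rule P.central_lift[OF C.central_ext_axioms H.G.dgla_axioms tops(2) inclusions(2)]) (simp add: om[OF hr hr] om_2)
  from coproduct_universal[OF cop complete(1,2) t f1 f2] obtain u where
    "mediates g h p \<iota>1 \<iota>2 ?t (\<lambda>x _. (\<iota>1 x \<alpha>, 0, 0)) (\<lambda>x _. (\<iota>2 x \<alpha>, 0, 0)) u" by (elim exE conjE) (rule that, assumption)
  hence u: "cont_hom p ?t u" and u1: "\<And>x n. x \<in> grd g n \<Longrightarrow> u (\<iota>1 x) = (\<lambda>_. (\<iota>1 x \<alpha>, 0, 0))"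
    and u2: "\<And>x n. x \<in> grd h n \<Longrightarrow> u (\<iota>2 x) = (\<lambda>_. (\<iota>2 x \<alpha>, 0, 0))" unfolding mediates_def by simp_all
  have F: "dgla_hom (obj (const_sys C.E) 0) (P.img \<alpha>) fst"
    unfolding dgla_hom_def by (auto simp: const_sys_def C.E_def)
  have I: "cont_hom p (inv_lim (const_sys (P.img \<alpha>))) (\<lambda>z _. z \<alpha>)"
  proof (rule cont_hom_const[OF _ P.cont_coord[OF P.cont_id] tops(3)])
    show "dgla_hom p (P.img \<alpha>) (\<lambda>z. z \<alpha>)" unfolding dgla_hom_def by (auto simp: P.img_simps P.comp)
  qed
  \<comment> \<open>Uniqueness identifies the first component of \<open>u\<close> with the
    projection to level \<open>\<alpha>\<close>, as they agree on both factors.\<close>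
  have fst_u: "fst (u z 0) = z \<alpha>" if "z \<in> grd p n" for z n
  proof -
    have "(\<lambda>_::nat. fst (u z 0)) = (\<lambda>_. z \<alpha>)"
      by (rule hom_unique[OF P.img cont_hom_to_const[OF u F tops(3)] I _ _ that]) (simp_all add: u1 u2)
    from fun_cong[OF this] show ?thesis by simp
  qed
  have hu: "u x \<in> grd ?t n" "y \<in> grd p n \<Longrightarrow> u (x + y) = u x + u y" "u (scl p c x) = scl ?t c (u x)"
    "z \<in> grd p m \<Longrightarrow> u (brk p x z) = brk ?t (u x) (u z)" if "x \<in> grd p n" for x y z n m c
    using u that unfolding cont_hom_def dgla_hom_def by blast+
  define y where "y z = (if z \<in> grd p r then fst (snd (u z 0)) else 0)" for z
  show thesis
  proof (rule that[of y])
    interpret T: complete_dg "const_sys C.E" ?t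
      by (simp add: complete_dg_def complete_dg_axioms_def inverse_system_const_sys E)
    have "continuous_map (topo p r) (discrete_topology UNIV) (\<lambda>z. fst (snd (u z 0)))" by (rule T.cont_coord[OF u])
    hence "continuous_map (topo p r) (discrete_topology UNIV) y"
      by (rule continuous_map_eq) (simp add: tops y_def)
    moreover have "fst (snd (scl C.E c v)) = c * fst (snd v)" for c v by (cases v) simp
    hence "y (scl p c x) = c * y x" if "x \<in> grd p r" for c x
      using that P.grd_closed(3)[OF that] hu(3)[OF that] by (simp add: y_def inv_lim_def const_sys_def)
    moreover have "y (x + x') = y x + y x'" if "x \<in> grd p r" "x' \<in> grd p r" for x x'
      using that P.grd_closed(2)[OF that] hu(2)[OF that] by (simp add: y_def plus_fun_apply)
    ultimately show "y \<in> dual p r" unfolding dual_def by (simp add: y_def)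
    show "y (brk p a b) = \<omega> i j a b" if a: "a \<in> grd p i" and b: "b \<in> grd p j" and r: "i + j = r" for i j a b
    proof -
      have "fst (snd (brk C.E v w)) = om (fst v) (fst w)" for v w by (cases v; cases w) simp
      hence "fst (snd (u (brk p a b) 0)) = om (fst (u a 0)) (fst (u b 0))"
        unfolding hu(4)[OF a b] by (simp add: inv_lim_def const_sys_def)
      thus ?thesis using P.brk_closed[OF a b r] by (simp add: y_def fst_u[OF a] fst_u[OF b] om[OF a b])
    qed
    show "y (\<iota>1 x) = 0" if "x \<in> grd g r" for x using u1[OF that] by (simp add: y_def)
    show "y (\<iota>2 x) = 0" if "x \<in> grd h r" for x using u2[OF that] by (simp add: y_def)
  qed
qed

end

section \<open>The lower central filtration\<close>

text \<open>Working with sets \<open>T j\<close> instead of subspaces lets the basis be chosen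
  inside a prescribed class, below the pure functionals: a maximal independent subset of
  \<open>T j\<close> is extended inside \<open>T (Suc j)\<close>.\<close>

lemma (in vector_space) filtered_basis:
  fixes T :: "nat \<Rightarrow> 'b set"
  assumes T: "\<And>j. T j \<subseteq> T (Suc j)" "T 0 \<subseteq> {0}"
  obtains B and rk :: "'b \<Rightarrow> nat" where "independent B" "\<And>j. T j \<subseteq> span {b \<in> B. rk b \<le> j}" "\<And>b. b \<in> B \<Longrightarrow> b \<in> T (rk b)"
proof -
  define P where "P j C \<longleftrightarrow> independent C \<and> C \<subseteq> T j \<and> T j \<subseteq> span C" for j C
  have "\<exists>C. \<forall>j. P j (C j) \<and> C j \<subseteq> C (Suc j)"
  proof (rule dependent_nat_choice)
    have "P 0 {}" using T(2) by (auto simp: P_def independent_empty)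
    thus "\<exists>C. P 0 C" ..
    fix C j assume C: "P j C"
    hence "C \<subseteq> T (Suc j)" "independent C" using T(1)[of j] by (auto simp: P_def)
    from maximal_independent_subset_extend[OF this]
    obtain D where "C \<subseteq> D" "D \<subseteq> T (Suc j)" "independent D" "T (Suc j) \<subseteq> span D" by blast
    hence "P (Suc j) D \<and> C \<subseteq> D" by (simp add: P_def)
    thus "\<exists>D. P (Suc j) D \<and> C \<subseteq> D" ..
  qed
  then obtain C where C: "\<And>j. P j (C j)" "\<And>j. C j \<subseteq> C (Suc j)" by blast
  have mono: "C i \<subseteq> C j" if "i \<le> j" for i j using lift_Suc_mono_le[of C, OF C(2) that] .
  define rk where "rk b = (LEAST j. b \<in> C j)" for b
  have rk: "b \<in> C (rk b)" "b \<in> C j \<Longrightarrow> rk b \<le> j" if "b \<in> C i" for b i j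
    using LeastI[of "\<lambda>j. b \<in> C j", OF that] Least_le[of "\<lambda>j. b \<in> C j"] by (auto simp: rk_def)
  have le: "{b \<in> \<Union>(range C). rk b \<le> j} = C j" for j using rk mono by blast
  have "c \<subseteq> d \<or> d \<subseteq> c" if "c \<in> range C" "d \<in> range C" for c d
  proof -
    from that obtain i j where "c = C i" "d = C j" by blast
    thus ?thesis using mono[of i j] mono[of j i] by (cases "i \<le> j") auto
  qed
  hence ind: "independent (\<Union>(range C))"
    by (rule independent_Union_directed) (use C(1) in \<open>auto simp: P_def\<close>)
  show thesis
  proof (rule that[OF ind])
    show "T j \<subseteq> span {b \<in> \<Union>(range C). rk b \<le> j}" for j
      unfolding le using C(1)[of j] by (simp add: P_def)
    show "b \<in> T (rk b)" if "b \<in> \<Union>(range C)" for b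
      using that rk(1) C(1)[of "rk b"] unfolding P_def by blast
  qed
qed

context complete_dg
begin

text \<open>Annihilators of the lower central series. They start at 0 (\<open>filt_0\<close>) and
  exhaust the dual (\<open>filt_exhaust\<close>), so the least \<open>j\<close> is a measure of the
  nilpotence that a functional sees.\<close>

definition filt :: "nat \<Rightarrow> int \<Rightarrow> (('i \<Rightarrow> 'a) \<Rightarrow> 'k) set" where
  "filt j n = {\<phi> \<in> Wg n. \<forall>x\<in>lower_central g j (n - 1). \<phi> x = 0}"

lemma lc_grd: "lower_central g j n \<subseteq> grd g n" by (rule lower_central_grd[OF G.dgla_axioms])

lemma lc_subspace: "GV.subspace (lower_central g j n)"
  using G.subspace by (cases j) (simp_all add: GV.subspace_span)

lemma lc_Suc: "lower_central g (Suc j) n \<subseteq> lower_central g j n"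
proof (induction j arbitrary: n)
  case 0
  thus ?case using lc_grd[of "Suc 0" n] by simp
next
  case (Suc j)
  have "{brk g x y |x y i k. x \<in> grd g i \<and> y \<in> lower_central g (Suc j) k \<and> i + k = n} \<subseteq>
      {brk g x y |x y i k. x \<in> grd g i \<and> y \<in> lower_central g j k \<and> i + k = n}" using Suc by blast
  thus ?case using GV.span_mono by simp
qed

lemma filt_Suc: "filt j n \<subseteq> filt (Suc j) n" using lc_Suc by (auto simp: filt_def)

lemma filt_0: "filt 0 n \<subseteq> {0}"
proof
  fix \<phi> assume "\<phi> \<in> filt 0 n"
  hence p: "\<phi> \<in> dual g (n - 1)" "\<forall>x\<in>grd g (n - 1). \<phi> x = 0" by (auto simp: filt_def susp_dual_def)
  hence "\<phi> x = 0" for x using dualD(3)[OF p(1), of x] by (cases "x \<in> grd g (n - 1)") auto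
  thus "\<phi> \<in> {0}" by (auto simp: fun_eq_iff fun_ap)
qed

text \<open>A functional factors through a level, and the lower central series of that nilpotent
  level ends at 0.\<close>

lemma filt_exhaust: assumes "\<phi> \<in> Wg n" shows "\<exists>j. \<phi> \<in> filt j n"
proof -
  have p: "\<phi> \<in> dual g (n - 1)" using assms by (simp add: susp_dual_def)
  obtain \<alpha> where \<alpha>: "\<And>x. x \<in> grd g (n - 1) \<Longrightarrow> x \<alpha> = 0 \<Longrightarrow> \<phi> x = 0" using dual_factor[OF p] le_refl by blast
  interpret OV: vector_space "scl (obj S \<alpha>)" by (rule dgla.vector_space[OF dgla_obj])
  have lc: "x \<alpha> \<in> lower_central (obj S \<alpha>) k m" if "x \<in> lower_central g k m" for x k m using that
  proof (induction k arbitrary: x m)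
    case 0
    thus ?case by (simp add: grd_obj)
  next
    case (Suc k)
    from Suc.prems have "x \<in> GV.span {brk g x y |x y i j. x \<in> grd g i \<and> y \<in> lower_central g k j \<and> i + j = m}" by simp
    thus ?case
    proof (induction rule: GV.span_induct)
      case base
      show ?case by (rule GV.subspaceI) (auto simp: comp OV.span_zero OV.span_add OV.span_scale)
    next
      case (step x)
      thus ?case using Suc.IH grd_obj by (auto simp: comp intro!: OV.span_base) blast
    qed
  qed
  obtain k where "\<And>m. lower_central (obj S \<alpha>) k m = {0}" using nilpotent_obj unfolding nilpotent_def by blast
  hence "\<phi> x = 0" if "x \<in> lower_central g k (n - 1)" for x
    using \<alpha>[of x] lc[OF that] lc_grd that by blast
  thus ?thesis using assms by (auto simp: filt_def)
qed

lemma filt_subspace: "module.subspace sc (filt j n)"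
proof -
  interpret F: vector_space "sc :: 'k \<Rightarrow> (('i \<Rightarrow> 'a) \<Rightarrow> 'k) \<Rightarrow> _" by (rule vector_space_sc)
  show ?thesis by (rule F.subspaceI) (auto simp: filt_def susp_dual_closed fun_ap)
qed

text \<open>Up to sign, the bracket lies in the next lower central term. This is why the quadratic
  differential lowers the rank.\<close>

lemma filt_brk: assumes "\<phi> \<in> filt (Suc j) n" "x \<in> lower_central g j m" "y \<in> grd g l" "m + l = n - 1"
  shows "\<phi> (brk g x y) = 0"
proof -
  have x: "x \<in> grd g m" using assms(2) lc_grd by blast
  have p: "\<phi> \<in> dual g (n - 1)" using assms(1) by (simp add: filt_def susp_dual_def)
  have "brk g y x \<in> lower_central g (Suc j) (n - 1)"
    using assms by (auto intro!: GV.span_base) (metis add.commute)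
  hence "\<phi> (brk g y x) = 0" using assms(1) by (simp add: filt_def)
  moreover have "brk g y x \<in> grd g (n - 1)" by (rule brk_closed[OF assms(3) x]) (use assms(4) in simp)
  ultimately show ?thesis unfolding G.brk_antisym[OF x assms(3)] by (simp only: dualD(2)[OF p] mult_zero_right)
qed

end

lemma (in cont_map) filt_pull: assumes "\<phi> \<in> B.filt j n" shows "pull g f n \<phi> \<in> A.filt j n"
proof -
  have lc: "x \<in> grd g m \<and> f x \<in> lower_central g' k m" if "x \<in> lower_central g k m" for x k m
    using that
  proof (induction k arbitrary: x m)
    case 0
    thus ?case by (simp add: f_hom)
  next
    case (Suc k)
    from Suc.prems have "x \<in> A.GV.span {brk g x y |x y i j. x \<in> grd g i \<and> y \<in> lower_central g k j \<and> i + j = m}" by simp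
    thus ?case
    proof (induction rule: A.GV.span_induct)
      case base
      show ?case
        by (rule A.GV.subspaceI) (auto simp: f_hom A.grd_closed f_hom(3)[of 0 m 0, simplified] B.GV.span_zero B.GV.span_add B.GV.span_scale)
    next
      case (step x)
      then obtain y z i j where x: "x = brk g y z" "y \<in> grd g i" "z \<in> lower_central g k j" "i + j = m" by blast
      hence "z \<in> grd g j" "f z \<in> lower_central g' k j" using Suc.IH by blast+
      moreover have "f y \<in> grd g' i" using x(2) by (rule f_hom)
      ultimately have "brk g' (f y) (f z) \<in> {brk g' x y |x y i j. x \<in> grd g' i \<and> y \<in> lower_central g' k j \<and> i + j = m}"
        using x(4) by blast
      moreover have "f x = brk g' (f y) (f z)" using f_hom(5)[OF x(2) \<open>z \<in> grd g j\<close>] by (simp add: x(1))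
      moreover have "x \<in> grd g m" unfolding x(1) by (rule A.brk_closed[OF x(2) \<open>z \<in> grd g j\<close> x(4)])
      ultimately show ?case by (simp only: lower_central.simps B.GV.span_base simp_thms)
    qed
  qed
  show ?thesis using assms pull_in lc by (auto simp: B.filt_def A.filt_def pull_def)
qed

section \<open>Retracts of a complete dgla and adapted bases\<close>

lemma (in sym_eval) Phi_supp_length: assumes "\<forall>u\<in>keys a. length u = k" shows "supp (Phi a) (len k)"
  using assms by (induction rule: free_induct_on) (auto simp: Phi_simps supp_closed intro: phw_supp)

lemma (in complete_dg) Phi_CE_zero: "M.Phi (CE_I g n 0) = 0" "M.Phi (CE_II g n 0) = 0"
proof -
  note 0 = susp_dual_closed(3)[of n]
  show "M.Phi (CE_I g n 0) = 0" "M.Phi (CE_II g n 0) = 0"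
    using M.Phi_symrel[OF CE_I_linear(2)[OF 0, of 0]] M.Phi_symrel[OF CE_II_linear(2)[OF 0, of 0]]
    by (simp_all add: M.Phi_simps)
qed

text \<open>Stands for either factor inside the coproduct. The idempotent
  \<open>\<iota> \<pi>\<close> expresses restriction to the factor by an operation on the cochains
  of \<open>p\<close>.\<close>

locale retract = K: complete_dg SK k + P: complete_dg S p
  for SK :: "('i, 'a::ab_group_add, 'k::field_char_0) inv_sys" and k
    and S :: "('l, 'c::ab_group_add, 'k) inv_sys" and p +
  fixes \<iota> \<pi>
  assumes i: "cont_hom k p \<iota>" and q: "cont_hom p k \<pi>" and qi: "\<And>n x. x \<in> grd k n \<Longrightarrow> \<pi> (\<iota> x) = x"
begin

sublocale I: cont_map SK k S p \<iota>
  by (intro cont_map.intro cont_map_axioms.intro K.complete_dg_axioms P.complete_dg_axioms i)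

sublocale Q: cont_map S p SK k \<pi>
  by (intro cont_map.intro cont_map_axioms.intro K.complete_dg_axioms P.complete_dg_axioms q)

sublocale E: cont_map S p S p "\<lambda>x. \<iota> (\<pi> x)"
  by (intro cont_map.intro cont_map_axioms.intro P.complete_dg_axioms cont_hom_comp[OF q i])

abbreviation "pe \<equiv> pull p (\<lambda>x. \<iota> (\<pi> x))"

lemma pull_comp: "pe n \<phi> = pull p \<pi> n (pull k \<iota> n \<phi>)" using Q.f_hom(1) by (auto simp: pull_def)

lemma pe_idem: "pe n (pe n \<phi>) = pe n \<phi>"
proof
  fix x show "pe n (pe n \<phi>) x = pe n \<phi> x"
    using qi[OF Q.f_hom(1)] Q.f_hom(1) I.f_hom(1) by (simp add: pull_def)
qed

lemma pe_linear: "pe n (\<phi> + \<psi>) = pe n \<phi> + pe n \<psi>" "pe n (sc c \<phi>) = sc c (pe n \<phi>)" "pe n 0 = 0" "pe n (\<phi> - \<psi>) = pe n \<phi> - pe n \<psi>"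
  by (auto simp: pull_def fun_eq_iff fun_ap)

lemma fmap_e: "fmap p (\<lambda>x. \<iota> (\<pi> x)) a = fmap p \<pi> (fmap k \<iota> a)"
  by (induction a rule: free_induct) (simp_all add: fmap_simps pull_comp comp_def)

lemma fmap_e_zero: assumes "a \<in> wordsp (susp_dual p)"
  shows "P.M.Phi (fmap p (\<lambda>x. \<iota> (\<pi> x)) a) = 0 \<longleftrightarrow> K.M.Phi (fmap k \<iota> a) = 0"
proof
  assume "K.M.Phi (fmap k \<iota> a) = 0"
  thus "P.M.Phi (fmap p (\<lambda>x. \<iota> (\<pi> x)) a) = 0" unfolding fmap_e by (rule Q.Phi_fmap_0)
next
  assume "P.M.Phi (fmap p (\<lambda>x. \<iota> (\<pi> x)) a) = 0"
  hence 0: "K.M.Phi (fmap k \<iota> (fmap p (\<lambda>x. \<iota> (\<pi> x)) a)) = 0" by (rule I.Phi_fmap_0)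
  have "pull k \<iota> n (pe n \<phi>) = pull k \<iota> n \<phi>" for n \<phi>
    by (rule ext) (use I.f_hom(1) qi in \<open>simp add: pull_def\<close>)
  hence "fmap k \<iota> (fmap p (\<lambda>x. \<iota> (\<pi> x)) a) = fmap k \<iota> a"
    by (induction a rule: free_induct) (simp_all add: fmap_simps comp_def)
  thus "K.M.Phi (fmap k \<iota> a) = 0" using 0 by simp
qed

text \<open>The basis letters fixed by the idempotent; for an adapted basis they are coordinates for
  the dual of the factor inside the dual of \<open>p\<close>.\<close>

definition klet :: "(int \<Rightarrow> (('l \<Rightarrow> 'c) \<Rightarrow> 'k) set) \<Rightarrow> (bool \<times> int \<times> (('l \<Rightarrow> 'c) \<Rightarrow> 'k)) set" where
  "klet B = {l. \<not> fst l \<and> snd (snd l) \<in> B (fst (snd l)) \<and> pe (fst (snd l)) (snd (snd l)) = snd (snd l)}"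

context
  fixes B assumes B: "graded_basis sc (susp_dual p) B" and pure: "\<And>n b. b \<in> B n \<Longrightarrow> pe n b = b \<or> pe n b = 0"
begin

interpretation GB: graded_basis sc "susp_dual p" B by (rule B)

text \<open>The idempotent fixes or kills each basis vector, so in coordinates it is the restriction
  to the fixed ones.\<close>

lemma gen_pe: assumes "\<phi> \<in> susp_dual p n" shows "GB.gen n (pe n \<phi>) = rs (klet B) (GB.gen n \<phi>)"
proof -
  let ?S = "{\<phi> \<in> susp_dual p n. GB.gen n (pe n \<phi>) = rs (klet B) (GB.gen n \<phi>)}"
  have 0: "GB.gen n 0 = 0"
    using GB.gen_add[OF P.susp_dual_closed(3) P.susp_dual_closed(3), of n] by simp
  have "GB.VS.subspace ?S" by (rule GB.VS.subspaceI)
      (auto simp: P.susp_dual_closed pe_linear GB.gen_add GB.gen_scale E.pull_in rst_add rst_sc 0)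
  moreover have "B n \<subseteq> ?S"
  proof
    fix b assume b: "b \<in> B n"
    have "b \<noteq> 0" using b GB.B_ind GB.VS.dependent_zero by metis
    moreover have "rs (klet B) (lett l) = (if l \<in> klet B then lett l else (0 :: _ \<Rightarrow> 'k))" for l
      by (auto simp: rst_def lett_def fun_eq_iff fun_ap)
    ultimately have "GB.gen n (pe n b) = rs (klet B) (GB.gen n b)"
      using pure[OF b] b 0 by (auto simp: GB.gen_basis klet_def)
    thus "b \<in> ?S" using b GB.B_W by blast
  qed
  ultimately have "GB.VS.span (B n) \<subseteq> ?S" by (rule GB.VS.span_minimal[rotated])
  thus ?thesis using assms GB.W_B by blast
qed

lemma Phi_pe: assumes "a \<in> wordsp (susp_dual p)" shows "GB.Phi (fmap p (\<lambda>x. \<iota> (\<pi> x)) a) = rs (klet B) (GB.Phi a)"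
  using assms
proof (induction rule: free_span_induct)
  case (word u)
  hence "GB.phw (map (\<lambda>l. (fst l, pe (fst l) (snd l))) u) = rs (klet B) (GB.phw u)"
  proof (induction u)
    case Nil
    show ?case by (auto simp: rst_def onef_def fun_eq_iff)
  next
    case (Cons l u)
    thus ?case by (simp add: GB.rst_letters_sp gen_pe)
  qed
  thus ?case by (simp add: fmap_simps GB.Phi_simps)
qed (simp_all add: fmap_simps GB.Phi_simps rst_add rst_sc)

lemma Phi_rst_zero:
  assumes "a \<in> wordsp (susp_dual p)" shows "rs (klet B) (GB.Phi a) = 0 \<longleftrightarrow> K.M.Phi (fmap k \<iota> a) = 0"
  using Phi_pe[OF assms] P.Phi_basis_iff(1)[OF B E.fmap_wordsp[OF assms]] fmap_e_zero[OF assms] by simp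

text \<open>By naturality, a basis vector killed by the idempotent has differentials killed by
  it.\<close>

lemma rst_dB: assumes "l \<notin> klet B"
  shows "rs (klet B) (sym_der.dB sc B (CE_I p) l) = 0" "rs (klet B) (sym_der.dB sc B (CE_II p) l) = 0"
proof -
  interpret I: sym_der sc "susp_dual p" B "CE_I p" by (rule P.sym_der_CE[OF B])
  interpret II: sym_der sc "susp_dual p" B "CE_II p" by (rule P.sym_der_CE[OF B])
  have "rs (klet B) (I.dB l) = 0 \<and> rs (klet B) (II.dB l) = 0"
  proof (cases "l \<in> GB.VL")
    case True
    let ?n = "fst (snd l)" and ?b = "snd (snd l)"
    have b: "?b \<in> susp_dual p ?n" using True GB.B_W by blast
    have "pe ?n ?b = 0" using pure[of ?b ?n] True assms by (auto simp: klet_def)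
    hence "P.M.Phi (fmap p (\<lambda>x. \<iota> (\<pi> x)) (CE_I p ?n ?b)) = 0" "P.M.Phi (fmap p (\<lambda>x. \<iota> (\<pi> x)) (CE_II p ?n ?b)) = 0"
      by (simp_all add: E.fmap_CE[OF b] P.Phi_CE_zero)
    moreover have w: "CE_I p ?n ?b \<in> wordsp (susp_dual p)" "CE_II p ?n ?b \<in> wordsp (susp_dual p)"
      using wordspn_sub[OF P.CE_I_in[OF b]] wordspn_sub[OF P.CE_II_wordspn[OF b]] .
    ultimately have "rs (klet B) (GB.Phi (CE_I p ?n ?b)) = 0" "rs (klet B) (GB.Phi (CE_II p ?n ?b)) = 0"
      by (simp_all add: Phi_pe[symmetric] P.Phi_basis_iff(1)[OF B E.fmap_wordsp])
    thus ?thesis using True by (simp add: I.dB_def II.dB_def)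
  qed (auto simp: I.dB_def II.dB_def)
  thus "rs (klet B) (I.dB l) = 0" "rs (klet B) (II.dB l) = 0" by blast+
qed

end

end

lemma (in coprod) projections:
  obtains \<pi>1 \<pi>2 where "cont_hom p g \<pi>1" "cont_hom p h \<pi>2"
    "\<forall>n. \<forall>x\<in>grd g n. \<pi>1 (\<iota>1 x) = x \<and> \<pi>2 (\<iota>1 x) = 0" "\<forall>n. \<forall>x\<in>grd h n. \<pi>1 (\<iota>2 x) = 0 \<and> \<pi>2 (\<iota>2 x) = x"
proof -
  have zhg: "cont_hom h g (\<lambda>_. 0)"
    using dgla_0[OF G.G.dgla_axioms] tops(1) by (auto simp: cont_hom_def dgla_hom_def)
  have zgh: "cont_hom g h (\<lambda>_. 0)"
    using dgla_0[OF H.G.dgla_axioms] tops(2) by (auto simp: cont_hom_def dgla_hom_def)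
  from coproduct_universal[OF cop complete(1,2,1) G.cont_id zhg]
  obtain \<pi>1 where "mediates g h p \<iota>1 \<iota>2 g (\<lambda>x. x) (\<lambda>_. 0) \<pi>1" by (elim exE conjE) (rule that, assumption)
  moreover from coproduct_universal[OF cop complete(1,2,2) zgh H.cont_id]
  obtain \<pi>2 where "mediates g h p \<iota>1 \<iota>2 h (\<lambda>_. 0) (\<lambda>x. x) \<pi>2" by (elim exE conjE) (rule that, assumption)
  ultimately show thesis by (intro that[of \<pi>1 \<pi>2]) (simp_all add: mediates_def)
qed

locale coprod_proj = coprod SG g SH h S p \<iota>1 \<iota>2 + R1: retract SG g S p \<iota>1 \<pi>1 + R2: retract SH h S p \<iota>2 \<pi>2
  for SG :: "('i, 'a::ab_group_add, 'k::field_char_0) inv_sys" and g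
    and SH :: "('j, 'b::ab_group_add, 'k) inv_sys" and h
    and S :: "('l, 'c::ab_group_add, 'k) inv_sys" and p and \<iota>1 \<iota>2 \<pi>1 \<pi>2 +
  assumes orth: "x \<in> grd g n \<Longrightarrow> \<pi>2 (\<iota>1 x) = 0" "y \<in> grd h n \<Longrightarrow> \<pi>1 (\<iota>2 y) = 0"
begin

lemma hom_zero: "\<iota>1 0 = 0" "\<iota>2 0 = 0"
  using R1.I.f_hom(2)[OF G.grd_closed(1) G.grd_closed(1)] R2.I.f_hom(2)[OF H.grd_closed(1) H.grd_closed(1)] by simp_all

text \<open>Each projection is zero on the other factor. Orthogonality is what splits a functional
  into its two projections and a remainder killed by both.\<close>

lemma pe_orth: assumes "\<phi> \<in> susp_dual p n" shows "R1.pe n (R2.pe n \<phi>) = 0" "R2.pe n (R1.pe n \<phi>) = 0"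
proof -
  have 0: "\<phi> 0 = 0" using P.dualD(5) assms unfolding susp_dual_def by blast
  show "R1.pe n (R2.pe n \<phi>) = 0"
    by (rule ext) (simp add: pull_def zero_fun_apply orth(1)[OF R1.Q.f_hom(1)] hom_zero 0)
  show "R2.pe n (R1.pe n \<phi>) = 0"
    by (rule ext) (simp add: pull_def zero_fun_apply orth(2)[OF R2.Q.f_hom(1)] hom_zero 0)
qed

definition pure :: "int \<Rightarrow> (('l \<Rightarrow> 'c) \<Rightarrow> 'k) \<Rightarrow> bool" where
  "pure n b \<longleftrightarrow> R1.pe n b = b \<and> R2.pe n b = 0 \<or> R1.pe n b = 0 \<and> R2.pe n b = b \<or> R1.pe n b = 0 \<and> R2.pe n b = 0"

text \<open>A functional in \<open>filt j\<close> is the sum of its two projections and the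
  remainder, all three pure and again in \<open>filt j\<close>. Hence \<open>filt j\<close> is
  spanned by its pure elements, and \<open>filtered_basis\<close> applies to them.\<close>

lemma adapted_basis:
  obtains B rk where "graded_basis sc (susp_dual p) B" "\<And>n b. b \<in> B n \<Longrightarrow> pure n b"
    "\<And>n b. b \<in> B n \<Longrightarrow> b \<in> P.filt (rk n b) n"
    "\<And>n j. P.filt j n \<subseteq> module.span sc {b \<in> B n. rk n b \<le> (j::nat)}"
proof -
  interpret F: vector_space "sc :: 'k \<Rightarrow> (('l \<Rightarrow> 'c) \<Rightarrow> 'k) \<Rightarrow> _" by (rule vector_space_sc)
  have "\<forall>n. \<exists>Br :: (('l \<Rightarrow> 'c) \<Rightarrow> 'k) set \<times> ((('l \<Rightarrow> 'c) \<Rightarrow> 'k) \<Rightarrow> nat). F.independent (fst Br) \<and> (\<forall>b\<in>fst Br. pure n b \<and> b \<in> P.filt (snd Br b) n) \<and>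
      (\<forall>j. P.filt j n \<subseteq> F.span {b \<in> fst Br. snd Br b \<le> j})"
  proof
    fix n
    define T where "T j = {b \<in> P.filt j n. pure n b}" for j
    have 1: "T j \<subseteq> T (Suc j)" for j using P.filt_Suc by (auto simp: T_def)
    have 2: "T 0 \<subseteq> {0}" using P.filt_0 by (auto simp: T_def)
    obtain C :: "(('l \<Rightarrow> 'c) \<Rightarrow> 'k) set" and r :: "_ \<Rightarrow> nat" where C: "F.independent C" "\<And>j. T j \<subseteq> F.span {b \<in> C. r b \<le> j}" "\<And>b. b \<in> C \<Longrightarrow> b \<in> T (r b)"
      by (rule F.filtered_basis[of T, OF 1 2]) (rule that)
    have "\<phi> \<in> F.span {b \<in> C. r b \<le> j}" if \<phi>: "\<phi> \<in> P.filt j n" for \<phi> j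
    proof -
      have w: "\<phi> \<in> susp_dual p n" using \<phi> by (simp add: P.filt_def)
      let ?r = "\<phi> - R1.pe n \<phi> - R2.pe n \<phi>"
      have f: "R1.pe n \<phi> \<in> P.filt j n" "R2.pe n \<phi> \<in> P.filt j n" using R1.E.filt_pull R2.E.filt_pull \<phi> by blast+
      have "?r \<in> P.filt j n" using f \<phi> F.subspace_diff[OF P.filt_subspace] by blast
      hence "R1.pe n \<phi> \<in> T j" "R2.pe n \<phi> \<in> T j" "?r \<in> T j"
        using f pe_orth[OF w] by (auto simp: T_def pure_def R1.pe_idem R2.pe_idem R1.pe_linear R2.pe_linear)
      hence s: "R1.pe n \<phi> \<in> F.span {b \<in> C. r b \<le> j}" "R2.pe n \<phi> \<in> F.span {b \<in> C. r b \<le> j}" "?r \<in> F.span {b \<in> C. r b \<le> j}"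
        using C(2) by blast+
      have "\<phi> = ?r + R1.pe n \<phi> + R2.pe n \<phi>" by simp
      thus ?thesis using F.span_add[OF F.span_add[OF s(3,1)] s(2)] by simp
    qed
    thus "\<exists>Br :: (('l \<Rightarrow> 'c) \<Rightarrow> 'k) set \<times> ((('l \<Rightarrow> 'c) \<Rightarrow> 'k) \<Rightarrow> nat). F.independent (fst Br) \<and> (\<forall>b\<in>fst Br. pure n b \<and> b \<in> P.filt (snd Br b) n) \<and>
      (\<forall>j. P.filt j n \<subseteq> F.span {b \<in> fst Br. snd Br b \<le> j})"
      using C by (intro exI[of _ "(C, r)"]) (auto simp: T_def)
  qed
  from choice[OF this] obtain Br where Br: "\<forall>n. F.independent (fst (Br n)) \<and> (\<forall>b\<in>fst (Br n). pure n b \<and> b \<in> P.filt (snd (Br n) b) n) \<and>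
      (\<forall>j. P.filt j n \<subseteq> F.span {b \<in> fst (Br n). snd (Br n) b \<le> j})" ..
  show thesis
  proof (rule that[of "\<lambda>n. fst (Br n)" "\<lambda>n. snd (Br n)"])
    show "graded_basis sc (susp_dual p) (\<lambda>n. fst (Br n))"
    proof (unfold_locales)
      show "F.subspace (susp_dual p n)" for n by (simp add: susp_dual_def P.dual_subspace)
      show "fst (Br n) \<subseteq> susp_dual p n" for n using Br by (auto simp: P.filt_def)
      show "F.independent (fst (Br n))" for n using Br by blast
      show "susp_dual p n \<subseteq> F.span (fst (Br n))" for n
      proof
        fix \<phi> assume "\<phi> \<in> susp_dual p n"
        then obtain j where "\<phi> \<in> P.filt j n" using P.filt_exhaust by blast
        hence "\<phi> \<in> F.span {b \<in> fst (Br n). snd (Br n) b \<le> j}" using Br by blast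
        thus "\<phi> \<in> F.span (fst (Br n))" using F.span_mono[of "{b \<in> fst (Br n). snd (Br n) b \<le> j}" "fst (Br n)"] by blast
      qed
    qed
  qed (use Br in blast)+
qed

end

section \<open>Ranks and the quadratic differential\<close>

locale adapted = coprod_proj SG g SH h S p \<iota>1 \<iota>2 \<pi>1 \<pi>2
  for SG :: "('i, 'a::ab_group_add, 'k::field_char_0) inv_sys" and g
    and SH :: "('j, 'b::ab_group_add, 'k) inv_sys" and h
    and S :: "('l, 'c::ab_group_add, 'k) inv_sys" and p and \<iota>1 \<iota>2 \<pi>1 \<pi>2 +
  fixes B :: "int \<Rightarrow> (('l \<Rightarrow> 'c) \<Rightarrow> 'k) set" and rk :: "int \<Rightarrow> (('l \<Rightarrow> 'c) \<Rightarrow> 'k) \<Rightarrow> nat"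
  assumes gb: "graded_basis sc (susp_dual p) B" and pure: "b \<in> B n \<Longrightarrow> pure n b"
    and rk_filt: "b \<in> B n \<Longrightarrow> b \<in> P.filt (rk n b) n"
    and filt_rk: "P.filt j n \<subseteq> module.span sc {b \<in> B n. rk n b \<le> j}"
begin

sublocale D1: sym_der sc "susp_dual p" B "CE_I p" by (rule P.sym_der_CE[OF gb])
sublocale D2: sym_der sc "susp_dual p" B "CE_II p" by (rule P.sym_der_CE[OF gb])

abbreviation "rkl l \<equiv> rk (fst (snd l)) (snd (snd l))"

lemma filt_mono: "i \<le> j \<Longrightarrow> P.filt i n \<subseteq> P.filt j n"
  using lift_Suc_mono_le[of "\<lambda>j. P.filt j n", OF P.filt_Suc] .

text \<open>Basis functionals of rank above \<open>j\<close> stay independent on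
  \<open>lower_central p j\<close>: a combination vanishing there lies in \<open>filt j\<close>,
  which is contained in the span of the basis vectors of rank at most \<open>j\<close>. Those of
  rank at most \<open>j\<close> vanish there by \<open>rk_filt\<close>.\<close>

lemma lc_dual: assumes A: "finite A" "A \<subseteq> B n" and b: "b \<in> A" "rk n b > j"
  obtains x where "x \<in> lower_central p j (n - 1)" "\<forall>c\<in>A. c x = (if c = b then 1 else 0)"
proof -
  let ?A = "{c \<in> A. rk n c > j}" and ?X = "lower_central p j (n - 1)"
  have AW: "c \<in> dual p (n - 1)" if "c \<in> A" for c using that A(2) D1.B_W[of n] by (auto simp: susp_dual_def)
  have Xg: "x \<in> grd p (n - 1)" if "x \<in> ?X" for x using that P.lc_grd by blast
  have "\<exists>x. \<forall>b\<in>?A. x b \<in> ?X \<and> (\<forall>c\<in>?A. c (x b) = (if c = b then 1 else 0))"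
  proof (rule linear_dual_elements[OF P.GV.vector_space_axioms P.lc_subspace])
    show "finite ?A" using A(1) by simp
    show "\<forall>b\<in>?A. \<forall>x\<in>?X. (\<forall>y\<in>?X. b (x + y) = b x + b y) \<and> (\<forall>c. b (scl p c x) = c * b x)"
      using P.dualD(1,2)[OF AW] Xg by blast
    fix u assume u: "\<forall>x\<in>?X. (\<Sum>c\<in>?A. u c * c x) = 0"
    let ?f = "\<Sum>c\<in>?A. sc (u c) c"
    have "?f x = 0" if "x \<in> ?X" for x using u that by (simp add: sum_fun_apply fun_ap)
    moreover have "?f \<in> susp_dual p n"
      using A(2) D1.B_W[of n] by (intro D1.VS.subspace_sum[OF D1.W_sub] D1.VS.subspace_scale[OF D1.W_sub]) auto
    ultimately have "?f \<in> P.filt j n" by (simp add: P.filt_def)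
    hence f: "?f \<in> D1.VS.span {b \<in> B n. rk n b \<le> j}" using filt_rk by blast
    show "\<forall>c\<in>?A. u c = 0"
    proof
      fix c assume c: "c \<in> ?A"
      have sp: "c \<in> D1.VS.span (B n)" if "c \<in> ?A" for c using that A(2) by (auto intro: D1.VS.span_base)
      have "D1.VS.representation (B n) ?f c = (\<Sum>d\<in>?A. D1.VS.representation (B n) (sc (u d) d) c)"
        by (subst D1.VS.representation_sum[OF D1.B_ind D1.VS.span_scale[OF sp]]) simp_all
      also have "\<dots> = (\<Sum>d\<in>?A. if d = c then u c else 0)"
      proof (rule sum.cong[OF refl])
        fix d assume d: "d \<in> ?A"
        hence "d \<in> B n" using A(2) by blast
        thus "D1.VS.representation (B n) (sc (u d) d) c = (if d = c then u c else 0)"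
          by (simp only: D1.VS.representation_scale[OF D1.B_ind sp[OF d]] D1.VS.representation_basis[OF D1.B_ind]) auto
      qed
      also have "\<dots> = u c" using c A(1) by simp
      finally have "u c = D1.VS.representation (B n) ?f c" ..
      also have "D1.VS.representation (B n) ?f = D1.VS.representation {b \<in> B n. rk n b \<le> j} ?f"
        by (rule D1.VS.representation_extend[OF D1.B_ind f]) blast
      also have "D1.VS.representation {b \<in> B n. rk n b \<le> j} ?f c = 0"
        using D1.VS.representation_ne_zero[of "{b \<in> B n. rk n b \<le> j}" ?f c] c by auto
      finally show "u c = 0" .
    qed
  qed
  then obtain x where x: "\<forall>b\<in>?A. x b \<in> ?X \<and> (\<forall>c\<in>?A. c (x b) = (if c = b then 1 else 0))" ..
  have xb: "x b \<in> ?X" using x b by blast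
  show thesis
  proof (rule that[OF xb], rule ballI)
    fix c assume c: "c \<in> A"
    show "c (x b) = (if c = b then 1 else 0)"
    proof (cases "rk n c > j")
      case True
      thus ?thesis using x b c by blast
    next
      case False
      hence "c \<in> P.filt j n" using filt_mono[of "rk n c" j n] rk_filt[of c n] c A(2) by auto
      hence "c (x b) = 0" using xb by (simp add: P.filt_def)
      thus ?thesis using False b by auto
    qed
  qed
qed

text \<open>Suppose a word in the differential of \<open>b\<close>, of rank \<open>j + 1\<close>,
  begins with a letter of rank above \<open>j\<close>. Evaluation at dual elements, the first one
  taken from \<open>lower_central p j\<close>, then gives a nonzero value, although \<open>b\<close>
  kills such brackets. Symmetry covers the second letter.\<close>

lemma rank_supp: assumes l: "l \<in> D1.VL" shows "supp (D2.dB l) (wds {m \<in> D1.VL. rkl m < rkl l} 2)"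
proof -
  obtain n b where nb: "l = (False, n, b)" "b \<in> B n" using l by (cases l) auto
  have bW: "b \<in> susp_dual p n" using nb D1.B_W by blast
  have w: "CE_II p n b \<in> wordsp (susp_dual p)" by (rule wordspn_sub[OF P.CE_II_wordspn[OF bW]])
  have "b \<noteq> 0" using nb D1.B_ind D1.VS.dependent_zero by metis
  hence "rk n b \<noteq> 0" using rk_filt[OF nb(2)] P.filt_0[of n] by (cases "rk n b") auto
  then obtain j where j: "rk n b = Suc j" by (cases "rk n b") auto
  have bj: "b \<in> P.filt (Suc j) n" using rk_filt[OF nb(2)] j by simp
  have dB: "D2.dB l = D1.Phi (CE_II p n b)" using nb by (simp add: D2.dB_def)
  have len: "supp (D2.dB l) (len 2)"
    unfolding dB by (rule D1.Phi_supp_length) (use P.CE_II_two[OF bW] in \<open>simp add: span_words\<close>)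
  have VL: "supp (D2.dB l) (over D1.VL)" unfolding dB by (rule D1.Phi_Lam(2)[OF w])
  have sym: "D1.supersym (D2.dB l)" using D2.dB_Lam[of l] by (simp add: D1.Lam_def)
  have key: "rkl l1 \<le> j" if nz: "D2.dB l [l1, l2] \<noteq> 0" for l1 l2
  proof (rule ccontr)
    assume "\<not> rkl l1 \<le> j"
    have v: "set [l1, l2] \<subseteq> D1.VL" using suppD[OF VL nz] .
    obtain A where A: "finite A" "set [l1, l2] \<subseteq> A" "A \<subseteq> D1.VL"
      "\<And>u m \<phi>. u \<in> keys (CE_II p n b) \<Longrightarrow> (m, \<phi>) \<in> set u \<Longrightarrow> (\<lambda>b. (False, m, b)) ` D1.bsupp m \<phi> \<subseteq> A"
      by (rule P.letters_finite[OF gb List.finite_set v, of "CE_II p n b"]) (rule that)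
    obtain X0 where X0: "\<forall>n. \<forall>b\<in>{b. (False, n, b) \<in> A}. X0 n b \<in> grd p (n - 1) \<and>
      (\<forall>c\<in>{b. (False, n, b) \<in> A}. c (X0 n b) = (if c = b then 1 else 0))"
      using P.dual_elements_ex[OF gb A(1,3)] by (elim exE)
    obtain n1 b1 where l1: "l1 = (False, n1, b1)" using v by (cases l1) auto
    obtain n2 b2 where l2: "l2 = (False, n2, b2)" using v by (cases l2) auto
    have "{c. (False, n1, c) \<in> A} \<subseteq> (\<lambda>l. snd (snd l)) ` A" by force
    hence fin: "finite {c. (False, n1, c) \<in> A}" using A(1) finite_surj by blast
    have sub: "{c. (False, n1, c) \<in> A} \<subseteq> B n1" using A(3) by auto
    have mem: "b1 \<in> {c. (False, n1, c) \<in> A}" using A(2) l1 by simp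
    have r: "rk n1 b1 > j" using \<open>\<not> rkl l1 \<le> j\<close> l1 by simp
    obtain x where x: "x \<in> lower_central p j (n1 - 1)" "\<forall>c\<in>{c. (False, n1, c) \<in> A}. c x = (if c = b1 then 1 else 0)"
      by (rule lc_dual[OF fin sub mem r])
    have xg: "x \<in> grd p (n1 - 1)" using x(1) P.lc_grd by blast
    \<comment> \<open>Replacing one dual element by \<open>x\<close> keeps the family dual to the
      letters in \<open>A\<close>.\<close>
    define X where "X m c = (if m = n1 \<and> c = b1 then x else X0 m c)" for m c
    have eq: "P.M.Phi (CE_II p n b) (map (\<lambda>l. (fst (snd l), X (fst (snd l)) (snd (snd l)))) [l1, l2]) = D1.Phi (CE_II p n b) [l1, l2]"
    proof (rule P.Phi_dual_elements[OF gb w A(3,2,4)])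
      show "X m c \<in> grd p (m - 1)" if "(False, m, c) \<in> A" for m c using X0 that xg by (auto simp: X_def)
      show "d (X m c) = (if d = c then 1 else 0)" if "(False, m, c) \<in> A" "(False, m, d) \<in> A" for m c d
      proof (cases "m = n1 \<and> c = b1")
        case True
        thus ?thesis using x(2) that by (simp add: X_def)
      next
        case False
        hence "X m c = X0 m c" by (auto simp: X_def)
        thus ?thesis using X0 that by simp
      qed
    qed
    have "(False, n2, b2) \<in> A" using A(2) l2 by simp
    hence yg: "X n2 b2 \<in> grd p (n2 - 1)" using X0 xg by (auto simp: X_def)
    have va: "valid p (n1, x)" "valid p (n2, X n2 b2)" using xg yg by (simp_all add: valid_def)
    have "ev2 p n b (P.merge (n1, x) (n2, X n2 b2)) = 0"
    proof (cases "n1 + n2 - 1 = n")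
      case True
      have "b (brk p x (X n2 b2)) = 0" by (rule P.filt_brk[OF bj x(1) yg]) (use True in simp)
      thus ?thesis by (simp add: ev2_def P.merge_def)
    qed (simp add: ev2_def P.merge_def)
    hence "P.M.Phi (CE_II p n b) [(n1, x), (n2, X n2 b2)] = 0" by (simp add: P.d2_len1[OF bW va])
    thus False using eq nz dB by (simp add: l1 l2) (simp add: X_def)
  qed
  show ?thesis unfolding supp_def
  proof (intro allI impI)
    fix w assume w: "D2.dB l w \<noteq> 0"
    obtain l1 l2 where l12: "w = [l1, l2]" using suppD[OF len w] by (auto simp: numeral_2_eq_2 length_Suc_conv)
    have "D2.dB l [l2, l1] \<noteq> 0" using D1.supersymD[OF sym, of "[]" l1 l2 "[]"] w l12 by auto
    hence "rkl l1 \<le> j" "rkl l2 \<le> j" using key w l12 by blast+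
    thus "set w \<subseteq> {m \<in> D1.VL. rkl m < rkl l} \<and> length w = 2"
      using suppD[OF VL w] by (simp add: l12 nb j)
  qed
qed

end

section \<open>Quadratic cochains as bilinear forms\<close>

context complete_dg
begin

lemma ev2_linear: assumes "\<phi> \<in> Wg m" "x \<in> grd g (n - 1)"
  shows "x' \<in> grd g (n - 1) \<Longrightarrow> ev2 g m \<phi> (n, x + x') = ev2 g m \<phi> (n, x) + ev2 g m \<phi> (n, x')"
    and "ev2 g m \<phi> (n, scl g c x) = c * ev2 g m \<phi> (n, x)"
  using assms dualD(1,2)[of \<phi> "m - 1"] grd_closed by (auto simp: ev2_def valid_def susp_dual_def)

lemma two_word_eval: assumes "u \<in> words Wg" "length u = 2"
  obtains p \<phi> q \<psi> where "u = [(p, \<phi>), (q, \<psi>)]" "\<phi> \<in> Wg p" "\<psi> \<in> Wg q"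
    "\<And>l1 l2. M.Phi (word u) [l1, l2] = ev2 g p \<phi> l1 * ev2 g q \<psi> l2 + eps (fst l1 * fst l2) * ev2 g p \<phi> l2 * ev2 g q \<psi> l1"
proof -
  obtain p \<phi> q \<psi> where u: "u = [(p, \<phi>), (q, \<psi>)]" "\<phi> \<in> Wg p" "\<psi> \<in> Wg q"
    using two_wordE[OF assms] by blast
  show thesis
  proof (rule that[OF u])
    show "M.Phi (word u) [l1, l2] = ev2 g p \<phi> l1 * ev2 g q \<psi> l2 + eps (fst l1 * fst l2) * ev2 g p \<phi> l2 * ev2 g q \<psi> l1" for l1 l2
      unfolding u(1) M.Phi_at M.phw.simps M.sp_onef two_gen fst_conv snd_conv ..
  qed
qed

lemma two_form: assumes a: "a \<in> two_words"
  shows "x \<in> grd g (n - 1) \<Longrightarrow> x' \<in> grd g (n - 1) \<Longrightarrow> M.Phi a [(n, x + x'), l] = M.Phi a [(n, x), l] + M.Phi a [(n, x'), l]"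
    and "x \<in> grd g (n - 1) \<Longrightarrow> M.Phi a [(n, scl g c x), l] = c * M.Phi a [(n, x), l]"
    and "M.Phi a [l1, l2] = eps (fst l1 * fst l2) * M.Phi a [l2, l1]"
proof -
  from a have "(x \<in> grd g (n - 1) \<longrightarrow> x' \<in> grd g (n - 1) \<longrightarrow> M.Phi a [(n, x + x'), l] = M.Phi a [(n, x), l] + M.Phi a [(n, x'), l]) \<and>
    (x \<in> grd g (n - 1) \<longrightarrow> M.Phi a [(n, scl g c x), l] = c * M.Phi a [(n, x), l]) \<and>
    M.Phi a [l1, l2] = eps (fst l1 * fst l2) * M.Phi a [l2, l1]"
  proof (induction rule: free_span_induct)
    case (word u)
    then obtain p \<phi> q \<psi> where u: "\<phi> \<in> Wg p" "\<psi> \<in> Wg q"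
      "\<And>l1 l2. M.Phi (word u) [l1, l2] = ev2 g p \<phi> l1 * ev2 g q \<psi> l2 + eps (fst l1 * fst l2) * ev2 g p \<phi> l2 * ev2 g q \<psi> l1"
      using two_word_eval by metis
    show ?case unfolding u(3)
      by (auto simp: ev2_linear[OF u(1)] ev2_linear[OF u(2)] algebra_simps) (auto simp: eps_def split: if_splits)
  qed (simp_all add: M.Phi_at algebra_simps)
  thus "x \<in> grd g (n - 1) \<Longrightarrow> x' \<in> grd g (n - 1) \<Longrightarrow> M.Phi a [(n, x + x'), l] = M.Phi a [(n, x), l] + M.Phi a [(n, x'), l]"
    "x \<in> grd g (n - 1) \<Longrightarrow> M.Phi a [(n, scl g c x), l] = c * M.Phi a [(n, x), l]"
    "M.Phi a [l1, l2] = eps (fst l1 * fst l2) * M.Phi a [l2, l1]" by blast+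
qed

text \<open>The finitely many functionals occurring in \<open>a\<close> factor through a common
  level.\<close>

lemma two_form_level: assumes a: "a \<in> two_words"
  obtains \<alpha> where "\<And>n x l. x \<in> grd g (n - 1) \<Longrightarrow> x \<alpha> = 0 \<Longrightarrow> M.Phi a [(n, x), l] = 0"
proof -
  have k: "\<forall>u\<in>keys a. u \<in> words Wg \<and> length u = 2" using a by (simp add: span_words)
  let ?L = "\<Union>u\<in>keys a. set u"
  have "\<forall>l\<in>?L. \<exists>\<alpha>. \<forall>\<beta>. le S \<alpha> \<beta> \<longrightarrow> (\<forall>x\<in>grd g (fst l - 1). x \<beta> = 0 \<longrightarrow> snd l x = 0)"
  proof
    fix l assume "l \<in> ?L"
    hence "snd l \<in> dual g (fst l - 1)" using k by (fastforce simp: words_def susp_dual_def)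
    thus "\<exists>\<alpha>. \<forall>\<beta>. le S \<alpha> \<beta> \<longrightarrow> (\<forall>x\<in>grd g (fst l - 1). x \<beta> = 0 \<longrightarrow> snd l x = 0)" by (rule dual_factor)
  qed
  from bchoice[OF this] obtain lev where lev: "\<forall>l\<in>?L. \<forall>\<beta>. le S (lev l) \<beta> \<longrightarrow> (\<forall>x\<in>grd g (fst l - 1). x \<beta> = 0 \<longrightarrow> snd l x = 0)" ..
  obtain \<alpha> where \<alpha>: "\<forall>\<beta>\<in>lev ` ?L. le S \<beta> \<alpha>" using upper_bound[of "lev ` ?L"] by auto
  have z: "\<forall>l\<in>?L. \<forall>x\<in>grd g (fst l - 1). x \<alpha> = 0 \<longrightarrow> snd l x = 0" using lev \<alpha> by blast
  show thesis
  proof (rule that)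
    fix n x l assume x: "x \<in> grd g (n - 1)" "x \<alpha> = 0"
    have "\<forall>u\<in>keys a. u \<in> words Wg \<and> length u = 2 \<and> set u \<subseteq> ?L" using k by blast
    thus "M.Phi a [(n, x), l] = 0"
    proof (induction rule: free_induct_on)
      case (word u)
      then obtain p \<phi> q \<psi> where u: "u = [(p, \<phi>), (q, \<psi>)]" "\<phi> \<in> Wg p" "\<psi> \<in> Wg q"
        "\<And>l1 l2. M.Phi (word u) [l1, l2] = ev2 g p \<phi> l1 * ev2 g q \<psi> l2 + eps (fst l1 * fst l2) * ev2 g p \<phi> l2 * ev2 g q \<psi> l1"
        using two_word_eval by metis
      have "(p, \<phi>) \<in> ?L" "(q, \<psi>) \<in> ?L" using word u(1) by auto
      hence "ev2 g p \<phi> (n, x) = 0" "ev2 g q \<psi> (n, x) = 0"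
        using z[rule_format, of "(p, \<phi>)" x] z[rule_format, of "(q, \<psi>)" x] x by (auto simp: ev2_def valid_def)
      thus ?case unfolding u(4) by simp
    qed (simp_all add: M.Phi_at)
  qed
qed

end

section \<open>Exactness for the quadratic differential\<close>

context adapted
begin

abbreviation "GL \<equiv> R1.klet B"
abbreviation "HL \<equiv> R2.klet B"

lemma pure1: "b \<in> B n \<Longrightarrow> R1.pe n b = b \<or> R1.pe n b = 0" and pure2: "b \<in> B n \<Longrightarrow> R2.pe n b = b \<or> R2.pe n b = 0"
  using pure[of b n] by (auto simp: pure_def)

lemmas rst_zero = R1.Phi_rst_zero[OF gb pure1] R2.Phi_rst_zero[OF gb pure2]

lemma linear_form: assumes "D1.hom m f" "f \<in> D1.Lam" "supp f (wds D1.VL 1)"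
  obtains y where "y \<in> susp_dual p m" "D1.gen m y = f"
proof -
  let ?S = "{b. f [(False, m, b)] \<noteq> 0}"

  have fin: "finite {l. ldel l f \<noteq> 0}" using assms(2) D1.finite_ldel by (auto simp: D1.Lam_def)
  have "(False, m, b) \<in> {l. ldel l f \<noteq> 0}" if "b \<in> ?S" for b
    using that by (auto simp: ldel_def fun_eq_iff fun_ap intro: exI[of _ "[]"])
  hence "?S \<subseteq> (\<lambda>l. snd (snd l)) ` {l. ldel l f \<noteq> 0}" by force
  hence fS: "finite ?S" using fin finite_surj by blast
  have SB: "?S \<subseteq> B m" using assms(3) by (auto simp: supp_def)
  hence SW: "?S \<subseteq> susp_dual p m" using D1.B_W by blast
  let ?y = "\<Sum>b\<in>?S. sc (f [(False, m, b)]) b"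
  note gs' = D1.gen_sum[OF fS SW, of "\<lambda>b. f [(False, m, b)]"]
  note gs = conjunct1[OF gs'] conjunct2[OF gs']
  show thesis
  proof (rule that[OF gs(2)])
    have "D1.gen m ?y = (\<Sum>b\<in>?S. sc (f [(False, m, b)]) (lett (False, m, b)))"
      unfolding gs(1) by (intro sum.cong refl arg_cong2[of _ _ _ _ sc] D1.gen_basis) (use SB in blast)
    also have "\<dots> = f"
    proof
      fix w
      show "(\<Sum>b\<in>?S. sc (f [(False, m, b)]) (lett (False, m, b))) w = f w"
      proof (cases "f w = 0")
        case True
        thus ?thesis unfolding sum_fun_apply by (intro trans[OF sum.neutral]) (auto simp: fun_ap lett_def)
      next
        case False
        hence "set w \<subseteq> D1.VL" "length w = 1" "wsum ldeg w = m" using assms(1,3) by (auto simp: supp_def D1.hom_def)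
        then obtain b where w: "w = [(False, m, b)]" by (auto simp: length_Suc_conv)
        have "(\<Sum>c\<in>?S. sc (f [(False, m, c)]) (lett (False, m, c))) w = (\<Sum>c\<in>?S. if c = b then f w else 0)"
          unfolding sum_fun_apply by (intro sum.cong) (auto simp: fun_ap lett_def w)
        thus ?thesis using False fS w by simp
      qed
    qed
    finally show "D1.gen m ?y = f" .
  qed
qed

lemma M_word: "P.M.Phi (word [(n, \<phi>)]) [l] = ev2 p n \<phi> l" by (simp add: P.M.Phi_at P.M.gen_apply)

lemma letter_eval:
  assumes y: "y \<in> susp_dual p m" and z: "rs GL (D1.gen m y) = 0" "rs HL (D1.gen m y) = 0"
  shows "x \<in> grd g (m - 1) \<Longrightarrow> y (\<iota>1 x) = 0" "x' \<in> grd h (m - 1) \<Longrightarrow> y (\<iota>2 x') = 0"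
proof -
  have w: "(word [(m, y)] :: _ \<Rightarrow>\<^sub>0 'k) \<in> wordsp (susp_dual p)" using y by (intro word_in) simp
  have G0: "G.M.Phi (fmap g \<iota>1 (word [(m, y)])) = 0" "H.M.Phi (fmap h \<iota>2 (word [(m, y)])) = 0"
    using rst_zero[OF _ w] z by (simp_all add: D1.Phi_simps)
  show "y (\<iota>1 x) = 0" if x: "x \<in> grd g (m - 1)"
    using fun_cong[OF G0(1), of "[(m, x)]"] x R1.I.f_hom(1)[OF x]
    by (simp add: R1.I.Phi_fmap valid_def flet_def M_word ev2_def zero_fun_apply)
  show "y (\<iota>2 x') = 0" if x: "x' \<in> grd h (m - 1)"
    using fun_cong[OF G0(2), of "[(m, x')]"] x R2.I.f_hom(1)[OF x]
    by (simp add: R2.I.Phi_fmap valid_def flet_def M_word ev2_def zero_fun_apply)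
qed

lemma Phi_transfer: "a \<in> wordsp (susp_dual p) \<Longrightarrow> b \<in> wordsp (susp_dual p) \<Longrightarrow> P.M.Phi a = P.M.Phi b \<longleftrightarrow> D1.Phi a = D1.Phi b"
  using P.Phi_basis_iff(1)[OF gb, of "a - b"] FA.span_diff[of a _ b] by (simp add: D1.Phi_simps P.M.Phi_simps)

lemma eps_nz: "eps n \<noteq> (0 :: 'k)" by (simp add: eps_def)

text \<open>A linear relative cochain is a functional vanishing on both factors, and closedness
  means that it kills brackets; \<open>dual_zero\<close> applies.\<close>

lemma degree_one: assumes "f \<in> D1.Lam" "D1.hom m f" "supp f (wds D1.VL 1)" "D1.der D2.dB f = 0"
    "rs GL f = 0" "rs HL f = 0"
  shows "f = 0"
proof -
  obtain y where y: "y \<in> susp_dual p m" "D1.gen m y = f" using linear_form[OF assms(2,1,3)] by blast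
  have "D1.Phi (CE_II p m y) = 0" using D2.der_gen[OF y(1)] assms(4) y(2) by simp
  hence 0: "P.M.Phi (CE_II p m y) = 0"
    using P.Phi_basis_iff(1)[OF gb wordspn_sub[OF P.CE_II_wordspn[OF y(1)]]] by simp
  have "y = 0"
  proof (rule dual_zero)
    show "y \<in> dual p (m - 1)" using y(1) by (simp add: susp_dual_def)
    show "y (\<iota>1 x) = 0" if "x \<in> grd g (m - 1)" for x using letter_eval(1)[OF y(1)] y(2) assms(5,6) that by simp
    show "y (\<iota>2 x) = 0" if "x \<in> grd h (m - 1)" for x using letter_eval(2)[OF y(1)] y(2) assms(5,6) that by simp
    fix i x z assume x: "x \<in> grd p i" and z: "z \<in> grd p (m - 1 - i)"
    have v: "valid p (i + 1, x)" "valid p (m - i, z)" using x z by (simp_all add: valid_def algebra_simps)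
    have "P.sgn2 (i + 1, x) (m - i, z) * ev2 p m y (P.merge (i + 1, x) (m - i, z)) = 0"
      using P.d2_len1[OF y(1) v] 0 by (simp add: zero_fun_apply)
    hence "ev2 p m y (P.merge (i + 1, x) (m - i, z)) = 0" using eps_nz by (simp add: P.sgn2_def)
    thus "y (brk p x z) = 0" using P.valid_merge[OF v] by (simp add: ev2_def P.merge_def)
  qed
  thus ?thesis using y D1.gen_add[OF P.susp_dual_closed(3) P.susp_dual_closed(3), of m] by simp
qed

text \<open>A quadratic cochain is a graded symmetric bilinear form on the suspension. Closedness is
  the 2-cocycle identity, and being relative means vanishing on both factors; the functional given
  by \<open>dual_exists\<close> is a primitive.\<close>

lemma degree_two: assumes f: "f \<in> D1.Lam" "D1.hom m f" "supp f (wds D1.VL 2)" "D1.der D2.dB f = 0"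
    "rs GL f = 0" "rs HL f = 0"
  shows "\<exists>y\<in>D1.Lam. D1.hom (m - 1) y \<and> supp y (wds D1.VL 1) \<and> D1.der D2.dB y = f \<and>
    rs GL y = 0 \<and> rs HL y = 0"
proof -
  define a where "a = D1.psi 2 f"
  have fV: "supp f (over D1.VL)" using f(3) by (auto simp: supp_def)
  have "supp f (\<lambda>w. set w \<subseteq> D1.VL \<and> wsum ldeg w = m)" using f(2,3) by (auto simp: supp_def D1.hom_def)
  from D1.psi_in[OF this, of 2] have a: "a \<in> P.two_words" "a \<in> wordspn (susp_dual p) m" "a \<in> wordsp (susp_dual p)"
    by (auto simp: a_def span_words)
  have Pa: "D1.Phi a = f"
    unfolding a_def D1.Phi_psi[OF f(1) fV] using f(3) by (auto simp: rst_def supp_def fun_eq_iff)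
  have "D1.Phi (dfree (CE_II p) a) = 0" using D2.Phi_dfree[OF a(3)] Pa f(4) by simp
  hence d0: "P.M.Phi (dfree (CE_II p) a) = 0"
    using P.Phi_basis_iff(1)[OF gb D2.dfree_wordsp[OF a(3)]] by simp
  have G0: "G.M.Phi (fmap g \<iota>1 a) = 0" "H.M.Phi (fmap h \<iota>2 a) = 0"
    using rst_zero[OF _ a(3)] f(5,6) Pa by simp_all
  define F where "F l1 l2 = P.M.Phi a [l1, l2]" for l1 l2
  \<comment> \<open>The sign is that of \<open>sgn2\<close>: it undoes the suspension, turning the
    graded symmetric form \<open>F\<close> into a graded antisymmetric one.\<close>
  define \<omega> where "\<omega> i j x y = - eps (i * (j + 1)) * F (i + 1, x) (j + 1, y)" for i j x y
  have F\<omega>: "F (i, x) (j, y) = - eps ((i - 1) * j) * \<omega> (i - 1) (j - 1) x y" for i j x y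
    by (simp add: \<omega>_def eps_sq_left)
  have Fsym: "F l1 l2 = eps (fst l1 * fst l2) * F l2 l1" for l1 l2 unfolding F_def by (rule P.two_form(3)[OF a(1)])
  obtain \<alpha> where \<alpha>: "\<And>n x l. x \<in> grd p (n - 1) \<Longrightarrow> x \<alpha> = 0 \<Longrightarrow> P.M.Phi a [(n, x), l] = 0"
    by (rule P.two_form_level[OF a(1)]) (rule that)
  have anti: "\<omega> i j x y = - eps (i * j) * \<omega> j i y x" for i j x y
    unfolding \<omega>_def Fsym[of "(i + 1, x)"] by (auto simp: eps_def)
  \<comment> \<open>The letters of \<open>f\<close> have degrees \<open>i + 1\<close> and
    \<open>j + 1\<close> with sum \<open>m\<close>, so the elements themselves have total degree
    \<open>m - 2\<close>.\<close>
  obtain y where y: "y \<in> dual p (m - 2)" "\<And>i j a b. a \<in> grd p i \<Longrightarrow> b \<in> grd p j \<Longrightarrow> i + j = m - 2 \<Longrightarrow> y (brk p a b) = \<omega> i j a b"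
    "\<And>x. x \<in> grd g (m - 2) \<Longrightarrow> y (\<iota>1 x) = 0" "\<And>x. x \<in> grd h (m - 2) \<Longrightarrow> y (\<iota>2 x) = 0"
  proof (rule dual_exists[of \<omega> "m - 2" \<alpha>])
    fix i j x y assume x: "x \<in> grd p i" and y: "y \<in> grd p j"
    have x': "x \<in> grd p (i + 1 - 1)" using x by simp
    show "\<omega> i j (x + x') y = \<omega> i j x y + \<omega> i j x' y" if "x' \<in> grd p i" for x'
      unfolding \<omega>_def F_def using P.two_form(1)[OF a(1) x', of x'] that by (simp add: algebra_simps)
    show "\<omega> i j (scl p c x) y = c * \<omega> i j x y" for c
      unfolding \<omega>_def F_def P.two_form(2)[OF a(1) x'] by simp
    show "\<omega> i j x y = - eps (i * j) * \<omega> j i y x" by (rule anti)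
    show "\<omega> i j x y = 0" if "i + j \<noteq> m - 2"
      using P.M.Phi_hom[OF a(2)] that unfolding P.M.hom_def by (auto simp: \<omega>_def F_def)
    show "\<omega> i j x y = 0" if "x \<alpha> = 0" using \<alpha>[OF x' that] by (simp add: \<omega>_def F_def)
    show "\<omega> i (j + l) x (brk p y z) = \<omega> (i + j) l (brk p x y) z + eps (i * j) * \<omega> j (i + l) y (brk p x z)"
      if z: "z \<in> grd p l" for l z
    proof -
      have v: "valid p (i + 1, x)" "valid p (j + 1, y)" "valid p (l + 1, z)" using x y z by (simp_all add: valid_def)
      \<comment> \<open>Closedness of \<open>a\<close> at three elements; with \<open>F\<close>
        rewritten in terms of \<open>\<omega>\<close> it becomes the cocycle identity up to signs
        that depend on parities only.\<close>
      have 0: "P.sgn2 (i + 1, x) (j + 1, y) * F (i + j + 1, brk p x y) (l + 1, z)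
        + eps ((j + 1) * (l + 1)) * P.sgn2 (i + 1, x) (l + 1, z) * F (i + l + 1, brk p x z) (j + 1, y)
        + eps ((i + 1) * (j + 1 + (l + 1))) * P.sgn2 (j + 1, y) (l + 1, z) * F (j + l + 1, brk p y z) (i + 1, x) = 0"
        using P.d2_len2[OF a(1) v] d0 by (simp add: F_def P.merge_def zero_fun_apply algebra_simps)
      have 1: "\<omega> i (j + l) x (brk p y z) = - eps (i * (j + l)) * \<omega> (j + l) i (brk p y z) x"
        "\<omega> j (i + l) y (brk p x z) = - eps (j * (i + l)) * \<omega> (i + l) j (brk p x z) y" by (rule anti)+
      define X Y Z where XYZ: "X = \<omega> (i + j) l (brk p x y) z" "Y = \<omega> (i + l) j (brk p x z) y" "Z = \<omega> (j + l) i (brk p y z) x"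
      have "i + j + 1 - 1 = i + j" "i + l + 1 - 1 = i + l" "j + l + 1 - 1 = j + l" "i + 1 - 1 = i" "j + 1 - 1 = j" "l + 1 - 1 = l" by simp_all
      note 2 = 0[unfolded F\<omega> P.sgn2_def fst_conv this, folded XYZ]
      show ?thesis using 2 unfolding 1 XYZ(1)[symmetric] XYZ(2)[symmetric] XYZ(3)[symmetric]
        by (cases "even i"; cases "even j"; cases "even l") (simp_all add: eps_def, (metis add_eq_0_iff minus_diff_eq minus_minus)+)
    qed
  next
    fix i j x y assume x: "x \<in> grd g i" and y: "y \<in> grd g j"
    show "\<omega> i j (\<iota>1 x) (\<iota>1 y) = 0" using fun_cong[OF G0(1), of "[(i + 1, x), (j + 1, y)]"] x y
      by (simp add: R1.I.Phi_fmap valid_def flet_def \<omega>_def F_def zero_fun_apply)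
  next
    fix i j x y assume x: "x \<in> grd h i" and y: "y \<in> grd h j"
    show "\<omega> i j (\<iota>2 x) (\<iota>2 y) = 0" using fun_cong[OF G0(2), of "[(i + 1, x), (j + 1, y)]"] x y
      by (simp add: R2.I.Phi_fmap valid_def flet_def \<omega>_def F_def zero_fun_apply)
  qed (rule that)
  have yW: "y \<in> susp_dual p (m - 1)" using y(1) by (simp add: susp_dual_def)
  have "P.M.Phi (CE_II p (m - 1) y) = P.M.Phi a"
  proof (rule P.len2_ext[OF P.CE_II_len[OF yW]])
    show "supp (P.M.Phi a) (len 2)"
      by (rule P.M.Phi_supp_length) (use a(1) in \<open>simp add: span_words\<close>)
    fix l1 l2 assume l: "valid p l1" "valid p l2"
    obtain i x j z where xz: "l1 = (i, x)" "l2 = (j, z)" by (cases l1, cases l2)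
    have xg: "x \<in> grd p (i - 1)" and zg: "z \<in> grd p (j - 1)" using l by (simp_all add: xz valid_def)
    show "P.M.Phi (CE_II p (m - 1) y) [l1, l2] = P.M.Phi a [l1, l2]"
    proof (cases "i + j = m")
      case True
      hence "y (brk p x z) = \<omega> (i - 1) (j - 1) x z" by (intro y(2)[OF xg zg]) simp
      moreover have "ev2 p (m - 1) y (P.merge l1 l2) = y (brk p x z)"
        using P.valid_merge[OF l] True by (auto simp: ev2_def P.merge_def xz)
      ultimately show ?thesis using F\<omega>[of i x j z] by (simp add: P.d2_len1[OF yW l[unfolded xz]] P.sgn2_def xz F_def)
    next
      case False
      hence "P.M.Phi a [l1, l2] = 0" using P.M.Phi_hom[OF a(2)] unfolding P.M.hom_def by (auto simp: xz)
      thus ?thesis using False by (simp add: P.d2_len1[OF yW l[unfolded xz]] ev2_def P.merge_def xz)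
    qed
  qed (rule P.Phi_valid, assumption+)+
  hence PD: "D1.Phi (CE_II p (m - 1) y) = f"
    using Phi_transfer[OF wordspn_sub[OF P.CE_II_wordspn[OF yW]] a(3)] Pa by simp
  have "pull g \<iota>1 (m - 1) y = 0" "pull h \<iota>2 (m - 1) y = 0"
    using y(3,4) by (auto simp: pull_def fun_eq_iff zero_fun_apply)
  hence "R1.pe (m - 1) y = 0" "R2.pe (m - 1) y = 0"
    unfolding R1.pull_comp R2.pull_comp by (auto simp: pull_def fun_eq_iff zero_fun_apply)
  moreover have "D1.gen (m - 1) 0 = 0"
    using D1.gen_add[OF P.susp_dual_closed(3) P.susp_dual_closed(3), of "m - 1"] by simp
  ultimately have "rs GL (D1.gen (m - 1) y) = 0" "rs HL (D1.gen (m - 1) y) = 0"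
    using R1.gen_pe[OF gb pure1 yW] R2.gen_pe[OF gb pure2 yW] by simp_all
  moreover have "supp (D1.gen (m - 1) y) (wds D1.VL 1)"
    using D1.gen_VL[of "m - 1" y] D1.gen_supp[of "m - 1" y] by (auto simp: supp_def)
  ultimately show ?thesis
    using D1.gen_Lam[OF yW] D1.gen_hom[OF yW] D2.der_gen[OF yW] PD by (intro bexI[of _ "D1.gen (m - 1) y"]) simp_all
qed

section \<open>From the quadratic to the full differential\<close>

definition "dd f = D1.der D1.dB f + D1.der D2.dB f"

lemma dB_supp: "supp (D1.dB l) (wds D1.VL 1)" "supp (D2.dB l) (wds D1.VL 2)"
proof -
  have "supp (D1.dB l) (wds D1.VL 1) \<and> supp (D2.dB l) (wds D1.VL 2)"
  proof (cases "l \<in> D1.VL")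
    case True
    hence b: "snd (snd l) \<in> susp_dual p (fst (snd l))" using D1.B_W by blast
    have "supp (D1.dB l) (len 1)" "supp (D1.dB l) (over D1.VL)"
      using True D1.Phi_supp_length[of "CE_I p (fst (snd l)) (snd (snd l))" 1] P.CE_I_one[OF b]
        D1.Phi_Lam(2)[OF wordspn_sub[OF P.CE_I_in[OF b]]] by (simp_all add: D1.dB_def span_words)
    moreover have "supp (D2.dB l) (wds D1.VL 2)" by (rule supp_mono[OF rank_supp[OF True]]) blast
    ultimately show ?thesis by (simp add: supp_def)
  next
    case False
    hence "D1.dB l = 0" "D2.dB l = 0" by (auto simp: D1.dB_def D2.dB_def)
    thus ?thesis by (simp add: supp_closed)
  qed
  thus "supp (D1.dB l) (wds D1.VL 1)" "supp (D2.dB l) (wds D1.VL 2)" by blast+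
qed

text \<open>A derivation whose values have length \<open>k + 1\<close> lengthens words by
  \<open>k\<close>. The cases \<open>k = 0\<close> and \<open>k = 1\<close> are \<open>d_I\<close>
  and \<open>d_II\<close>.\<close>

lemma der_supp:
  assumes f: "supp f (\<lambda>w. set w \<subseteq> D1.VL \<and> Q (length w))" and \<delta>: "\<And>l. supp (\<delta> l) (wds D1.VL (Suc k))"
  shows "supp (D1.der \<delta> f) (\<lambda>w. set w \<subseteq> D1.VL \<and> length w \<ge> Suc k \<and> Q (length w - k))"
  unfolding supp_def
proof (intro allI impI)
  fix w assume "D1.der \<delta> f w \<noteq> 0"
  then obtain b u v where *: "\<delta> b u \<noteq> 0" "f (b # v) \<noteq> 0" "w \<in> shuffles u v" by (rule D1.der_support)
  have u: "set u \<subseteq> D1.VL \<and> length u = Suc k" by (rule suppD[OF \<delta> *(1)])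
  have v: "set (b # v) \<subseteq> D1.VL \<and> Q (length (b # v))" by (rule suppD[OF f *(2)])
  show "set w \<subseteq> D1.VL \<and> length w \<ge> Suc k \<and> Q (length w - k)"
    using u v *(3) set_shuffles[OF *(3)] length_shuffles[OF *(3)] by auto
qed

lemma der_supp1: assumes "supp f (\<lambda>w. set w \<subseteq> D1.VL \<and> Q (length w))"
  shows "supp (D1.der D1.dB f) (\<lambda>w. set w \<subseteq> D1.VL \<and> Q (length w))"
proof -
  have "supp (D1.dB l) (wds D1.VL (Suc 0))" for l using dB_supp(1)[of l] by simp
  from der_supp[of f Q, OF assms this] show ?thesis by (rule supp_mono) (simp only: diff_zero simp_thms)
qed

lemma der_supp2: assumes "supp f (\<lambda>w. set w \<subseteq> D1.VL \<and> Q (length w))"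
  shows "supp (D1.der D2.dB f) (\<lambda>w. set w \<subseteq> D1.VL \<and> length w > 0 \<and> Q (length w - 1))"
proof -
  have "supp (D2.dB l) (wds D1.VL (Suc 1))" for l using dB_supp(2)[of l] by (simp add: numeral_2_eq_2)
  from der_supp[of f Q, OF assms this] show ?thesis by (rule supp_mono) auto
qed

lemma der_closed: assumes "f \<in> D1.Lam" "D1.hom m f"
  shows "D1.der D1.dB f \<in> D1.Lam" "D1.der D2.dB f \<in> D1.Lam" "D1.hom (m + 1) (D1.der D1.dB f)" "D1.hom (m + 1) (D1.der D2.dB f)"
  by (rule D1.der_Lam[OF D1.dB_Lam] D1.der_Lam[OF D2.dB_Lam] D1.hom_der[OF D1.dB_hom] D1.hom_der[OF D2.dB_hom]; fact assms)+

text \<open>A preimage is the sum of \<open>psi n f\<close> over the word lengths that occur in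
  \<open>f\<close>.\<close>

lemma Phi_surj: assumes "f \<in> D1.Lam" "D1.hom m f" "supp f (over D1.VL)"
  obtains a where "a \<in> wordspn (susp_dual p) m" "D1.Phi a = f"
proof -
  obtain A N where N: "\<And>w. f w \<noteq> 0 \<Longrightarrow> set w \<subseteq> A \<and> length w \<le> (N::nat)"
    using assms(1) unfolding D1.Lam_def D1.finsupp_def by blast
  have "supp f (\<lambda>w. set w \<subseteq> D1.VL \<and> wsum ldeg w = m)" using assms(2,3) by (auto simp: supp_def D1.hom_def)
  from D1.psi_in[OF this] have a: "D1.psi n f \<in> wordspn (susp_dual p) m" for n by (auto simp: span_words)
  show thesis
  proof (rule that)
    show "(\<Sum>n\<le>N. D1.psi n f) \<in> wordspn (susp_dual p) m" by (intro FA.span_sum a)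
    have "D1.Phi (\<Sum>n\<le>N. D1.psi n f) = (\<Sum>n\<le>N. rst (len n) f)"
      by (simp add: D1.Phi_sum D1.Phi_psi[OF assms(1,3)])
    also have "\<dots> = f"
    proof
      fix w show "(\<Sum>n\<le>N. rst (len n) f) w = f w"
        using N[of w] by (simp add: sum_fun_apply rst_def sum.delta') blast
    qed
    finally show "D1.Phi (\<Sum>n\<le>N. D1.psi n f) = f" .
  qed
qed

lemma Phi_dtot: "a \<in> wordsp (susp_dual p) \<Longrightarrow> D1.Phi (dtot p a) = dd (D1.Phi a)"
  by (simp add: dtot_def D1.Phi_simps D1.Phi_dfree D2.Phi_dfree dd_def)

lemma dd_square: assumes "f \<in> D1.Lam" "D1.hom m f" "supp f (over D1.VL)" shows "dd (dd f) = 0"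
proof -
  obtain a where a: "a \<in> wordspn (susp_dual p) m" "D1.Phi a = f" by (rule Phi_surj[OF assms])
  have w: "a \<in> wordsp (susp_dual p)" by (rule wordspn_sub[OF a(1)])
  have "D1.Phi (dtot p (dtot p a)) = 0"
    using P.Phi_basis_iff(1)[OF gb P.dtot_wordsp[OF P.dtot_wordsp[OF w]]] P.dtot_square[OF w] by simp
  thus ?thesis by (simp add: Phi_dtot P.dtot_wordsp w a(2))
qed

text \<open>The letters \<open>(True, n, b)\<close> become the new variables, and \<open>low\<close>
  is the content of \<open>degree_one\<close> and \<open>degree_two\<close>.\<close>

lemma quadratic: "quadratic_coproduct ldeg D1.VL GL HL (\<lambda>l. (True, snd l)) rkl D2.dB"
proof
  show "inj_on (\<lambda>l. (True, snd l)) D1.VL" by (auto simp: inj_on_def)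
  show "(\<lambda>l. (True, snd l)) ` D1.VL \<inter> D1.VL = {}" by auto
  show "GL \<subseteq> D1.VL" "HL \<subseteq> D1.VL" by (auto simp: R1.klet_def R2.klet_def)
  show "GL \<inter> HL = {}"
  proof -
    have False if "l \<in> GL" "l \<in> HL" for l
    proof -
      let ?n = "fst (snd l)" and ?b = "snd (snd l)"
      have b: "?b \<in> B ?n" "R1.pe ?n ?b = ?b" "R2.pe ?n ?b = ?b" using that by (auto simp: R1.klet_def R2.klet_def)
      hence "?b = 0" using pure[OF b(1)] by (auto simp: pure_def)
      thus False using b(1) D1.B_ind D1.VS.dependent_zero by metis
    qed
    thus ?thesis by blast
  qed
  show "D2.dB l \<in> D1.Lam" "D1.hom (ldeg l + 1) (D2.dB l)" for l by (rule D2.dB_Lam D2.dB_hom)+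
  show "supp (D2.dB l) (wds {m \<in> D1.VL. rkl m < rkl l} 2)" if "l \<in> D1.VL" for l
    by (rule rank_supp[OF that])
  show "D2.dB l = 0" if "l \<notin> D1.VL" for l using that by (auto simp: D2.dB_def)
  show "D1.der D2.dB (D2.dB l) = 0" for l
  proof (cases "l \<in> D1.VL")
    case True
    hence b: "snd (snd l) \<in> susp_dual p (fst (snd l))" using D1.B_W by blast
    note w = wordspn_sub[OF P.CE_II_wordspn[OF b]]
    have "D1.Phi (dfree (CE_II p) (CE_II p (fst (snd l)) (snd (snd l)))) = 0"
      using P.Phi_basis_iff(1)[OF gb D2.dfree_wordsp[OF w]] P.square_II[OF b] by simp
    thus ?thesis using True D2.Phi_dfree[OF w] by (simp add: D2.dB_def)
  next
    case False
    hence "D2.dB l = 0" by (auto simp: D2.dB_def)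
    thus ?thesis by simp
  qed
  show "rs GL (D2.dB l) = 0" if "l \<in> D1.VL - GL" for l using R1.rst_dB(2)[OF gb pure1] that by blast
  show "rs HL (D2.dB l) = 0" if "l \<in> D1.VL - HL" for l using R2.rst_dB(2)[OF gb pure2] that by blast
  show "ldeg (True, snd l) = ldeg l - 1" if "l \<in> D1.VL" for l using that by simp
  show "\<exists>y. y \<in> D1.Lam \<and> D1.hom (m - 1) y \<and> supp y (wds D1.VL (i - 1)) \<and> rs GL y = 0 \<and> rs HL y = 0 \<and> D1.der D2.dB y = f"
    if i: "i = 1 \<or> i = 2" and f: "f \<in> D1.Lam" "D1.hom m f" "supp f (wds D1.VL i)" "D1.der D2.dB f = 0" "rs GL f = 0" "rs HL f = 0"
    for f m i using i
  proof
    assume "i = 1"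
    hence "f = 0" using degree_one[OF f(1,2) _ f(4-6)] f(3) by simp
    thus ?thesis by (intro exI[of _ 0]) (simp add: D1.Lam_closed D1.hom_closed supp_closed)
  next
    assume i: "i = 2"
    show ?thesis using degree_two[OF f(1,2) f(3)[unfolded i] f(4-6)] unfolding i by auto
  qed
qed

text \<open>Arranges that the primitive has no constant term, which keeps it in the augmentation
  ideal: for \<open>N = 0\<close> all derivatives of a primitive vanish, so \<open>f = 0\<close> and
  0 serves.\<close>

lemma exact_two: assumes "f \<in> D1.Lam" "D1.hom m f" "supp f (wds D1.VL (Suc N))" "D1.der D2.dB f = 0"
    "rs GL f = 0" "rs HL f = 0"
  shows "\<exists>y. y \<in> D1.Lam \<and> D1.hom (m - 1) y \<and> supp y (\<lambda>w. set w \<subseteq> D1.VL \<and> 0 < length w \<and> length w = N) \<and>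
    rs GL y = 0 \<and> rs HL y = 0 \<and> D1.der D2.dB y = f"
proof -
  have "quadratic_coproduct.exact_in ldeg D1.VL GL HL D2.dB (Suc N)" by (rule quadratic_coproduct.exact[OF quadratic]) simp
  from this[unfolded quadratic_coproduct.exact_in_def[OF quadratic], rule_format, OF assms]
  obtain y where y: "y \<in> D1.Lam" "D1.hom (m - 1) y" "supp y (wds D1.VL N)"
    "rs GL y = 0" "rs HL y = 0" "D1.der D2.dB y = f" by auto
  show ?thesis
  proof (cases "N = 0")
    case True
    hence "ldel b y = 0" for b using y(3) by (auto simp: supp_def ldel_def fun_eq_iff fun_ap)
    hence "f = 0" using y(6) by (simp add: D1.der_def)
    thus ?thesis by (intro exI[of _ 0]) (simp add: D1.Lam_closed D1.hom_closed supp_closed)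
  next
    case False
    have "supp y (\<lambda>w. set w \<subseteq> D1.VL \<and> 0 < length w \<and> length w = N)" by (rule supp_mono[OF y(3)]) (use False in auto)
    thus ?thesis using y by (intro exI[of _ y] conjI)
  qed
qed

lemma finsupp_Lam: "f \<in> D1.Lam \<Longrightarrow> D1.finsupp f" by (simp add: D1.Lam_def)

lemma dd_diff: "f \<in> D1.Lam \<Longrightarrow> f' \<in> D1.Lam \<Longrightarrow> dd (f - f') = dd f - dd f'"
  and dd_add: "f \<in> D1.Lam \<Longrightarrow> f' \<in> D1.Lam \<Longrightarrow> dd (f + f') = dd f + dd f'"
  by (simp_all add: dd_def D1.der_diff D1.der_add finsupp_Lam)

lemma dd_closed: assumes "f \<in> D1.Lam" "D1.hom m f" shows "dd f \<in> D1.Lam" "D1.hom (m + 1) (dd f)"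
  unfolding dd_def by (intro D1.Lam_closed D1.hom_closed der_closed[OF assms])+

lemma dd_rst: assumes "f \<in> D1.Lam" shows "rs GL f = 0 \<Longrightarrow> rs GL (dd f) = 0"
    and "rs HL f = 0 \<Longrightarrow> rs HL (dd f) = 0"
  using D1.rst_der[OF assms R1.rst_dB(1)[OF gb pure1]] D1.rst_der[OF assms R1.rst_dB(2)[OF gb pure1]]
    D1.rst_der[OF assms R2.rst_dB(1)[OF gb pure2]] D1.rst_der[OF assms R2.rst_dB(2)[OF gb pure2]]
  by (simp_all add: dd_def rst_add)

text \<open>Induction on the largest word length. \<open>d_I\<close> keeps the length and
  \<open>d_II\<close> raises it by one, so the top component is closed for \<open>d_II\<close>;
  subtracting \<open>dd\<close> of a primitive for \<open>d_II\<close> leaves shorter words.\<close>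

lemma kernel_exact:
  assumes "f \<in> D1.Lam" "D1.hom m f" "supp f (\<lambda>w. set w \<subseteq> D1.VL \<and> 0 < length w \<and> length w \<le> N)" "dd f = 0"
    "rs GL f = 0" "rs HL f = 0"
  shows "\<exists>y. y \<in> D1.Lam \<and> D1.hom (m - 1) y \<and> supp y (\<lambda>w. set w \<subseteq> D1.VL \<and> 0 < length w) \<and> dd y = f"
  using assms
proof (induction N arbitrary: f)
  case 0
  hence "f = 0" by (auto simp: supp_def fun_eq_iff fun_ap)
  thus ?case by (intro exI[of _ 0]) (simp add: D1.Lam_closed D1.hom_closed supp_closed dd_def)
next
  case (Suc N)
  let ?t = "rst (len (Suc N)) f"
  have tL: "?t \<in> D1.Lam" by (rule D1.Lam_rst[OF Suc.prems(1)]) simp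
  have th: "D1.hom m ?t" by (rule D1.hom_closed(5)[OF Suc.prems(2)])
  have ts: "supp ?t (wds D1.VL (Suc N))" using Suc.prems(3) by (auto simp: supp_def rst_def)
  have td: "D1.der D2.dB ?t = 0"
  proof
    fix w
    have rs: "supp (f - ?t) (\<lambda>w. set w \<subseteq> D1.VL \<and> 0 < length w \<and> length w \<le> N)" unfolding supp_def
    proof (intro allI impI)
      fix w assume nz: "(f - ?t) w \<noteq> 0"
      hence "length w \<noteq> Suc N" "f w \<noteq> 0" by (auto simp: fun_ap rst_def split: if_splits)
      thus "set w \<subseteq> D1.VL \<and> 0 < length w \<and> length w \<le> N" using suppD[OF Suc.prems(3)] by fastforce
    qed
    show "D1.der D2.dB ?t w = 0 w"
    \<comment> \<open>In length \<open>N + 2\<close> the equation \<open>dd f = 0\<close> involves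
      the top component of \<open>f\<close> only.\<close>
    proof (cases "length w = Suc (Suc N)")
      case True
      have "D1.der D1.dB f w = 0"
        using suppD[OF der_supp1[of f "\<lambda>n. 0 < n \<and> n \<le> Suc N", OF Suc.prems(3)], of w] True by fastforce
      moreover have "D1.der D2.dB (f - ?t) w = 0"
        using suppD[OF der_supp2[of "f - ?t" "\<lambda>n. 0 < n \<and> n \<le> N", OF rs], of w] True by fastforce
      moreover have "D1.der D2.dB f = D1.der D2.dB (f - ?t) + D1.der D2.dB ?t"
        using D1.der_add[OF finsupp_Lam[OF D1.Lam_diff[OF Suc.prems(1) tL]] finsupp_Lam[OF tL], of D2.dB] by simp
      moreover have "D1.der D1.dB f w + D1.der D2.dB f w = 0" using fun_cong[OF Suc.prems(4), of w] by (simp add: dd_def fun_ap)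
      ultimately show ?thesis by (simp add: fun_ap)
    next
      case False
      thus ?thesis
        using suppD[OF der_supp2[of ?t "\<lambda>n. n = Suc N", OF ts], of w] by (fastforce simp: fun_ap)
    qed
  qed
  have tr: "rs GL ?t = 0" "rs HL ?t = 0"
  proof -
    have "rst P ?t = rst (len (Suc N)) (rst P f)" for P by (simp add: rst_def fun_eq_iff)
    thus "rs GL ?t = 0" "rs HL ?t = 0" using Suc.prems(5,6) by simp_all
  qed
  obtain y where y: "y \<in> D1.Lam" "D1.hom (m - 1) y" "supp y (\<lambda>w. set w \<subseteq> D1.VL \<and> 0 < length w \<and> length w = N)"
    "rs GL y = 0" "rs HL y = 0" "D1.der D2.dB y = ?t"
    using exact_two[OF tL th ts td tr] by (elim exE conjE) (rule that)
  let ?f = "f - dd y"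
  have yV: "supp y (over D1.VL)" using y(3) by (auto simp: supp_def)
  have dyL: "dd y \<in> D1.Lam" "D1.hom m (dd y)" using dd_closed[OF y(1,2)] by simp_all
  have fL: "?f \<in> D1.Lam" by (rule D1.Lam_diff[OF Suc.prems(1) dyL(1)])
  have fh: "D1.hom m ?f" by (rule D1.hom_closed(4)[OF Suc.prems(2) dyL(2)])
  have fd: "dd ?f = 0" using dd_diff[OF Suc.prems(1) dyL(1)] Suc.prems(4) dd_square[OF y(1,2) yV] by simp
  have fr: "rs GL ?f = 0" "rs HL ?f = 0"
    using Suc.prems(5,6) dd_rst[OF y(1)] y(4,5) by (simp_all add: rst_diff)
  have fs: "supp ?f (\<lambda>w. set w \<subseteq> D1.VL \<and> 0 < length w \<and> length w \<le> N)" unfolding supp_def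
  proof (intro allI impI)
    fix w assume nz: "?f w \<noteq> 0"
    have e: "?f w = (f w - ?t w) - D1.der D1.dB y w" by (simp add: dd_def y(6) fun_ap)
    have "f w - ?t w \<noteq> 0 \<or> D1.der D1.dB y w \<noteq> 0" using nz unfolding e by (metis diff_self)
    then consider "f w - ?t w \<noteq> 0" | "D1.der D1.dB y w \<noteq> 0" by blast
    thus "set w \<subseteq> D1.VL \<and> 0 < length w \<and> length w \<le> N"
    proof cases
      case 1
      hence "length w \<noteq> Suc N" "f w \<noteq> 0" by (auto simp: rst_def split: if_splits)
      thus ?thesis using suppD[OF Suc.prems(3)] by fastforce
    next
      case 2
      thus ?thesis using suppD[OF der_supp1[of y "\<lambda>n. 0 < n \<and> n = N", OF y(3)] 2] by auto
    qed
  qed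
  obtain x where x: "x \<in> D1.Lam" "D1.hom (m - 1) x" "supp x (\<lambda>w. set w \<subseteq> D1.VL \<and> 0 < length w)" "dd x = ?f"
    using Suc.IH[OF fL fh fs fd fr] by (elim exE conjE) (rule that)
  show ?case
  proof (intro exI[of _ "x + y"] conjI)
    show "supp (x + y) (\<lambda>w. set w \<subseteq> D1.VL \<and> 0 < length w)" by (intro supp_closed x(3) supp_mono[OF y(3)]) blast
    show "dd (x + y) = f" using dd_add[OF x(1) y(1)] x(4) by simp
  qed (intro D1.Lam_closed D1.hom_closed x y)+
qed

lemma kernel_acyclic:
  assumes z: "z \<in> wordspn (susp_dual p) n" "lookup z [] = 0" "P.M.Phi (dtot p z) = 0"
    and 0: "G.M.Phi (fmap g \<iota>1 z) = 0" "H.M.Phi (fmap h \<iota>2 z) = 0"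
  obtains y where "y \<in> wordspn (susp_dual p) (n - 1)" "lookup y [] = 0" "P.M.Phi (dtot p y) = P.M.Phi z"
proof -
  let ?f = "D1.Phi z"
  have w: "z \<in> wordsp (susp_dual p)" by (rule wordspn_sub[OF z(1)])
  note fL = D1.Phi_Lam[OF w]
  obtain A N where N: "\<And>v. ?f v \<noteq> 0 \<Longrightarrow> set v \<subseteq> A \<and> length v \<le> (N::nat)"
    using fL(1) unfolding D1.Lam_def D1.finsupp_def by blast
  have nil: "?f [] = 0" using z(2) by (simp add: D1.Phi_nil)
  have s: "supp ?f (\<lambda>w. set w \<subseteq> D1.VL \<and> 0 < length w \<and> length w \<le> N)" unfolding supp_def
  proof (intro allI impI conjI)
    fix v assume v: "?f v \<noteq> 0"
    show "set v \<subseteq> D1.VL" by (rule suppD[OF fL(2) v])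
    show "0 < length v" using v nil by auto
    show "length v \<le> N" using N[OF v] by blast
  qed
  have d: "dd ?f = 0"
    using P.Phi_basis_iff(1)[OF gb P.dtot_wordsp[OF w]] z(3) Phi_dtot[OF w] by simp
  have r: "rs GL ?f = 0" "rs HL ?f = 0" using rst_zero[OF _ w] 0 by simp_all
  obtain y where y: "y \<in> D1.Lam" "D1.hom (n - 1) y" "supp y (\<lambda>w. set w \<subseteq> D1.VL \<and> 0 < length w)" "dd y = ?f"
    using kernel_exact[OF fL(1) D1.Phi_hom[OF z(1)] s d r] by (elim exE conjE) (rule that)
  have "supp y (over D1.VL)" by (rule supp_mono[OF y(3)]) blast
  then obtain a where a: "a \<in> wordspn (susp_dual p) (n - 1)" "D1.Phi a = y" by (rule Phi_surj[OF y(1,2)])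
  show thesis
  proof (rule that[OF a(1)])
    have "y [] = 0" using y(3) by (auto simp: supp_def)
    thus "lookup a [] = 0" using a(2) D1.Phi_nil[of a] by simp
    show "P.M.Phi (dtot p a) = P.M.Phi z"
      using Phi_transfer[OF P.dtot_wordsp[OF wordspn_sub[OF a(1)]] w] Phi_dtot[OF wordspn_sub[OF a(1)]] a(2) y(4) by simp
  qed
qed

end

section \<open>Cohomology\<close>

text \<open>A complex given by representatives: \<open>c\<close> passes to classes and
  \<open>D\<close> is a differential on representatives that squares to 0 up to \<open>c\<close>. It
  covers \<open>CE_plus\<close> and the product of two such algebras alike.\<close>

locale presented_complex =
  fixes A :: "('m, 'k) dg_alg" and c :: "'v::ab_group_add \<Rightarrow> 'm" and Z :: "int \<Rightarrow> 'v set" and D :: "'v \<Rightarrow> 'v"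
  assumes Z: "0 \<in> Z n" "a \<in> Z n \<Longrightarrow> b \<in> Z n \<Longrightarrow> a + b \<in> Z n" "a \<in> Z n \<Longrightarrow> b \<in> Z n \<Longrightarrow> a - b \<in> Z n"
    and part: "part A n = c ` Z n" and aadd: "aadd A (c a) (c b) = c (a + b)" and azero: "azero A = c 0"
    and adiff: "a \<in> Z n \<Longrightarrow> adiff A (c a) = c (D a)" and D_in: "a \<in> Z n \<Longrightarrow> D a \<in> Z (n + 1)"
    and D_diff: "D (a - b) = D a - D b" and c_eq: "c a = c b \<longleftrightarrow> c (a - b) = c 0"
    and D_D: "a \<in> Z n \<Longrightarrow> c (D (D a)) = c 0"
begin

lemma D_in': "y \<in> Z (n - 1) \<Longrightarrow> D y \<in> Z n" using D_in[of y "n - 1"] by simp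

lemma D_add: "D (a + b) = D a + D b" using D_diff[of "a + b" b] by simp

lemma class_c: "coh_class A n (c a) = (\<lambda>y. c (a + D y)) ` Z (n - 1)"
proof -
  have "aadd A (c a) (adiff A (c y)) = c (a + D y)" if "y \<in> Z (n - 1)" for y by (simp add: adiff[OF that] aadd)
  thus ?thesis unfolding coh_class_def part by force
qed

lemma class_eq: "coh_class A n (c a) = coh_class A n (c b) \<longleftrightarrow> (\<exists>y\<in>Z (n - 1). c b = c (a + D y))"
proof
  assume "coh_class A n (c a) = coh_class A n (c b)"
  moreover have "c b \<in> coh_class A n (c b)"
    unfolding class_c using Z(1)[of "n - 1"] D_diff[of 0 0] by (auto intro: image_eqI[of _ _ 0])
  ultimately show "\<exists>y\<in>Z (n - 1). c b = c (a + D y)" unfolding class_c by blast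
next
  assume "\<exists>y\<in>Z (n - 1). c b = c (a + D y)"
  then obtain y where y: "y \<in> Z (n - 1)" "c b = c (a + D y)" by blast
  hence e: "c (b - (a + D y)) = c 0" using c_eq by blast
  have "c (b + D x) = c (a + D (y + x))" for x
  proof -
    have "(b + D x) - (a + D (y + x)) = b - (a + D y)" by (simp add: D_add)
    thus ?thesis using e c_eq by metis
  qed
  moreover have "c (a + D x) = c (b + D (x - y))" for x
  proof -
    have "c (b + D (x - y)) = c (a + D (y + (x - y)))" by fact
    thus ?thesis by simp
  qed
  ultimately show "coh_class A n (c a) = coh_class A n (c b)" unfolding class_c
  proof (intro equalityI subsetI; elim imageE)
    fix v x assume x: "x \<in> Z (n - 1)"
    show "v \<in> (\<lambda>y. c (b + D y)) ` Z (n - 1)" if "v = c (a + D x)"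
      unfolding that \<open>\<And>x. c (a + D x) = c (b + D (x - y))\<close> by (rule imageI[OF Z(3)[OF x y(1)]])
    show "v \<in> (\<lambda>y. c (a + D y)) ` Z (n - 1)" if "v = c (b + D x)"
      unfolding that \<open>\<And>x. c (b + D x) = c (a + D (y + x))\<close> by (rule imageI[OF Z(2)[OF y(1) x]])
  qed
qed

lemma cocycles_c: "z \<in> cocycles A n \<longleftrightarrow> (\<exists>a\<in>Z n. z = c a \<and> c (D a) = c 0)"
  unfolding cocycles_def part azero by (auto simp: adiff)

end

text \<open>\<open>S\<close> is a section of \<open>F\<close> by a map of complexes, and
  \<open>ker\<close> is the acyclicity of the kernel of \<open>F\<close>. If \<open>F b\<close> and
  \<open>F a\<close> differ by the boundary of \<open>w\<close>, then \<open>b - a - D (S w)\<close>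
  is a cocycle in the kernel, hence a boundary; surjectivity comes from \<open>S\<close>.\<close>

lemma coh_map_bij: assumes P: "presented_complex A c Z D" and P': "presented_complex B c' Z' D'"
    and f: "\<And>a. f (c a) = c' (F a)" and F_diff: "\<And>a b. F (a - b) = F a - F b" and F_in: "\<And>n a. a \<in> Z n \<Longrightarrow> F a \<in> Z' n"
    and F_D: "\<And>n a. a \<in> Z n \<Longrightarrow> c' (F (D a)) = c' (D' (F a))"
    and S_in: "\<And>n b. b \<in> Z' n \<Longrightarrow> S b \<in> Z n" and S_D: "\<And>n b. b \<in> Z' n \<Longrightarrow> c (S (D' b)) = c (D (S b))"
    and S_0: "\<And>b. c' b = c' 0 \<Longrightarrow> c (S b) = c 0" and F_S: "\<And>n b. b \<in> Z' n \<Longrightarrow> c' (F (S b)) = c' b"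
    and ker: "\<And>n a. a \<in> Z n \<Longrightarrow> c (D a) = c 0 \<Longrightarrow> c' (F a) = c' 0 \<Longrightarrow> \<exists>y\<in>Z (n - 1). c (D y) = c a"
  shows "bij_betw (coh_map B n f) (cohomology A n) (cohomology B n)"
proof -
  interpret A: presented_complex A c Z D by fact
  interpret B: presented_complex B c' Z' D' by fact
  have F0: "F 0 = 0" using F_diff[of 0 0] by simp
  have F_add: "F (a + b) = F a + F b" for a b using F_diff[of "a + b" b] by simp
  have congr: "c' (a + b) = c' (a + b')" if "c' b = c' b'" for a b b'
    using that B.c_eq[of b b'] B.c_eq[of "a + b" "a + b'"] by simp
  have map: "coh_map B n f (coh_class A n (c a)) = coh_class B n (c' (F a))" if a: "a \<in> Z n" for a
  proof -
    have "coh_class B n (f (c (a + D y))) = coh_class B n (c' (F a))" if y: "y \<in> Z (n - 1)" for y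
    proof -
      have "c' (F a + F (D y)) = c' (F a + D' (F y))" by (rule congr[OF F_D[OF y]])
      hence "coh_class B n (c' (F a)) = coh_class B n (c' (F a + F (D y)))"
        unfolding B.class_eq using F_in[OF y] by blast
      thus ?thesis by (simp add: f F_add)
    qed
    thus ?thesis unfolding coh_map_def A.class_c using A.Z(1) by auto
  qed
  show ?thesis unfolding bij_betw_def
  proof
    show "inj_on (coh_map B n f) (cohomology A n)"
    proof (rule inj_onI)
      fix X Y assume "X \<in> cohomology A n" "Y \<in> cohomology A n" and e: "coh_map B n f X = coh_map B n f Y"
      then obtain a b where a: "a \<in> Z n" "c (D a) = c 0" "X = coh_class A n (c a)"
        and b: "b \<in> Z n" "c (D b) = c 0" "Y = coh_class A n (c b)"
        unfolding cohomology_def by (auto simp: A.cocycles_c)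
      from e have "coh_class B n (c' (F a)) = coh_class B n (c' (F b))" by (simp add: a b map)
      then obtain w where w: "w \<in> Z' (n - 1)" "c' (F b) = c' (F a + D' w)" unfolding B.class_eq by blast
      let ?u = "S w"
      have u: "?u \<in> Z (n - 1)" by (rule S_in[OF w(1)])
      let ?x = "b - (a + D ?u)"
      have x: "?x \<in> Z n" using A.Z a b A.D_in'[OF u] by blast
      have "c (D ?x) = c 0"
      proof -
        have 1: "c (D b - D a) = c 0" using a(2) b(2) A.c_eq[of "D b" "D a"] by simp
        have "c ((D b - D a) - D (D ?u)) = c 0"
          using 1 A.D_D[OF u] A.c_eq[of "D b - D a" "D (D ?u)"] by simp
        thus ?thesis by (simp add: A.D_diff A.D_add diff_diff_eq)
      qed
      moreover have "c' (F ?x) = c' 0"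
      proof -
        have "c' (F (D ?u)) = c' (D' (F ?u))" by (rule F_D[OF u])
        also have "\<dots> = c' (D' w)"
        proof -
          have "c' (F ?u - w) = c' 0" using F_S[OF w(1)] B.c_eq by blast
          moreover have "F ?u - w \<in> Z' (n - 1)" using B.Z F_in[OF u] w(1) by blast
          ultimately have "adiff B (c' 0) = c' (D' (F ?u - w))" using B.adiff by metis
          moreover have "adiff B (c' 0) = c' (D' 0)" by (rule B.adiff[OF B.Z(1)])
          moreover have "D' 0 = 0" using B.D_diff[of 0 0] by simp
          ultimately show ?thesis using B.c_eq[of "D' (F ?u)" "D' w"] by (simp add: B.D_diff)
        qed
        finally have "c' (F a + F (D ?u)) = c' (F a + D' w)" by (rule congr)
        hence "c' (F b) = c' (F a + F (D ?u))" using w(2) by simp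
        thus ?thesis using B.c_eq[of "F b" "F a + F (D ?u)"] by (simp add: F_diff F_add)
      qed
      ultimately obtain y where y: "y \<in> Z (n - 1)" "c (D y) = c ?x" using ker[OF x] by blast
      have "c (?x - D y) = c 0" using A.c_eq[of ?x "D y"] y(2) by simp
      moreover have "b - (a + D (?u + y)) = ?x - D y" by (simp add: A.D_add)
      ultimately have "c b = c (a + D (?u + y))" using A.c_eq by metis
      thus "X = Y" unfolding a(3) b(3) A.class_eq using A.Z(2)[OF u y(1)] by blast
    qed
    show "coh_map B n f ` cohomology A n = cohomology B n"
    proof
      show "coh_map B n f ` cohomology A n \<subseteq> cohomology B n"
      proof clarify
        fix X assume "X \<in> cohomology A n"
        then obtain a where a: "a \<in> Z n" "c (D a) = c 0" "X = coh_class A n (c a)"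
          unfolding cohomology_def by (auto simp: A.cocycles_c)
        have "c' (D' (F a)) = f (c (D a))" using F_D[OF a(1)] by (simp add: f)
        also have "\<dots> = c' 0" by (simp add: a(2) f F0)
        finally have "c' (F a) \<in> cocycles B n" using F_in[OF a(1)] by (auto simp: B.cocycles_c)
        thus "coh_map B n f X \<in> cohomology B n" unfolding a(3) map[OF a(1)] cohomology_def by blast
      qed
      show "cohomology B n \<subseteq> coh_map B n f ` cohomology A n"
      proof
        fix Y assume "Y \<in> cohomology B n"
        then obtain b where b: "b \<in> Z' n" "c' (D' b) = c' 0" "Y = coh_class B n (c' b)"
          unfolding cohomology_def by (auto simp: B.cocycles_c)
        have s: "S b \<in> Z n" by (rule S_in[OF b(1)])
        have "c (D (S b)) = c 0" using S_D[OF b(1)] S_0[OF b(2)] by simp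
        hence "c (S b) \<in> cocycles A n" using s unfolding A.cocycles_c by blast
        hence "coh_class A n (c (S b)) \<in> cohomology A n" unfolding cohomology_def by (rule imageI)
        moreover have "coh_map B n f (coh_class A n (c (S b))) = Y" by (simp add: map[OF s] F_S[OF b(1)] b(3))
        ultimately show "Y \<in> coh_map B n f ` cohomology A n" by blast
      qed
    qed
  qed
qed

section \<open>The comparison map and its section\<close>

context complete_dg
begin

abbreviation ZZ :: "int \<Rightarrow> (('i \<Rightarrow> 'a) \<Rightarrow> 'k, 'k) free_alg set" where
  "ZZ n \<equiv> {a \<in> wordspn Wg n. lookup a [] = 0}"

lemma presented: "presented_complex (CE_plus g) cl ZZ (dtot g)"
proof
  show "0 \<in> ZZ n" for n by (simp add: FA.span_zero)
  show "a + b \<in> ZZ n" "a - b \<in> ZZ n" if "a \<in> ZZ n" "b \<in> ZZ n" for a b n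
    using that FA.span_add FA.span_diff by (auto simp: lookup_add lookup_minus)
  show "part (CE_plus g) n = cl ` ZZ n" for n by (rule part_CE)
  show "aadd (CE_plus g) (cl a) (cl b) = cl (a + b)" "azero (CE_plus g) = cl 0" for a b by (rule CE_ops)+
  show "adiff (CE_plus g) (cl a) = cl (dtot g a)" if "a \<in> ZZ n" for a n using CE_ops(5)[of a n] that by simp
  show "dtot g a \<in> ZZ (n + 1)" if "a \<in> ZZ n" for a n
    using that dtot_in dtot_nil wordspn_sub by blast
  show "dtot g (a - b) = dtot g a - dtot g b" for a b by (rule dtot_simps)
  show "cl a = cl b \<longleftrightarrow> cl (a - b) = cl 0" for a b by (simp add: cl_eq)
  show "cl (dtot g (dtot g a)) = cl 0" if "a \<in> ZZ n" for a n
  proof -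
    have "a \<in> wordsp Wg" using that wordspn_sub by blast
    thus ?thesis using dtot_square by (subst cl_Phi) (simp_all add: dtot_wordsp FA.span_zero M.Phi_simps)
  qed
qed

lemma cl_zero: "a \<in> wordsp Wg \<Longrightarrow> cl a = cl 0 \<longleftrightarrow> M.Phi a = 0"
  using cl_Phi[of a 0] by (simp add: FA.span_zero M.Phi_simps)

end

lemma (in cont_map) fmap_dtot:
  assumes "a \<in> wordspn (susp_dual g') n" shows "A.cl (fmap g f (dtot g' a)) = A.cl (dtot g (fmap g f a))"
proof -
  note a = wordspn_sub[OF assms]
  show ?thesis
    using A.cl_Phi[OF fmap_wordsp[OF B.dtot_wordsp[OF a]] A.dtot_wordsp[OF fmap_wordsp[OF a]]] Phi_fmap_dtot[OF a] by simp
qed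

lemma (in cont_map) fmap_ZZ: "a \<in> B.ZZ n \<Longrightarrow> fmap g f a \<in> A.ZZ n"
  using fmap_in by (simp add: fmap_nil)

lemma (in retract) fmap_retract: assumes "b \<in> wordsp (susp_dual k)"
  shows "K.cl (fmap k \<iota> (fmap p \<pi> b)) = K.cl b"
proof -
  have "K.M.Phi (fmap k \<iota> (fmap p \<pi> b)) = K.M.Phi b"
  proof
    fix w
    show "K.M.Phi (fmap k \<iota> (fmap p \<pi> b)) w = K.M.Phi b w"
    proof (cases "\<forall>l\<in>set w. valid k l")
      case True
      hence v: "\<forall>l\<in>set (map (flet \<iota>) w). valid p l" using I.valid_flet by auto
      have "map (flet \<pi>) (map (flet \<iota>) w) = w"
        unfolding map_map by (rule map_idI) (use True qi in \<open>auto simp: flet_def valid_def\<close>)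
      thus ?thesis using I.Phi_fmap[OF True] Q.Phi_fmap[OF v] by simp
    next
      case False
      hence "K.M.Phi (fmap k \<iota> (fmap p \<pi> b)) w = 0" "K.M.Phi b w = 0" using K.Phi_valid by blast+
      thus ?thesis by simp
    qed
  qed
  thus ?thesis using K.cl_Phi[OF I.fmap_wordsp[OF Q.fmap_wordsp[OF assms]] assms] by simp
qed

lemma (in complete_dg) Phi_zero_words: assumes "\<forall>u\<in>keys a. u \<noteq> [] \<and> (\<forall>l\<in>set u. snd l = 0)"
  shows "M.Phi a = 0" using assms
proof (induction rule: free_induct_on)
  case (word u)
  then obtain l v where u: "u = l # v" "snd l = 0" by (cases u) auto
  have "M.gen (fst l) 0 = 0"
    using M.gen_add[OF susp_dual_closed(3) susp_dual_closed(3), of "fst l"] by simp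
  thus ?case by (simp add: M.Phi_simps u)
qed (simp_all add: M.Phi_simps)

text \<open>The composite of the two maps is zero, so every letter pulls back to 0. All words of
  \<open>b\<close> have a letter because \<open>b\<close> lies in the augmentation ideal; a constant
  term would survive.\<close>

lemma fmap_zero_comp:
  fixes SG :: "('i, 'a::ab_group_add, 'k::field_char_0) inv_sys" and S :: "('l, 'c::ab_group_add, 'k) inv_sys"
    and SH :: "('j, 'b::ab_group_add, 'k) inv_sys"
  assumes "cont_map SG g S p \<iota>" "cont_map S p SH h \<pi>" and 0: "\<And>n x. x \<in> grd g n \<Longrightarrow> \<pi> (\<iota> x) = 0"
    and b: "b \<in> wordspn (susp_dual h) n" "lookup b [] = 0"
  shows "sym_class sc (susp_dual g) (fmap g \<iota> (fmap p \<pi> b)) = sym_class sc (susp_dual g) 0"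
proof -
  interpret I: cont_map SG g S p \<iota> by fact
  interpret Q: cont_map S p SH h \<pi> by fact
  have "\<forall>u\<in>keys b. u \<in> words (susp_dual h) \<and> u \<noteq> []"
    using b by (auto simp: span_words lookup_not_eq_zero_eq_in_keys[symmetric])
  hence "I.A.M.Phi (fmap g \<iota> (fmap p \<pi> b)) = 0"
  proof (induction rule: free_induct_on)
    case (word u)
    have "pull g \<iota> n (pull p \<pi> n \<phi>) = 0" if "\<phi> \<in> susp_dual h n" for n \<phi>
    proof -
      have "\<phi> 0 = 0" using that Q.B.dualD(5) unfolding susp_dual_def by blast
      thus ?thesis by (rule_tac ext) (simp add: pull_def zero_fun_apply 0)
    qed
    hence "\<forall>l\<in>set (map (\<lambda>l. (fst l, pull g \<iota> (fst l) (snd l))) (map (\<lambda>l. (fst l, pull p \<pi> (fst l) (snd l))) u)). snd l = 0"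
      using word by (auto simp: words_def)
    thus ?case using word unfolding fmap_simps by (intro I.A.Phi_zero_words) auto
  qed (simp_all add: fmap_simps I.A.M.Phi_simps)
  thus ?thesis
    using I.A.cl_zero[OF I.fmap_wordsp[OF Q.fmap_wordsp[OF wordspn_sub[OF b(1)]]]] by blast
qed

theorem theoremA7:
  fixes g :: "('i \<Rightarrow> 'a::ab_group_add, 'k::field_char_0) top_dgla"
    and h :: "('j \<Rightarrow> 'b::ab_group_add, 'k) top_dgla"
    and p :: "('l \<Rightarrow> 'c::ab_group_add, 'k) top_dgla"
  assumes "complete_dgla g" and "complete_dgla h" and "is_coproduct g h p \<iota>\<^sub>1 \<iota>\<^sub>2"
  shows "\<exists>f. quasi_isomorphism (CE_plus p) (dg_prod (CE_plus g) (CE_plus h)) f"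
proof -
  have "complete_dgla p" using assms(3) by (simp add: is_coproduct_def)
  then obtain SG SH S where S: "complete_dg SG g" "complete_dg SH h" "complete_dg S p"
    using assms(1,2) by (elim complete_dgE)
  then interpret C: coprod SG g SH h S p \<iota>\<^sub>1 \<iota>\<^sub>2
    by (intro coprod.intro coprod_axioms.intro assms(3))
  obtain \<pi>1 \<pi>2 where pr: "cont_hom p g \<pi>1" "cont_hom p h \<pi>2"
    "\<forall>n. \<forall>x\<in>grd g n. \<pi>1 (\<iota>\<^sub>1 x) = x \<and> \<pi>2 (\<iota>\<^sub>1 x) = 0" "\<forall>n. \<forall>x\<in>grd h n. \<pi>1 (\<iota>\<^sub>2 x) = 0 \<and> \<pi>2 (\<iota>\<^sub>2 x) = x"
    by (rule C.projections)
  have "coprod_proj SG g SH h S p \<iota>\<^sub>1 \<iota>\<^sub>2 \<pi>1 \<pi>2"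
    by (intro coprod_proj.intro coprod_proj_axioms.intro C.coprod_axioms retract.intro retract_axioms.intro S C.inclusions pr)
      (use pr(3,4) in blast)+
  then interpret CP: coprod_proj SG g SH h S p \<iota>\<^sub>1 \<iota>\<^sub>2 \<pi>1 \<pi>2 .
  obtain B rk where "graded_basis sc (susp_dual p) B" "\<And>n b. b \<in> B n \<Longrightarrow> CP.pure n b"
    "\<And>n b. b \<in> B n \<Longrightarrow> b \<in> C.P.filt (rk n b) n"
    "\<And>n j. C.P.filt j n \<subseteq> module.span sc {b \<in> B n. rk n b \<le> (j::nat)}" by (rule CP.adapted_basis) (rule that)
  then interpret AD: adapted SG g SH h S p \<iota>\<^sub>1 \<iota>\<^sub>2 \<pi>1 \<pi>2 B rk
    by (intro adapted.intro adapted_axioms.intro CP.coprod_proj_axioms)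
  define c' where "c' ab = (C.G.cl (fst ab), C.H.cl (snd ab))" for ab
  define F where "F a = (fmap g \<iota>\<^sub>1 a, fmap h \<iota>\<^sub>2 a)" for a
  define Sec where "Sec ab = fmap p \<pi>1 (fst ab) + fmap p \<pi>2 (snd ab)" for ab
  \<comment> \<open>The choice of a representative is harmless because \<open>fmap\<close> preserves
    the relators.\<close>
  define f where "f X = c' (F (SOME a. C.P.cl a = X))" for X
  define Z' where "Z' n = C.G.ZZ n \<times> C.H.ZZ n" for n
  define D' where "D' ab = (dtot g (fst ab), dtot h (snd ab))" for ab
  note pc = C.P.presented and pcG = C.G.presented and pcH = C.H.presented
  interpret PP: presented_complex "CE_plus p" C.P.cl C.P.ZZ "dtot p" by (rule pc)
  interpret PG: presented_complex "CE_plus g" C.G.cl C.G.ZZ "dtot g" by (rule pcG)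
  interpret PH: presented_complex "CE_plus h" C.H.cl C.H.ZZ "dtot h" by (rule pcH)
  let ?B = "dg_prod (CE_plus g) (CE_plus h)"
  have P': "presented_complex ?B c' Z' D'"
  proof
    show "part ?B n = c' ` Z' n" for n
      unfolding dg_prod_def c'_def Z'_def by (auto simp: PG.part PH.part image_iff)
    show "aadd ?B (c' a) (c' b) = c' (a + b)" for a b
      by (simp add: dg_prod_def c'_def PG.aadd PH.aadd)
    show "azero ?B = c' 0" by (simp add: dg_prod_def c'_def PG.azero PH.azero)
    show "adiff ?B (c' a) = c' (D' a)" if "a \<in> Z' n" for a n
      using that PG.adiff PH.adiff by (auto simp: dg_prod_def c'_def Z'_def D'_def)
    show "D' a \<in> Z' (n + 1)" if "a \<in> Z' n" for a n
      using that PG.D_in[of "fst a" n] PH.D_in[of "snd a" n] by (simp add: Z'_def D'_def mem_Times_iff)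
    show "c' a = c' b \<longleftrightarrow> c' (a - b) = c' 0" for a b
      using PG.c_eq[of "fst a" "fst b"] PH.c_eq[of "snd a" "snd b"] by (simp add: c'_def)
    show "c' (D' (D' a)) = c' 0" if "a \<in> Z' n" for a n
      using that PG.D_D[of "fst a" n] PH.D_D[of "snd a" n] by (simp add: Z'_def D'_def c'_def mem_Times_iff)
    show "0 \<in> Z' n" for n using PG.Z(1) PH.Z(1) by (simp add: Z'_def mem_Times_iff)
    show "a + b \<in> Z' n" "a - b \<in> Z' n" if "a \<in> Z' n" "b \<in> Z' n" for a b n
      using that PG.Z(2,3)[of "fst a" n "fst b"] PH.Z(2,3)[of "snd a" n "snd b"] by (simp_all add: Z'_def mem_Times_iff)
    show "D' (a - b) = D' a - D' b" for a b by (simp add: D'_def PG.D_diff PH.D_diff)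
  qed
  have fc: "f (C.P.cl a) = c' (F a)" for a
  proof -
    have "C.P.cl (SOME b. C.P.cl b = C.P.cl a) = C.P.cl a" by (rule someI[of _ a]) simp
    note CP.R1.I.fmap_cl[OF this] CP.R2.I.fmap_cl[OF this]
    thus ?thesis unfolding f_def c'_def F_def fst_conv snd_conv by (rule arg_cong2[of _ _ _ _ Pair])
  qed
  have w: "a \<in> wordspn (susp_dual p) n" "a \<in> wordsp (susp_dual p)" if "a \<in> C.P.ZZ n" for a n
    using that wordspn_sub by blast+
  have F_in: "F a \<in> Z' n" if "a \<in> C.P.ZZ n" for a n
    using CP.R1.I.fmap_ZZ[OF that] CP.R2.I.fmap_ZZ[OF that] by (simp add: F_def Z'_def)
  have F_D: "c' (F (dtot p a)) = c' (D' (F a))" if "a \<in> C.P.ZZ n" for a n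
    using CP.R1.I.fmap_dtot[OF w(1)[OF that]] CP.R2.I.fmap_dtot[OF w(1)[OF that]] by (simp add: F_def c'_def D'_def)
  have hom: "dg_alg_hom (CE_plus p) ?B f" unfolding dg_alg_hom_def PP.part
  proof (intro conjI allI ballI; elim imageE; hypsubst)
    fix n a assume a: "a \<in> C.P.ZZ n"
    show "f (C.P.cl a) \<in> part ?B n" using F_in[OF a] by (simp add: fc presented_complex.part[OF P'])
    show "f (asmul (CE_plus p) r (C.P.cl a)) = asmul ?B r (f (C.P.cl a))" for r
      by (simp add: C.P.CE_ops fc F_def c'_def dg_prod_def C.G.CE_ops C.H.CE_ops fmap_simps)
    show "f (adiff (CE_plus p) (C.P.cl a)) = adiff ?B (f (C.P.cl a))"
      using F_D[OF a] presented_complex.adiff[OF P' F_in[OF a]] PP.adiff[OF a] by (simp add: fc)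
    fix m b
    show "f (aadd (CE_plus p) (C.P.cl a) (C.P.cl b)) = aadd ?B (f (C.P.cl a)) (f (C.P.cl b))"
      by (simp add: C.P.CE_ops fc F_def c'_def dg_prod_def C.G.CE_ops C.H.CE_ops fmap_simps)
    assume b: "b \<in> C.P.ZZ m"
    show "f (amul (CE_plus p) (C.P.cl a) (C.P.cl b)) = amul ?B (f (C.P.cl a)) (f (C.P.cl b))"
      by (simp add: C.P.CE_ops(4) w(2)[OF a] w(2)[OF b] fc F_def c'_def dg_prod_def C.G.CE_ops(4) C.H.CE_ops(4)
          CP.R1.I.fmap_wordsp CP.R2.I.fmap_wordsp fmap_fmul)
  qed
  have "bij_betw (coh_map ?B n f) (cohomology (CE_plus p) n) (cohomology ?B n)" for n
  proof (rule coh_map_bij[OF pc P' fc _ F_in F_D])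
    show "F (a - b) = F a - F b" for a b by (simp add: F_def fmap_simps)
    show "Sec b \<in> C.P.ZZ n" if "b \<in> Z' n" for b n
      using that CP.R1.Q.fmap_ZZ[of "fst b" n] CP.R2.Q.fmap_ZZ[of "snd b" n] PP.Z(2)
      unfolding Sec_def Z'_def mem_Times_iff by blast
    show "C.P.cl (Sec (D' b)) = C.P.cl (dtot p (Sec b))" if "b \<in> Z' n" for b n
    proof -
      have "C.P.cl (fmap p \<pi>1 (dtot g (fst b))) = C.P.cl (dtot p (fmap p \<pi>1 (fst b)))"
        "C.P.cl (fmap p \<pi>2 (dtot h (snd b))) = C.P.cl (dtot p (fmap p \<pi>2 (snd b)))"
        using that CP.R1.Q.fmap_dtot[of "fst b" n] CP.R2.Q.fmap_dtot[of "snd b" n] unfolding Z'_def by auto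
      thus ?thesis by (simp add: Sec_def D'_def PP.D_add flip: PP.aadd)
    qed
    show "C.P.cl (Sec b) = C.P.cl 0" if "c' b = c' 0" for b
    proof -
      have "C.P.cl (fmap p \<pi>1 (fst b)) = C.P.cl (fmap p \<pi>1 0)" "C.P.cl (fmap p \<pi>2 (snd b)) = C.P.cl (fmap p \<pi>2 0)"
        using that CP.R1.Q.fmap_cl[of "fst b" 0] CP.R2.Q.fmap_cl[of "snd b" 0] by (simp_all add: c'_def)
      hence "C.P.cl (Sec b) = aadd (CE_plus p) (C.P.cl 0) (C.P.cl 0)"
        by (simp add: Sec_def fmap_simps flip: PP.aadd)
      thus ?thesis by (simp add: PP.aadd)
    qed
    show "c' (F (Sec b)) = c' b" if "b \<in> Z' n" for b n
    proof -
      have b: "fst b \<in> wordspn (susp_dual g) n" "lookup (fst b) [] = 0"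
        "snd b \<in> wordspn (susp_dual h) n" "lookup (snd b) [] = 0" using that by (auto simp: Z'_def)
      have 1: "C.G.cl (fmap g \<iota>\<^sub>1 (fmap p \<pi>1 (fst b))) = C.G.cl (fst b)"
        "C.H.cl (fmap h \<iota>\<^sub>2 (fmap p \<pi>2 (snd b))) = C.H.cl (snd b)"
        by (rule CP.R1.fmap_retract CP.R2.fmap_retract; rule wordspn_sub; fact b)+
      \<comment> \<open>The cross terms vanish because each projection is zero on the other
        factor.\<close>
      have 2: "C.G.cl (fmap g \<iota>\<^sub>1 (fmap p \<pi>2 (snd b))) = C.G.cl 0"
        by (rule fmap_zero_comp[OF CP.R1.I.cont_map_axioms CP.R2.Q.cont_map_axioms CP.orth(1) b(3,4)])
      have 3: "C.H.cl (fmap h \<iota>\<^sub>2 (fmap p \<pi>1 (fst b))) = C.H.cl 0"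
        by (rule fmap_zero_comp[OF CP.R2.I.cont_map_axioms CP.R1.Q.cont_map_axioms CP.orth(2) b(1,2)])
      have "C.G.cl (fmap g \<iota>\<^sub>1 (Sec b)) = aadd (CE_plus g) (C.G.cl (fst b)) (C.G.cl 0)"
        by (simp only: Sec_def fmap_simps PG.aadd[symmetric] 1 2)
      moreover have "C.H.cl (fmap h \<iota>\<^sub>2 (Sec b)) = aadd (CE_plus h) (C.H.cl 0) (C.H.cl (snd b))"
        by (simp only: Sec_def fmap_simps PH.aadd[symmetric] 1 3)
      ultimately show ?thesis by (simp add: c'_def F_def PG.aadd PH.aadd)
    qed
    fix n a assume a: "a \<in> C.P.ZZ n" and d: "C.P.cl (dtot p a) = C.P.cl 0" and 0: "c' (F a) = c' 0"
    have "C.P.M.Phi (dtot p a) = 0" using d C.P.cl_zero[OF C.P.dtot_wordsp[OF w(2)[OF a]]] by simp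
    moreover have "C.G.M.Phi (fmap g \<iota>\<^sub>1 a) = 0" "C.H.M.Phi (fmap h \<iota>\<^sub>2 a) = 0"
      using 0 C.G.cl_zero[OF CP.R1.I.fmap_wordsp[OF w(2)[OF a]]] C.H.cl_zero[OF CP.R2.I.fmap_wordsp[OF w(2)[OF a]]]
      by (simp_all add: c'_def F_def)
    ultimately obtain y where y: "y \<in> wordspn (susp_dual p) (n - 1)" "lookup y [] = 0"
      "C.P.M.Phi (dtot p y) = C.P.M.Phi a" using AD.kernel_acyclic[OF w(1)[OF a]] a by blast
    have "C.P.cl (dtot p y) = C.P.cl a"
      using C.P.cl_Phi[OF C.P.dtot_wordsp[OF wordspn_sub[OF y(1)]] w(2)[OF a]] y(3) by simp
    thus "\<exists>y\<in>C.P.ZZ (n - 1). C.P.cl (dtot p y) = C.P.cl a" using y by blast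
  qed
  with hom show ?thesis unfolding quasi_isomorphism_def by blast
qed

end
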